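(* Let $G$ be a finite group, $V$ a finite-dimensional complex representation of $G$, $u\in G$ a central element of order $2$ acting by $-1$ on $V$, and $B\in S^2V$. Then there is an isomorphism of algebras $$A(G,V,u,B)^*\cong\bigoplus_{h\in G/\langle u\rangle}\mathrm{Cl}\left(V^*\oplus\mathbb{C},\begin{pmatrix}B-B^h&0\\0&1\end{pmatrix}\right),$$ where for $h=\{g,gu\}\in G/\langle u\rangle$, $B^h$ denotes $B^g=B^{gu}$.
   Context: The ground field is $\mathbb{C}$. $S^2V$ denotes the space of symmetric tensors in $V\otimes V$; elements of $S^2V$ are regarded as symmetric bilinear forms on $V^*$ via $B(x,y)=(x\otimes y)(B)$. For $g\in G$, $B^g(x,y):=B(gx,gy)$ for $x,y\in V^*$ (equivalently $B^g=(g^{-1}\otimes g^{-1})(B)$). $H^*$ is the dual Hopf algebra. For a finite-dimensional vector space $W$ with a symmetric bilinear form $Q$, the Clifford algebra $\mathrm{Cl}(W,Q)$ is the quotient of the tensor algebra $T(W)$ by the ideal generated by $vw+wv-2Q(v,w)1$, $v,w\in W$. The block matrix denotes the orthogonal direct sum of the form $B-B^h$ on $V^*$ and the form $(s,t)\mapsto st$ on $\mathbb{C}$. Definition of $A(G,V,u,B)$. Let $\mathbb{C}[G\ltimes V]:=\mathbb{C}[G]\ltimes\Lambda V$ be the Hopf superalgebra generated by $G$ (even) and $V$ (odd), with $gvg^{-1}=g\cdot v$, $vw=-wv$, $\Delta(g)=g\otimes g$, $\Delta(v)=v\otimes1+1\otimes v$, $\varepsilon(g)=1$, $\varepsilon(v)=0$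 (tensor products of superalgebras have the super multiplication). Let $J:=e^B\in\Lambda V\otimes\Lambda V\subset\mathbb{C}[G\ltimes V]^{\otimes2}$. The twisted Hopf superalgebra $\mathbb{C}[G\ltimes V]^J$ has the same multiplication and counit, and coproduct $\Delta^J(x)=J^{-1}\Delta(x)J$. For $x$ homogeneous of parity $p(x)$ write $\Delta^J(x)=\Delta^J_0(x)+\Delta^J_1(x)$, where the second tensor factor of $\Delta^J_0(x)$ is even and that of $\Delta_1^J(x)$ is odd. Then $A(G,V,u,B)$ is the ordinary Hopf algebra which, as an algebra with counit, is $\mathbb{C}[G]\ltimes\Lambda V$ (grading forgotten), with coproduct $\widetilde{\Delta^J}(x)=\Delta^J_0(x)-(-1)^{p(x)}(u\otimes1)\Delta^J_1(x)$. *)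

theory Defs
  imports
    "HOL-Algebra.QuotRing"
    "HOL-Algebra.Group_Action"
    "HOL-Algebra.Multiplicative_Group"
    "HOL-Algebra.Generated_Groups"
    "HOL-Library.Poly_Mapping"
    "Jordan_Normal_Form.VS_Connect"
begin

text \<open>
  Vector spaces over the complex numbers are \<^typ>\<open>(complex, 'v) module\<close> records over
  \<^term>\<open>class_ring :: complex ring\<close>; for a mere vector space the fields \<open>mult\<close> and \<open>one\<close> carry no
  meaning. Unital associative algebras use the same records, now with all fields meaningful
  (the locale \<open>algebra\<close> of \<open>HOL-Algebra\<close> is restricted to commutative algebras).
\<close>

abbreviation CC :: "complex ring" where
  "CC \<equiv> class_ring"

definition ground :: "(complex, complex) module" where
  "ground = \<lparr>carrier = UNIV, mult = (*), one = 1, zero = 0, add = (+), smult = (*)\<rparr>"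


section \<open>Duals and tensor products\<close>

definition dual_space :: "(complex, 'v, 'm) module_scheme \<Rightarrow> (complex, 'v \<Rightarrow> complex) module" where
  "dual_space V = (ring.func_space CC (carrier V))
     \<lparr>carrier := module_hom CC V ground \<inter> extensional (carrier V)\<rparr>"

text \<open>Bilinear forms \<open>U \<times> W \<rightarrow> \<complex>\<close>; their values off the carriers are arbitrary.\<close>

definition bilin ::
  "(complex, 'a, 'm) module_scheme \<Rightarrow> (complex, 'b, 'n) module_scheme \<Rightarrow> ('a \<Rightarrow> 'b \<Rightarrow> complex) set"
where
  "bilin U W = {\<beta>. (\<forall>a\<in>carrier U. \<beta> a \<in> module_hom CC W ground) \<and>
                   (\<forall>b\<in>carrier W. (\<lambda>a. \<beta> a b) \<in> module_hom CC U ground)}"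

text \<open>
  The tensor product of \<open>U\<close> and \<open>W\<close> is realised inside the space of functions on bilinear forms: the
  pure tensor of \<open>a\<close> and \<open>b\<close> is evaluation \<open>\<beta> \<mapsto> \<beta> a b\<close>, and \<open>U \<otimes> W\<close> is the span of the pure tensors.
  (Over a field this is the tensor product in every dimension, since \<open>U \<otimes> W\<close> embeds into its double
  dual and \<open>Bil(U, W) = (U \<otimes> W)\<^sup>*\<close>.) By construction \<open>t \<beta>\<close> is the value at \<open>t\<close> of the linear form
  \<open>U \<otimes> W \<rightarrow> \<complex>\<close> induced by \<open>\<beta>\<close>; in particular \<open>(f \<otimes> g)(t) = t (\<lambda>a b. f a * g b)\<close>. Similarly, the
  linear map \<open>U \<otimes> W \<rightarrow> X \<otimes> Y\<close> induced by linear maps \<open>p\<close>, \<open>q\<close> sends \<open>t\<close> to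
  \<open>\<beta> \<mapsto> t (\<lambda>a b. \<beta> (p a) (q b))\<close>.
\<close>

type_synonym ('a, 'b) tens = "('a \<Rightarrow> 'b \<Rightarrow> complex) \<Rightarrow> complex"

definition pure_tensor ::
  "(complex, 'a, 'm) module_scheme \<Rightarrow> (complex, 'b, 'n) module_scheme \<Rightarrow> 'a \<Rightarrow> 'b \<Rightarrow> ('a, 'b) tens"
where
  "pure_tensor U W a b = (\<lambda>\<beta>\<in>bilin U W. \<beta> a b)"

definition tensor ::
  "(complex, 'a, 'm) module_scheme \<Rightarrow> (complex, 'b, 'n) module_scheme \<Rightarrow>
     (complex, ('a, 'b) tens) module"
where
  "tensor U W = module.span_vs CC (ring.func_space CC (bilin U W))
     {pure_tensor U W a b | a b. a \<in> carrier U \<and> b \<in> carrier W}"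

definition tensor_eval :: "('a, 'b) tens \<Rightarrow> ('a \<Rightarrow> complex) \<Rightarrow> ('b \<Rightarrow> complex) \<Rightarrow> complex" where
  "tensor_eval t f g = t (\<lambda>a b. f a * g b)"

definition sym_square :: "(complex, 'v, 'm) module_scheme \<Rightarrow> ('v, 'v) tens set" where
  "sym_square V = {B \<in> carrier (tensor V V). (\<lambda>\<beta>\<in>bilin V V. B (\<lambda>v w. \<beta> w v)) = B}"


section \<open>Free algebras, quotients and products of algebras\<close>

datatype 'x fword = FWord (letters: "'x list")

instantiation fword :: (type) monoid_add
begin
definition "0 = FWord []"
definition "v + w = FWord (letters v @ letters w)"
instance
  by standard (simp_all add: zero_fword_def plus_fword_def)
end

text \<open>The free unital algebra on the set \<open>X\<close>: finitely supported functions on words over \<open>X\<close>.\<close>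

definition free_alg :: "'x set \<Rightarrow> (complex, 'x fword \<Rightarrow>\<^sub>0 complex) module" where
  "free_alg X = \<lparr>carrier = {f. \<forall>w\<in>Poly_Mapping.keys f. set (letters w) \<subseteq> X},
     mult = (*), one = 1, zero = 0, add = (+),
     smult = (\<lambda>c f. Poly_Mapping.single 0 c * f)\<rparr>"

lemma ring_free_alg: "ring (free_alg X)"
proof -
  have add: "f + g \<in> carrier (free_alg X)"
    if "f \<in> carrier (free_alg X)" "g \<in> carrier (free_alg X)" for f g
    using that Poly_Mapping.keys_add[of f g] by (fastforce simp: free_alg_def)
  have mult: "f * g \<in> carrier (free_alg X)"
    if "f \<in> carrier (free_alg X)" "g \<in> carrier (free_alg X)" for f g
    using that keys_mult[of f g] by (fastforce simp: free_alg_def plus_fword_def)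
  have uminus: "- f \<in> carrier (free_alg X)" if "f \<in> carrier (free_alg X)" for f
    using that by (simp add: free_alg_def in_keys_iff)
  have zero_one: "0 \<in> carrier (free_alg X)" "1 \<in> carrier (free_alg X)"
    by (auto simp: free_alg_def zero_fword_def)
  have ops: "add (free_alg X) = (+)" "mult (free_alg X) = (*)"
    "zero (free_alg X) = 0" "one (free_alg X) = 1"
    by (simp_all add: free_alg_def)
  have "abelian_group (free_alg X)"
  proof (rule abelian_groupI)
    show "\<exists>g\<in>carrier (free_alg X). g \<oplus>\<^bsub>free_alg X\<^esub> f = \<zero>\<^bsub>free_alg X\<^esub>"
      if "f \<in> carrier (free_alg X)" for f
      using uminus[OF that] by (intro bexI[of _ "- f"]) (simp_all add: ops)
  qed (simp_all add: ops add zero_one algebra_simps)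
  moreover have "Group.monoid (free_alg X)"
    by (rule monoidI) (simp_all add: ops mult zero_one algebra_simps)
  ultimately show ?thesis
    by (rule ringI) (simp_all add: ops algebra_simps)
qed

definition letter :: "'x \<Rightarrow> 'x fword \<Rightarrow>\<^sub>0 complex" where
  "letter x = Poly_Mapping.single (FWord [x]) 1"

text \<open>The algebra homomorphism from a free algebra to \<open>A\<close> which extends \<open>\<phi>\<close> on letters.\<close>

definition free_lift ::
  "(complex, 'a, 'm) module_scheme \<Rightarrow> ('x \<Rightarrow> 'a) \<Rightarrow> ('x fword \<Rightarrow>\<^sub>0 complex) \<Rightarrow> 'a"
where
  "free_lift A \<phi> f = (\<Oplus>\<^bsub>A\<^esub>w\<in>Poly_Mapping.keys f.
     Poly_Mapping.lookup f w \<odot>\<^bsub>A\<^esub> foldr (\<lambda>x y. \<phi> x \<otimes>\<^bsub>A\<^esub> y) (letters w) \<one>\<^bsub>A\<^esub>)"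

definition quot_alg :: "(complex, 'a, 'm) module_scheme \<Rightarrow> 'a set \<Rightarrow> (complex, 'a set) module" where
  "quot_alg A I = ring.extend (A Quot I) (module.fields (\<lambda>c X. \<Union>x\<in>X. I +>\<^bsub>A\<^esub> (c \<odot>\<^bsub>A\<^esub> x)))"

text \<open>For a finite index set the product is the direct sum of algebras.\<close>

definition prod_alg :: "'i set \<Rightarrow> ('i \<Rightarrow> (complex, 'a) module) \<Rightarrow> (complex, 'i \<Rightarrow> 'a) module" where
  "prod_alg I A = \<lparr>carrier = (\<Pi>\<^sub>E i\<in>I. carrier (A i)),
     mult = (\<lambda>x y. \<lambda>i\<in>I. x i \<otimes>\<^bsub>A i\<^esub> y i),
     one = (\<lambda>i\<in>I. \<one>\<^bsub>A i\<^esub>),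
     zero = (\<lambda>i\<in>I. \<zero>\<^bsub>A i\<^esub>),
     add = (\<lambda>x y. \<lambda>i\<in>I. x i \<oplus>\<^bsub>A i\<^esub> y i),
     smult = (\<lambda>c x. \<lambda>i\<in>I. c \<odot>\<^bsub>A i\<^esub> x i)\<rparr>"

definition alg_iso ::
  "(complex, 'a, 'm) module_scheme \<Rightarrow> (complex, 'b, 'n) module_scheme \<Rightarrow> ('a \<Rightarrow> 'b) set"
where
  "alg_iso A B = ring_iso A B \<inter> module_hom CC A B"

text \<open>\<open>e\<^sup>x\<close> for nilpotent \<open>x\<close>: the exponential series summed over its finitely many nonzero terms.\<close>

definition nil_exp :: "(complex, 'a, 'm) module_scheme \<Rightarrow> 'a \<Rightarrow> 'a" where
  "nil_exp A x = (\<Oplus>\<^bsub>A\<^esub>k\<in>{k::nat. x [^]\<^bsub>A\<^esub> k \<noteq> \<zero>\<^bsub>A\<^esub>}. (1 / fact k) \<odot>\<^bsub>A\<^esub> (x [^]\<^bsub>A\<^esub> k))"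


section \<open>Tensor and Clifford algebras\<close>

text \<open>
  The tensor algebra is the free algebra on the underlying set of \<open>W\<close> modulo the relations which make
  the inclusion of \<open>W\<close> linear.
\<close>

definition linear_rels ::
  "(complex, 'w, 'm) module_scheme \<Rightarrow> ('w \<Rightarrow> 'x fword \<Rightarrow>\<^sub>0 complex) \<Rightarrow> ('x fword \<Rightarrow>\<^sub>0 complex) set"
where
  "linear_rels W j =
     {j (v \<oplus>\<^bsub>W\<^esub> w) - j v - j w | v w. v \<in> carrier W \<and> w \<in> carrier W} \<union>
     {j (c \<odot>\<^bsub>W\<^esub> v) - Poly_Mapping.single 0 c * j v | c v. v \<in> carrier W}"

definition tensor_alg_ideal :: "(complex, 'w, 'm) module_scheme \<Rightarrow> ('w fword \<Rightarrow>\<^sub>0 complex) set" where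
  "tensor_alg_ideal W = Idl\<^bsub>free_alg (carrier W)\<^esub> (linear_rels W letter)"

definition tensor_alg ::
  "(complex, 'w, 'm) module_scheme \<Rightarrow> (complex, ('w fword \<Rightarrow>\<^sub>0 complex) set) module"
where
  "tensor_alg W = quot_alg (free_alg (carrier W)) (tensor_alg_ideal W)"

definition tensor_alg_incl ::
  "(complex, 'w, 'm) module_scheme \<Rightarrow> 'w \<Rightarrow> ('w fword \<Rightarrow>\<^sub>0 complex) set"
where
  "tensor_alg_incl W w = tensor_alg_ideal W +>\<^bsub>free_alg (carrier W)\<^esub> letter w"

definition clifford_rel ::
  "(complex, 'w, 'm) module_scheme \<Rightarrow> ('w \<Rightarrow> 'w \<Rightarrow> complex) \<Rightarrow> 'w \<Rightarrow> 'w \<Rightarrow> ('w fword \<Rightarrow>\<^sub>0 complex) set"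
where
  "clifford_rel W Q v w = (let T = tensor_alg W; j = tensor_alg_incl W in
     (j v \<otimes>\<^bsub>T\<^esub> j w \<oplus>\<^bsub>T\<^esub> j w \<otimes>\<^bsub>T\<^esub> j v) \<ominus>\<^bsub>T\<^esub> ((2 * Q v w) \<odot>\<^bsub>T\<^esub> \<one>\<^bsub>T\<^esub>))"

definition clifford ::
  "(complex, 'w, 'm) module_scheme \<Rightarrow> ('w \<Rightarrow> 'w \<Rightarrow> complex) \<Rightarrow>
     (complex, ('w fword \<Rightarrow>\<^sub>0 complex) set set) module"
where
  "clifford W Q = quot_alg (tensor_alg W)
     (Idl\<^bsub>tensor_alg W\<^esub> {clifford_rel W Q v w | v w. v \<in> carrier W \<and> w \<in> carrier W})"


section \<open>Superalgebras and bialgebras\<close>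

text \<open>
  \<open>part p x\<close> is the homogeneous component of \<open>x\<close> of parity \<open>p \<in> {0, 1}\<close>. Antipodes are not recorded:
  they are determined by the bialgebra structure and do not enter the algebra structure of the dual.
\<close>

record 'a super_algebra = "(complex, 'a) module" +
  part :: "nat \<Rightarrow> 'a \<Rightarrow> 'a"

record 'a super_bialgebra = "'a super_algebra" +
  scounit :: "'a \<Rightarrow> complex"
  scomult :: "'a \<Rightarrow> ('a, 'a) tens"

record 'a bialgebra = "(complex, 'a) module" +
  counit :: "'a \<Rightarrow> complex"
  comult :: "'a \<Rightarrow> ('a, 'a) tens"

text \<open>
  The multiplication on \<open>A \<otimes> A\<close> is \<open>(a \<otimes> b)(c \<otimes> d) = (-1)\<^bsup>p(b)p(c)\<^esup> ac \<otimes> bd\<close>, with \<open>b\<close> and \<open>c\<close>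
  decomposed into homogeneous components and extended to all tensors \<open>s\<close>, \<open>t\<close>.
\<close>

definition super_tensor_sq :: "('a, 'm) super_algebra_scheme \<Rightarrow> (complex, ('a, 'a) tens) module" where
  "super_tensor_sq A = (tensor A A)
     \<lparr>mult := (\<lambda>s t. \<lambda>\<beta>\<in>bilin A A. t (\<lambda>c d. s (\<lambda>a b.
        \<Sum>p<2. \<Sum>q<2. (-1) ^ (p * q) * \<beta> (a \<otimes>\<^bsub>A\<^esub> part A q c) (part A p b \<otimes>\<^bsub>A\<^esub> d)))),
      one := pure_tensor A A \<one>\<^bsub>A\<^esub> \<one>\<^bsub>A\<^esub>\<rparr>"

definition snd_part :: "('a, 'm) super_algebra_scheme \<Rightarrow> nat \<Rightarrow> ('a, 'a) tens \<Rightarrow> ('a, 'a) tens" where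
  "snd_part A p t = (\<lambda>\<beta>\<in>bilin A A. t (\<lambda>a b. \<beta> a (part A p b)))"

definition twist :: "('a, 'm) super_bialgebra_scheme \<Rightarrow> ('a, 'a) tens \<Rightarrow> ('a, 'm) super_bialgebra_scheme"
where
  "twist H J = (let T = super_tensor_sq H in
     H\<lparr>scomult := \<lambda>x. inv\<^bsub>T\<^esub> J \<otimes>\<^bsub>T\<^esub> scomult H x \<otimes>\<^bsub>T\<^esub> J\<rparr>)"

text \<open>
  The ordinary bialgebra with coproduct \<open>x \<mapsto> \<Delta>\<^sub>0(x) - (-1)\<^bsup>p(x)\<^esup> (u \<otimes> 1) \<Delta>\<^sub>1(x)\<close> for homogeneous \<open>x\<close>;
  the sum over \<open>p\<close> extends this formula linearly to all \<open>x\<close>. Left multiplication by \<open>u \<otimes> 1\<close> involves no sign as \<open>1\<close> is even.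
\<close>

definition bosonize :: "'a super_bialgebra \<Rightarrow> 'a \<Rightarrow> 'a bialgebra" where
  "bosonize H u = (let T = super_tensor_sq H in
     module.extend (module.truncate H)
       (bialgebra.fields (scounit H)
         (\<lambda>x. \<Oplus>\<^bsub>T\<^esub>p\<in>{0, 1}.
            snd_part H 0 (scomult H (part H p x)) \<ominus>\<^bsub>T\<^esub>
            ((-1) ^ p \<odot>\<^bsub>T\<^esub>
              (pure_tensor H H u \<one>\<^bsub>H\<^esub> \<otimes>\<^bsub>T\<^esub> snd_part H 1 (scomult H (part H p x)))))))"

text \<open>The dual algebra: \<open>(f g)(x) = (f \<otimes> g)(\<Delta> x)\<close>, with unit the counit.\<close>

definition dual_alg :: "('a, 'm) bialgebra_scheme \<Rightarrow> (complex, 'a \<Rightarrow> complex) module" where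
  "dual_alg H = (dual_space H)
     \<lparr>mult := (\<lambda>f g. \<lambda>x\<in>carrier H. tensor_eval (comult H x) f g),
      one := (\<lambda>x\<in>carrier H. counit H x)\<rparr>"


section \<open>The Hopf algebras \<open>\<complex>[G \<ltimes> V]\<close> and \<open>A(G, V, u, B)\<close>\<close>

text \<open>
  \<open>\<complex>[G \<ltimes> V]\<close> is presented by the generators \<open>Inl g\<close> (even) and \<open>Inr v\<close> (odd). Since all relations are
  homogeneous and respected by counit and coproduct, the values of the maps induced on cosets do not
  depend on the representative, which is what \<^const>\<open>the_elem\<close> relies on.
\<close>

type_synonym ('g, 'v) gv = "(('g + 'v) fword \<Rightarrow>\<^sub>0 complex) set"

definition gv_free ::
  "('g, 'n) monoid_scheme \<Rightarrow> (complex, 'v, 'm) module_scheme \<Rightarrow>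
     (complex, ('g + 'v) fword \<Rightarrow>\<^sub>0 complex) module"
where
  "gv_free G V = free_alg (carrier G <+> carrier V)"

definition gv_rels ::
  "('g, 'n) monoid_scheme \<Rightarrow> (complex, 'v, 'm) module_scheme \<Rightarrow> ('g \<Rightarrow> 'v \<Rightarrow> 'v) \<Rightarrow> ('g, 'v) gv"
where
  "gv_rels G V \<rho> =
     {letter (Inl g) * letter (Inl h) - letter (Inl (g \<otimes>\<^bsub>G\<^esub> h)) | g h.
        g \<in> carrier G \<and> h \<in> carrier G} \<union>
     {letter (Inl \<one>\<^bsub>G\<^esub>) - 1} \<union>
     linear_rels V (\<lambda>v. letter (Inr v)) \<union>
     {letter (Inl g) * letter (Inr v) * letter (Inl (inv\<^bsub>G\<^esub> g)) - letter (Inr (\<rho> g v)) | g v.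
        g \<in> carrier G \<and> v \<in> carrier V} \<union>
     {letter (Inr v) * letter (Inr w) + letter (Inr w) * letter (Inr v) | v w.
        v \<in> carrier V \<and> w \<in> carrier V}"

definition gv_ideal ::
  "('g, 'n) monoid_scheme \<Rightarrow> (complex, 'v, 'm) module_scheme \<Rightarrow> ('g \<Rightarrow> 'v \<Rightarrow> 'v) \<Rightarrow> ('g, 'v) gv"
where
  "gv_ideal G V \<rho> = Idl\<^bsub>gv_free G V\<^esub> (gv_rels G V \<rho>)"

definition gv_gen ::
  "('g, 'n) monoid_scheme \<Rightarrow> (complex, 'v, 'm) module_scheme \<Rightarrow> ('g \<Rightarrow> 'v \<Rightarrow> 'v) \<Rightarrow>
     'g + 'v \<Rightarrow> ('g, 'v) gv"
where
  "gv_gen G V \<rho> x = gv_ideal G V \<rho> +>\<^bsub>gv_free G V\<^esub> letter x"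

definition word_parity :: "('g + 'v) fword \<Rightarrow> nat" where
  "word_parity w = length (filter (\<lambda>x. \<not> isl x) (letters w)) mod 2"

definition free_part ::
  "nat \<Rightarrow> (('g + 'v) fword \<Rightarrow>\<^sub>0 complex) \<Rightarrow> ('g + 'v) fword \<Rightarrow>\<^sub>0 complex"
where
  "free_part p f = (\<Sum>w\<in>{w \<in> Poly_Mapping.keys f. word_parity w = p}.
     Poly_Mapping.single w (Poly_Mapping.lookup f w))"

definition gv_super_alg ::
  "('g, 'n) monoid_scheme \<Rightarrow> (complex, 'v, 'm) module_scheme \<Rightarrow> ('g \<Rightarrow> 'v \<Rightarrow> 'v) \<Rightarrow>
     ('g, 'v) gv super_algebra"
where
  "gv_super_alg G V \<rho> = module.extend (quot_alg (gv_free G V) (gv_ideal G V \<rho>))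
     (super_algebra.fields
       (\<lambda>p X. the_elem ((\<lambda>f. gv_ideal G V \<rho> +>\<^bsub>gv_free G V\<^esub> free_part p f) ` X)))"

definition gv_super_bialg ::
  "('g, 'n) monoid_scheme \<Rightarrow> (complex, 'v, 'm) module_scheme \<Rightarrow> ('g \<Rightarrow> 'v \<Rightarrow> 'v) \<Rightarrow>
     ('g, 'v) gv super_bialgebra"
where
  "gv_super_bialg G V \<rho> =
    (let A = gv_super_alg G V \<rho>; T = super_tensor_sq A; j = gv_gen G V \<rho>;
         \<epsilon> = case_sum (\<lambda>g. 1) (\<lambda>v. 0);
         \<Delta> = case_sum
           (\<lambda>g. pure_tensor A A (j (Inl g)) (j (Inl g)))
           (\<lambda>v. pure_tensor A A (j (Inr v)) \<one>\<^bsub>A\<^esub> \<oplus>\<^bsub>T\<^esub> pure_tensor A A \<one>\<^bsub>A\<^esub> (j (Inr v)))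
     in super_algebra.extend A (super_bialgebra.fields
          (\<lambda>X. the_elem (free_lift ground \<epsilon> ` X))
          (\<lambda>X. the_elem (free_lift T \<Delta> ` X))))"

text \<open>The image of \<open>B \<in> V \<otimes> V\<close> in \<open>\<complex>[G \<ltimes> V] \<otimes> \<complex>[G \<ltimes> V]\<close>.\<close>

definition gv_tensor ::
  "('g, 'n) monoid_scheme \<Rightarrow> (complex, 'v, 'm) module_scheme \<Rightarrow> ('g \<Rightarrow> 'v \<Rightarrow> 'v) \<Rightarrow>
     ('v, 'v) tens \<Rightarrow> (('g, 'v) gv, ('g, 'v) gv) tens"
where
  "gv_tensor G V \<rho> B = (let H = gv_super_bialg G V \<rho>; j = gv_gen G V \<rho> in
     (\<lambda>\<beta>\<in>bilin H H. B (\<lambda>v w. \<beta> (j (Inr v)) (j (Inr w)))))"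

definition A_Hopf ::
  "('g, 'n) monoid_scheme \<Rightarrow> (complex, 'v, 'm) module_scheme \<Rightarrow> ('g \<Rightarrow> 'v \<Rightarrow> 'v) \<Rightarrow> 'g \<Rightarrow>
     ('v, 'v) tens \<Rightarrow> ('g, 'v) gv bialgebra"
where
  "A_Hopf G V \<rho> u B =
    (let H = gv_super_bialg G V \<rho>; J = nil_exp (super_tensor_sq H) (gv_tensor G V \<rho> B)
     in bosonize (twist H J) (gv_gen G V \<rho> (Inl u)))"


section \<open>The quadratic spaces \<open>V\<^sup>* \<oplus> \<complex>\<close>\<close>

text \<open>The dual action \<open>(g x)(v) = x (g\<^sup>-\<^sup>1 v)\<close>.\<close>

definition dual_act ::
  "('g, 'n) monoid_scheme \<Rightarrow> (complex, 'v, 'm) module_scheme \<Rightarrow> ('g \<Rightarrow> 'v \<Rightarrow> 'v) \<Rightarrow> 'g \<Rightarrow>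
     ('v \<Rightarrow> complex) \<Rightarrow> 'v \<Rightarrow> complex"
where
  "dual_act G V \<rho> g x = (\<lambda>v\<in>carrier V. x (\<rho> (inv\<^bsub>G\<^esub> g) v))"

text \<open>The form \<open>B\<^sup>g\<close> on \<open>V\<^sup>*\<close>, cut off outside \<open>V\<^sup>*\<close> so that \<open>B\<^sup>g = B\<^bsup>gu\<^esup>\<close> holds as functions.\<close>

definition form_act ::
  "('g, 'n) monoid_scheme \<Rightarrow> (complex, 'v, 'm) module_scheme \<Rightarrow> ('g \<Rightarrow> 'v \<Rightarrow> 'v) \<Rightarrow>
     ('v, 'v) tens \<Rightarrow> 'g \<Rightarrow> ('v \<Rightarrow> complex) \<Rightarrow> ('v \<Rightarrow> complex) \<Rightarrow> complex"
where
  "form_act G V \<rho> B g = (\<lambda>x\<in>carrier (dual_space V). \<lambda>y\<in>carrier (dual_space V).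
     tensor_eval B (dual_act G V \<rho> g x) (dual_act G V \<rho> g y))"

text \<open>For a coset \<open>h\<close> of \<open>\<langle>u\<rangle>\<close>: the common value \<open>B\<^sup>h\<close> of \<open>B\<^sup>g\<close> for \<open>g \<in> h\<close>.\<close>

definition form_coset ::
  "('g, 'n) monoid_scheme \<Rightarrow> (complex, 'v, 'm) module_scheme \<Rightarrow> ('g \<Rightarrow> 'v \<Rightarrow> 'v) \<Rightarrow>
     ('v, 'v) tens \<Rightarrow> 'g set \<Rightarrow> ('v \<Rightarrow> complex) \<Rightarrow> ('v \<Rightarrow> complex) \<Rightarrow> complex"
where
  "form_coset G V \<rho> B h = the_elem (form_act G V \<rho> B ` h)"

definition block_form ::
  "('g, 'n) monoid_scheme \<Rightarrow> (complex, 'v, 'm) module_scheme \<Rightarrow> ('g \<Rightarrow> 'v \<Rightarrow> 'v) \<Rightarrow>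
     ('v, 'v) tens \<Rightarrow> 'g set \<Rightarrow> ('v \<Rightarrow> complex) \<times> complex \<Rightarrow> ('v \<Rightarrow> complex) \<times> complex \<Rightarrow> complex"
where
  "block_form G V \<rho> B h = (\<lambda>(x, s) (y, t).
     (tensor_eval B x y - form_coset G V \<rho> B h x y) + s * t)"

end

theory Submission
  imports Defs
begin

text \<open>
  Write \<open>H = \<complex>[G \<ltimes> V]\<close>; the product of the dual is computed on linear forms on \<open>H\<close>. The functions on \<open>G\<close>,
  extended by zero on the multiples of \<open>V\<close>, act by left multiplication, and the indicators of the
  cosets \<open>h = {g, gu}\<close> are orthogonal idempotents with sum \<open>1\<close>; let \<open>D\<^sub>h\<close> be the corresponding summand.
  For \<open>\<xi> \<in> V\<^sup>*\<close> let \<open>\<iota>\<^sub>\<xi>\<close> be the antiderivation of the linear forms with \<open>(\<iota>\<^sub>\<xi> f)(x v) = \<xi>(v) f(x) - \<iota>\<^sub>\<xi>(f(\<cdot> v))(x)\<close>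
  and \<open>\<iota>\<^sub>\<xi> f = 0\<close> on \<open>G\<close>, and let \<open>z\<close> be the function on \<open>h\<close> with values \<open>\<plusminus>1\<close>. The twist by \<open>e\<^sup>B\<close> enters
  only through the identity \<open>(\<iota>\<^sub>\<xi> f \<cdot> f')(g) = -(f(\<cdot> u) \<cdot> f'(\<cdot> c))(g)\<close>, in which \<open>c \<in> V\<close> represents \<open>(B - B\<^sup>g)(\<xi>, \<cdot>)\<close>. It shows
  that the operators \<open>f \<mapsto> \<i>(\<iota>\<^sub>\<xi> f - f(\<cdot> c)) + s z f\<close> on \<open>D\<^sub>h\<close> commute with right multiplications; they also satisfy the
  Clifford relations of \<open>(\<xi>, s)\<close>. Applying them to the unit of \<open>D\<^sub>h\<close> therefore gives an algebra homomorphism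
  \<open>Cl \<rightarrow> D\<^sub>h\<close>. It is bijective by induction on the degree: contraction with \<open>v\<close> in \<open>Cl\<close> corresponds
  to \<open>f \<mapsto> f(\<cdot> v)\<close>, and on both sides the Euler operator separates the degrees.
\<close>

section \<open>Free algebras and quotient algebras\<close>

text \<open>No basis of H or of a Clifford algebra is constructed and no dimensions are compared. H
  is used through its presentation only: a linear form is a function on words that kills the
  relations, and two forms agree once they agree on G and obey the same recursion under x \<mapsto>
  x v. A tensor is likewise replaced by the operator that right multiplication by it induces on
  bilinear forms, so that products become compositions and J a truncated exponential series of
  operators. Operators that commute with right multiplications are wanted because on a unital
  algebra they are left multiplications: multiplicativity of the map from Cl then needs no
  computation, and associativity of the dual product is never proved in general. The summand
  \<complex> of the quadratic space accounts for degree zero: the functions on {g, gu} are spanned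
  by 1 and z, with z^2 = 1. Each vector that a function on G passes translates it by u, and this
  changes the sign of z; hence z anticommutes with the operators of V*. The Euler argument divides
  by the degree, which characteristic 0 permits.\<close>

definition wsum :: "('x fword \<Rightarrow>\<^sub>0 complex) \<Rightarrow> ('x list \<Rightarrow> complex) \<Rightarrow> complex" where
  "wsum p F = (\<Sum>w\<in>Poly_Mapping.keys p. Poly_Mapping.lookup p w * F (letters w))"

lemma wsum_superset:
  assumes "finite S" "Poly_Mapping.keys p \<subseteq> S"
  shows "wsum p F = (\<Sum>w\<in>S. Poly_Mapping.lookup p w * F (letters w))"
  unfolding wsum_def by (rule sum.mono_neutral_left) (use assms in \<open>auto simp: in_keys_iff\<close>)

lemma wsum_zero [simp]: "wsum 0 F = 0"
  by (simp add: wsum_def)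

lemma wsum_add [simp]: "wsum (p + q) F = wsum p F + wsum q F"
proof -
  let ?S = "Poly_Mapping.keys p \<union> Poly_Mapping.keys q"
  have "wsum (p + q) F = (\<Sum>w\<in>?S. Poly_Mapping.lookup (p + q) w * F (letters w))"
    by (rule wsum_superset) (use Poly_Mapping.keys_add[of p q] in auto)
  moreover have "wsum p F = (\<Sum>w\<in>?S. Poly_Mapping.lookup p w * F (letters w))"
    by (rule wsum_superset) auto
  moreover have "wsum q F = (\<Sum>w\<in>?S. Poly_Mapping.lookup q w * F (letters w))"
    by (rule wsum_superset) auto
  ultimately show ?thesis by (simp add: lookup_add sum.distrib algebra_simps)
qed

lemma wsum_uminus [simp]: "wsum (- p) F = - wsum p F"
  using wsum_add[of p "- p" F] by (simp add: add_eq_0_iff)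

lemma wsum_diff [simp]: "wsum (p - q) F = wsum p F - wsum q F"
  using wsum_add[of p "- q" F] by simp

lemma wsum_single [simp]: "wsum (Poly_Mapping.single w c) F = c * F (letters w)"
  by (cases "c = 0") (simp_all add: wsum_def)

lemma letters_simps [simp]:
  "letters (0 :: 'x fword) = []" "letters (v + w) = letters v @ letters w"
  by (simp_all add: zero_fword_def plus_fword_def)

lemma wsum_one [simp]: "wsum 1 F = F []"
  using wsum_single[of 0 1 F] by simp

lemma wsum_letter [simp]: "wsum (letter x) F = F [x]"
  by (simp add: letter_def)

lemma wsum_fun_zero [simp]: "wsum p (\<lambda>w. 0) = 0"
  by (simp add: wsum_def)

lemma wsum_fun_add: "wsum p (\<lambda>w. F w + G w) = wsum p F + wsum p G"
  by (simp add: wsum_def algebra_simps sum.distrib)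

lemma wsum_fun_diff: "wsum p (\<lambda>w. F w - G w) = wsum p F - wsum p G"
  by (simp add: wsum_def algebra_simps sum_subtractf)

lemma wsum_fun_mult: "wsum p (\<lambda>w. c * F w) = c * wsum p F"
  by (simp add: wsum_def algebra_simps sum_distrib_left)

lemma carrier_free_alg: "p \<in> carrier (free_alg X) \<longleftrightarrow> (\<forall>w\<in>Poly_Mapping.keys p. set (letters w) \<subseteq> X)"
  by (simp add: free_alg_def)

lemma wsum_cong:
  assumes "p \<in> carrier (free_alg X)" "\<And>w. set w \<subseteq> X \<Longrightarrow> F w = G w"
  shows "wsum p F = wsum p G"
  unfolding wsum_def using assms by (auto simp: carrier_free_alg intro!: sum.cong)

lemma free_alg_induct [consumes 1, case_names zero add]:
  assumes "p \<in> carrier (free_alg X)" "P 0"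
    and step: "\<And>p u c. p \<in> carrier (free_alg X) \<Longrightarrow> P p \<Longrightarrow> set u \<subseteq> X \<Longrightarrow>
       P (p + Poly_Mapping.single (FWord u) c)"
  shows "P p"
  using assms(1)
proof (induction p rule: Poly_Mapping.update_induct)
  case const
  then show ?case using assms(2) by simp
next
  case (update f a b)
  have eq: "Poly_Mapping.update a b f = f + Poly_Mapping.single a b"
    using update(1) by (intro poly_mapping_eqI) (auto simp: lookup_update lookup_add lookup_single in_keys_iff)
  have keys: "Poly_Mapping.keys (Poly_Mapping.update a b f) = insert a (Poly_Mapping.keys f)"
    using update by (simp add: keys_update)
  have "set (letters a) \<subseteq> X" "f \<in> carrier (free_alg X)"
    using update(4) keys by (auto simp: carrier_free_alg)
  then show ?case using step[of f "letters a" b] update(3) by (simp add: eq)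
qed

lemma wsum_mult [simp]: "wsum (p * q) F = wsum p (\<lambda>u. wsum q (\<lambda>v. F (u @ v)))"
proof -
  have p: "p \<in> carrier (free_alg UNIV)" and q: "q \<in> carrier (free_alg UNIV)"
    by (auto simp: carrier_free_alg)
  show ?thesis
    using p
  proof (induction p rule: free_alg_induct)
    case zero
    then show ?case by simp
  next
    case (add p u c)
    have "wsum (Poly_Mapping.single (FWord u) c * q) F = c * wsum q (\<lambda>v. F (u @ v))"
      using q
      by (induction q rule: free_alg_induct) (simp_all add: distrib_left mult_single algebra_simps)
    then show ?case using add by (simp add: distrib_right)
  qed
qed

lemma free_alg_simps [simp]:
  "mult (free_alg X) = (*)" "one (free_alg X) = 1" "zero (free_alg X) = 0" "add (free_alg X) = (+)"
  "smult (free_alg X) = (\<lambda>c f. Poly_Mapping.single 0 c * f)"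
  by (simp_all add: free_alg_def)

lemma single_zero_comm: "Poly_Mapping.single 0 c * p = p * Poly_Mapping.single 0 (c :: complex)"
  for p :: "'x fword \<Rightarrow>\<^sub>0 complex"
proof -
  have "p \<in> carrier (free_alg UNIV)" by (auto simp: carrier_free_alg)
  then show ?thesis
    by (induction p rule: free_alg_induct) (simp_all add: distrib_left distrib_right mult_single mult.commute)
qed

locale calg = module CC A + ring A for A (structure) +
  assumes smult_mult_l [simp]: "x \<in> carrier A \<Longrightarrow> y \<in> carrier A \<Longrightarrow> (c \<odot> x) \<otimes> y = c \<odot> (x \<otimes> y)"
    and smult_mult_r [simp]: "x \<in> carrier A \<Longrightarrow> y \<in> carrier A \<Longrightarrow> x \<otimes> (c \<odot> y) = c \<odot> (x \<otimes> y)"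

lemma cring_CC: "cring CC"
  by (rule class_cring.is_cring)

lemma single_in_free_alg [simp]: "set (letters w) \<subseteq> X \<Longrightarrow> Poly_Mapping.single w c \<in> carrier (free_alg X)"
  by (simp add: carrier_free_alg)

lemma letter_in_free_alg [simp]: "x \<in> X \<Longrightarrow> letter x \<in> carrier (free_alg X)"
  by (simp add: letter_def)

lemma calg_free_alg: "calg (free_alg X)"
proof -
  interpret ring "free_alg X" by (rule ring_free_alg)
  have closed: "Poly_Mapping.single 0 c * p \<in> carrier (free_alg X)" if "p \<in> carrier (free_alg X)" for c p
    using m_closed[of "Poly_Mapping.single 0 c" p] that by simp
  have "module CC (free_alg X)"
    by (rule moduleI[OF cring_CC abelian_group_axioms])
      (use closed in \<open>simp_all add: single_add distrib_left distrib_right mult.assoc [symmetric] mult_single\<close>)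
  then show ?thesis
  proof (intro calg.intro calg_axioms.intro ring_axioms)
    show "x \<otimes>\<^bsub>free_alg X\<^esub> (c \<odot>\<^bsub>free_alg X\<^esub> y) = c \<odot>\<^bsub>free_alg X\<^esub> (x \<otimes>\<^bsub>free_alg X\<^esub> y)" for x c y
      by simp (metis mult.assoc single_zero_comm)
  qed (simp_all add: mult.assoc)
qed

lemma free_alg_uminus_closed [simp]: "p \<in> carrier (free_alg X) \<Longrightarrow> - p \<in> carrier (free_alg X)"
  by (simp add: carrier_free_alg in_keys_iff)

lemma free_alg_closed [simp]:
  assumes "p \<in> carrier (free_alg X)" "q \<in> carrier (free_alg X)"
  shows "p + q \<in> carrier (free_alg X)" "p * q \<in> carrier (free_alg X)" "p - q \<in> carrier (free_alg X)"
proof -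
  interpret ring "free_alg X" by (rule ring_free_alg)
  show "p + q \<in> carrier (free_alg X)" "p * q \<in> carrier (free_alg X)"
    using add.m_closed[OF assms] m_closed[OF assms] by simp_all
  show "p - q \<in> carrier (free_alg X)"
    using add.m_closed[OF assms(1) free_alg_uminus_closed[OF assms(2)]] by simp
qed

lemma free_alg_zero_one [simp]: "0 \<in> carrier (free_alg X)" "1 \<in> carrier (free_alg X)"
  by (auto simp: carrier_free_alg)

lemma free_alg_minus [simp]:
  assumes "p \<in> carrier (free_alg X)" "q \<in> carrier (free_alg X)"
  shows "p \<ominus>\<^bsub>free_alg X\<^esub> q = p - q"
proof -
  interpret ring "free_alg X" by (rule ring_free_alg)
  have "\<ominus>\<^bsub>free_alg X\<^esub> q = - q"
    by (rule minus_equality) (use assms in simp_all)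
  then show ?thesis by (simp add: a_minus_def)
qed

text \<open>Every element of the free algebra is a sum of words, so the ideal generated by
  \<open>R\<close> is already the additive span of the products u r v with words u and v. One
  coefficient suffices because scalars are central.\<close>

lemma Idl_free_alg_induct [consumes 2, case_names zero add gen]:
  assumes R: "R \<subseteq> carrier (free_alg X)" and p: "p \<in> Idl\<^bsub>free_alg X\<^esub> R"
    and zero: "P 0" and add: "\<And>p q. P p \<Longrightarrow> P q \<Longrightarrow> P (p + q)"
    and gen: "\<And>u v c r. set u \<subseteq> X \<Longrightarrow> set v \<subseteq> X \<Longrightarrow> r \<in> R \<Longrightarrow>
      P (Poly_Mapping.single (FWord u) c * r * Poly_Mapping.single (FWord v) 1)"
  shows "P p"
proof -
  interpret ring "free_alg X" by (rule ring_free_alg)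
  \<comment> \<open>The additive closure of these products, taken as an intersection so that
    inductions over it retain membership.\<close>
  define S where "S = \<Inter>{S. S \<subseteq> carrier (free_alg X) \<and> 0 \<in> S \<and> (\<forall>p\<in>S. \<forall>q\<in>S. p + q \<in> S) \<and>
    (\<forall>u v c r. set u \<subseteq> X \<longrightarrow> set v \<subseteq> X \<longrightarrow> r \<in> R \<longrightarrow>
      Poly_Mapping.single (FWord u) c * r * Poly_Mapping.single (FWord v) 1 \<in> S)}"
  have S_carr: "S \<subseteq> carrier (free_alg X)" unfolding S_def
    by (rule Inter_lower) (use R in auto)
  have S0: "0 \<in> S" and Sadd: "\<And>p q. p \<in> S \<Longrightarrow> q \<in> S \<Longrightarrow> p + q \<in> S"
    and Sgen: "\<And>u v c r. set u \<subseteq> X \<Longrightarrow> set v \<subseteq> X \<Longrightarrow> r \<in> R \<Longrightarrow>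
      Poly_Mapping.single (FWord u) c * r * Poly_Mapping.single (FWord v) 1 \<in> S"
    unfolding S_def by blast+
  have S_ind: "Q p" if "p \<in> S" "Q 0" "\<And>p q. p \<in> S \<Longrightarrow> q \<in> S \<Longrightarrow> Q p \<Longrightarrow> Q q \<Longrightarrow> Q (p + q)"
    "\<And>u v c r. set u \<subseteq> X \<Longrightarrow> set v \<subseteq> X \<Longrightarrow> r \<in> R \<Longrightarrow>
      Q (Poly_Mapping.single (FWord u) c * r * Poly_Mapping.single (FWord v) 1)" for Q p
  proof -
    have "S \<subseteq> {p \<in> S. Q p}"
      by (subst S_def, rule Inter_lower) (use that(2-4) S0 Sadd Sgen S_carr in auto)
    then show ?thesis using that(1) by blast
  qed
  have l: "q * p \<in> S" if "p \<in> S" "q \<in> carrier (free_alg X)" for p q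
    using that(2)
  proof (induction q rule: free_alg_induct)
    case (add q u c)
    have "Poly_Mapping.single (FWord u) c * p \<in> S"
    proof (rule S_ind[OF that(1), of "\<lambda>p. Poly_Mapping.single (FWord u) c * p \<in> S"])
      fix u' v c' r
      assume uv: "set u' \<subseteq> X" "set v \<subseteq> X" "r \<in> R"
      have "Poly_Mapping.single (FWord u) c * (Poly_Mapping.single (FWord u') c' * r * Poly_Mapping.single (FWord v) 1)
        = Poly_Mapping.single (FWord (u @ u')) (c * c') * r * Poly_Mapping.single (FWord v) 1"
        by (simp add: mult_single plus_fword_def flip: mult.assoc)
      then show "Poly_Mapping.single (FWord u) c * (Poly_Mapping.single (FWord u') c' * r * Poly_Mapping.single (FWord v) 1) \<in> S"
        using add uv Sgen[of "u @ u'" v r "c * c'"] by simp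
    qed (simp_all add: S0 Sadd distrib_left)
    then show ?case using add by (simp add: distrib_right Sadd)
  qed (simp add: S0)
  have r: "p * q \<in> S" if "p \<in> S" "q \<in> carrier (free_alg X)" for p q
    using that(2)
  proof (induction q rule: free_alg_induct)
    case (add q v c)
    have "p * Poly_Mapping.single (FWord v) c \<in> S"
    proof (rule S_ind[OF that(1), of "\<lambda>p. p * Poly_Mapping.single (FWord v) c \<in> S"])
      fix u v' c' r
      assume uv: "set u \<subseteq> X" "set v' \<subseteq> X" "r \<in> R"
      have "Poly_Mapping.single (FWord u) c' * r * Poly_Mapping.single (FWord v') 1 * Poly_Mapping.single (FWord v) c
        = Poly_Mapping.single (FWord u) c' * r * (Poly_Mapping.single 0 c * Poly_Mapping.single (FWord (v' @ v)) 1)"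
        by (simp add: mult.assoc mult_single plus_fword_def)
      \<comment> \<open>The coefficient of the right word is carried across \<open>r\<close> to the
        left word.\<close>
      also have "\<dots> = Poly_Mapping.single (FWord u) (c * c') * r * Poly_Mapping.single (FWord (v' @ v)) 1"
        by (simp only: mult.assoc[symmetric] single_zero_comm[symmetric])
          (simp add: mult_single)
      finally show "Poly_Mapping.single (FWord u) c' * r * Poly_Mapping.single (FWord v') 1 *
          Poly_Mapping.single (FWord v) c \<in> S"
        using uv add Sgen[of u "v' @ v" r "c * c'"] by simp
    qed (simp_all add: S0 Sadd distrib_right)
    then show ?case using add by (simp add: distrib_left Sadd)
  qed (simp add: S0)
  have "ideal S (free_alg X)"
  proof (rule idealI[OF ring_axioms])
    show "subgroup S (add_monoid (free_alg X))"
    proof (rule add.subgroupI)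
      show "\<ominus>\<^bsub>free_alg X\<^esub> p \<in> S" if "p \<in> S" for p
      proof -
        have "\<ominus>\<^bsub>free_alg X\<^esub> p = - p"
          by (rule minus_equality) (use that S_carr in auto)
        then show ?thesis
          using l[OF that, of "- 1"] by simp
      qed
    qed (use S0 Sadd S_carr in auto)
  qed (use l r in auto)
  moreover have "R \<subseteq> S"
    using Sgen[of "[]" "[]" _ 1] by (auto simp: zero_fword_def[symmetric])
  ultimately have "p \<in> S"
    using p genideal_minimal by blast
  then show ?thesis
    by (rule S_ind) (use zero add gen in auto)
qed

text \<open>Criterion for a function on words to descend to a presented algebra: by the spanning set
  above, it is enough to test each relation inside every context of words.\<close>

lemma wsum_Idl:
  assumes "R \<subseteq> carrier (free_alg X)" "p \<in> Idl\<^bsub>free_alg X\<^esub> R"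
    and "\<And>u v r. set u \<subseteq> X \<Longrightarrow> set v \<subseteq> X \<Longrightarrow> r \<in> R \<Longrightarrow> wsum r (\<lambda>w. F (u @ w @ v)) = 0"
  shows "wsum p F = 0"
  using assms(1,2) by (induction rule: Idl_free_alg_induct) (simp_all add: assms(3))

section \<open>Quotients of algebras by two-sided ideals\<close>

lemma quot_alg_simps:
  "carrier (quot_alg A I) = a_rcosets\<^bsub>A\<^esub> I" "mult (quot_alg A I) = rcoset_mult A I"
  "one (quot_alg A I) = I +>\<^bsub>A\<^esub> \<one>\<^bsub>A\<^esub>" "zero (quot_alg A I) = I" "add (quot_alg A I) = set_add A"
  "smult (quot_alg A I) = (\<lambda>c X. \<Union>x\<in>X. I +>\<^bsub>A\<^esub> (c \<odot>\<^bsub>A\<^esub> x))"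
  by (simp_all add: quot_alg_def ring.defs module.defs FactRing_def)

locale calg_ideal = calg A + ideal I A for A (structure) and I
begin

abbreviation cls where "cls a \<equiv> I +> a"

lemma smult_ideal: "x \<in> I \<Longrightarrow> c \<odot> x \<in> I"
  using I_l_closed[of x "c \<odot> \<one>"] a_subset by auto

lemma carrier_quot: "carrier (quot_alg A I) = cls ` carrier A"
  by (auto simp: quot_alg_simps A_RCOSETS_def RCOSETS_def a_r_coset_def)

lemma cls_in_quot [simp]: "a \<in> carrier A \<Longrightarrow> cls a \<in> carrier (quot_alg A I)"
  by (simp add: carrier_quot)

lemma cls_mult [simp]:
  "a \<in> carrier A \<Longrightarrow> b \<in> carrier A \<Longrightarrow> cls a \<otimes>\<^bsub>quot_alg A I\<^esub> cls b = cls (a \<otimes> b)"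
  by (simp add: quot_alg_simps rcoset_mult_add)

lemma cls_add [simp]:
  "a \<in> carrier A \<Longrightarrow> b \<in> carrier A \<Longrightarrow> cls a \<oplus>\<^bsub>quot_alg A I\<^esub> cls b = cls (a \<oplus> b)"
  by (simp add: quot_alg_simps a_rcos_sum)

lemma cls_eq_iff: "a \<in> carrier A \<Longrightarrow> b \<in> carrier A \<Longrightarrow> cls a = cls b \<longleftrightarrow> a \<ominus> b \<in> I"
  using quotient_eq_iff_same_a_r_cos[OF is_ideal] by simp

lemma in_cls: "x \<in> cls a \<Longrightarrow> a \<in> carrier A \<Longrightarrow> x \<in> carrier A \<and> cls x = cls a"
  using a_r_coset_subset_G[OF a_subset] a_repr_independence[OF _ _ a_subgroup, of x a] by auto

text \<open>Scalar multiplication on the quotient is a union of cosets over all representatives.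
  These cosets coincide because the ideal is closed under scalars.\<close>

lemma cls_smult [simp]: "a \<in> carrier A \<Longrightarrow> c \<odot>\<^bsub>quot_alg A I\<^esub> cls a = cls (c \<odot> a)"
proof -
  assume a: "a \<in> carrier A"
  have "cls (c \<odot> x) = cls (c \<odot> a)" if "x \<in> cls a" for x
  proof -
    have x: "x \<in> carrier A" "x \<ominus> a \<in> I" using in_cls[OF that a] a cls_eq_iff by auto
    have eq: "c \<odot> x \<ominus> c \<odot> a = c \<odot> (x \<ominus> a)"
      using x a by (simp add: a_minus_def smult_r_distr smult_r_minus)
    have "c \<odot> x \<in> carrier A" "c \<odot> a \<in> carrier A" using x a by simp_all
    then show ?thesis using cls_eq_iff smult_ideal[OF x(2), of c] eq by metis
  qed
  moreover have "a \<in> cls a" using a a_rcos_self by blast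
  ultimately show ?thesis unfolding quot_alg_simps by blast
qed

lemma quot_one [simp]: "\<one>\<^bsub>quot_alg A I\<^esub> = cls \<one>"
  by (simp add: quot_alg_simps)

lemma quot_zero [simp]: "\<zero>\<^bsub>quot_alg A I\<^esub> = cls \<zero>"
  by (simp add: quot_alg_simps a_coset_add_zero a_subset)

lemma calg_quot: "calg (quot_alg A I)"
proof -
  have "ring (quot_alg A I)"
  proof (rule ringI)
    show "abelian_group (quot_alg A I)"
    proof (rule abelian_groupI)
      show "\<exists>y\<in>carrier (quot_alg A I). y \<oplus>\<^bsub>quot_alg A I\<^esub> x = \<zero>\<^bsub>quot_alg A I\<^esub>"
        if x: "x \<in> carrier (quot_alg A I)" for x
      proof -
        obtain a where a: "a \<in> carrier A" "x = cls a" using x by (auto simp: carrier_quot)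
        then show ?thesis by (intro bexI[of _ "cls (\<ominus> a)"]) (simp_all add: l_neg)
      qed
    qed (auto simp: carrier_quot a_ac)
    show "Group.monoid (quot_alg A I)"
      by (rule monoidI) (auto simp: carrier_quot m_assoc)
  qed (auto simp: carrier_quot l_distr r_distr)
  then interpret Q: ring "quot_alg A I" .
  have "module CC (quot_alg A I)"
    by (rule moduleI[OF cring_CC Q.abelian_group_axioms])
      (auto simp: carrier_quot smult_l_distr[simplified] smult_r_distr smult_assoc1[simplified] smult_one[simplified])
  then show ?thesis
    by (intro calg.intro calg_axioms.intro Q.ring_axioms) (auto simp: carrier_quot)
qed

end

section \<open>Tensors as finite sums of pure tensors\<close>

abbreviation lforms :: "(complex, 'a, 'm) module_scheme \<Rightarrow> ('a \<Rightarrow> complex) set" where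
  "lforms M \<equiv> module_hom CC M ground"

lemma lforms_iff: "f \<in> lforms M \<longleftrightarrow>
  (\<forall>x\<in>carrier M. \<forall>y\<in>carrier M. f (x \<oplus>\<^bsub>M\<^esub> y) = f x + f y) \<and>
  (\<forall>c. \<forall>x\<in>carrier M. f (c \<odot>\<^bsub>M\<^esub> x) = c * f x)"
  by (auto simp: module_hom_def ground_def)

lemma lforms_add: "f \<in> lforms M \<Longrightarrow> x \<in> carrier M \<Longrightarrow> y \<in> carrier M \<Longrightarrow> f (x \<oplus>\<^bsub>M\<^esub> y) = f x + f y"
  and lforms_smult: "f \<in> lforms M \<Longrightarrow> x \<in> carrier M \<Longrightarrow> f (c \<odot>\<^bsub>M\<^esub> x) = c * f x"
  by (auto simp: lforms_iff)

lemma bilin_iff: "\<beta> \<in> bilin U W \<longleftrightarrow>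
  (\<forall>a\<in>carrier U. \<forall>x\<in>carrier W. \<forall>y\<in>carrier W. \<beta> a (x \<oplus>\<^bsub>W\<^esub> y) = \<beta> a x + \<beta> a y) \<and>
  (\<forall>a\<in>carrier U. \<forall>c. \<forall>x\<in>carrier W. \<beta> a (c \<odot>\<^bsub>W\<^esub> x) = c * \<beta> a x) \<and>
  (\<forall>b\<in>carrier W. \<forall>x\<in>carrier U. \<forall>y\<in>carrier U. \<beta> (x \<oplus>\<^bsub>U\<^esub> y) b = \<beta> x b + \<beta> y b) \<and>
  (\<forall>b\<in>carrier W. \<forall>c. \<forall>x\<in>carrier U. \<beta> (c \<odot>\<^bsub>U\<^esub> x) b = c * \<beta> x b)"
  unfolding bilin_def lforms_iff by blast

lemma bilin_lform1: "\<beta> \<in> bilin U W \<Longrightarrow> b \<in> carrier W \<Longrightarrow> (\<lambda>a. \<beta> a b) \<in> lforms U"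
  and bilin_lform2: "\<beta> \<in> bilin U W \<Longrightarrow> a \<in> carrier U \<Longrightarrow> \<beta> a \<in> lforms W"
  by (auto simp: bilin_def)

lemma bilin_add1: "\<beta> \<in> bilin U W \<Longrightarrow> x \<in> carrier U \<Longrightarrow> y \<in> carrier U \<Longrightarrow> b \<in> carrier W \<Longrightarrow>
    \<beta> (x \<oplus>\<^bsub>U\<^esub> y) b = \<beta> x b + \<beta> y b"
  and bilin_smult1: "\<beta> \<in> bilin U W \<Longrightarrow> x \<in> carrier U \<Longrightarrow> b \<in> carrier W \<Longrightarrow> \<beta> (c \<odot>\<^bsub>U\<^esub> x) b = c * \<beta> x b"
  and bilin_add2: "\<beta> \<in> bilin U W \<Longrightarrow> b \<in> carrier W \<Longrightarrow> b' \<in> carrier W \<Longrightarrow> x \<in> carrier U \<Longrightarrow>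
    \<beta> x (b \<oplus>\<^bsub>W\<^esub> b') = \<beta> x b + \<beta> x b'"
  and bilin_smult2: "\<beta> \<in> bilin U W \<Longrightarrow> b \<in> carrier W \<Longrightarrow> x \<in> carrier U \<Longrightarrow> \<beta> x (c \<odot>\<^bsub>W\<^esub> b) = c * \<beta> x b"
  by (simp_all add: bilin_iff)

lemma lforms_zero:
  assumes "module CC M" "f \<in> lforms M" shows "f \<zero>\<^bsub>M\<^esub> = 0"
proof -
  interpret M: module CC M by fact
  show ?thesis
    using lforms_smult[OF assms(2), of "\<zero>\<^bsub>M\<^esub>" 0] M.smult_r_null[of 0] by simp
qed

lemma lforms_uminus:
  assumes "module CC M" "f \<in> lforms M" "x \<in> carrier M" shows "f (\<ominus>\<^bsub>M\<^esub> x) = - f x"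
proof -
  interpret M: module CC M by fact
  show ?thesis
    using lforms_add[OF assms(2,3), of "\<ominus>\<^bsub>M\<^esub> x"] lforms_zero[OF assms(1,2)] assms(3)
    by (simp add: M.r_neg add_eq_0_iff2)
qed

lemma lforms_minus:
  assumes "module CC M" "f \<in> lforms M" "x \<in> carrier M" "y \<in> carrier M"
  shows "f (x \<ominus>\<^bsub>M\<^esub> y) = f x - f y"
proof -
  interpret M: module CC M by fact
  show ?thesis
    using lforms_add[OF assms(2,3), of "\<ominus>\<^bsub>M\<^esub> y"] lforms_uminus[OF assms(1,2)] assms(3,4)
    by (simp add: a_minus_def)
qed

lemma lforms_sum_list:
  assumes "\<And>x. x \<in> set xs \<Longrightarrow> g x \<in> lforms M"
  shows "(\<lambda>a. \<Sum>x\<leftarrow>xs. g x a) \<in> lforms M"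
  using assms by (induction xs) (auto simp: lforms_iff algebra_simps)

text \<open>Normal form of a tensor: statements about tensors are reduced to sums over a list of
  pairs.\<close>

definition list_tensor ::
  "(complex, 'a, 'm) module_scheme \<Rightarrow> (complex, 'b, 'n) module_scheme \<Rightarrow> ('a \<times> 'b) list \<Rightarrow> ('a, 'b) tens"
where
  "list_tensor U W xs = (\<lambda>\<beta>\<in>bilin U W. \<Sum>(a, b)\<leftarrow>xs. \<beta> a b)"

lemma list_tensor_apply: "\<beta> \<in> bilin U W \<Longrightarrow> list_tensor U W xs \<beta> = (\<Sum>(a, b)\<leftarrow>xs. \<beta> a b)"
  by (simp add: list_tensor_def)

lemma module_func_space: "module CC (class_ring.func_space (S :: 'z set) :: (complex, 'z \<Rightarrow> complex) module)"
  by (rule class_cring.func_space_is_module)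

lemma tensor_simps:
  "zero (tensor U W) = (\<lambda>\<beta>\<in>bilin U W. 0)"
  "add (tensor U W) = (\<lambda>s t. \<lambda>\<beta>\<in>bilin U W. s \<beta> + t \<beta>)"
  "smult (tensor U W) = (\<lambda>c t. \<lambda>\<beta>\<in>bilin U W. c * t \<beta>)"
  by (simp_all add: tensor_def class_ring.func_space_def)

text \<open>Finite sums of pure tensors form a submodule, hence contain the span; they lie in it by
  induction on the list. A scalar is absorbed by the first factors.\<close>

lemma carrier_tensor:
  fixes U :: "(complex, 'a, 'm) module_scheme" and W :: "(complex, 'b, 'n) module_scheme"
  assumes "module CC U"
  shows "carrier (tensor U W) = {list_tensor U W xs | xs. set xs \<subseteq> carrier U \<times> carrier W}"
proof -
  let ?F = "class_ring.func_space (bilin U W) :: (complex, ('a, 'b) tens) module"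
  let ?S = "{pure_tensor U W a b | a b. a \<in> carrier U \<and> b \<in> carrier W}"
  let ?P = "{list_tensor U W xs | xs. set xs \<subseteq> carrier U \<times> carrier W}"
  interpret F: module CC ?F by (rule module_func_space)
  interpret U: module CC U by fact
  have S: "?S \<subseteq> carrier ?F"
    by (auto simp: class_ring.func_space_def pure_tensor_def)
  have carr: "carrier (tensor U W) = F.span ?S"
    by (simp add: tensor_def)
  have "submodule CC ?P ?F"
  proof (unfold_locales, goal_cases)
    case 1
    then show ?case by (auto simp: class_ring.func_space_def list_tensor_def)
  next
    case (2 v w)
    then obtain xs ys where "v = list_tensor U W xs" "w = list_tensor U W ys"
      "set xs \<subseteq> carrier U \<times> carrier W" "set ys \<subseteq> carrier U \<times> carrier W" by blast
    then show ?case
      by (auto simp: class_ring.func_space_def list_tensor_def fun_eq_iff intro!: exI[of _ "xs @ ys"])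
  next
    case 3
    then show ?case
      by (auto simp: class_ring.func_space_def list_tensor_def fun_eq_iff intro!: exI[of _ "[]"])
  next
    case (4 c v)
    then obtain xs where xs: "v = list_tensor U W xs" "set xs \<subseteq> carrier U \<times> carrier W" by blast
    let ?ys = "map (\<lambda>(a, b). (c \<odot>\<^bsub>U\<^esub> a, b)) xs"
    have "(\<Sum>(a, b)\<leftarrow>?ys. \<beta> a b) = c * (\<Sum>(a, b)\<leftarrow>xs. \<beta> a b)" if "\<beta> \<in> bilin U W" for \<beta>
      using xs(2) by (induction xs) (auto simp: algebra_simps bilin_smult1[OF that])
    then have "c \<odot>\<^bsub>?F\<^esub> v = list_tensor U W ?ys"
      by (auto simp: class_ring.func_space_def list_tensor_def fun_eq_iff xs(1))
    moreover have "set ?ys \<subseteq> carrier U \<times> carrier W" using xs(2) by auto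
    ultimately show ?case by blast
  qed
  moreover have "?S \<subseteq> ?P"
  proof safe
    fix a b assume "a \<in> carrier U" "b \<in> carrier W"
    then show "\<exists>xs. pure_tensor U W a b = list_tensor U W xs \<and> set xs \<subseteq> carrier U \<times> carrier W"
      by (intro exI[of _ "[(a, b)]"]) (auto simp: pure_tensor_def list_tensor_def)
  qed
  ultimately have 1: "F.span ?S \<subseteq> ?P"
    by (intro F.span_is_subset)
  have sub: "submodule CC (F.span ?S) ?F" by (rule F.span_is_submodule[OF S])
  have 2: "list_tensor U W xs \<in> F.span ?S" if "set xs \<subseteq> carrier U \<times> carrier W" for xs
    using that
  proof (induction xs)
    case Nil
    have "\<zero>\<^bsub>?F\<^esub> \<in> F.span ?S" using sub by (rule submodule.zero_closed)
    also have "\<zero>\<^bsub>?F\<^esub> = list_tensor U W []" by (simp add: list_tensor_def class_ring.func_space_def)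
    finally show ?case .
  next
    case (Cons x xs)
    obtain a b where x: "x = (a, b)" by force
    have "pure_tensor U W a b \<in> F.span ?S"
      using F.in_own_span[OF S] Cons(2) x by auto
    then have "pure_tensor U W a b \<oplus>\<^bsub>?F\<^esub> list_tensor U W xs \<in> F.span ?S"
      using submodule.m_closed[OF sub] Cons by auto
    also have "pure_tensor U W a b \<oplus>\<^bsub>?F\<^esub> list_tensor U W xs = list_tensor U W (x # xs)"
      by (auto simp: class_ring.func_space_def list_tensor_def pure_tensor_def x fun_eq_iff)
    finally show ?case .
  qed
  show ?thesis unfolding carr
  proof (rule subset_antisym[OF 1], rule subsetI)
    fix t assume "t \<in> ?P"
    then obtain xs where "t = list_tensor U W xs" "set xs \<subseteq> carrier U \<times> carrier W" by blast
    then show "t \<in> F.span ?S" using 2 by simp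
  qed
qed

lemma module_tensor:
  fixes U :: "(complex, 'a, 'm) module_scheme" and W :: "(complex, 'b, 'n) module_scheme"
  shows "module CC (tensor U W)"
proof -
  let ?F = "class_ring.func_space (bilin U W) :: (complex, ('a, 'b) tens) module"
  let ?S = "{pure_tensor U W a b | a b. a \<in> carrier U \<and> b \<in> carrier W}"
  interpret F: module CC ?F by (rule module_func_space)
  have S: "?S \<subseteq> carrier ?F"
    by (auto simp: class_ring.func_space_def pure_tensor_def)
  show ?thesis unfolding tensor_def
    by (rule F.submodule_is_module[OF F.span_is_submodule[OF S]])
qed

lemma tensor_ext:
  assumes "s \<in> carrier (tensor U W)" "t \<in> carrier (tensor U W)" "module CC U"
    "\<And>\<beta>. \<beta> \<in> bilin U W \<Longrightarrow> s \<beta> = t \<beta>"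
  shows "s = t"
  using assms by (auto simp: carrier_tensor list_tensor_def fun_eq_iff)

lemma bilin_cong:
  assumes "\<And>a b. a \<in> carrier U \<Longrightarrow> b \<in> carrier W \<Longrightarrow> \<beta> a b = \<gamma> a b" "module CC U" "module CC W"
  shows "\<beta> \<in> bilin U W \<longleftrightarrow> \<gamma> \<in> bilin U W"
proof -
  interpret U: module CC U by fact
  interpret W: module CC W by fact
  show ?thesis unfolding bilin_iff using assms(1) by (simp cong: ball_cong)
qed

text \<open>Forms are total functions with arbitrary values off the carriers. Two forms that agree
  on the carriers are both bilinear or both not, and in the second case \<open>t\<close> takes the
  same default value at both.\<close>

lemma tensor_cong:
  assumes "t \<in> carrier (tensor U W)" "module CC U" "module CC W"
    "\<And>a b. a \<in> carrier U \<Longrightarrow> b \<in> carrier W \<Longrightarrow> \<beta> a b = \<gamma> a b"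
  shows "t \<beta> = t \<gamma>"
proof -
  obtain xs where xs: "t = list_tensor U W xs" "set xs \<subseteq> carrier U \<times> carrier W"
    using assms by (auto simp: carrier_tensor)
  have "(\<Sum>(a, b)\<leftarrow>xs. \<beta> a b) = (\<Sum>(a, b)\<leftarrow>xs. \<gamma> a b)"
    using assms(4) xs(2) by (intro arg_cong[where f = sum_list] map_cong) auto
  then show ?thesis
    using bilin_cong[OF assms(4,2,3)] by (auto simp: xs(1) list_tensor_def)
qed

lemma pure_tensor_in [simp]: "module CC U \<Longrightarrow> a \<in> carrier U \<Longrightarrow> b \<in> carrier W \<Longrightarrow>
  pure_tensor U W a b \<in> carrier (tensor U W)"
  by (auto simp: carrier_tensor pure_tensor_def list_tensor_def intro!: exI[of _ "[(a, b)]"])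

lemma pure_tensor_apply: "\<beta> \<in> bilin U W \<Longrightarrow> pure_tensor U W a b \<beta> = \<beta> a b"
  by (simp add: pure_tensor_def)

section \<open>The tensor square of a superalgebra\<close>

text \<open>The grading rule is stated with a projected right factor only; general products follow
  by additivity.\<close>

locale superalg = calg A for A :: "('a, 'm) super_algebra_scheme" (structure) +
  assumes part_closed [simp]: "x \<in> carrier A \<Longrightarrow> part A p x \<in> carrier A"
    and part_add: "x \<in> carrier A \<Longrightarrow> y \<in> carrier A \<Longrightarrow> part A p (x \<oplus> y) = part A p x \<oplus> part A p y"
    and part_smult: "x \<in> carrier A \<Longrightarrow> part A p (c \<odot> x) = c \<odot> part A p x"
    and part_sum: "x \<in> carrier A \<Longrightarrow> part A 0 x \<oplus> part A 1 x = x"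
    and part_mult: "x \<in> carrier A \<Longrightarrow> y \<in> carrier A \<Longrightarrow>
        part A 0 (x \<otimes> part A 0 y) = part A 0 x \<otimes> part A 0 y \<and>
        part A 1 (x \<otimes> part A 0 y) = part A 1 x \<otimes> part A 0 y \<and>
        part A 0 (x \<otimes> part A 1 y) = part A 1 x \<otimes> part A 1 y \<and>
        part A 1 (x \<otimes> part A 1 y) = part A 0 x \<otimes> part A 1 y"
    and part_one: "part A 0 \<one> = \<one>" "part A 1 \<one> = \<zero>"
begin

abbreviation Ev ("\<pi>\<^sub>0") where "\<pi>\<^sub>0 \<equiv> part A 0"
abbreviation Od ("\<pi>\<^sub>1") where "\<pi>\<^sub>1 \<equiv> part A (Suc 0)"

text \<open>The parity automorphism, which carries the Koszul signs from here on.\<close>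

definition sgm ("\<sigma>") where "\<sigma> x = \<pi>\<^sub>0 x \<ominus> \<pi>\<^sub>1 x"

lemma part_mult' [simp]:
  assumes "x \<in> carrier A" "y \<in> carrier A"
  shows "\<pi>\<^sub>0 (x \<otimes> \<pi>\<^sub>0 y) = \<pi>\<^sub>0 x \<otimes> \<pi>\<^sub>0 y" "\<pi>\<^sub>1 (x \<otimes> \<pi>\<^sub>0 y) = \<pi>\<^sub>1 x \<otimes> \<pi>\<^sub>0 y"
    "\<pi>\<^sub>0 (x \<otimes> \<pi>\<^sub>1 y) = \<pi>\<^sub>1 x \<otimes> \<pi>\<^sub>1 y" "\<pi>\<^sub>1 (x \<otimes> \<pi>\<^sub>1 y) = \<pi>\<^sub>0 x \<otimes> \<pi>\<^sub>1 y"
  using part_mult[OF assms] by simp_all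

lemma part_one' [simp]: "\<pi>\<^sub>0 \<one> = \<one>" "\<pi>\<^sub>1 \<one> = \<zero>"
  using part_one by simp_all

text \<open>Orthogonality of the projections is the grading rule with left factor
  \<open>\<one>\<close>, which is even.\<close>

lemma part_part [simp]:
  assumes "y \<in> carrier A"
  shows "\<pi>\<^sub>0 (\<pi>\<^sub>0 y) = \<pi>\<^sub>0 y" "\<pi>\<^sub>1 (\<pi>\<^sub>0 y) = \<zero>" "\<pi>\<^sub>0 (\<pi>\<^sub>1 y) = \<zero>" "\<pi>\<^sub>1 (\<pi>\<^sub>1 y) = \<pi>\<^sub>1 y"
  using part_mult'[OF one_closed assms] assms by simp_all

lemma part_zero [simp]: "part A p \<zero> = \<zero>"
  using part_smult[of \<zero> p 0] smult_l_null[of "part A p \<zero>"] by simp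

lemma part_uminus [simp]: "x \<in> carrier A \<Longrightarrow> part A p (\<ominus> x) = \<ominus> part A p x"
  using part_add[of "\<ominus> x" x p] minus_equality[of "part A p (\<ominus> x)" "part A p x"] by (simp add: l_neg)

lemma sgm_closed [simp]: "x \<in> carrier A \<Longrightarrow> \<sigma> x \<in> carrier A"
  by (simp add: sgm_def)

lemma sgm_one [simp]: "\<sigma> \<one> = \<one>"
  by (simp add: sgm_def a_minus_def)

lemma sgm_part [simp]:
  assumes "x \<in> carrier A"
  shows "\<sigma> (\<pi>\<^sub>0 x) = \<pi>\<^sub>0 x" "\<sigma> (\<pi>\<^sub>1 x) = \<ominus> \<pi>\<^sub>1 x" "\<pi>\<^sub>0 (\<sigma> x) = \<pi>\<^sub>0 x" "\<pi>\<^sub>1 (\<sigma> x) = \<ominus> \<pi>\<^sub>1 x"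
  using assms by (simp_all add: sgm_def a_minus_def part_add)

lemma sgm_add: "x \<in> carrier A \<Longrightarrow> y \<in> carrier A \<Longrightarrow> \<sigma> (x \<oplus> y) = \<sigma> x \<oplus> \<sigma> y"
  by (simp add: sgm_def part_add a_minus_def minus_add a_ac)

lemma sgm_smult: "x \<in> carrier A \<Longrightarrow> \<sigma> (c \<odot> x) = c \<odot> \<sigma> x"
  by (simp add: sgm_def part_smult a_minus_def smult_r_distr smult_r_minus)

lemma sgm_sgm [simp]: "x \<in> carrier A \<Longrightarrow> \<sigma> (\<sigma> x) = x"
  using part_sum[of x] by (simp add: sgm_def[of "\<sigma> x"] a_minus_def)

lemma sgm_mult:
  assumes "x \<in> carrier A" "y \<in> carrier A"
  shows "\<sigma> (x \<otimes> y) = \<sigma> x \<otimes> \<sigma> y"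
proof -
  have "\<sigma> (x \<otimes> y) = \<sigma> (x \<otimes> \<pi>\<^sub>0 y \<oplus> x \<otimes> \<pi>\<^sub>1 y)"
    using assms part_sum[of y] by (simp add: r_distr[symmetric])
  also have "\<dots> = \<sigma> x \<otimes> \<sigma> y"
    using assms by (simp add: sgm_def part_add a_minus_def l_distr r_distr l_minus r_minus minus_add a_ac)
  finally show ?thesis .
qed

abbreviation Bil where "Bil \<equiv> bilin A A"

abbreviation TT where "TT \<equiv> super_tensor_sq A"

text \<open>The value of \<beta> at the super product (a \<otimes> b)(c \<otimes> d).\<close>

definition mform :: "('a \<Rightarrow> 'a \<Rightarrow> complex) \<Rightarrow> 'a \<Rightarrow> 'a \<Rightarrow> 'a \<Rightarrow> 'a \<Rightarrow> complex" where
  "mform \<beta> a b c d = (\<Sum>p<2. \<Sum>q<2. (-1) ^ (p * q) * \<beta> (a \<otimes> part A q c) (part A p b \<otimes> d))"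

text \<open>The right multiplication by \<open>t\<close> on \<open>A \<otimes> A\<close>, transposed to bilinear forms.\<close>

definition bact :: "('a, 'a) tens \<Rightarrow> ('a \<Rightarrow> 'a \<Rightarrow> complex) \<Rightarrow> 'a \<Rightarrow> 'a \<Rightarrow> complex" where
  "bact t \<beta> = (\<lambda>a b. t (\<lambda>c d. mform \<beta> a b c d))"

lemma module_A: "module CC A"
  by (rule module_axioms)

lemmas bil_simps = bilin_add1 bilin_add2 bilin_smult1 bilin_smult2

lemma bilin_zero1: "\<beta> \<in> Bil \<Longrightarrow> b \<in> carrier A \<Longrightarrow> \<beta> \<zero> b = 0"
  and bilin_zero2: "\<beta> \<in> Bil \<Longrightarrow> b \<in> carrier A \<Longrightarrow> \<beta> b \<zero> = 0"
  and bilin_uminus1: "\<beta> \<in> Bil \<Longrightarrow> a \<in> carrier A \<Longrightarrow> b \<in> carrier A \<Longrightarrow> \<beta> (\<ominus> a) b = - \<beta> a b"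
  and bilin_uminus2: "\<beta> \<in> Bil \<Longrightarrow> a \<in> carrier A \<Longrightarrow> b \<in> carrier A \<Longrightarrow> \<beta> b (\<ominus> a) = - \<beta> b a"
  using lforms_zero[OF module_A bilin_lform1[of \<beta> A A b]] lforms_zero[OF module_A bilin_lform2[of \<beta> A A b]]
    lforms_uminus[OF module_A bilin_lform1[of \<beta> A A b]] lforms_uminus[OF module_A bilin_lform2[of \<beta> A A b]]
  by auto

lemmas bil_simps' = bil_simps bilin_zero1 bilin_zero2 bilin_uminus1 bilin_uminus2

text \<open>The Koszul sign is trivial for even c; for odd c it is the parity sign of b, that is
  \<open>\<sigma>\<close>.\<close>

lemma mform_eq:
  assumes "\<beta> \<in> Bil" "a \<in> carrier A" "b \<in> carrier A" "c \<in> carrier A" "d \<in> carrier A"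
  shows "mform \<beta> a b c d = \<beta> (a \<otimes> \<pi>\<^sub>0 c) (b \<otimes> d) + \<beta> (a \<otimes> \<pi>\<^sub>1 c) (\<sigma> b \<otimes> d)"
proof -
  have 1: "\<beta> x (b \<otimes> d) = \<beta> x (\<pi>\<^sub>0 b \<otimes> d) + \<beta> x (\<pi>\<^sub>1 b \<otimes> d)" if "x \<in> carrier A" for x
    using part_sum[of b] that assms by (simp add: l_distr[symmetric] bilin_add2[symmetric])
  have 2: "\<beta> x (\<sigma> b \<otimes> d) = \<beta> x (\<pi>\<^sub>0 b \<otimes> d) - \<beta> x (\<pi>\<^sub>1 b \<otimes> d)" if "x \<in> carrier A" for x
    using that assms by (simp add: sgm_def l_distr a_minus_def l_minus bil_simps')
  show ?thesis using assms by (simp add: mform_def 1 2 numeral_2_eq_2)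
qed

lemma mform_bilin1: "\<beta> \<in> Bil \<Longrightarrow> c \<in> carrier A \<Longrightarrow> d \<in> carrier A \<Longrightarrow> (\<lambda>a b. mform \<beta> a b c d) \<in> Bil"
  by (simp add: bilin_iff mform_eq l_distr r_distr part_add part_smult sgm_add sgm_smult algebra_simps)

lemma mform_bilin2: "\<beta> \<in> Bil \<Longrightarrow> a \<in> carrier A \<Longrightarrow> b \<in> carrier A \<Longrightarrow> (\<lambda>c d. mform \<beta> a b c d) \<in> Bil"
  by (simp add: bilin_iff mform_eq l_distr r_distr part_add part_smult sgm_add sgm_smult algebra_simps)

lemma tensor_list:
  assumes "t \<in> carrier (tensor A A)"
  obtains xs where "set xs \<subseteq> carrier A \<times> carrier A" "t = list_tensor A A xs"
  using assms by (auto simp: carrier_tensor[OF module_A])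

lemma list_tensor_in: "set xs \<subseteq> carrier A \<times> carrier A \<Longrightarrow> list_tensor A A xs \<in> carrier (tensor A A)"
  by (auto simp: carrier_tensor[OF module_A])

lemma bilin_sum_list:
  assumes "\<And>x. x \<in> set xs \<Longrightarrow> g x \<in> Bil"
  shows "(\<lambda>a b. \<Sum>x\<leftarrow>xs. g x a b) \<in> Bil"
  using assms by (induction xs) (auto simp: bilin_iff algebra_simps)

lemma bilin_sum:
  assumes "\<And>x. x \<in> S \<Longrightarrow> g x \<in> Bil"
  shows "(\<lambda>a b. \<Sum>x\<in>S. g x a b) \<in> Bil"
  using assms by (auto simp: bilin_iff sum.distrib sum_distrib_left)

lemma bilin_add: "\<beta> \<in> Bil \<Longrightarrow> \<gamma> \<in> Bil \<Longrightarrow> (\<lambda>a b. \<beta> a b + \<gamma> a b) \<in> Bil"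
  and bilin_cmult: "\<beta> \<in> Bil \<Longrightarrow> (\<lambda>a b. c * \<beta> a b) \<in> Bil"
  and bilin_0: "(\<lambda>a b. 0) \<in> Bil"
  by (auto simp: bilin_iff algebra_simps)

lemma tensor_congA:
  assumes "t \<in> carrier (tensor A A)" "\<And>a b. a \<in> carrier A \<Longrightarrow> b \<in> carrier A \<Longrightarrow> \<beta> a b = \<gamma> a b"
  shows "t \<beta> = t \<gamma>"
  by (rule tensor_cong[OF assms(1) module_A module_A assms(2)])

lemma tensor_form_add:
  assumes "t \<in> carrier (tensor A A)" "\<beta> \<in> Bil" "\<gamma> \<in> Bil"
  shows "t (\<lambda>a b. \<beta> a b + \<gamma> a b) = t \<beta> + t \<gamma>"
proof -
  obtain xs where xs: "t = list_tensor A A xs" using assms(1) by (rule tensor_list)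
  show ?thesis
    using assms(2,3) by (simp add: xs list_tensor_apply bilin_add sum_list_addf case_prod_unfold)
qed

lemma tensor_form_cmult:
  assumes "t \<in> carrier (tensor A A)" "\<beta> \<in> Bil"
  shows "t (\<lambda>a b. c * \<beta> a b) = c * t \<beta>"
proof -
  obtain xs where xs: "t = list_tensor A A xs" using assms(1) by (rule tensor_list)
  show ?thesis
    using assms(2) by (simp add: xs list_tensor_apply bilin_cmult sum_list_const_mult case_prod_unfold)
qed

lemma bact_bilin:
  assumes "t \<in> carrier (tensor A A)" "\<beta> \<in> Bil"
  shows "bact t \<beta> \<in> Bil"
proof -
  obtain xs where xs: "set xs \<subseteq> carrier A \<times> carrier A" "t = list_tensor A A xs"
    using assms(1) by (rule tensor_list)
  have "(\<lambda>a b. \<Sum>z\<leftarrow>xs. mform \<beta> a b (fst z) (snd z)) \<in> Bil"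
    by (rule bilin_sum_list) (use xs assms(2) in \<open>auto intro!: mform_bilin1\<close>)
  moreover have eq: "bact t \<beta> a b = (\<Sum>z\<leftarrow>xs. mform \<beta> a b (fst z) (snd z))"
    if "a \<in> carrier A" "b \<in> carrier A" for a b
    unfolding bact_def xs(2) using list_tensor_apply[OF mform_bilin2[OF assms(2) that]]
    by (simp add: case_prod_unfold)
  ultimately show ?thesis
    by (subst bilin_cong[OF eq module_A module_A])
qed

text \<open>Fubini for finite sums. The multiplication of \<open>super_tensor_sq\<close> is written
  with the right factor outermost, while transposition by \<open>bact\<close> needs the left factor
  there.\<close>

lemma tensor_swap:
  assumes s: "s \<in> carrier (tensor A A)" and t: "t \<in> carrier (tensor A A)"
    and F1: "\<And>c d. c \<in> carrier A \<Longrightarrow> d \<in> carrier A \<Longrightarrow> (\<lambda>a b. F a b c d) \<in> Bil"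
    and F2: "\<And>a b. a \<in> carrier A \<Longrightarrow> b \<in> carrier A \<Longrightarrow> (\<lambda>c d. F a b c d) \<in> Bil"
  shows "t (\<lambda>c d. s (\<lambda>a b. F a b c d)) = s (\<lambda>a b. t (\<lambda>c d. F a b c d))"
proof -
  obtain xs where xs: "set xs \<subseteq> carrier A \<times> carrier A" "s = list_tensor A A xs"
    using s by (rule tensor_list)
  obtain ys where ys: "set ys \<subseteq> carrier A \<times> carrier A" "t = list_tensor A A ys"
    using t by (rule tensor_list)
  have "t (\<lambda>c d. s (\<lambda>a b. F a b c d)) = t (\<lambda>c d. \<Sum>z\<leftarrow>xs. F (fst z) (snd z) c d)"
    by (rule tensor_congA[OF t]) (use F1 in \<open>simp add: xs list_tensor_apply case_prod_unfold\<close>)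
  also have "\<dots> = (\<Sum>w\<leftarrow>ys. \<Sum>z\<leftarrow>xs. F (fst z) (snd z) (fst w) (snd w))"
    unfolding ys(2)
    by (subst list_tensor_apply) (use F2 xs in \<open>auto intro!: bilin_sum_list simp: case_prod_unfold\<close>)
  also have "\<dots> = (\<Sum>z\<leftarrow>xs. \<Sum>w\<leftarrow>ys. F (fst z) (snd z) (fst w) (snd w))"
    by (induction xs) (auto simp: sum_list_addf)
  also have "\<dots> = s (\<lambda>a b. \<Sum>w\<leftarrow>ys. F a b (fst w) (snd w))"
    unfolding xs(2)
    by (subst list_tensor_apply) (use F1 ys in \<open>auto intro!: bilin_sum_list simp: case_prod_unfold\<close>)
  also have "\<dots> = s (\<lambda>a b. t (\<lambda>c d. F a b c d))"
    by (rule tensor_congA[OF s]) (use F2 in \<open>simp add: ys list_tensor_apply case_prod_unfold\<close>)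
  finally show ?thesis .
qed

lemma TT_simps:
  "carrier TT = carrier (tensor A A)" "zero TT = zero (tensor A A)" "add TT = add (tensor A A)"
  "smult TT = smult (tensor A A)" "one TT = pure_tensor A A \<one> \<one>"
  "mult TT = (\<lambda>s t. \<lambda>\<beta>\<in>Bil. t (\<lambda>c d. s (\<lambda>a b. mform \<beta> a b c d)))"
  by (simp_all add: super_tensor_sq_def mform_def)

lemma TT_mult_apply:
  assumes "s \<in> carrier TT" "t \<in> carrier TT" "\<beta> \<in> Bil"
  shows "(s \<otimes>\<^bsub>TT\<^esub> t) \<beta> = s (bact t \<beta>)"
  using assms unfolding TT_simps bact_def
  by (simp add: tensor_swap mform_bilin1 mform_bilin2)

lemma TT_mult_closed [simp]:
  assumes "s \<in> carrier TT" "t \<in> carrier TT"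
  shows "s \<otimes>\<^bsub>TT\<^esub> t \<in> carrier TT"
proof -
  have st: "s \<in> carrier (tensor A A)" "t \<in> carrier (tensor A A)" using assms by (simp_all add: TT_simps)
  obtain xs where xs: "set xs \<subseteq> carrier A \<times> carrier A" "s = list_tensor A A xs"
    using st(1) by (rule tensor_list)
  obtain ys where ys: "set ys \<subseteq> carrier A \<times> carrier A" "t = list_tensor A A ys"
    using st(2) by (rule tensor_list)
  \<comment> \<open>An explicit list for the product: each pair of pure tensors contributes one
    entry for the even and one for the odd part of c.\<close>
  define zs where "zs = concat (map (\<lambda>(a, b). concat (map (\<lambda>(c, d).
    [(a \<otimes> \<pi>\<^sub>0 c, b \<otimes> d), (a \<otimes> \<pi>\<^sub>1 c, \<sigma> b \<otimes> d)]) ys)) xs)"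
  have zs: "set zs \<subseteq> carrier A \<times> carrier A"
    using xs(1) ys(1) by (fastforce simp: zs_def)
  have inner: "(\<Sum>(a, b)\<leftarrow>concat (map (\<lambda>(c, d). [(a \<otimes> \<pi>\<^sub>0 c, b \<otimes> d), (a \<otimes> \<pi>\<^sub>1 c, \<sigma> b \<otimes> d)]) ys). \<beta> a b)
      = (\<Sum>(c, d)\<leftarrow>ys. mform \<beta> a b c d)" if "a \<in> carrier A" "b \<in> carrier A" "\<beta> \<in> Bil" for a b \<beta>
    using ys(1) by (induction ys) (auto simp: mform_eq that)
  have "(s \<otimes>\<^bsub>TT\<^esub> t) \<beta> = list_tensor A A zs \<beta>" if \<beta>: "\<beta> \<in> Bil" for \<beta>
  proof -
    have "(s \<otimes>\<^bsub>TT\<^esub> t) \<beta> = (\<Sum>(a, b)\<leftarrow>xs. bact t \<beta> a b)"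
      using TT_mult_apply[OF assms \<beta>] bact_bilin[OF st(2) \<beta>] by (simp add: xs list_tensor_apply)
    also have "\<dots> = (\<Sum>(a, b)\<leftarrow>xs. \<Sum>(c, d)\<leftarrow>ys. mform \<beta> a b c d)"
      using xs(1) \<beta> by (intro arg_cong[where f = sum_list] map_cong)
        (auto simp: bact_def ys(2) list_tensor_apply mform_bilin2)
    also have "\<dots> = (\<Sum>(a, b)\<leftarrow>zs. \<beta> a b)"
      unfolding zs_def using xs(1)
      by (induction xs) (auto simp: inner \<beta>)
    finally show ?thesis using \<beta> by (simp add: list_tensor_apply)
  qed
  moreover have "(s \<otimes>\<^bsub>TT\<^esub> t) \<beta> = list_tensor A A zs \<beta>" if "\<beta> \<notin> Bil" for \<beta>
    using that by (simp add: TT_simps list_tensor_def)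
  ultimately have "s \<otimes>\<^bsub>TT\<^esub> t = list_tensor A A zs" by blast
  then show ?thesis using list_tensor_in[OF zs] by (simp add: TT_simps)
qed

lemma TT_ext:
  assumes "s \<in> carrier TT" "t \<in> carrier TT" "\<And>\<beta>. \<beta> \<in> Bil \<Longrightarrow> s \<beta> = t \<beta>"
  shows "s = t"
  using tensor_ext[of s A A t] assms module_A by (simp add: TT_simps)

text \<open>Associativity of the super multiplication on pure tensors; the signs match because
  \<open>\<sigma>\<close> is multiplicative.\<close>

lemma mform_mform:
  assumes "\<beta> \<in> Bil" "a \<in> carrier A" "b \<in> carrier A" "a' \<in> carrier A" "b' \<in> carrier A"
    "c \<in> carrier A" "d \<in> carrier A"
  shows "mform (\<lambda>a' b'. mform \<beta> a' b' c d) a b a' b' = mform (\<lambda>c d. mform \<beta> a b c d) a' b' c d"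
  using assms
  by (simp add: mform_eq mform_bilin1 mform_bilin2 m_assoc sgm_mult)

text \<open>Transposing right multiplications keeps the order of the factors: in \<beta>((a
  \<otimes> b) s t) the outer factor t is transposed first, and s is applied to the result.\<close>

lemma bact_mult:
  assumes s: "s \<in> carrier TT" and t: "t \<in> carrier TT" and \<beta>: "\<beta> \<in> Bil" and ab: "a \<in> carrier A" "b \<in> carrier A"
  shows "bact (s \<otimes>\<^bsub>TT\<^esub> t) \<beta> a b = bact s (bact t \<beta>) a b"
proof -
  have st: "s \<in> carrier (tensor A A)" "t \<in> carrier (tensor A A)" using assms by (simp_all add: TT_simps)
  have "bact (s \<otimes>\<^bsub>TT\<^esub> t) \<beta> a b = t (\<lambda>c d. s (\<lambda>a' b'. mform (\<lambda>c d. mform \<beta> a b c d) a' b' c d))"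
    using mform_bilin2[OF \<beta> ab] by (simp add: bact_def TT_simps)
  also have "\<dots> = t (\<lambda>c d. s (\<lambda>a' b'. mform (\<lambda>a' b'. mform \<beta> a' b' c d) a b a' b'))"
    by (intro tensor_congA[OF st(2)] tensor_congA[OF st(1)]) (simp add: mform_mform \<beta> ab)
  also have "\<dots> = s (\<lambda>a' b'. t (\<lambda>c d. mform (\<lambda>a' b'. mform \<beta> a' b' c d) a b a' b'))"
  proof (rule tensor_swap[OF st])
    fix c d assume "c \<in> carrier A" "d \<in> carrier A"
    then show "mform (\<lambda>a' b'. mform \<beta> a' b' c d) a b \<in> Bil"
      using mform_bilin2[OF mform_bilin1[OF \<beta>] ab] by simp
  next
    fix a' b' assume a': "a' \<in> carrier A" "b' \<in> carrier A"
    have "(\<lambda>c d. mform (\<lambda>a' b'. mform \<beta> a' b' c d) a b a' b') \<in> Bil \<longleftrightarrow>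
        (\<lambda>c d. mform (\<lambda>c d. mform \<beta> a b c d) a' b' c d) \<in> Bil"
      by (rule bilin_cong[OF _ module_A module_A]) (simp add: mform_mform \<beta> ab a')
    then show "(\<lambda>c d. mform (\<lambda>a' b'. mform \<beta> a' b' c d) a b a' b') \<in> Bil"
      using mform_bilin2[OF mform_bilin2[OF \<beta> ab] a'] by simp
  qed
  also have "\<dots> = s (\<lambda>a' b'. mform (bact t \<beta>) a b a' b')"
  proof (rule tensor_congA[OF st(1)])
    fix a' b' assume a': "a' \<in> carrier A" "b' \<in> carrier A"
    have 1: "t (\<lambda>c d. mform (\<lambda>a' b'. mform \<beta> a' b' c d) a b a' b') =
       t (\<lambda>c d. mform \<beta> (a \<otimes> \<pi>\<^sub>0 a') (b \<otimes> b') c d + mform \<beta> (a \<otimes> \<pi>\<^sub>1 a') (\<sigma> b \<otimes> b') c d)"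
      by (rule tensor_congA[OF st(2)]) (simp add: mform_eq[OF mform_bilin1[OF \<beta>]] ab a')
    also have "\<dots> = bact t \<beta> (a \<otimes> \<pi>\<^sub>0 a') (b \<otimes> b') + bact t \<beta> (a \<otimes> \<pi>\<^sub>1 a') (\<sigma> b \<otimes> b')"
      unfolding bact_def
      by (rule tensor_form_add[OF st(2)]) (simp_all add: mform_bilin2 \<beta> ab a')
    also have "\<dots> = mform (bact t \<beta>) a b a' b'"
      by (rule mform_eq[OF bact_bilin[OF st(2) \<beta>] ab a', symmetric])
    finally show "t (\<lambda>c d. mform (\<lambda>a' b'. mform \<beta> a' b' c d) a b a' b') = mform (bact t \<beta>) a b a' b'" .
  qed
  finally show ?thesis by (simp add: bact_def)
qed

lemma bact_pure:
  assumes "\<beta> \<in> Bil" "a \<in> carrier A" "b \<in> carrier A" "c \<in> carrier A" "d \<in> carrier A"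
  shows "bact (pure_tensor A A c d) \<beta> a b = \<beta> (a \<otimes> \<pi>\<^sub>0 c) (b \<otimes> d) + \<beta> (a \<otimes> \<pi>\<^sub>1 c) (\<sigma> b \<otimes> d)"
  unfolding bact_def using assms by (simp add: pure_tensor_apply mform_bilin2 mform_eq)

lemma bact_one:
  assumes "\<beta> \<in> Bil" "a \<in> carrier A" "b \<in> carrier A"
  shows "bact \<one>\<^bsub>TT\<^esub> \<beta> a b = \<beta> a b"
  using assms by (simp add: TT_simps bact_pure bilin_zero1)

lemma TT_one_closed [simp]: "\<one>\<^bsub>TT\<^esub> \<in> carrier TT"
  by (simp add: TT_simps module_A)

text \<open>A tensor is recovered by applying its right multiplication to the unit. Identities
  between tensors thus become identities between operators on forms.\<close>

lemma bact_one_one: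
  assumes "t \<in> carrier TT" "\<beta> \<in> Bil"
  shows "bact t \<beta> \<one> \<one> = t \<beta>"
  unfolding bact_def
  by (rule tensor_congA) (use assms part_sum in \<open>simp_all add: TT_simps mform_eq bilin_add1[symmetric]\<close>)

lemma monoid_TT: "Group.monoid TT"
proof (rule monoidI)
  fix r s t assume *: "r \<in> carrier TT" "s \<in> carrier TT" "t \<in> carrier TT"
  show "r \<otimes>\<^bsub>TT\<^esub> s \<otimes>\<^bsub>TT\<^esub> t = r \<otimes>\<^bsub>TT\<^esub> (s \<otimes>\<^bsub>TT\<^esub> t)"
  proof (rule TT_ext)
    fix \<beta> assume \<beta>: "\<beta> \<in> Bil"
    have "(r \<otimes>\<^bsub>TT\<^esub> (s \<otimes>\<^bsub>TT\<^esub> t)) \<beta> = r (bact (s \<otimes>\<^bsub>TT\<^esub> t) \<beta>)"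
      by (rule TT_mult_apply[OF *(1) TT_mult_closed[OF *(2,3)] \<beta>])
    also have "\<dots> = r (bact s (bact t \<beta>))"
      by (rule tensor_congA) (use * in \<open>simp_all add: bact_mult[OF *(2,3) \<beta>] TT_simps(1)\<close>)
    also have "\<dots> = (r \<otimes>\<^bsub>TT\<^esub> s \<otimes>\<^bsub>TT\<^esub> t) \<beta>"
      using TT_mult_apply[OF TT_mult_closed[OF *(1,2)] *(3) \<beta>]
        TT_mult_apply[OF *(1,2) bact_bilin[OF _ \<beta>], of t] *(3) by (simp add: TT_simps(1))
    finally show "(r \<otimes>\<^bsub>TT\<^esub> s \<otimes>\<^bsub>TT\<^esub> t) \<beta> = (r \<otimes>\<^bsub>TT\<^esub> (s \<otimes>\<^bsub>TT\<^esub> t)) \<beta>" ..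
  qed (use * in simp_all)
next
  fix t assume t: "t \<in> carrier TT"
  show "\<one>\<^bsub>TT\<^esub> \<otimes>\<^bsub>TT\<^esub> t = t"
  proof (rule TT_ext)
    fix \<beta> assume \<beta>: "\<beta> \<in> Bil"
    have "(\<one>\<^bsub>TT\<^esub> \<otimes>\<^bsub>TT\<^esub> t) \<beta> = bact t \<beta> \<one> \<one>"
      using t \<beta> bact_bilin[of t \<beta>] by (subst TT_mult_apply)
        (simp_all add: TT_simps module_A pure_tensor_apply)
    also have "\<dots> = t \<beta>" by (rule bact_one_one[OF t \<beta>])
    finally show "(\<one>\<^bsub>TT\<^esub> \<otimes>\<^bsub>TT\<^esub> t) \<beta> = t \<beta>" .
  qed (use t in simp_all)
  show "t \<otimes>\<^bsub>TT\<^esub> \<one>\<^bsub>TT\<^esub> = t"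
  proof (rule TT_ext)
    fix \<beta> assume \<beta>: "\<beta> \<in> Bil"
    have "(t \<otimes>\<^bsub>TT\<^esub> \<one>\<^bsub>TT\<^esub>) \<beta> = t (bact \<one>\<^bsub>TT\<^esub> \<beta>)"
      using t \<beta> by (subst TT_mult_apply) (simp_all add: TT_simps module_A)
    also have "\<dots> = t \<beta>"
      by (rule tensor_congA) (use t \<beta> in \<open>simp_all add: TT_simps(1) bact_one\<close>)
    finally show "(t \<otimes>\<^bsub>TT\<^esub> \<one>\<^bsub>TT\<^esub>) \<beta> = t \<beta>" .
  qed (use t in simp_all)
qed simp_all

lemma module_TT: "module CC TT"
proof -
  interpret T: module CC "tensor A A" by (rule module_tensor)
  have "abelian_group TT"
    by (rule abelian_groupI)
      (use T.l_neg T.a_inv_closed in \<open>auto simp: TT_simps T.a_ac\<close>)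
  then show ?thesis
    by (intro moduleI cring_CC)
      (simp_all add: TT_simps T.smult_l_distr[simplified] T.smult_r_distr T.smult_assoc1[simplified] T.smult_one[simplified]
        T.smult_closed[simplified])
qed

lemma TT_add_apply: "\<beta> \<in> Bil \<Longrightarrow> (s \<oplus>\<^bsub>TT\<^esub> t) \<beta> = s \<beta> + t \<beta>"
  and TT_zero_apply: "\<beta> \<in> Bil \<Longrightarrow> \<zero>\<^bsub>TT\<^esub> \<beta> = 0"
  and TT_smult_apply: "\<beta> \<in> Bil \<Longrightarrow> (c \<odot>\<^bsub>TT\<^esub> t) \<beta> = c * t \<beta>"
  by (simp_all add: TT_simps tensor_simps)

lemma TT_minus_apply:
  assumes "s \<in> carrier TT" "t \<in> carrier TT" "\<beta> \<in> Bil"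
  shows "(s \<ominus>\<^bsub>TT\<^esub> t) \<beta> = s \<beta> - t \<beta>"
proof -
  interpret T: module CC TT by (rule module_TT)
  have "s = (s \<ominus>\<^bsub>TT\<^esub> t) \<oplus>\<^bsub>TT\<^esub> t"
    using assms by (simp add: a_minus_def T.a_assoc T.l_neg)
  then have "s \<beta> = ((s \<ominus>\<^bsub>TT\<^esub> t) \<oplus>\<^bsub>TT\<^esub> t) \<beta>" by simp
  then show ?thesis using TT_add_apply[OF assms(3), of "s \<ominus>\<^bsub>TT\<^esub> t" t] by simp
qed

lemma TT_finsum_apply:
  assumes "\<And>x. x \<in> S \<Longrightarrow> g x \<in> carrier TT" "finite S" "\<beta> \<in> Bil"
  shows "finsum TT g S \<beta> = (\<Sum>x\<in>S. g x \<beta>)"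
proof -
  interpret T: module CC TT by (rule module_TT)
  show ?thesis using assms(2,1)
  proof (induction S rule: finite_induct)
    case empty
    then show ?case by (simp add: TT_zero_apply assms)
  next
    case (insert x F)
    then show ?case by (subst T.finsum_insert) (auto simp: TT_add_apply assms(3))
  qed
qed

end

section \<open>The algebra \<open>\<complex>[G \<ltimes> V]\<close>\<close>

lemma calg_transfer:
  assumes "calg M" "carrier N = carrier M" "mult N = mult M" "one N = one M" "zero N = zero M"
    "add N = add M" "smult N = smult M"
  shows "calg N"
proof -
  interpret M: calg M by fact
  have "ring N"
  proof (rule ringI)
    show "abelian_group N"
      by (rule abelian_groupI) (use M.l_neg M.a_inv_closed in \<open>auto simp: assms M.a_ac\<close>)
    show "Group.monoid N"
      by (rule monoidI) (simp_all add: assms M.m_assoc)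
  qed (simp_all add: assms M.l_distr M.r_distr)
  then interpret N: ring N .
  have "module CC N"
    by (rule moduleI[OF cring_CC N.abelian_group_axioms])
      (simp_all add: assms M.smult_l_distr[simplified] M.smult_r_distr M.smult_assoc1[simplified]
        M.smult_one[simplified] M.smult_closed[simplified])
  then show ?thesis
    by (intro calg.intro calg_axioms.intro N.ring_axioms) (simp_all add: assms)
qed

section \<open>Parity on the free algebra\<close>

lemma lookup_free_part [simp]:
  "Poly_Mapping.lookup (free_part p f) w = (if word_parity w = p then Poly_Mapping.lookup f w else 0)"
  by (simp add: free_part_def lookup_sum lookup_single when_def sum.delta in_keys_iff)

lemma free_part_add [simp]: "free_part p (f + g) = free_part p f + free_part p g"
  by (rule poly_mapping_eqI) (simp add: lookup_add)

lemma free_part_diff [simp]: "free_part p (f - g) = free_part p f - free_part p g"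
  by (rule poly_mapping_eqI) (simp add: lookup_minus)

lemma free_part_zero [simp]: "free_part p 0 = 0"
  by (rule poly_mapping_eqI) simp

lemma free_part_single [simp]:
  "free_part p (Poly_Mapping.single w c) = (if word_parity w = p then Poly_Mapping.single w c else 0)"
  by (rule poly_mapping_eqI) (simp add: lookup_single when_def)

lemma word_parity_simps [simp]:
  "word_parity (0 :: ('g + 'v) fword) = 0"
  "word_parity (v + w) = (word_parity v + word_parity w) mod 2"
  "word_parity (FWord []) = 0"
  "word_parity (FWord (Inl g # xs)) = word_parity (FWord xs)"
  "word_parity (FWord (Inr x # xs)) = (word_parity (FWord xs) + 1) mod 2"
  "word_parity w mod 2 = word_parity w"
  by (auto simp: word_parity_def mod_simps)

lemma word_parity_less: "word_parity w < 2"
  by (simp add: word_parity_def)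

lemma free_part_one [simp]: "free_part p 1 = (if p = 0 then 1 else 0)"
  by (rule poly_mapping_eqI) (auto simp: lookup_one when_def)

lemma free_part_letter [simp]:
  "free_part p (letter (Inl g)) = (if p = 0 then letter (Inl g) else 0)"
  "free_part p (letter (Inr v)) = (if p = 1 then letter (Inr v) else 0)"
  by (simp_all add: letter_def)

lemma free_part_closed [simp]: "f \<in> carrier (free_alg X) \<Longrightarrow> free_part p f \<in> carrier (free_alg X)"
proof -
  have "Poly_Mapping.keys (free_part p f) \<subseteq> Poly_Mapping.keys f"
    by (auto simp: in_keys_iff split: if_splits)
  then show "f \<in> carrier (free_alg X) \<Longrightarrow> free_part p f \<in> carrier (free_alg X)"
    unfolding carrier_free_alg by blast
qed

lemma in_free_alg_UNIV: "f \<in> carrier (free_alg UNIV)"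
  by (simp add: carrier_free_alg)

lemma parity_shift:
  fixes a p q :: nat
  assumes "p < 2" "q < 2" "a < 2"
  shows "(a + q) mod 2 = p \<longleftrightarrow> a = (p + q) mod 2"
  using assms by (auto simp: less_2_cases_iff)

lemma free_part_mult:
  assumes "p < 2" "q < 2"
  shows "free_part p (x * free_part q y) = free_part ((p + q) mod 2) x * free_part q y"
  using in_free_alg_UNIV[of y]
proof (induction y rule: free_alg_induct)
  case (add y v d)
  have *: "free_part p (x * Poly_Mapping.single (FWord v) d) =
      free_part ((p + q) mod 2) x * Poly_Mapping.single (FWord v) d" if v: "word_parity (FWord v) = q"
    using in_free_alg_UNIV[of x]
  proof (induction x rule: free_alg_induct)
    case (add x u c)
    have "(word_parity (FWord u) + q) mod 2 = p \<longleftrightarrow> word_parity (FWord u) = (p + q) mod 2"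
      by (rule parity_shift[OF assms word_parity_less])
    then have "free_part p (Poly_Mapping.single (FWord u) c * Poly_Mapping.single (FWord v) d) =
        free_part ((p + q) mod 2) (Poly_Mapping.single (FWord u) c) * Poly_Mapping.single (FWord v) d"
      using v by (simp add: mult_single)
    then show ?case unfolding distrib_right free_part_add add.IH by (simp only:)
  qed simp
  have "free_part p (x * free_part q (Poly_Mapping.single (FWord v) d)) =
      free_part ((p + q) mod 2) x * free_part q (Poly_Mapping.single (FWord v) d)"
    using * by simp
  then show ?case unfolding distrib_left free_part_add add.IH by (simp only:)
qed simp

lemma free_part_sum: "free_part 0 x + free_part 1 x = x"
proof (rule poly_mapping_eqI)
  fix w show "Poly_Mapping.lookup (free_part 0 x + free_part 1 x) w = Poly_Mapping.lookup x w"
    using word_parity_less[of w] by (auto simp: lookup_add)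
qed

lemma free_part_ge: "p \<ge> 2 \<Longrightarrow> free_part p x = 0"
proof (rule poly_mapping_eqI)
  fix w assume "p \<ge> 2" then show "Poly_Mapping.lookup (free_part p x) w = Poly_Mapping.lookup 0 w"
    using word_parity_less[of w] by auto
qed

lemma free_part_scale: "free_part p (Poly_Mapping.single 0 c * x) = Poly_Mapping.single 0 c * free_part p x"
  using in_free_alg_UNIV[of x]
  by (induction x rule: free_alg_induct) (simp_all add: distrib_left mult_single)

text \<open>Words are homogeneous, so projecting a product u x v amounts to projecting x to a
  shifted parity. This reduces homogeneity of an ideal to homogeneity of its generators.\<close>

lemma free_part_sandwich:
  assumes "p < 2"
  shows "free_part p (Poly_Mapping.single u c * x * Poly_Mapping.single v d) =
    Poly_Mapping.single u c * free_part ((p + word_parity u + word_parity v) mod 2) x * Poly_Mapping.single v d"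
  using in_free_alg_UNIV[of x]
proof (induction x rule: free_alg_induct)
  case (add x w e)
  have "(word_parity u + word_parity (FWord w) + word_parity v) mod 2 = p \<longleftrightarrow>
      word_parity (FWord w) = (p + word_parity u + word_parity v) mod 2"
    using assms word_parity_less[of "FWord w"] word_parity_less[of u] word_parity_less[of v]
    by (auto simp: less_2_cases_iff)
  then have "free_part p (Poly_Mapping.single u c * Poly_Mapping.single (FWord w) e * Poly_Mapping.single v d) =
    Poly_Mapping.single u c * free_part ((p + word_parity u + word_parity v) mod 2) (Poly_Mapping.single (FWord w) e) *
      Poly_Mapping.single v d"
    by (simp add: mult_single mod_simps)
  then show ?case unfolding distrib_left distrib_right free_part_add add.IH by (simp only:)
qed simp

section \<open>The presented algebra H\<close>

locale gvdata =
  fixes G :: "('g, 'n) monoid_scheme" and V :: "(complex, 'v, 'm) module_scheme" and \<rho> :: "'g \<Rightarrow> 'v \<Rightarrow> 'v"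
  assumes grp: "group G" and finG: "finite (carrier G)"
    and vs: "vectorspace CC V" and fd: "vectorspace.fin_dim CC V"
    and act: "group_action G (carrier V) \<rho>"
    and lin: "\<forall>g\<in>carrier G. linear_map CC V V (\<rho> g)"
begin

sublocale GG: group G by (rule grp)
sublocale VV: vectorspace CC V by (rule vs)
sublocale ACT: group_action G "carrier V" \<rho> by (rule act)

lemma rho_closed [simp]: "g \<in> carrier G \<Longrightarrow> v \<in> carrier V \<Longrightarrow> \<rho> g v \<in> carrier V"
  using ACT.element_image by blast

lemma rho_mult: "g \<in> carrier G \<Longrightarrow> h \<in> carrier G \<Longrightarrow> v \<in> carrier V \<Longrightarrow> \<rho> (g \<otimes>\<^bsub>G\<^esub> h) v = \<rho> g (\<rho> h v)"
  by (rule ACT.composition_rule)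

lemma rho_one [simp]: "v \<in> carrier V \<Longrightarrow> \<rho> \<one>\<^bsub>G\<^esub> v = v"
  using ACT.id_eq_one by (metis restrict_apply')

lemma rho_inv [simp]:
  "g \<in> carrier G \<Longrightarrow> v \<in> carrier V \<Longrightarrow> \<rho> (inv\<^bsub>G\<^esub> g) (\<rho> g v) = v"
  "g \<in> carrier G \<Longrightarrow> v \<in> carrier V \<Longrightarrow> \<rho> g (\<rho> (inv\<^bsub>G\<^esub> g) v) = v"
  by (simp_all flip: rho_mult)

lemma rho_add: "g \<in> carrier G \<Longrightarrow> v \<in> carrier V \<Longrightarrow> w \<in> carrier V \<Longrightarrow> \<rho> g (v \<oplus>\<^bsub>V\<^esub> w) = \<rho> g v \<oplus>\<^bsub>V\<^esub> \<rho> g w"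
proof -
  assume *: "g \<in> carrier G" "v \<in> carrier V" "w \<in> carrier V"
  interpret linear_map CC V V "\<rho> g" using lin *(1) by blast
  show ?thesis using * by simp
qed

lemma rho_smult: "g \<in> carrier G \<Longrightarrow> v \<in> carrier V \<Longrightarrow> \<rho> g (c \<odot>\<^bsub>V\<^esub> v) = c \<odot>\<^bsub>V\<^esub> \<rho> g v"
proof -
  assume *: "g \<in> carrier G" "v \<in> carrier V"
  interpret linear_map CC V V "\<rho> g" using lin *(1) by blast
  show ?thesis using * by simp
qed

abbreviation "XX \<equiv> carrier G <+> carrier V"
abbreviation "FF \<equiv> free_alg XX"
abbreviation "II \<equiv> gv_ideal G V \<rho>"
abbreviation "AA \<equiv> gv_super_alg G V \<rho>"
abbreviation "\<gamma> g \<equiv> gv_gen G V \<rho> (Inl g)"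
abbreviation "\<eta> v \<equiv> gv_gen G V \<rho> (Inr v)"

lemma in_XX [simp]: "Inl g \<in> XX \<longleftrightarrow> g \<in> carrier G" "Inr v \<in> XX \<longleftrightarrow> v \<in> carrier V"
  by auto

lemma rels_cases [consumes 1, case_names mult one add smult conj anti]:
  assumes "r \<in> gv_rels G V \<rho>"
  obtains (mult) g h where "g \<in> carrier G" "h \<in> carrier G"
      "r = letter (Inl g) * letter (Inl h) - letter (Inl (g \<otimes>\<^bsub>G\<^esub> h))"
    | (one) "r = letter (Inl \<one>\<^bsub>G\<^esub>) - 1"
    | (add) v w where "v \<in> carrier V" "w \<in> carrier V"
      "r = letter (Inr (v \<oplus>\<^bsub>V\<^esub> w)) - letter (Inr v) - letter (Inr w)"
    | (smult) c v where "v \<in> carrier V"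
      "r = letter (Inr (c \<odot>\<^bsub>V\<^esub> v)) - Poly_Mapping.single 0 c * letter (Inr v)"
    | (conj) g v where "g \<in> carrier G" "v \<in> carrier V"
      "r = letter (Inl g) * letter (Inr v) * letter (Inl (inv\<^bsub>G\<^esub> g)) - letter (Inr (\<rho> g v))"
    | (anti) v w where "v \<in> carrier V" "w \<in> carrier V"
      "r = letter (Inr v) * letter (Inr w) + letter (Inr w) * letter (Inr v)"
  using assms unfolding gv_rels_def linear_rels_def Un_iff mem_Collect_eq singleton_iff
  by (elim disjE exE conjE) (rule mult one add smult conj anti; assumption)+

lemma rels_carrier: "gv_rels G V \<rho> \<subseteq> carrier FF"
proof
  fix r assume "r \<in> gv_rels G V \<rho>"
  then show "r \<in> carrier FF"
    by (cases rule: rels_cases) (simp_all add: free_alg_closed)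
qed

lemma gv_free_eq: "gv_free G V = FF"
  by (simp add: gv_free_def)

lemma II_eq: "II = Idl\<^bsub>FF\<^esub> (gv_rels G V \<rho>)"
  by (simp add: gv_ideal_def gv_free_eq)

lemma II_ideal: "ideal II FF"
  unfolding II_eq by (rule ring.genideal_ideal[OF ring_free_alg rels_carrier])

sublocale Q: calg_ideal FF II
  by (intro calg_ideal.intro calg_free_alg II_ideal)

lemma rels_II: "r \<in> gv_rels G V \<rho> \<Longrightarrow> r \<in> II"
  unfolding II_eq using ring.genideal_self[OF ring_free_alg rels_carrier] by blast

lemma AA_simps:
  "carrier AA = carrier (quot_alg FF II)" "mult AA = mult (quot_alg FF II)" "one AA = one (quot_alg FF II)"
  "zero AA = zero (quot_alg FF II)" "add AA = add (quot_alg FF II)" "smult AA = smult (quot_alg FF II)"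
  "part AA = (\<lambda>p X. the_elem ((\<lambda>f. II +>\<^bsub>FF\<^esub> free_part p f) ` X))"
  by (simp_all add: gv_super_alg_def module.defs super_algebra.defs gv_free_eq)

lemma gv_gen_eq: "gv_gen G V \<rho> x = Q.cls (letter x)"
  by (simp add: gv_gen_def gv_free_eq)

lemma free_part_rels:
  assumes "r \<in> gv_rels G V \<rho>"
  shows "free_part q r = r \<or> free_part q r = 0"
proof -
  have 1: "letter (Inl g) * letter (Inl h) = Poly_Mapping.single (FWord [Inl g, Inl h]) 1"
    "letter (Inr v) * letter (Inr w) = Poly_Mapping.single (FWord [Inr v, Inr w]) 1"
    "letter (Inl g) * letter (Inr v) * letter (Inl h) = Poly_Mapping.single (FWord [Inl g, Inr v, Inl h]) 1"
    for g h :: 'g and v w :: 'v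
    by (simp_all add: letter_def mult_single plus_fword_def)
  show ?thesis using assms
    by (cases rule: rels_cases) (auto simp: 1 free_part_scale)
qed

text \<open>Each relation is homogeneous, so a projected product u r v is the product itself or
  zero. Parities other than 0 and 1 project to zero.\<close>

lemma free_part_II:
  assumes "f \<in> II" shows "free_part p f \<in> II"
proof (cases "p < 2")
  case True
  have "f \<in> Idl\<^bsub>FF\<^esub> (gv_rels G V \<rho>)" using assms by (simp add: II_eq)
  with rels_carrier show ?thesis
  proof (induction rule: Idl_free_alg_induct)
    case zero
    then show ?case using Q.zero_closed by simp
  next
    case (add f g)
    then show ?case using Q.a_closed by simp
  next
    case (gen u v c r)
    let ?q = "(p + word_parity (FWord u) + word_parity (FWord v)) mod 2"
    have "free_part ?q r \<in> II"
      using free_part_rels[OF gen(3), of ?q] rels_II[OF gen(3)] Q.zero_closed by auto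
    then have "Poly_Mapping.single (FWord u) c * free_part ?q r * Poly_Mapping.single (FWord v) 1 \<in> II"
      using Q.I_l_closed Q.I_r_closed gen(1,2) by simp
    then show ?case using True by (simp add: free_part_sandwich)
  qed
next
  case False
  then show ?thesis using Q.zero_closed by (simp add: free_part_ge)
qed

lemma part_cls [simp]:
  assumes "f \<in> carrier FF"
  shows "part AA p (Q.cls f) = Q.cls (free_part p f)"
proof -
  have "Q.cls (free_part p x) = Q.cls (free_part p f)" if "x \<in> Q.cls f" for x
  proof -
    have x: "x \<in> carrier FF" "x - f \<in> II"
      using Q.in_cls[OF that assms] Q.cls_eq_iff[of x f] assms by auto
    then have "free_part p x - free_part p f \<in> II"
      using free_part_II[OF x(2), of p] by simp
    then show ?thesis using x(1) assms by (simp add: Q.cls_eq_iff)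
  qed
  moreover have "f \<in> Q.cls f" using assms Q.a_rcos_self by blast
  ultimately have "(\<lambda>f. Q.cls (free_part p f)) ` Q.cls f = {Q.cls (free_part p f)}" by blast
  then show ?thesis by (simp add: AA_simps)
qed

lemma AA_cases [consumes 1]:
  assumes "x \<in> carrier AA"
  obtains f where "f \<in> carrier FF" "x = Q.cls f"
  using assms by (auto simp: AA_simps Q.carrier_quot)

sublocale S: superalg AA
proof (intro superalg.intro superalg_axioms.intro)
  show "calg AA" by (rule calg_transfer[OF Q.calg_quot]) (simp_all add: AA_simps)
next
  fix x p assume "x \<in> carrier AA"
  then show "part AA p x \<in> carrier AA"
    by (cases rule: AA_cases) (simp add: AA_simps(1))
next
  fix x y p assume "x \<in> carrier AA" "y \<in> carrier AA"
  then show "part AA p (x \<oplus>\<^bsub>AA\<^esub> y) = part AA p x \<oplus>\<^bsub>AA\<^esub> part AA p y"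
    by (elim AA_cases) (simp add: AA_simps(5) free_alg_closed)
next
  fix x p c assume "x \<in> carrier AA"
  then show "part AA p (c \<odot>\<^bsub>AA\<^esub> x) = c \<odot>\<^bsub>AA\<^esub> part AA p x"
    using Q.smult_closed[of c] by (elim AA_cases) (simp add: AA_simps(6) free_part_scale)
next
  fix x assume "x \<in> carrier AA"
  then show "part AA 0 x \<oplus>\<^bsub>AA\<^esub> part AA 1 x = x"
    by (elim AA_cases) (simp add: AA_simps(5) free_part_sum[simplified])
next
  fix x y assume "x \<in> carrier AA" "y \<in> carrier AA"
  then show "part AA 0 (x \<otimes>\<^bsub>AA\<^esub> part AA 0 y) = part AA 0 x \<otimes>\<^bsub>AA\<^esub> part AA 0 y \<and>
        part AA 1 (x \<otimes>\<^bsub>AA\<^esub> part AA 0 y) = part AA 1 x \<otimes>\<^bsub>AA\<^esub> part AA 0 y \<and>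
        part AA 0 (x \<otimes>\<^bsub>AA\<^esub> part AA 1 y) = part AA 1 x \<otimes>\<^bsub>AA\<^esub> part AA 1 y \<and>
        part AA 1 (x \<otimes>\<^bsub>AA\<^esub> part AA 1 y) = part AA 0 x \<otimes>\<^bsub>AA\<^esub> part AA 1 y"
    by (elim AA_cases) (simp add: AA_simps(2) free_part_mult free_alg_closed)
next
  show "part AA 0 \<one>\<^bsub>AA\<^esub> = \<one>\<^bsub>AA\<^esub>" "part AA 1 \<one>\<^bsub>AA\<^esub> = \<zero>\<^bsub>AA\<^esub>"
    by (simp_all add: AA_simps(3,4))
qed

lemma gen_closed [simp]:
  "g \<in> carrier G \<Longrightarrow> \<gamma> g \<in> carrier AA" "v \<in> carrier V \<Longrightarrow> \<eta> v \<in> carrier AA"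
  by (simp_all add: gv_gen_eq AA_simps(1))

lemma part_gen [simp]:
  "g \<in> carrier G \<Longrightarrow> part AA p (\<gamma> g) = (if p = 0 then \<gamma> g else \<zero>\<^bsub>AA\<^esub>)"
  "v \<in> carrier V \<Longrightarrow> part AA p (\<eta> v) = (if p = 1 then \<eta> v else \<zero>\<^bsub>AA\<^esub>)"
  by (simp_all add: gv_gen_eq AA_simps(4))

lemma sgm_gen [simp]:
  "g \<in> carrier G \<Longrightarrow> S.sgm (\<gamma> g) = \<gamma> g" "v \<in> carrier V \<Longrightarrow> S.sgm (\<eta> v) = \<ominus>\<^bsub>AA\<^esub> \<eta> v"
  by (simp_all add: S.sgm_def a_minus_def)

lemma rels_mem:
  "g \<in> carrier G \<Longrightarrow> h \<in> carrier G \<Longrightarrow>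
    letter (Inl g) * letter (Inl h) - letter (Inl (g \<otimes>\<^bsub>G\<^esub> h)) \<in> gv_rels G V \<rho>"
  "letter (Inl \<one>\<^bsub>G\<^esub>) - 1 \<in> gv_rels G V \<rho>"
  "v \<in> carrier V \<Longrightarrow> w \<in> carrier V \<Longrightarrow>
    letter (Inr (v \<oplus>\<^bsub>V\<^esub> w)) - letter (Inr v) - letter (Inr w) \<in> gv_rels G V \<rho>"
  "v \<in> carrier V \<Longrightarrow>
    letter (Inr (c \<odot>\<^bsub>V\<^esub> v)) - Poly_Mapping.single 0 c * letter (Inr v) \<in> gv_rels G V \<rho>"
  "g \<in> carrier G \<Longrightarrow> v \<in> carrier V \<Longrightarrow>
    letter (Inl g) * letter (Inr v) * letter (Inl (inv\<^bsub>G\<^esub> g)) - letter (Inr (\<rho> g v)) \<in> gv_rels G V \<rho>"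
  "v \<in> carrier V \<Longrightarrow> w \<in> carrier V \<Longrightarrow>
    letter (Inr v) * letter (Inr w) + letter (Inr w) * letter (Inr v) \<in> gv_rels G V \<rho>"
  unfolding gv_rels_def linear_rels_def Un_iff mem_Collect_eq singleton_iff by blast+

lemma cls_eqI: "a - b \<in> gv_rels G V \<rho> \<Longrightarrow> a \<in> carrier FF \<Longrightarrow> b \<in> carrier FF \<Longrightarrow> Q.cls a = Q.cls b"
  using rels_II[of "a - b"] by (simp add: Q.cls_eq_iff)

lemma gen_mult: "g \<in> carrier G \<Longrightarrow> h \<in> carrier G \<Longrightarrow> \<gamma> g \<otimes>\<^bsub>AA\<^esub> \<gamma> h = \<gamma> (g \<otimes>\<^bsub>G\<^esub> h)"
  using cls_eqI[OF rels_mem(1)[of g h]] by (simp add: gv_gen_eq AA_simps(2))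

lemma gen_one: "\<gamma> \<one>\<^bsub>G\<^esub> = \<one>\<^bsub>AA\<^esub>"
  using cls_eqI[OF rels_mem(2)] by (simp add: gv_gen_eq AA_simps(3))

lemma gen_add: "v \<in> carrier V \<Longrightarrow> w \<in> carrier V \<Longrightarrow> \<eta> (v \<oplus>\<^bsub>V\<^esub> w) = \<eta> v \<oplus>\<^bsub>AA\<^esub> \<eta> w"
  using cls_eqI[of "letter (Inr (v \<oplus>\<^bsub>V\<^esub> w))" "letter (Inr v) + letter (Inr w)"] rels_mem(3)[of v w]
  by (simp add: gv_gen_eq AA_simps(5) algebra_simps)

lemma gen_smult: "v \<in> carrier V \<Longrightarrow> \<eta> (c \<odot>\<^bsub>V\<^esub> v) = c \<odot>\<^bsub>AA\<^esub> \<eta> v"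
  using cls_eqI[OF rels_mem(4)[of v c]] by (simp add: gv_gen_eq AA_simps(6))

lemma gen_conj: "g \<in> carrier G \<Longrightarrow> v \<in> carrier V \<Longrightarrow>
    \<gamma> g \<otimes>\<^bsub>AA\<^esub> \<eta> v \<otimes>\<^bsub>AA\<^esub> \<gamma> (inv\<^bsub>G\<^esub> g) = \<eta> (\<rho> g v)"
  using cls_eqI[OF rels_mem(5)[of g v]] by (simp add: gv_gen_eq AA_simps(2))

lemma gen_anti: "v \<in> carrier V \<Longrightarrow> w \<in> carrier V \<Longrightarrow>
    \<eta> v \<otimes>\<^bsub>AA\<^esub> \<eta> w \<oplus>\<^bsub>AA\<^esub> \<eta> w \<otimes>\<^bsub>AA\<^esub> \<eta> v = \<zero>\<^bsub>AA\<^esub>"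
  using cls_eqI[of "letter (Inr v) * letter (Inr w) + letter (Inr w) * letter (Inr v)" 0] rels_mem(6)[of v w]
  by (simp add: gv_gen_eq AA_simps(2,4,5))

lemma gen_swap: "v \<in> carrier V \<Longrightarrow> w \<in> carrier V \<Longrightarrow>
    \<eta> v \<otimes>\<^bsub>AA\<^esub> \<eta> w = \<ominus>\<^bsub>AA\<^esub> (\<eta> w \<otimes>\<^bsub>AA\<^esub> \<eta> v)"
  using S.minus_equality[OF gen_anti] by simp

text \<open>Vectors can be moved to the right of group elements, which is the source of the normal
  form g v_1 ... v_k.\<close>

lemma gen_gv: 
  assumes "g \<in> carrier G" "v \<in> carrier V"
  shows "\<eta> v \<otimes>\<^bsub>AA\<^esub> \<gamma> g = \<gamma> g \<otimes>\<^bsub>AA\<^esub> \<eta> (\<rho> (inv\<^bsub>G\<^esub> g) v)"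
proof -
  let ?w = "\<rho> (inv\<^bsub>G\<^esub> g) v"
  have "\<gamma> g \<otimes>\<^bsub>AA\<^esub> \<eta> ?w = \<gamma> g \<otimes>\<^bsub>AA\<^esub> \<eta> ?w \<otimes>\<^bsub>AA\<^esub> (\<gamma> (inv\<^bsub>G\<^esub> g) \<otimes>\<^bsub>AA\<^esub> \<gamma> g)"
    using assms by (simp add: gen_mult gen_one)
  also have "\<dots> = \<gamma> g \<otimes>\<^bsub>AA\<^esub> \<eta> ?w \<otimes>\<^bsub>AA\<^esub> \<gamma> (inv\<^bsub>G\<^esub> g) \<otimes>\<^bsub>AA\<^esub> \<gamma> g"
    using assms by (simp only: S.m_assoc gen_closed rho_closed GG.inv_closed S.m_closed)
  also have "\<dots> = \<eta> v \<otimes>\<^bsub>AA\<^esub> \<gamma> g"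
    using assms by (simp add: gen_conj)
  finally show ?thesis ..
qed

text \<open>H is spanned by the products g v_1 ... v_k. Their span is closed under right
  multiplication by group elements too, because these pass the vectors by \<open>gen_gv\<close>;
  hence it contains all words.\<close>

lemma AA_induct [consumes 1, case_names grp vec add smult]:
  assumes x: "x \<in> carrier AA"
    and grp: "\<And>g. g \<in> carrier G \<Longrightarrow> P (\<gamma> g)"
    and vec: "\<And>x v. x \<in> carrier AA \<Longrightarrow> v \<in> carrier V \<Longrightarrow> P x \<Longrightarrow> P (x \<otimes>\<^bsub>AA\<^esub> \<eta> v)"
    and add: "\<And>x y. x \<in> carrier AA \<Longrightarrow> y \<in> carrier AA \<Longrightarrow> P x \<Longrightarrow> P y \<Longrightarrow> P (x \<oplus>\<^bsub>AA\<^esub> y)"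
    and smult: "\<And>x c. x \<in> carrier AA \<Longrightarrow> P x \<Longrightarrow> P (c \<odot>\<^bsub>AA\<^esub> x)"
  shows "P x"
proof -
  define S where "S = \<Inter>{S. S \<subseteq> carrier AA \<and> (\<forall>g\<in>carrier G. \<gamma> g \<in> S) \<and>
    (\<forall>x\<in>S. \<forall>v\<in>carrier V. x \<otimes>\<^bsub>AA\<^esub> \<eta> v \<in> S) \<and> (\<forall>x\<in>S. \<forall>y\<in>S. x \<oplus>\<^bsub>AA\<^esub> y \<in> S) \<and> (\<forall>x\<in>S. \<forall>c. c \<odot>\<^bsub>AA\<^esub> x \<in> S)}"
  have S_carr: "S \<subseteq> carrier AA" unfolding S_def by (rule Inter_lower) auto
  have S_grp: "\<And>g. g \<in> carrier G \<Longrightarrow> \<gamma> g \<in> S"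
    and S_vec: "\<And>x v. x \<in> S \<Longrightarrow> v \<in> carrier V \<Longrightarrow> x \<otimes>\<^bsub>AA\<^esub> \<eta> v \<in> S"
    and S_add: "\<And>x y. x \<in> S \<Longrightarrow> y \<in> S \<Longrightarrow> x \<oplus>\<^bsub>AA\<^esub> y \<in> S"
    and S_smult: "\<And>x c. x \<in> S \<Longrightarrow> c \<odot>\<^bsub>AA\<^esub> x \<in> S"
    unfolding S_def by blast+
  have S_ind: "Q x" if "x \<in> S" and Q: "\<And>g. g \<in> carrier G \<Longrightarrow> Q (\<gamma> g)"
    "\<And>x v. x \<in> S \<Longrightarrow> v \<in> carrier V \<Longrightarrow> Q x \<Longrightarrow> Q (x \<otimes>\<^bsub>AA\<^esub> \<eta> v)"
    "\<And>x y. x \<in> S \<Longrightarrow> y \<in> S \<Longrightarrow> Q x \<Longrightarrow> Q y \<Longrightarrow> Q (x \<oplus>\<^bsub>AA\<^esub> y)"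
    "\<And>x c. x \<in> S \<Longrightarrow> Q x \<Longrightarrow> Q (c \<odot>\<^bsub>AA\<^esub> x)" for Q x
  proof -
    have "S \<subseteq> {x \<in> S. Q x}"
      by (subst S_def, rule Inter_lower) (use Q S_grp S_vec S_add S_smult S_carr in auto)
    then show ?thesis using that(1) by blast
  qed
  have S_g: "x \<otimes>\<^bsub>AA\<^esub> \<gamma> h \<in> S" if x: "x \<in> S" and h: "h \<in> carrier G" for x h
  proof (rule S_ind[OF x, of "\<lambda>x. x \<otimes>\<^bsub>AA\<^esub> \<gamma> h \<in> S"])
    fix g assume "g \<in> carrier G"
    then show "\<gamma> g \<otimes>\<^bsub>AA\<^esub> \<gamma> h \<in> S" using h S_grp by (simp add: gen_mult)
  next
    fix x v assume *: "x \<in> S" "v \<in> carrier V" "x \<otimes>\<^bsub>AA\<^esub> \<gamma> h \<in> S"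
    have "x \<otimes>\<^bsub>AA\<^esub> \<eta> v \<otimes>\<^bsub>AA\<^esub> \<gamma> h = x \<otimes>\<^bsub>AA\<^esub> \<gamma> h \<otimes>\<^bsub>AA\<^esub> \<eta> (\<rho> (inv\<^bsub>G\<^esub> h) v)"
      using * h S_carr by (simp add: S.m_assoc gen_gv subset_iff)
    then show "x \<otimes>\<^bsub>AA\<^esub> \<eta> v \<otimes>\<^bsub>AA\<^esub> \<gamma> h \<in> S" using * h S_vec by simp
  next
    fix x y assume *: "x \<in> S" "y \<in> S" "x \<otimes>\<^bsub>AA\<^esub> \<gamma> h \<in> S" "y \<otimes>\<^bsub>AA\<^esub> \<gamma> h \<in> S"
    have "x \<in> carrier AA" "y \<in> carrier AA" using * S_carr by auto
    then show "(x \<oplus>\<^bsub>AA\<^esub> y) \<otimes>\<^bsub>AA\<^esub> \<gamma> h \<in> S" using * h S_add by (simp add: S.l_distr)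
  next
    fix x c assume *: "x \<in> S" "x \<otimes>\<^bsub>AA\<^esub> \<gamma> h \<in> S"
    have "x \<in> carrier AA" using * S_carr by auto
    then show "c \<odot>\<^bsub>AA\<^esub> x \<otimes>\<^bsub>AA\<^esub> \<gamma> h \<in> S" using * h S_smult by simp
  qed
  have word: "Q.cls (Poly_Mapping.single (FWord w) 1) \<in> S" if "set w \<subseteq> XX" for w
    using that
  proof (induction w rule: rev_induct)
    case Nil
    have "Q.cls (Poly_Mapping.single (FWord []) 1) = \<gamma> \<one>\<^bsub>G\<^esub>"
      by (simp add: gen_one AA_simps(3) flip: zero_fword_def)
    then show ?case using S_grp by simp
  next
    case (snoc x w)
    have "Q.cls (Poly_Mapping.single (FWord (w @ [x])) 1) = Q.cls (Poly_Mapping.single (FWord w) 1 * letter x)"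
      by (simp add: letter_def mult_single plus_fword_def)
    also have "\<dots> = Q.cls (Poly_Mapping.single (FWord w) 1) \<otimes>\<^bsub>AA\<^esub> gv_gen G V \<rho> x"
      using snoc by (simp add: gv_gen_eq AA_simps(2))
    also have "\<dots> \<in> S"
      using snoc S_g S_vec by auto
    finally show ?case .
  qed
  obtain f where f: "f \<in> carrier FF" "x = Q.cls f" using x by (cases rule: AA_cases)
  have "Q.cls f \<in> S" using f(1)
  proof (induction f rule: free_alg_induct)
    case zero
    have "0 \<odot>\<^bsub>AA\<^esub> \<gamma> \<one>\<^bsub>G\<^esub> = Q.cls 0"
      using S.smult_l_null[of "\<gamma> \<one>\<^bsub>G\<^esub>"] by (simp add: AA_simps(4))
    then show ?case using S_smult[OF S_grp[of "\<one>\<^bsub>G\<^esub>"], of 0] by simp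
  next
    case (add p u c)
    have "Q.cls (Poly_Mapping.single (FWord u) c) = c \<odot>\<^bsub>AA\<^esub> Q.cls (Poly_Mapping.single (FWord u) 1)"
      using add by (simp add: AA_simps(6) mult_single)
    then have "Q.cls p \<oplus>\<^bsub>AA\<^esub> Q.cls (Poly_Mapping.single (FWord u) c) \<in> S"
      using add word S_add S_smult by simp
    then show ?case using add by (simp add: AA_simps(5))
  qed
  then have "x \<in> S" by (simp add: f)
  then show ?thesis
    by (rule S_ind) (blast intro: grp vec add smult dest: subsetD[OF S_carr])+
qed

section \<open>Linear forms given by functions on words\<close>

definition lift_form :: "(('g + 'v) list \<Rightarrow> complex) \<Rightarrow> ('g, 'v) gv \<Rightarrow> complex" where
  "lift_form F = (\<lambda>x\<in>carrier AA. wsum (SOME f. f \<in> carrier FF \<and> x = Q.cls f) F)"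

definition kills :: "(('g + 'v) list \<Rightarrow> complex) \<Rightarrow> bool" where
  "kills F \<longleftrightarrow> (\<forall>u v r. set u \<subseteq> XX \<longrightarrow> set v \<subseteq> XX \<longrightarrow> r \<in> gv_rels G V \<rho> \<longrightarrow> wsum r (\<lambda>w. F (u @ w @ v)) = 0)"

lemma wsum_eq_cls:
  assumes F: "kills F" and "f \<in> carrier FF" "g \<in> carrier FF" "Q.cls f = Q.cls g"
  shows "wsum f F = wsum g F"
proof -
  have "f - g \<in> Idl\<^bsub>FF\<^esub> (gv_rels G V \<rho>)"
    using assms by (simp add: Q.cls_eq_iff II_eq[symmetric])
  then have "wsum (f - g) F = 0"
    by (rule wsum_Idl[OF rels_carrier]) (rule F[unfolded kills_def, rule_format])
  then show ?thesis by simp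
qed

lemma lift_form_cls [simp]:
  assumes F: "kills F" and f: "f \<in> carrier FF"
  shows "lift_form F (Q.cls f) = wsum f F"
proof -
  let ?g = "SOME g. g \<in> carrier FF \<and> Q.cls f = Q.cls g"
  have g: "?g \<in> carrier FF \<and> Q.cls f = Q.cls ?g"
    by (rule someI[of _ f]) (rule conjI[OF f refl])
  have "wsum ?g F = wsum f F"
    by (rule wsum_eq_cls[OF F conjunct1[OF g] f conjunct2[OF g, symmetric]])
  moreover have "Q.cls f \<in> carrier AA" using f by (simp add: AA_simps(1))
  ultimately show ?thesis by (simp only: lift_form_def restrict_apply')
qed

lemma lift_form_lforms:
  assumes F: "kills F"
  shows "lift_form F \<in> lforms AA"
proof -
  have "lift_form F (x \<oplus>\<^bsub>AA\<^esub> y) = lift_form F x + lift_form F y"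
    if "x \<in> carrier AA" "y \<in> carrier AA" for x y
    using that F by (elim AA_cases) (simp add: AA_simps(5))
  moreover have "lift_form F (c \<odot>\<^bsub>AA\<^esub> x) = c * lift_form F x" if "x \<in> carrier AA" for c x
    using that F Q.smult_closed[of c] by (elim AA_cases) (simp add: AA_simps(6))
  ultimately show ?thesis by (simp add: lforms_iff)
qed

end

context gvdata
begin

subsection \<open>The coproduct\<close>

abbreviation "HH \<equiv> gv_super_bialg G V \<rho>"
abbreviation "TT \<equiv> S.TT"
abbreviation "Bil \<equiv> S.Bil"

definition Dlt :: "'g + 'v \<Rightarrow> (('g, 'v) gv, ('g, 'v) gv) tens" where
  "Dlt = case_sum (\<lambda>g. pure_tensor AA AA (\<gamma> g) (\<gamma> g))
     (\<lambda>v. pure_tensor AA AA (\<eta> v) \<one>\<^bsub>AA\<^esub> \<oplus>\<^bsub>TT\<^esub> pure_tensor AA AA \<one>\<^bsub>AA\<^esub> (\<eta> v))"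

lemma HH_simps:
  "carrier HH = carrier AA" "mult HH = mult AA" "one HH = one AA" "zero HH = zero AA"
  "add HH = add AA" "smult HH = smult AA" "part HH = part AA"
  "scounit HH = (\<lambda>X. the_elem (free_lift ground (case_sum (\<lambda>g. 1) (\<lambda>v. 0)) ` X))"
  "scomult HH = (\<lambda>X. the_elem (free_lift TT Dlt ` X))"
  by (simp_all add: gv_super_bialg_def Let_def super_algebra.defs super_bialgebra.defs Dlt_def)

lemma bilin_HH: "bilin HH HH = Bil"
  by (auto simp: bilin_iff HH_simps)

lemma super_tensor_sq_HH: "super_tensor_sq HH = TT"
  by (simp add: super_tensor_sq_def tensor_def bilin_HH HH_simps pure_tensor_def)

text \<open>Transposed right multiplication by \<Delta>(g) and by \<Delta>(v); the parity
  automorphism is the sign in (a \<otimes> b)(v \<otimes> 1).\<close>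

fun Op :: "'g + 'v \<Rightarrow> (('g, 'v) gv \<Rightarrow> ('g, 'v) gv \<Rightarrow> complex) \<Rightarrow> ('g, 'v) gv \<Rightarrow> ('g, 'v) gv \<Rightarrow> complex" where
  "Op (Inl g) \<beta> = (\<lambda>a b. \<beta> (a \<otimes>\<^bsub>AA\<^esub> \<gamma> g) (b \<otimes>\<^bsub>AA\<^esub> \<gamma> g))"
| "Op (Inr v) \<beta> = (\<lambda>a b. \<beta> (a \<otimes>\<^bsub>AA\<^esub> \<eta> v) (S.sgm b) + \<beta> a (b \<otimes>\<^bsub>AA\<^esub> \<eta> v))"

lemma Op_bilin [simp]: "x \<in> XX \<Longrightarrow> \<beta> \<in> Bil \<Longrightarrow> Op x \<beta> \<in> Bil"
  by (cases x) (simp_all add: bilin_iff S.l_distr S.sgm_add S.sgm_smult algebra_simps)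

lemma Op_cong:
  assumes "x \<in> XX" "\<And>a b. a \<in> carrier AA \<Longrightarrow> b \<in> carrier AA \<Longrightarrow> \<beta> a b = \<beta>' a b"
    "a \<in> carrier AA" "b \<in> carrier AA"
  shows "Op x \<beta> a b = Op x \<beta>' a b"
  using assms by (cases x) simp_all

lemma foldr_Op_bilin [simp]: "set w \<subseteq> XX \<Longrightarrow> \<beta> \<in> Bil \<Longrightarrow> foldr Op w \<beta> \<in> Bil"
  by (induction w) simp_all

lemma Dlt_closed [simp]: "x \<in> XX \<Longrightarrow> Dlt x \<in> carrier TT"
proof -
  interpret T: module CC TT by (rule S.module_TT)
  have *: "pure_tensor AA AA a b \<in> carrier TT" if "a \<in> carrier AA" "b \<in> carrier AA" for a b
    using that S.module_A by (simp add: S.TT_simps)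
  show "x \<in> XX \<Longrightarrow> Dlt x \<in> carrier TT"
    by (cases x) (simp_all add: Dlt_def *)
qed

lemma bact_add:
  assumes "s \<in> carrier TT" "t \<in> carrier TT" "\<beta> \<in> Bil" "a \<in> carrier AA" "b \<in> carrier AA"
  shows "S.bact (s \<oplus>\<^bsub>TT\<^esub> t) \<beta> a b = S.bact s \<beta> a b + S.bact t \<beta> a b"
  using assms by (simp add: S.bact_def S.TT_add_apply S.mform_bilin2)

lemma bact_Dlt:
  assumes "x \<in> XX" "\<beta> \<in> Bil" "a \<in> carrier AA" "b \<in> carrier AA"
  shows "S.bact (Dlt x) \<beta> a b = Op x \<beta> a b"
proof (cases x)
  case (Inl g)
  then show ?thesis using assms by (simp add: Dlt_def S.bact_pure S.bilin_zero1)
next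
  case (Inr v)
  have *: "pure_tensor AA AA a b \<in> carrier TT" if "a \<in> carrier AA" "b \<in> carrier AA" for a b
    using that S.module_A by (simp add: S.TT_simps)
  show ?thesis using assms Inr by (simp add: Dlt_def bact_add * S.bact_pure S.bilin_zero1)
qed

definition Wd :: "('g + 'v) list \<Rightarrow> (('g, 'v) gv, ('g, 'v) gv) tens" where
  "Wd w = foldr (\<lambda>x y. Dlt x \<otimes>\<^bsub>TT\<^esub> y) w \<one>\<^bsub>TT\<^esub>"

lemma Wd_closed [simp]: "set w \<subseteq> XX \<Longrightarrow> Wd w \<in> carrier TT"
  unfolding Wd_def by (induction w) simp_all

lemma bact_Wd:
  assumes "set w \<subseteq> XX" "\<beta> \<in> Bil" "a \<in> carrier AA" "b \<in> carrier AA"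
  shows "S.bact (Wd w) \<beta> a b = foldr Op w \<beta> a b"
  using assms
proof (induction w arbitrary: a b)
  case Nil
  then show ?case by (simp add: Wd_def S.bact_one)
next
  case (Cons x w)
  have w: "Wd w \<in> carrier TT" using Cons by simp
  have bil: "S.bact (Wd w) \<beta> \<in> Bil"
    using S.bact_bilin[of "Wd w" \<beta>] w Cons(3) by (simp add: S.TT_simps(1))
  have "S.bact (Wd (x # w)) \<beta> a b = S.bact (Dlt x \<otimes>\<^bsub>TT\<^esub> Wd w) \<beta> a b" by (simp add: Wd_def)
  also have "\<dots> = S.bact (Dlt x) (S.bact (Wd w) \<beta>) a b"
    by (rule S.bact_mult) (use Cons w in simp_all)
  also have "\<dots> = Op x (S.bact (Wd w) \<beta>) a b"
    by (rule bact_Dlt) (use Cons bil in simp_all)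
  also have "\<dots> = Op x (foldr Op w \<beta>) a b"
    by (rule Op_cong) (use Cons in simp_all)
  finally show ?case by simp
qed

lemma Wd_apply:
  assumes "set w \<subseteq> XX" "\<beta> \<in> Bil"
  shows "Wd w \<beta> = foldr Op w \<beta> \<one>\<^bsub>AA\<^esub> \<one>\<^bsub>AA\<^esub>"
  using S.bact_one_one[OF Wd_closed[OF assms(1)] assms(2)] bact_Wd[OF assms] by simp

lemma free_lift_Dlt_closed: "f \<in> carrier FF \<Longrightarrow> free_lift TT Dlt f \<in> carrier TT"
proof -
  assume f: "f \<in> carrier FF"
  interpret T: module CC TT by (rule S.module_TT)
  show ?thesis unfolding free_lift_def
    by (rule T.finsum_closed) (use f in \<open>auto simp: carrier_free_alg simp flip: Wd_def intro!: T.smult_closed\<close>)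
qed

lemma free_lift_Dlt_apply:
  assumes f: "f \<in> carrier FF" and \<beta>: "\<beta> \<in> Bil"
  shows "free_lift TT Dlt f \<beta> = wsum f (\<lambda>w. foldr Op w \<beta> \<one>\<^bsub>AA\<^esub> \<one>\<^bsub>AA\<^esub>)"
proof -
  interpret T: module CC TT by (rule S.module_TT)
  have w: "set (letters w) \<subseteq> XX" if "w \<in> Poly_Mapping.keys f" for w
    using f that by (simp add: carrier_free_alg)
  have "free_lift TT Dlt f \<beta> =
      (\<Sum>w\<in>Poly_Mapping.keys f. (Poly_Mapping.lookup f w \<odot>\<^bsub>TT\<^esub> Wd (letters w)) \<beta>)"
    unfolding free_lift_def Wd_def[symmetric]
    by (rule S.TT_finsum_apply) (use w \<beta> in \<open>auto intro!: T.smult_closed\<close>)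
  then show ?thesis unfolding wsum_def
    using w \<beta> by (simp add: S.TT_smult_apply Wd_apply)
qed

lemma foldr_Op_wsum_zero:
  assumes "set u \<subseteq> XX" "\<And>a b. a \<in> carrier AA \<Longrightarrow> b \<in> carrier AA \<Longrightarrow> wsum r (\<lambda>w. \<Phi> w a b) = 0"
    "a \<in> carrier AA" "b \<in> carrier AA"
  shows "wsum r (\<lambda>w. foldr Op u (\<Phi> w) a b) = 0"
  using assms(1,3,4)
proof (induction u arbitrary: a b)
  case Nil
  then show ?case using assms(2) by simp
next
  case (Cons x u)
  then show ?case by (cases x) (simp_all add: wsum_fun_add)
qed

text \<open>Compatibility of \<Delta> with the relations, in transposed form: the operators
  \<open>Op\<close> satisfy the relations of H. The right context is absorbed into the form first,
  and the left context is applied to the resulting zero.\<close>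

lemma kills_Op:
  assumes \<beta>: "\<beta> \<in> Bil" and ab: "a \<in> carrier AA" "b \<in> carrier AA"
  shows "kills (\<lambda>w. foldr Op w \<beta> a b)"
  unfolding kills_def
proof (intro allI impI)
  fix u v r assume uv: "set u \<subseteq> XX" "set v \<subseteq> XX" and r: "r \<in> gv_rels G V \<rho>"
  define \<beta>' where "\<beta>' = foldr Op v \<beta>"
  have \<beta>': "\<beta>' \<in> Bil" using uv \<beta> by (simp add: \<beta>'_def)
  have "wsum r (\<lambda>w. foldr Op w \<beta>' a b) = 0" if "a \<in> carrier AA" "b \<in> carrier AA" for a b
    using r
  proof (cases rule: rels_cases)
    case (mult g h)
    then show ?thesis using that by (simp add: S.m_assoc gen_mult)
  next
    case one
    then show ?thesis using that by (simp add: gen_one)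
  next
    case (add v w)
    then show ?thesis using that \<beta>' by (simp add: gen_add S.r_distr S.bil_simps)
  next
    case (smult c v)
    then show ?thesis using that \<beta>' by (simp add: gen_smult S.bil_simps distrib_left)
  next
    case (conj g v)
    have 1: "c \<otimes>\<^bsub>AA\<^esub> \<gamma> g \<otimes>\<^bsub>AA\<^esub> \<eta> v \<otimes>\<^bsub>AA\<^esub> \<gamma> (inv\<^bsub>G\<^esub> g) = c \<otimes>\<^bsub>AA\<^esub> \<eta> (\<rho> g v)" if "c \<in> carrier AA" for c
      using that conj by (simp add: S.m_assoc flip: gen_conj)
    have 2: "c \<otimes>\<^bsub>AA\<^esub> \<gamma> g \<otimes>\<^bsub>AA\<^esub> \<gamma> (inv\<^bsub>G\<^esub> g) = c" if "c \<in> carrier AA" for c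
      using that conj by (simp add: S.m_assoc gen_mult gen_one)
    show ?thesis using that conj by (simp add: 1 2 S.sgm_mult)
  next
    case (anti v w)
    have 1: "c \<otimes>\<^bsub>AA\<^esub> \<eta> w \<otimes>\<^bsub>AA\<^esub> \<eta> v = \<ominus>\<^bsub>AA\<^esub> (c \<otimes>\<^bsub>AA\<^esub> \<eta> v \<otimes>\<^bsub>AA\<^esub> \<eta> w)" if "c \<in> carrier AA" for c
      using that anti by (simp add: S.m_assoc gen_swap[of w v] S.r_minus)
    show ?thesis using that anti \<beta>'
      by (simp add: 1 S.sgm_mult S.bil_simps' S.r_minus)
  qed
  then have "wsum r (\<lambda>w. foldr Op u (foldr Op w \<beta>') a b) = 0"
    by (intro foldr_Op_wsum_zero uv ab)
  then show "wsum r (\<lambda>w. foldr Op (u @ w @ v) \<beta> a b) = 0" by (simp add: \<beta>'_def)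
qed

lemma scomult_cls:
  assumes f: "f \<in> carrier FF"
  shows "scomult HH (Q.cls f) = free_lift TT Dlt f"
proof -
  have "free_lift TT Dlt x = free_lift TT Dlt f" if x: "x \<in> Q.cls f" for x
  proof -
    have xc: "x \<in> carrier FF" "Q.cls x = Q.cls f" using Q.in_cls[OF x f] by auto
    show ?thesis
    proof (rule S.TT_ext)
      fix \<beta> assume \<beta>: "\<beta> \<in> Bil"
      have "wsum x (\<lambda>w. foldr Op w \<beta> \<one>\<^bsub>AA\<^esub> \<one>\<^bsub>AA\<^esub>) = wsum f (\<lambda>w. foldr Op w \<beta> \<one>\<^bsub>AA\<^esub> \<one>\<^bsub>AA\<^esub>)"
        by (rule wsum_eq_cls[OF kills_Op[OF \<beta>] xc(1) f xc(2)]) simp_all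
      then show "free_lift TT Dlt x \<beta> = free_lift TT Dlt f \<beta>"
        by (simp only: free_lift_Dlt_apply[OF xc(1) \<beta>] free_lift_Dlt_apply[OF f \<beta>])
    qed (rule free_lift_Dlt_closed, fact)+
  qed
  moreover have "f \<in> Q.cls f" using f Q.a_rcos_self by blast
  ultimately have "free_lift TT Dlt ` Q.cls f = {free_lift TT Dlt f}" by blast
  then show ?thesis by (simp only: HH_simps the_elem_eq)
qed

lemma scomult_closed [simp]: "x \<in> carrier AA \<Longrightarrow> scomult HH x \<in> carrier TT"
  by (elim AA_cases) (simp add: scomult_cls free_lift_Dlt_closed)

lemma bact_scomult_cls:
  assumes f: "f \<in> carrier FF" and "\<beta> \<in> Bil" "a \<in> carrier AA" "b \<in> carrier AA"
  shows "S.bact (scomult HH (Q.cls f)) \<beta> a b = wsum f (\<lambda>w. foldr Op w \<beta> a b)"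
proof -
  have m: "(\<lambda>c d. S.mform \<beta> a b c d) \<in> Bil" using assms by (simp add: S.mform_bilin2)
  have "S.bact (scomult HH (Q.cls f)) \<beta> a b = wsum f (\<lambda>w. foldr Op w (\<lambda>c d. S.mform \<beta> a b c d) \<one>\<^bsub>AA\<^esub> \<one>\<^bsub>AA\<^esub>)"
    unfolding S.bact_def scomult_cls[OF f] by (rule free_lift_Dlt_apply[OF f m])
  also have "\<dots> = wsum f (\<lambda>w. foldr Op w \<beta> a b)"
  proof (rule wsum_cong[OF f])
    fix w assume w: "set w \<subseteq> XX"
    have "foldr Op w (\<lambda>c d. S.mform \<beta> a b c d) \<one>\<^bsub>AA\<^esub> \<one>\<^bsub>AA\<^esub> = Wd w (\<lambda>c d. S.mform \<beta> a b c d)"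
      by (rule Wd_apply[OF w m, symmetric])
    also have "\<dots> = foldr Op w \<beta> a b"
      using bact_Wd[OF w assms(2-4)] by (simp add: S.bact_def)
    finally show "foldr Op w (\<lambda>c d. S.mform \<beta> a b c d) \<one>\<^bsub>AA\<^esub> \<one>\<^bsub>AA\<^esub> = foldr Op w \<beta> a b" .
  qed
  finally show ?thesis .
qed

text \<open>Multiplicativity of \<Delta> for a generator on the right: the letter appended to a word
  is the innermost operator.\<close>

lemma bact_scomult_gen:
  assumes x: "x \<in> carrier AA" and y: "y \<in> XX" and "\<beta> \<in> Bil" "a \<in> carrier AA" "b \<in> carrier AA"
  shows "S.bact (scomult HH (x \<otimes>\<^bsub>AA\<^esub> gv_gen G V \<rho> y)) \<beta> a b = S.bact (scomult HH x) (Op y \<beta>) a b"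
proof -
  obtain f where f: "f \<in> carrier FF" "x = Q.cls f" using x by (cases rule: AA_cases)
  have "x \<otimes>\<^bsub>AA\<^esub> gv_gen G V \<rho> y = Q.cls (f * letter y)"
    using f y by (simp add: gv_gen_eq AA_simps(2))
  then show ?thesis using assms(3-5) f y by (simp add: bact_scomult_cls)
qed

lemma bact_scomult_add:
  assumes "x \<in> carrier AA" "y \<in> carrier AA" "\<beta> \<in> Bil" "a \<in> carrier AA" "b \<in> carrier AA"
  shows "S.bact (scomult HH (x \<oplus>\<^bsub>AA\<^esub> y)) \<beta> a b = S.bact (scomult HH x) \<beta> a b + S.bact (scomult HH y) \<beta> a b"
proof -
  obtain p q where "p \<in> carrier FF" "x = Q.cls p" "q \<in> carrier FF" "y = Q.cls q"
    using assms(1,2) by (meson AA_cases)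
  then show ?thesis using assms(3-5) by (simp add: AA_simps(5) bact_scomult_cls)
qed

lemma bact_scomult_smult:
  assumes "x \<in> carrier AA" "\<beta> \<in> Bil" "a \<in> carrier AA" "b \<in> carrier AA"
  shows "S.bact (scomult HH (c \<odot>\<^bsub>AA\<^esub> x)) \<beta> a b = c * S.bact (scomult HH x) \<beta> a b"
proof -
  obtain p where "p \<in> carrier FF" "x = Q.cls p"
    using assms(1) by (rule AA_cases)
  then show ?thesis using assms(2-4) Q.smult_closed[of c p] by (simp add: AA_simps(6) bact_scomult_cls)
qed

lemma bact_scomult_grp:
  assumes "g \<in> carrier G" "\<beta> \<in> Bil" "a \<in> carrier AA" "b \<in> carrier AA"
  shows "S.bact (scomult HH (\<gamma> g)) \<beta> a b = \<beta> (a \<otimes>\<^bsub>AA\<^esub> \<gamma> g) (b \<otimes>\<^bsub>AA\<^esub> \<gamma> g)"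
  using bact_scomult_cls[of "letter (Inl g)" \<beta> a b] assms by (simp add: gv_gen_eq)

subsection \<open>Linear forms\<close>

definition wc :: "('g + 'v) list \<Rightarrow> ('g, 'v) gv" where
  "wc w = Q.cls (Poly_Mapping.single (FWord w) 1)"

lemma wc_closed [simp]: "set w \<subseteq> XX \<Longrightarrow> wc w \<in> carrier AA"
  by (simp add: wc_def AA_simps(1))

lemma wc_snoc [simp]: "set w \<subseteq> XX \<Longrightarrow> x \<in> XX \<Longrightarrow> wc (w @ [x]) = wc w \<otimes>\<^bsub>AA\<^esub> gv_gen G V \<rho> x"
  by (simp add: wc_def AA_simps(2) gv_gen_eq letter_def mult_single plus_fword_def)

lemma lform_wsum:
  assumes f: "f \<in> lforms AA" and p: "p \<in> carrier FF"
  shows "f (Q.cls p) = wsum p (\<lambda>w. f (wc w))"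
  using p
proof (induction p rule: free_alg_induct)
  case zero
  then show ?case using lforms_zero[OF S.module_A f] by (simp add: AA_simps(4))
next
  case (add p u c)
  have 1: "Q.cls (p + Poly_Mapping.single (FWord u) c) = Q.cls p \<oplus>\<^bsub>AA\<^esub> c \<odot>\<^bsub>AA\<^esub> wc u"
    using add by (simp add: AA_simps(5,6) wc_def mult_single)
  have 2: "Q.cls p \<in> carrier AA" using add by (simp add: AA_simps(1))
  have 3: "wc u \<in> carrier AA" using add by simp
  have "f (Q.cls p \<oplus>\<^bsub>AA\<^esub> c \<odot>\<^bsub>AA\<^esub> wc u) = f (Q.cls p) + c * f (wc u)"
    using 2 3 S.smult_closed[of c "wc u"] by (simp add: lforms_add[OF f] lforms_smult[OF f])
  then show ?case using add 1 by simp
qed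

text \<open>A relation inside a context lies in the ideal. This serves the contractions, which
  evaluate a given form on the letters that are left over.\<close>

lemma kills_lform:
  assumes f: "f \<in> lforms AA"
  shows "kills (\<lambda>w. f (wc w))"
  unfolding kills_def
proof (intro allI impI)
  fix u v r assume uv: "set u \<subseteq> XX" "set v \<subseteq> XX" and r: "r \<in> gv_rels G V \<rho>"
  let ?p = "Poly_Mapping.single (FWord u) 1 * r * Poly_Mapping.single (FWord v) 1"
  have rc: "r \<in> carrier FF" using r rels_carrier by blast
  have "?p \<in> II" using rels_II[OF r] Q.I_l_closed Q.I_r_closed uv by simp
  then have "Q.cls ?p = Q.cls 0" using uv rc by (simp add: Q.cls_eq_iff)
  then have "f (Q.cls ?p) = 0" using lforms_zero[OF S.module_A f] by (simp add: AA_simps(4))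
  moreover have "f (Q.cls ?p) = wsum ?p (\<lambda>w. f (wc w))"
    by (rule lform_wsum[OF f]) (use uv rc in simp)
  moreover have "wsum ?p (\<lambda>w. f (wc w)) = wsum r (\<lambda>w. f (wc (u @ w @ v)))" by simp
  ultimately show "wsum r (\<lambda>w. f (wc (u @ w @ v))) = 0" by (simp only:)
qed

definition gprod :: "('g + 'v) list \<Rightarrow> 'g" where
  "gprod w = foldr (\<lambda>x h. case x of Inl g \<Rightarrow> g \<otimes>\<^bsub>G\<^esub> h | Inr _ \<Rightarrow> h) w \<one>\<^bsub>G\<^esub>"

lemma gprod_simps [simp]:
  "gprod [] = \<one>\<^bsub>G\<^esub>" "gprod (Inl g # w) = g \<otimes>\<^bsub>G\<^esub> gprod w" "gprod (Inr v # w) = gprod w"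
  by (simp_all add: gprod_def)

lemma gprod_closed [simp]: "set w \<subseteq> XX \<Longrightarrow> gprod w \<in> carrier G"
  by (induction w) (auto simp: gprod_def)

lemma gprod_append [simp]: "set u \<subseteq> XX \<Longrightarrow> set w \<subseteq> XX \<Longrightarrow> gprod (u @ w) = gprod u \<otimes>\<^bsub>G\<^esub> gprod w"
proof (induction u)
  case (Cons x u)
  then show ?case by (cases x) (simp_all add: GG.m_assoc)
qed simp

definition phi_word :: "('g \<Rightarrow> complex) \<Rightarrow> ('g + 'v) list \<Rightarrow> complex" where
  "phi_word \<phi> w = (if \<exists>v. Inr v \<in> set w then 0 else \<phi> (gprod w))"

text \<open>A relation that involves vectors has one in each of its terms, so all terms vanish; the
  other relations preserve the product in G.\<close>

lemma kills_phi: "kills (phi_word \<phi>)"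
  unfolding kills_def
proof (intro allI impI)
  fix u v r assume uv: "set u \<subseteq> XX" "set v \<subseteq> XX" and r: "r \<in> gv_rels G V \<rho>"
  show "wsum r (\<lambda>w. phi_word \<phi> (u @ w @ v)) = 0" using r
    by (cases rule: rels_cases) (use uv in \<open>auto simp: phi_word_def GG.m_assoc\<close>)
qed

definition phi :: "('g \<Rightarrow> complex) \<Rightarrow> ('g, 'v) gv \<Rightarrow> complex" where
  "phi \<phi> = lift_form (phi_word \<phi>)"

lemma phi_lform: "phi \<phi> \<in> lforms AA"
  unfolding phi_def by (rule lift_form_lforms[OF kills_phi])

lemma phi_grp: "g \<in> carrier G \<Longrightarrow> phi \<phi> (\<gamma> g) = \<phi> g"
  by (simp add: phi_def gv_gen_eq kills_phi phi_word_def)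

lemma phi_vec:
  assumes "x \<in> carrier AA" "v \<in> carrier V"
  shows "phi \<phi> (x \<otimes>\<^bsub>AA\<^esub> \<eta> v) = 0"
proof -
  obtain f where f: "f \<in> carrier FF" "x = Q.cls f" using assms(1) by (cases rule: AA_cases)
  have "x \<otimes>\<^bsub>AA\<^esub> \<eta> v = Q.cls (f * letter (Inr v))"
    using f assms by (simp add: gv_gen_eq AA_simps(2))
  moreover have "phi_word \<phi> (u @ [Inr v]) = 0" for u by (auto simp: phi_word_def)
  ultimately show ?thesis using f assms by (simp add: phi_def kills_phi)
qed

text \<open>The list is the reversed word, because the recursion removes the last letter. On g v_1
  ... v_k the result is the alternating sum of \<xi>(v_j) times the value of f with v_j omitted,
  with sign plus for j = k. A group element at the end is moved to the front, which translates
  \<xi>.\<close>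

fun iota_word :: "('v \<Rightarrow> complex) \<Rightarrow> (('g, 'v) gv \<Rightarrow> complex) \<Rightarrow> ('g + 'v) list \<Rightarrow> complex" where
  "iota_word \<xi> f [] = 0"
| "iota_word \<xi> f (Inr v # r) = \<xi> v * f (wc (rev r)) - iota_word \<xi> (\<lambda>x. f (x \<otimes>\<^bsub>AA\<^esub> \<eta> v)) r"
| "iota_word \<xi> f (Inl g # r) = iota_word (\<lambda>v. \<xi> (\<rho> (inv\<^bsub>G\<^esub> g) v)) (\<lambda>x. f (x \<otimes>\<^bsub>AA\<^esub> \<gamma> g)) r"

lemma iota_word_cong:
  assumes "set r \<subseteq> XX" "\<And>v. v \<in> carrier V \<Longrightarrow> \<xi> v = \<xi>' v" "\<And>x. x \<in> carrier AA \<Longrightarrow> f x = f' x"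
  shows "iota_word \<xi> f r = iota_word \<xi>' f' r"
  using assms
proof (induction r arbitrary: \<xi> \<xi>' f f')
  case (Cons x r)
  show ?case
  proof (cases x)
    case (Inl g)
    have "iota_word (\<lambda>v. \<xi> (\<rho> (inv\<^bsub>G\<^esub> g) v)) (\<lambda>x. f (x \<otimes>\<^bsub>AA\<^esub> \<gamma> g)) r =
        iota_word (\<lambda>v. \<xi>' (\<rho> (inv\<^bsub>G\<^esub> g) v)) (\<lambda>x. f' (x \<otimes>\<^bsub>AA\<^esub> \<gamma> g)) r"
      by (rule Cons.IH) (use Cons.prems Inl in simp_all)
    then show ?thesis by (simp only: Inl iota_word.simps)
  next
    case (Inr v)
    have "iota_word \<xi> (\<lambda>x. f (x \<otimes>\<^bsub>AA\<^esub> \<eta> v)) r = iota_word \<xi>' (\<lambda>x. f' (x \<otimes>\<^bsub>AA\<^esub> \<eta> v)) r"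
      by (rule Cons.IH) (use Cons.prems Inr in simp_all)
    moreover have "\<xi> v = \<xi>' v" "f (wc (rev r)) = f' (wc (rev r))"
      using Cons.prems Inr by simp_all
    ultimately show ?thesis by (simp only: Inr iota_word.simps)
  qed
qed simp

lemma iota_word_add: "iota_word \<xi> (\<lambda>x. f x + f' x) r = iota_word \<xi> f r + iota_word \<xi> f' r"
  by (induction \<xi> f r arbitrary: f' rule: iota_word.induct) (simp_all add: distrib_left add_diff_add)

lemma iota_word_cmult: "iota_word \<xi> (\<lambda>x. c * f x) r = c * iota_word \<xi> f r"
  by (induction \<xi> f r rule: iota_word.induct) (simp_all add: algebra_simps)

lemma lform_rmult: "f \<in> lforms AA \<Longrightarrow> y \<in> carrier AA \<Longrightarrow> (\<lambda>x. f (x \<otimes>\<^bsub>AA\<^esub> y)) \<in> lforms AA"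
  by (simp add: lforms_iff S.l_distr)

lemma lform_lmult: "f \<in> lforms AA \<Longrightarrow> y \<in> carrier AA \<Longrightarrow> (\<lambda>x. f (y \<otimes>\<^bsub>AA\<^esub> x)) \<in> lforms AA"
  by (simp add: lforms_iff S.r_distr)

lemma lform_rho: "\<xi> \<in> lforms V \<Longrightarrow> g \<in> carrier G \<Longrightarrow> (\<lambda>v. \<xi> (\<rho> g v)) \<in> lforms V"
  by (simp add: lforms_iff rho_add rho_smult)

text \<open>The relation stands at the right end of the word, and \<open>u\<close> is the reversed
  left context. For the anticommutator, the terms in which v or w is contracted cancel in pairs, and
  the remaining ones cancel because f respects anticommutation.\<close>

lemma iota_word_rels:
  assumes r: "r \<in> gv_rels G V \<rho>" and u: "set u \<subseteq> XX" and \<xi>: "\<xi> \<in> lforms V" and f: "f \<in> lforms AA"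
  shows "wsum r (\<lambda>w. iota_word \<xi> f (rev w @ u)) = 0"
  using r
proof (cases rule: rels_cases)
  case (mult g h)
  have "iota_word (\<lambda>v. \<xi> (\<rho> (inv\<^bsub>G\<^esub> h) (\<rho> (inv\<^bsub>G\<^esub> g) v))) (\<lambda>x. f (x \<otimes>\<^bsub>AA\<^esub> \<gamma> g \<otimes>\<^bsub>AA\<^esub> \<gamma> h)) u =
      iota_word (\<lambda>v. \<xi> (\<rho> (inv\<^bsub>G\<^esub> (g \<otimes>\<^bsub>G\<^esub> h)) v)) (\<lambda>x. f (x \<otimes>\<^bsub>AA\<^esub> \<gamma> (g \<otimes>\<^bsub>G\<^esub> h))) u"
    by (rule iota_word_cong[OF u])
      (use mult in \<open>simp_all add: S.m_assoc gen_mult GG.inv_mult_group rho_mult\<close>)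
  then show ?thesis using mult by simp
next
  case one
  have "iota_word (\<lambda>v. \<xi> (\<rho> (inv\<^bsub>G\<^esub> \<one>\<^bsub>G\<^esub>) v)) (\<lambda>x. f (x \<otimes>\<^bsub>AA\<^esub> \<gamma> \<one>\<^bsub>G\<^esub>)) u = iota_word \<xi> f u"
    by (rule iota_word_cong[OF u]) (simp_all add: gen_one)
  then show ?thesis using one by simp
next
  case (add v w)
  have "iota_word \<xi> (\<lambda>x. f (x \<otimes>\<^bsub>AA\<^esub> \<eta> (v \<oplus>\<^bsub>V\<^esub> w))) u =
      iota_word \<xi> (\<lambda>x. f (x \<otimes>\<^bsub>AA\<^esub> \<eta> v) + f (x \<otimes>\<^bsub>AA\<^esub> \<eta> w)) u"
    by (rule iota_word_cong[OF u]) (use add(1,2) in \<open>simp_all add: gen_add S.r_distr lforms_add[OF f]\<close>)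
  then show ?thesis unfolding add(3) using add(1,2)
    by (simp add: iota_word_add lforms_add[OF \<xi>] distrib_right)
next
  case (smult c v)
  have "iota_word \<xi> (\<lambda>x. f (x \<otimes>\<^bsub>AA\<^esub> \<eta> (c \<odot>\<^bsub>V\<^esub> v))) u = iota_word \<xi> (\<lambda>x. c * f (x \<otimes>\<^bsub>AA\<^esub> \<eta> v)) u"
    by (rule iota_word_cong[OF u]) (use smult(1) in \<open>simp_all add: gen_smult lforms_smult[OF f]\<close>)
  then show ?thesis unfolding smult(2) using smult(1)
    by (simp add: iota_word_cmult lforms_smult[OF \<xi>] right_diff_distrib)
next
  case (conj g v)
  have u': "set (rev u) \<subseteq> XX" using u by simp
  have 1: "c \<otimes>\<^bsub>AA\<^esub> \<gamma> g \<otimes>\<^bsub>AA\<^esub> \<eta> v \<otimes>\<^bsub>AA\<^esub> \<gamma> (inv\<^bsub>G\<^esub> g) = c \<otimes>\<^bsub>AA\<^esub> \<eta> (\<rho> g v)" if "c \<in> carrier AA" for c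
    using that conj by (simp add: S.m_assoc flip: gen_conj)
  have "wc (rev u) \<otimes>\<^bsub>AA\<^esub> \<gamma> g \<otimes>\<^bsub>AA\<^esub> \<gamma> (inv\<^bsub>G\<^esub> g) = wc (rev u)"
    using conj u by (simp add: S.m_assoc gen_mult gen_one)
  moreover have "iota_word (\<lambda>v. \<xi> (\<rho> (inv\<^bsub>G\<^esub> (inv\<^bsub>G\<^esub> g)) (\<rho> (inv\<^bsub>G\<^esub> g) v)))
      (\<lambda>x. f (x \<otimes>\<^bsub>AA\<^esub> \<gamma> g \<otimes>\<^bsub>AA\<^esub> \<eta> v \<otimes>\<^bsub>AA\<^esub> \<gamma> (inv\<^bsub>G\<^esub> g))) u =
      iota_word \<xi> (\<lambda>x. f (x \<otimes>\<^bsub>AA\<^esub> \<eta> (\<rho> g v))) u"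
    by (rule iota_word_cong[OF u]) (use conj 1 in simp_all)
  ultimately show ?thesis using conj u' wc_snoc[of "rev u" "Inl g"] by simp
next
  case (anti v w)
  have u': "set (rev u) \<subseteq> XX" using u by simp
  have "iota_word \<xi> (\<lambda>x. f (x \<otimes>\<^bsub>AA\<^esub> \<eta> w \<otimes>\<^bsub>AA\<^esub> \<eta> v)) u = iota_word \<xi> (\<lambda>x. (-1) * f (x \<otimes>\<^bsub>AA\<^esub> \<eta> v \<otimes>\<^bsub>AA\<^esub> \<eta> w)) u"
    by (rule iota_word_cong[OF u])
      (use anti gen_swap[of w v] in \<open>simp_all add: S.m_assoc S.r_minus lforms_uminus[OF S.module_A f]\<close>)
  then have "iota_word \<xi> (\<lambda>x. f (x \<otimes>\<^bsub>AA\<^esub> \<eta> w \<otimes>\<^bsub>AA\<^esub> \<eta> v)) u = - iota_word \<xi> (\<lambda>x. f (x \<otimes>\<^bsub>AA\<^esub> \<eta> v \<otimes>\<^bsub>AA\<^esub> \<eta> w)) u"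
    unfolding iota_word_cmult by simp
  then show ?thesis
    using anti wc_snoc[OF u', of "Inr v"] wc_snoc[OF u', of "Inr w"] by simp
qed

text \<open>Induction on the right context, whose letters the recursion removes one by one; the
  empty context is \<open>iota_word_rels\<close>.\<close>

lemma kills_iota:
  assumes "\<xi> \<in> lforms V" "f \<in> lforms AA"
  shows "kills (\<lambda>w. iota_word \<xi> f (rev w))"
  unfolding kills_def
proof (intro allI impI)
  fix u v r assume uv: "set u \<subseteq> XX" "set v \<subseteq> XX" and r: "r \<in> gv_rels G V \<rho>"
  have "wsum r (\<lambda>w. iota_word \<xi> f (v @ rev w @ rev u)) = 0" if "set v \<subseteq> XX" for v
    using assms that
  proof (induction v arbitrary: \<xi> f)
    case Nil
    then show ?case using iota_word_rels[OF r _ Nil(1,2), of "rev u"] uv by simp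
  next
    case (Cons x v)
    show ?case
    proof (cases x)
      case (Inl g)
      then show ?thesis using Cons by (simp add: Cons.IH lform_rho lform_rmult)
    next
      case (Inr y)
      have "wsum r (\<lambda>w. f (wc (u @ w @ rev v))) = 0"
        using kills_lform[OF Cons.prems(2)] uv r Cons.prems(3) unfolding kills_def by simp
      then show ?thesis using Cons Inr
        by (simp add: wsum_fun_diff wsum_fun_mult Cons.IH lform_rmult)
    qed
  qed
  from this[of "rev v"] show "wsum r (\<lambda>w. iota_word \<xi> f (rev (u @ w @ v))) = 0"
    using uv by simp
qed

definition iota :: "('v \<Rightarrow> complex) \<Rightarrow> (('g, 'v) gv \<Rightarrow> complex) \<Rightarrow> ('g, 'v) gv \<Rightarrow> complex" where
  "iota \<xi> f = lift_form (\<lambda>w. iota_word \<xi> f (rev w))"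

lemma iota_lform: "\<xi> \<in> lforms V \<Longrightarrow> f \<in> lforms AA \<Longrightarrow> iota \<xi> f \<in> lforms AA"
  unfolding iota_def by (rule lift_form_lforms[OF kills_iota])

lemma iota_one:
  assumes "\<xi> \<in> lforms V" "f \<in> lforms AA"
  shows "iota \<xi> f \<one>\<^bsub>AA\<^esub> = 0"
proof -
  have "lift_form (\<lambda>w. iota_word \<xi> f (rev w)) (Q.cls 1) = wsum 1 (\<lambda>w. iota_word \<xi> f (rev w))"
    by (rule lift_form_cls[OF kills_iota[OF assms]]) simp
  then show ?thesis by (simp add: iota_def AA_simps(3))
qed

lemma iota_grp:
  assumes "\<xi> \<in> lforms V" "f \<in> lforms AA" "x \<in> carrier AA" "g \<in> carrier G"
  shows "iota \<xi> f (x \<otimes>\<^bsub>AA\<^esub> \<gamma> g) = iota (\<lambda>v. \<xi> (\<rho> (inv\<^bsub>G\<^esub> g) v)) (\<lambda>x. f (x \<otimes>\<^bsub>AA\<^esub> \<gamma> g)) x"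
proof -
  obtain p where p: "p \<in> carrier FF" "x = Q.cls p" using assms(3) by (cases rule: AA_cases)
  have "x \<otimes>\<^bsub>AA\<^esub> \<gamma> g = Q.cls (p * letter (Inl g))"
    using p assms by (simp add: gv_gen_eq AA_simps(2))
  then show ?thesis using p assms by (simp add: iota_def kills_iota lform_rho lform_rmult)
qed

lemma iota_vec:
  assumes "\<xi> \<in> lforms V" "f \<in> lforms AA" "x \<in> carrier AA" "v \<in> carrier V"
  shows "iota \<xi> f (x \<otimes>\<^bsub>AA\<^esub> \<eta> v) = \<xi> v * f x - iota \<xi> (\<lambda>x. f (x \<otimes>\<^bsub>AA\<^esub> \<eta> v)) x"
proof -
  obtain p where p: "p \<in> carrier FF" "x = Q.cls p" using assms(3) by (cases rule: AA_cases)
  have "x \<otimes>\<^bsub>AA\<^esub> \<eta> v = Q.cls (p * letter (Inr v))"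
    using p assms by (simp add: gv_gen_eq AA_simps(2))
  then show ?thesis using p assms
    by (simp add: iota_def kills_iota lform_rmult wsum_fun_diff wsum_fun_mult lform_wsum)
qed

end

context gvdata
begin

subsection \<open>Dual bases and nilpotency\<close>

lemma lform_finsum:
  assumes F: "F \<in> lforms V" and "finite S" "\<And>x. x \<in> S \<Longrightarrow> h x \<in> carrier V"
  shows "F (finsum V h S) = (\<Sum>x\<in>S. F (h x))"
  using assms(2,3)
proof (induction S rule: finite_induct)
  case empty
  then show ?case using lforms_zero[OF VV.module_axioms F] by simp
next
  case (insert x S)
  then have "finsum V h (insert x S) = h x \<oplus>\<^bsub>V\<^esub> finsum V h S"
    by (intro VV.finsum_insert) auto
  moreover have "finsum V h S \<in> carrier V" using insert by (intro VV.finsum_closed) auto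
  ultimately show ?case using insert by (simp add: lforms_add[OF F])
qed

text \<open>The \<epsilon> e are the coordinate functions of a basis, cut off outside V so that they
  lie in the dual space. The expansion is stated under a linear form F because vectors are always
  tested by forms in what follows.\<close>

lemma dual_basis:
  obtains E \<epsilon> where "finite E" "E \<subseteq> carrier V" "\<And>e. e \<in> E \<Longrightarrow> \<epsilon> e \<in> lforms V \<inter> extensional (carrier V)"
    "\<And>F v. F \<in> lforms V \<Longrightarrow> v \<in> carrier V \<Longrightarrow> F v = (\<Sum>e\<in>E. \<epsilon> e v * F e)"
proof -
  obtain E where E: "finite E" "VV.basis E" using VV.finite_basis_exists[OF fd] by blast
  have EV: "E \<subseteq> carrier V" using E(2) by (simp add: VV.basis_def)
  have ex1: "\<exists>!a. a \<in> E \<rightarrow>\<^sub>E carrier CC \<and> VV.lincomb a E = v" if "v \<in> carrier V" for v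
    using VV.basis_criterion[OF E(1) EV] E(2) that by blast
  define cf where "cf v = (THE a. a \<in> E \<rightarrow>\<^sub>E carrier CC \<and> VV.lincomb a E = v)" for v
  have cf: "cf v \<in> E \<rightarrow>\<^sub>E carrier CC" "VV.lincomb (cf v) E = v" if "v \<in> carrier V" for v
    using theI'[OF ex1[OF that]] by (auto simp: cf_def)
  have uniq: "cf v = a" if "v \<in> carrier V" "a \<in> E \<rightarrow>\<^sub>E carrier CC" "VV.lincomb a E = v" for v a
    using ex1[OF that(1)] cf[OF that(1)] that by blast
  define \<epsilon> where "\<epsilon> e = (\<lambda>v\<in>carrier V. cf v e)" for e
  have lc: "VV.lincomb a E = finsum V (\<lambda>e. a e \<odot>\<^bsub>V\<^esub> e) E" for a by (simp add: VV.lincomb_def)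
  have cl: "VV.lincomb a E \<in> carrier V" for a
    unfolding lc by (rule VV.finsum_closed) (use EV in auto)
  have add: "cf (v \<oplus>\<^bsub>V\<^esub> w) = (\<lambda>e\<in>E. cf v e + cf w e)" if "v \<in> carrier V" "w \<in> carrier V" for v w
  proof (rule uniq)
    have "VV.lincomb (\<lambda>e\<in>E. cf v e + cf w e) E = finsum V (\<lambda>e. cf v e \<odot>\<^bsub>V\<^esub> e \<oplus>\<^bsub>V\<^esub> cf w e \<odot>\<^bsub>V\<^esub> e) E"
      unfolding lc using EV by (intro VV.finsum_cong') (auto simp: VV.smult_l_distr[simplified])
    also have "\<dots> = VV.lincomb (cf v) E \<oplus>\<^bsub>V\<^esub> VV.lincomb (cf w) E"
      unfolding lc by (rule VV.finsum_addf) (use EV in auto)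
    finally show "VV.lincomb (\<lambda>e\<in>E. cf v e + cf w e) E = v \<oplus>\<^bsub>V\<^esub> w" using cf that by simp
  qed (use that in auto)
  have scale: "cf (c \<odot>\<^bsub>V\<^esub> v) = (\<lambda>e\<in>E. c * cf v e)" if "v \<in> carrier V" for c v
  proof (rule uniq)
    have "VV.lincomb (\<lambda>e\<in>E. c * cf v e) E = finsum V (\<lambda>e. c \<odot>\<^bsub>V\<^esub> (cf v e \<odot>\<^bsub>V\<^esub> e)) E"
      unfolding lc using EV by (intro VV.finsum_cong') (auto simp: VV.smult_assoc1[simplified])
    also have "\<dots> = c \<odot>\<^bsub>V\<^esub> VV.lincomb (cf v) E"
      unfolding lc by (rule VV.finsum_smult[symmetric]) (use EV E in auto)
    finally show "VV.lincomb (\<lambda>e\<in>E. c * cf v e) E = c \<odot>\<^bsub>V\<^esub> v" using cf that by simp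
  qed (use that in auto)
  show ?thesis
  proof (rule that[OF E(1) EV, of \<epsilon>])
    fix e assume "e \<in> E"
    then show "\<epsilon> e \<in> lforms V \<inter> extensional (carrier V)"
      by (auto simp: lforms_iff \<epsilon>_def add scale)
  next
    fix F v assume F: "F \<in> lforms V" and v: "v \<in> carrier V"
    have "F v = F (VV.lincomb (cf v) E)" using cf v by simp
    also have "\<dots> = (\<Sum>e\<in>E. F (cf v e \<odot>\<^bsub>V\<^esub> e))"
      unfolding lc by (rule lform_finsum[OF F E(1)]) (use EV in auto)
    also have "\<dots> = (\<Sum>e\<in>E. \<epsilon> e v * F e)"
      using EV v by (intro sum.cong) (auto simp: \<epsilon>_def lforms_smult[OF F])
    finally show "F v = (\<Sum>e\<in>E. \<epsilon> e v * F e)" .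
  qed
qed

abbreviation vmul :: "('g, 'v) gv \<Rightarrow> 'v \<Rightarrow> ('g, 'v) gv" where
  "vmul x v \<equiv> x \<otimes>\<^bsub>AA\<^esub> \<eta> v"

lemma foldl_vmul_closed [simp]: "x \<in> carrier AA \<Longrightarrow> set vs \<subseteq> carrier V \<Longrightarrow> foldl vmul x vs \<in> carrier AA"
  by (induction vs arbitrary: x) simp_all

lemma lform_foldl: "f \<in> lforms AA \<Longrightarrow> set vs \<subseteq> carrier V \<Longrightarrow> (\<lambda>x. f (foldl vmul x vs)) \<in> lforms AA"
proof (induction vs)
  case (Cons v vs)
  then show ?case using lform_rmult[of "\<lambda>x. f (foldl vmul x vs)" "\<eta> v"] by simp
qed (simp add: lforms_iff)

lemma lform_vec: "f \<in> lforms AA \<Longrightarrow> x \<in> carrier AA \<Longrightarrow> (\<lambda>v. f (x \<otimes>\<^bsub>AA\<^esub> \<eta> v)) \<in> lforms V"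
  by (simp add: lforms_iff gen_add gen_smult S.r_distr)

lemma lform_swap:
  assumes "f \<in> lforms AA" "x \<in> carrier AA" "v \<in> carrier V" "w \<in> carrier V"
  shows "f (x \<otimes>\<^bsub>AA\<^esub> \<eta> v \<otimes>\<^bsub>AA\<^esub> \<eta> w) = - f (x \<otimes>\<^bsub>AA\<^esub> \<eta> w \<otimes>\<^bsub>AA\<^esub> \<eta> v)"
proof -
  have "x \<otimes>\<^bsub>AA\<^esub> \<eta> v \<otimes>\<^bsub>AA\<^esub> \<eta> w = x \<otimes>\<^bsub>AA\<^esub> (\<ominus>\<^bsub>AA\<^esub> (\<eta> w \<otimes>\<^bsub>AA\<^esub> \<eta> v))"
    using assms gen_swap[OF assms(3,4)] by (simp only: S.m_assoc gen_closed)
  also have "\<dots> = \<ominus>\<^bsub>AA\<^esub> (x \<otimes>\<^bsub>AA\<^esub> \<eta> w \<otimes>\<^bsub>AA\<^esub> \<eta> v)"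
    using assms by (simp add: S.m_assoc S.r_minus)
  finally show ?thesis
    using assms by (simp add: lforms_uminus[OF S.module_A assms(1)])
qed

text \<open>Transpositions bring the two copies of y together; when adjacent, they make the value
  equal to its own negative.\<close>

lemma lform_repeat:
  assumes "f \<in> lforms AA" "x \<in> carrier AA" "y \<in> carrier V" "set ys \<subseteq> carrier V"
  shows "f (foldl vmul (vmul x y) (ys @ [y])) = 0"
  using assms(2,4)
proof (induction ys arbitrary: x)
  case Nil
  then show ?case using lform_swap[OF assms(1) _ assms(3,3), of x] by simp
next
  case (Cons z ys)
  have "(\<lambda>x. f (foldl vmul x (ys @ [y]))) \<in> lforms AA"
    using assms Cons by (intro lform_foldl) auto
  from lform_swap[OF this, of x y z] show ?case
    using Cons assms by simp
qed

text \<open>Length from which on products of vectors are invisible to all linear forms; it truncates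
  the exponential series. Its existence is witnessed by \<open>Suc (card E)\<close> for a basis
  E.\<close>

definition nilp :: nat where
  "nilp = (LEAST k. \<forall>f\<in>lforms AA. \<forall>x\<in>carrier AA. \<forall>vs. set vs \<subseteq> carrier V \<longrightarrow> length vs = k \<longrightarrow> f (foldl vmul x vs) = 0)"

text \<open>Pigeonhole: the vectors are expanded one after the other in a basis, \<open>es\<close>
  being the part already expanded. More factors than basis vectors force a repetition.\<close>

lemma nilp:
  assumes "f \<in> lforms AA" "x \<in> carrier AA" "set vs \<subseteq> carrier V" "length vs = nilp"
  shows "f (foldl vmul x vs) = 0"
proof -
  obtain E \<epsilon> where E: "finite E" "E \<subseteq> carrier V" and "\<And>e. e \<in> E \<Longrightarrow> \<epsilon> e \<in> lforms V \<inter> extensional (carrier V)"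
    and expand: "\<And>F v. F \<in> lforms V \<Longrightarrow> v \<in> carrier V \<Longrightarrow> F v = (\<Sum>e\<in>E. \<epsilon> e v * F e)"
    by (rule dual_basis) blast
  have "f (foldl vmul x (es @ vs)) = 0"
    if "f \<in> lforms AA" "x \<in> carrier AA" "set vs \<subseteq> carrier V" "set es \<subseteq> E" "length es + length vs > card E" for f x es vs
    using that(3-5)
  proof (induction vs arbitrary: es)
    case Nil
    have "\<not> distinct es"
      using Nil card_mono[OF E(1), of "set es"] distinct_card[of es] by auto
    then obtain xs y ys zs where es: "es = xs @ [y] @ ys @ [y] @ zs" using not_distinct_decomp by blast
    have "set es \<subseteq> carrier V" using Nil E(2) by blast
    then have V: "set xs \<subseteq> carrier V" "y \<in> carrier V" "set ys \<subseteq> carrier V" "set zs \<subseteq> carrier V" by (auto simp: es)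
    have "(\<lambda>x. f (foldl vmul x zs)) \<in> lforms AA" using that(1) V by (intro lform_foldl)
    from lform_repeat[OF this foldl_vmul_closed[OF that(2) V(1)] V(2,3)]
    show ?case by (simp add: es)
  next
    case (Cons v vs)
    have esV: "set es \<subseteq> carrier V" using Cons E(2) by blast
    have "(\<lambda>v. f (foldl vmul (vmul (foldl vmul x es) v) vs)) \<in> lforms V"
      using lform_vec[OF lform_foldl[OF that(1)], of vs "foldl vmul x es"] Cons that(2) esV by simp
    from expand[OF this, of v] have "f (foldl vmul (vmul (foldl vmul x es) v) vs) =
        (\<Sum>e\<in>E. \<epsilon> e v * f (foldl vmul (vmul (foldl vmul x es) e) vs))" using Cons by simp
    also have "\<dots> = 0"
    proof (rule sum.neutral, rule ballI)
      fix e assume "e \<in> E"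
      then have "f (foldl vmul x ((es @ [e]) @ vs)) = 0" using Cons by (intro Cons.IH) auto
      then show "\<epsilon> e v * f (foldl vmul (vmul (foldl vmul x es) e) vs) = 0" by simp
    qed
    finally show ?case by simp
  qed
  from this[of _ _ _ "[]"]
  have "\<forall>f\<in>lforms AA. \<forall>x\<in>carrier AA. \<forall>vs. set vs \<subseteq> carrier V \<longrightarrow> length vs = Suc (card E) \<longrightarrow> f (foldl vmul x vs) = 0"
    by simp
  from LeastI[of "\<lambda>k. \<forall>f\<in>lforms AA. \<forall>x\<in>carrier AA. \<forall>vs. set vs \<subseteq> carrier V \<longrightarrow> length vs = k \<longrightarrow> f (foldl vmul x vs) = 0", OF this]
  show ?thesis using assms unfolding nilp_def[symmetric] by blast
qed

subsection \<open>Further properties of the contractions\<close>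

lemma iota_cls:
  assumes "\<xi> \<in> lforms V" "f \<in> lforms AA" "p \<in> carrier FF"
  shows "iota \<xi> f (Q.cls p) = wsum p (\<lambda>w. iota_word \<xi> f (rev w))"
  unfolding iota_def by (rule lift_form_cls[OF kills_iota[OF assms(1,2)] assms(3)])

lemma lform_lin:
  assumes "f \<in> lforms M" "f' \<in> lforms M"
  shows "(\<lambda>x. f x + f' x) \<in> lforms M" "(\<lambda>x. c * f x) \<in> lforms M" "(\<lambda>x. f x - f' x) \<in> lforms M"
    "(\<lambda>x. - f x) \<in> lforms M" "(\<lambda>x. f x * c) \<in> lforms M"
  using assms by (simp_all add: lforms_iff algebra_simps)

lemma iota_add:
  assumes "\<xi> \<in> lforms V" "f \<in> lforms AA" "f' \<in> lforms AA" "x \<in> carrier AA"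
  shows "iota \<xi> (\<lambda>x. f x + f' x) x = iota \<xi> f x + iota \<xi> f' x"
  using assms by (elim AA_cases) (simp add: iota_cls lform_lin iota_word_add wsum_fun_add)

lemma iota_cmult:
  assumes "\<xi> \<in> lforms V" "f \<in> lforms AA" "x \<in> carrier AA"
  shows "iota \<xi> (\<lambda>x. c * f x) x = c * iota \<xi> f x"
proof -
  have "(\<lambda>x. c * f x) \<in> lforms AA" using assms by (simp add: lforms_iff algebra_simps)
  then show ?thesis
    using assms by (elim AA_cases) (simp add: iota_cls iota_word_cmult wsum_fun_mult)
qed

lemma iota_cong:
  assumes "\<xi> \<in> lforms V" "f \<in> lforms AA" "\<And>x. x \<in> carrier AA \<Longrightarrow> f x = f' x"
    "\<And>v. v \<in> carrier V \<Longrightarrow> \<xi> v = \<xi>' v" "x \<in> carrier AA"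
  shows "iota \<xi> f x = iota \<xi>' f' x"
proof -
  have f': "f' \<in> lforms AA"
    using assms(2) S.smult_closed by (simp add: lforms_iff flip: assms(3))
  have \<xi>': "\<xi>' \<in> lforms V"
    using assms(1) by (simp add: lforms_iff flip: assms(4))
  obtain p where p: "p \<in> carrier FF" "x = Q.cls p" using assms(5) by (rule AA_cases)
  have "wsum p (\<lambda>w. iota_word \<xi> f (rev w)) = wsum p (\<lambda>w. iota_word \<xi>' f' (rev w))"
    by (rule wsum_cong[OF p(1)]) (auto intro!: iota_word_cong assms(3,4))
  then show ?thesis using iota_cls[OF assms(1,2) p(1)] iota_cls[OF \<xi>' f' p(1)] p(2) by simp
qed

lemma iota_g:
  assumes "\<xi> \<in> lforms V" "f \<in> lforms AA" "g \<in> carrier G"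
  shows "iota \<xi> f (\<gamma> g) = 0"
proof -
  have "iota \<xi> f (\<gamma> g) = iota \<xi> f (\<one>\<^bsub>AA\<^esub> \<otimes>\<^bsub>AA\<^esub> \<gamma> g)" using assms by simp
  also have "\<dots> = 0" using assms
    by (subst iota_grp) (simp_all add: iota_one lform_rho lform_rmult)
  finally show ?thesis .
qed

lemma iota_left:
  assumes "\<xi> \<in> lforms V" "f \<in> lforms AA" "x \<in> carrier AA" "g \<in> carrier G"
  shows "iota \<xi> f (\<gamma> g \<otimes>\<^bsub>AA\<^esub> x) = iota \<xi> (\<lambda>x. f (\<gamma> g \<otimes>\<^bsub>AA\<^esub> x)) x"
  using assms(3,2)
proof (induction x arbitrary: f rule: AA_induct)
  case (grp h)
  then show ?case using assms by (simp add: gen_mult iota_g lform_lmult)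
next
  case (vec x v)
  have "iota \<xi> (\<lambda>x. f (x \<otimes>\<^bsub>AA\<^esub> \<eta> v)) (\<gamma> g \<otimes>\<^bsub>AA\<^esub> x) = iota \<xi> (\<lambda>x. f (\<gamma> g \<otimes>\<^bsub>AA\<^esub> x \<otimes>\<^bsub>AA\<^esub> \<eta> v)) x"
    by (rule vec(3)) (use vec lform_rmult in simp)
  also have "\<dots> = iota \<xi> (\<lambda>x. f (\<gamma> g \<otimes>\<^bsub>AA\<^esub> (x \<otimes>\<^bsub>AA\<^esub> \<eta> v))) x"
    by (rule iota_cong) (use vec assms in \<open>simp_all add: S.m_assoc lform_rmult lform_lmult[of "\<lambda>x. f (x \<otimes>\<^bsub>AA\<^esub> \<eta> v)"]\<close>)
  finally have 1: "iota \<xi> f (\<gamma> g \<otimes>\<^bsub>AA\<^esub> x \<otimes>\<^bsub>AA\<^esub> \<eta> v) =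
      \<xi> v * f (\<gamma> g \<otimes>\<^bsub>AA\<^esub> x) - iota \<xi> (\<lambda>x. f (\<gamma> g \<otimes>\<^bsub>AA\<^esub> (x \<otimes>\<^bsub>AA\<^esub> \<eta> v))) x"
    using vec assms by (simp add: iota_vec)
  have 2: "iota \<xi> (\<lambda>x. f (\<gamma> g \<otimes>\<^bsub>AA\<^esub> x)) (x \<otimes>\<^bsub>AA\<^esub> \<eta> v) =
      \<xi> v * f (\<gamma> g \<otimes>\<^bsub>AA\<^esub> x) - iota \<xi> (\<lambda>x. f (\<gamma> g \<otimes>\<^bsub>AA\<^esub> (x \<otimes>\<^bsub>AA\<^esub> \<eta> v))) x"
    by (rule iota_vec) (use vec assms in \<open>simp_all add: lform_lmult\<close>)
  have "\<gamma> g \<otimes>\<^bsub>AA\<^esub> (x \<otimes>\<^bsub>AA\<^esub> \<eta> v) = \<gamma> g \<otimes>\<^bsub>AA\<^esub> x \<otimes>\<^bsub>AA\<^esub> \<eta> v"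
    using vec assms by (simp add: S.m_assoc)
  with 1 2 show ?case by (simp only:)
next
  case (add x y)
  then show ?case using assms
    by (simp add: S.r_distr lforms_add[OF iota_lform] lform_lmult)
next
  case (smult x c)
  then show ?case using assms
    by (simp add: lforms_smult[OF iota_lform] lform_lmult)
qed

end

section \<open>The twisted coproduct\<close>

locale gvtwist = gvdata G V \<rho>
  for G :: "('g, 'n) monoid_scheme" and V :: "(complex, 'v, 'm) module_scheme" and \<rho> :: "'g \<Rightarrow> 'v \<Rightarrow> 'v" +
  fixes u :: 'g and B :: "('v, 'v) tens"
  assumes u_in [simp]: "u \<in> carrier G" and u_central: "\<forall>g\<in>carrier G. u \<otimes>\<^bsub>G\<^esub> g = g \<otimes>\<^bsub>G\<^esub> u"
    and u_ord: "group.ord G u = 2" and u_act: "\<forall>v\<in>carrier V. \<rho> u v = \<ominus>\<^bsub>V\<^esub> v"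
    and B_sym: "B \<in> sym_square V"
begin

lemma u_u [simp]: "u \<otimes>\<^bsub>G\<^esub> u = \<one>\<^bsub>G\<^esub>"
  using GG.pow_ord_eq_1[OF u_in] u_ord by (simp add: numeral_2_eq_2)

lemma u_neq: "u \<noteq> \<one>\<^bsub>G\<^esub>"
  using u_ord GG.ord_eq_1[OF u_in] by auto

lemma inv_u [simp]: "inv\<^bsub>G\<^esub> u = u"
  by (rule GG.inv_equality) simp_all

lemma u_comm: "g \<in> carrier G \<Longrightarrow> g \<otimes>\<^bsub>G\<^esub> u = u \<otimes>\<^bsub>G\<^esub> g"
  using u_central by simp

lemma B_in: "B \<in> carrier (tensor V V)"
  using B_sym by (simp add: sym_square_def)

definition bs :: "('v \<times> 'v) list" where
  "bs = (SOME xs. set xs \<subseteq> carrier V \<times> carrier V \<and> B = list_tensor V V xs)"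

lemma bs: "set bs \<subseteq> carrier V \<times> carrier V" "B = list_tensor V V bs"
proof -
  have "\<exists>xs. set xs \<subseteq> carrier V \<times> carrier V \<and> B = list_tensor V V xs"
    using B_in carrier_tensor[OF VV.module_axioms, of V] by auto
  from someI_ex[OF this] show "set bs \<subseteq> carrier V \<times> carrier V" "B = list_tensor V V bs"
    unfolding bs_def by blast+
qed

section \<open>Linear operators on bilinear forms\<close>

definition eqf :: "(('g, 'v) gv \<Rightarrow> ('g, 'v) gv \<Rightarrow> complex) \<Rightarrow> (('g, 'v) gv \<Rightarrow> ('g, 'v) gv \<Rightarrow> complex) \<Rightarrow> bool"
    (infix "\<approx>" 50) where
  "\<beta> \<approx> \<beta>' \<longleftrightarrow> (\<forall>a\<in>carrier AA. \<forall>b\<in>carrier AA. \<beta> a b = \<beta>' a b)"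

lemma eqfI: "(\<And>a b. a \<in> carrier AA \<Longrightarrow> b \<in> carrier AA \<Longrightarrow> \<beta> a b = \<beta>' a b) \<Longrightarrow> \<beta> \<approx> \<beta>'"
  and eqfD: "\<beta> \<approx> \<beta>' \<Longrightarrow> a \<in> carrier AA \<Longrightarrow> b \<in> carrier AA \<Longrightarrow> \<beta> a b = \<beta>' a b"
  by (auto simp: eqf_def)

lemma eqf_refl: "\<beta> \<approx> \<beta>"
  and eqf_sym: "\<beta> \<approx> \<beta>' \<Longrightarrow> \<beta>' \<approx> \<beta>"
  and eqf_trans [trans]: "\<beta> \<approx> \<beta>' \<Longrightarrow> \<beta>' \<approx> \<beta>'' \<Longrightarrow> \<beta> \<approx> \<beta>''"
  by (simp_all add: eqf_def)

lemma eqf_bilin: "\<beta> \<approx> \<beta>' \<Longrightarrow> \<beta> \<in> Bil \<Longrightarrow> \<beta>' \<in> Bil"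
  using bilin_cong[OF _ S.module_A S.module_A, of \<beta> \<beta>'] by (simp add: eqf_def)

text \<open>All transposed multiplications are of this kind. Linearity lets them pass through the
  exponential series, and respecting agreement on the carriers allows rewriting below them.\<close>

definition fop where
  "fop K \<longleftrightarrow> (\<forall>\<beta>\<in>Bil. K \<beta> \<in> Bil) \<and> (\<forall>\<beta> \<beta>'. \<beta> \<in> Bil \<longrightarrow> \<beta> \<approx> \<beta>' \<longrightarrow> K \<beta> \<approx> K \<beta>') \<and>
    (\<forall>\<beta>\<in>Bil. \<forall>\<beta>'\<in>Bil. K (\<lambda>a b. \<beta> a b + \<beta>' a b) \<approx> (\<lambda>a b. K \<beta> a b + K \<beta>' a b)) \<and>
    (\<forall>\<beta>\<in>Bil. \<forall>c. K (\<lambda>a b. c * \<beta> a b) \<approx> (\<lambda>a b. c * K \<beta> a b))"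

lemma fopD:
  assumes "fop K" "\<beta> \<in> Bil"
  shows "K \<beta> \<in> Bil" "\<beta> \<approx> \<beta>' \<Longrightarrow> K \<beta> \<approx> K \<beta>'"
    "\<beta>' \<in> Bil \<Longrightarrow> K (\<lambda>a b. \<beta> a b + \<beta>' a b) \<approx> (\<lambda>a b. K \<beta> a b + K \<beta>' a b)"
    "K (\<lambda>a b. c * \<beta> a b) \<approx> (\<lambda>a b. c * K \<beta> a b)"
  using assms unfolding fop_def by blast+

lemma fopI:
  assumes "\<And>\<beta>. \<beta> \<in> Bil \<Longrightarrow> K \<beta> \<in> Bil"
    "\<And>\<beta> \<beta>' a b. \<beta> \<in> Bil \<Longrightarrow> \<beta> \<approx> \<beta>' \<Longrightarrow> a \<in> carrier AA \<Longrightarrow> b \<in> carrier AA \<Longrightarrow> K \<beta> a b = K \<beta>' a b"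
    "\<And>\<beta> \<beta>' a b. \<beta> \<in> Bil \<Longrightarrow> \<beta>' \<in> Bil \<Longrightarrow> a \<in> carrier AA \<Longrightarrow> b \<in> carrier AA \<Longrightarrow>
      K (\<lambda>a b. \<beta> a b + \<beta>' a b) a b = K \<beta> a b + K \<beta>' a b"
    "\<And>\<beta> c a b. \<beta> \<in> Bil \<Longrightarrow> a \<in> carrier AA \<Longrightarrow> b \<in> carrier AA \<Longrightarrow> K (\<lambda>a b. c * \<beta> a b) a b = c * K \<beta> a b"
  shows "fop K"
  unfolding fop_def using assms by (auto simp: eqf_def)

lemma fop_sum:
  assumes K: "fop K" and "finite S" and \<Phi>: "\<And>k. k \<in> S \<Longrightarrow> \<Phi> k \<in> Bil"
  shows "K (\<lambda>a b. \<Sum>k\<in>S. c k * \<Phi> k a b) \<approx> (\<lambda>a b. \<Sum>k\<in>S. c k * K (\<Phi> k) a b)"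
  using assms(2,3)
proof (induction S rule: finite_induct)
  case empty
  have "K (\<lambda>a b. 0 * (\<lambda>a b. 0) a b) \<approx> (\<lambda>a b. 0 * K (\<lambda>a b. 0) a b)"
    using fopD(4)[OF K S.bilin_0] .
  then show ?case by simp
next
  case (insert k S)
  have b1: "(\<lambda>a b. c k * \<Phi> k a b) \<in> Bil" using insert by (simp add: S.bilin_cmult)
  have b2: "(\<lambda>a b. \<Sum>k\<in>S. c k * \<Phi> k a b) \<in> Bil" using insert by (intro S.bilin_sum S.bilin_cmult) simp
  show ?case
    using fopD(3)[OF K b1 b2] fopD(4)[OF K, of "\<Phi> k" "c k"] insert by (simp add: eqf_def)
qed

lemma fop_comp: "fop K \<Longrightarrow> fop L \<Longrightarrow> fop (\<lambda>\<beta>. K (L \<beta>))"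
proof -
  assume K: "fop K" and L: "fop L"
  show ?thesis unfolding fop_def
  proof (intro conjI ballI allI impI)
    fix \<beta> assume \<beta>: "\<beta> \<in> Bil"
    show "K (L \<beta>) \<in> Bil" by (intro fopD(1)[OF K] fopD(1)[OF L] \<beta>)
    show "K (L \<beta>) \<approx> K (L \<beta>')" if "\<beta> \<approx> \<beta>'" for \<beta>'
      by (intro fopD(2)[OF K] fopD(2)[OF L] fopD(1)[OF L] \<beta> that)
    show "K (L (\<lambda>a b. \<beta> a b + \<beta>' a b)) \<approx> (\<lambda>a b. K (L \<beta>) a b + K (L \<beta>') a b)" if \<beta>': "\<beta>' \<in> Bil" for \<beta>'
      by (rule eqf_trans[OF fopD(2)[OF K _ fopD(3)[OF L \<beta> \<beta>']] fopD(3)[OF K]])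
        (intro fopD(1)[OF L] \<beta> \<beta>' S.bilin_add)+
    show "K (L (\<lambda>a b. c * \<beta> a b)) \<approx> (\<lambda>a b. c * K (L \<beta>) a b)" for c
      by (rule eqf_trans[OF fopD(2)[OF K _ fopD(4)[OF L \<beta>]] fopD(4)[OF K]])
        (intro fopD(1)[OF L] \<beta> S.bilin_cmult)+
  qed
qed

lemma fop_Op: "x \<in> XX \<Longrightarrow> fop (Op x)"
proof (rule fopI)
  assume x: "x \<in> XX"
  fix \<beta> assume \<beta>: "\<beta> \<in> Bil"
  show "Op x \<beta> \<in> Bil" using x \<beta> by (rule Op_bilin)
  fix a b assume ab: "a \<in> carrier AA" "b \<in> carrier AA"
  show "Op x \<beta> a b = Op x \<beta>' a b" if "\<beta> \<approx> \<beta>'" for \<beta>'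
    by (rule Op_cong[OF x _ ab]) (rule eqfD[OF that])
  show "Op x (\<lambda>a b. \<beta> a b + \<beta>' a b) a b = Op x \<beta> a b + Op x \<beta>' a b" for \<beta>'
    by (cases x) simp_all
  show "Op x (\<lambda>a b. c * \<beta> a b) a b = c * Op x \<beta> a b" for c
    by (cases x) (simp_all add: distrib_left)
qed

lemma fop_bact:
  assumes t: "t \<in> carrier TT"
  shows "fop (S.bact t)"
proof (rule fopI)
  have t': "t \<in> carrier (tensor AA AA)" using t by (simp add: S.TT_simps(1))
  fix \<beta> assume \<beta>: "\<beta> \<in> Bil"
  show "S.bact t \<beta> \<in> Bil" by (rule S.bact_bilin[OF t' \<beta>])
  fix a b assume ab: "a \<in> carrier AA" "b \<in> carrier AA"
  show "S.bact t \<beta> a b = S.bact t \<beta>' a b" if "\<beta> \<approx> \<beta>'" for \<beta>'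
    unfolding S.bact_def
    by (rule S.tensor_congA[OF t']) (use ab \<beta> eqf_bilin[OF that \<beta>] that in \<open>simp add: S.mform_eq eqf_def\<close>)
  show "S.bact t (\<lambda>a b. \<beta> a b + \<beta>' a b) a b = S.bact t \<beta> a b + S.bact t \<beta>' a b" if \<beta>': "\<beta>' \<in> Bil" for \<beta>'
  proof -
    have "S.bact t (\<lambda>a b. \<beta> a b + \<beta>' a b) a b = t (\<lambda>c d. S.mform \<beta> a b c d + S.mform \<beta>' a b c d)"
      unfolding S.bact_def
      by (rule S.tensor_congA[OF t']) (use ab \<beta> \<beta>' in \<open>simp add: S.mform_eq S.bilin_add\<close>)
    then show ?thesis using S.tensor_form_add[OF t' S.mform_bilin2[OF \<beta> ab] S.mform_bilin2[OF \<beta>' ab]]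
      by (simp add: S.bact_def)
  qed
  show "S.bact t (\<lambda>a b. c * \<beta> a b) a b = c * S.bact t \<beta> a b" for c
  proof -
    have "S.bact t (\<lambda>a b. c * \<beta> a b) a b = t (\<lambda>c' d. c * S.mform \<beta> a b c' d)"
      unfolding S.bact_def
      by (rule S.tensor_congA[OF t']) (use ab \<beta> in \<open>simp add: S.mform_eq S.bilin_cmult distrib_left\<close>)
    then show ?thesis using S.tensor_form_cmult[OF t' S.mform_bilin2[OF \<beta> ab]]
      by (simp add: S.bact_def)
  qed
qed

subsection \<open>The exponential of \<open>B\<close>\<close>

text \<open>Transposed right multiplication by B, since (a \<otimes> b)(v \<otimes> w) = a v
  \<otimes> \<sigma>(b) w.\<close>

definition XB :: "(('g, 'v) gv \<Rightarrow> ('g, 'v) gv \<Rightarrow> complex) \<Rightarrow> ('g, 'v) gv \<Rightarrow> ('g, 'v) gv \<Rightarrow> complex" where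
  "XB \<beta> = (\<lambda>a b. \<Sum>z\<leftarrow>bs. \<beta> (a \<otimes>\<^bsub>AA\<^esub> \<eta> (fst z)) (S.sgm b \<otimes>\<^bsub>AA\<^esub> \<eta> (snd z)))"

lemma bs_in: "z \<in> set bs \<Longrightarrow> fst z \<in> carrier V \<and> snd z \<in> carrier V"
  using bs(1) by auto

lemma bs_cong: "(\<And>z. z \<in> set bs \<Longrightarrow> f z = g z) \<Longrightarrow> (\<Sum>z\<leftarrow>bs. f z) = (\<Sum>z\<leftarrow>bs. g z)" for f g :: "'v \<times> 'v \<Rightarrow> complex"
  by (simp cong: map_cong)

lemma fop_XB: "fop XB"
proof (rule fopI)
  fix \<beta> assume \<beta>: "\<beta> \<in> Bil"
  show "XB \<beta> \<in> Bil" unfolding XB_def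
    by (rule S.bilin_sum_list)
      (use \<beta> bs_in in \<open>simp add: bilin_iff S.l_distr S.sgm_add S.sgm_smult\<close>)
  fix a b assume ab: "a \<in> carrier AA" "b \<in> carrier AA"
  show "XB \<beta> a b = XB \<beta>' a b" if "\<beta> \<approx> \<beta>'" for \<beta>'
    unfolding XB_def by (rule bs_cong) (use that ab bs_in in \<open>simp add: eqf_def\<close>)
  show "XB (\<lambda>a b. \<beta> a b + \<beta>' a b) a b = XB \<beta> a b + XB \<beta>' a b" for \<beta>'
    by (simp add: XB_def sum_list_addf)
  show "XB (\<lambda>a b. c * \<beta> a b) a b = c * XB \<beta> a b" for c
    by (simp add: XB_def sum_list_const_mult)
qed

lemma fop_XBk: "fop (XB ^^ k)"
proof (induction k)
  case 0
  show ?case by (rule fopI) (simp_all add: eqf_def)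
next
  case (Suc k)
  then show ?case using fop_comp[OF fop_XB Suc] by (simp add: o_def)
qed

lemma XBk_zero:
  assumes "\<beta> \<in> Bil" "k \<ge> nilp" "a \<in> carrier AA" "b \<in> carrier AA"
  shows "(XB ^^ k) \<beta> a b = 0"
proof -
  \<comment> \<open>Each application of \<open>XB\<close> appends a vector to the first argument.
    \<open>vs\<close> collects these vectors, and once there are \<open>nilp\<close> of them the
    form vanishes.\<close>
  have van: "(XB ^^ k) \<beta> (foldl vmul a vs) b = 0"
    if "\<beta> \<in> Bil" "a \<in> carrier AA" "b \<in> carrier AA" "set vs \<subseteq> carrier V" "length vs + k = nilp" for \<beta> k a b vs
    using that(2-5)
  proof (induction k arbitrary: vs b)
    case 0
    then show ?case using nilp[OF bilin_lform1[OF \<open>\<beta> \<in> Bil\<close>], of b a vs] by simp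
  next
    case (Suc k)
    have "(XB ^^ k) \<beta> (foldl vmul a (vs @ [fst z])) (S.sgm b \<otimes>\<^bsub>AA\<^esub> \<eta> (snd z)) = 0" if "z \<in> set bs" for z
      using Suc bs_in[OF that] by (intro Suc.IH) simp_all
    then have "(\<Sum>z\<leftarrow>bs. (XB ^^ k) \<beta> (foldl vmul a (vs @ [fst z])) (S.sgm b \<otimes>\<^bsub>AA\<^esub> \<eta> (snd z))) = (\<Sum>z\<leftarrow>bs. 0)"
      by (intro bs_cong)
    then show ?case by (simp add: XB_def[of "(XB ^^ k) \<beta>"])
  qed
  have "(XB ^^ k) \<beta> = (XB ^^ nilp) ((XB ^^ (k - nilp)) \<beta>)"
    using funpow_add[of nilp "k - nilp" XB] assms(2) by simp
  then show ?thesis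
    using van[OF fopD(1)[OF fop_XBk[of "k - nilp"] assms(1)] assms(3,4), of "[]" nilp] by simp
qed

text \<open>Transposed right multiplication by exp(c B). The summand for \<open>k = nilp\<close> is
  zero by \<open>XBk_zero\<close>; with it present, the summand for \<open>k = 0\<close> can always
  be split off.\<close>

definition eX :: "complex \<Rightarrow> (('g, 'v) gv \<Rightarrow> ('g, 'v) gv \<Rightarrow> complex) \<Rightarrow> ('g, 'v) gv \<Rightarrow> ('g, 'v) gv \<Rightarrow> complex" where
  "eX c \<beta> = (\<lambda>a b. \<Sum>k\<le>nilp. c ^ k / fact k * (XB ^^ k) \<beta> a b)"

lemma eX_bilin [simp]: "\<beta> \<in> Bil \<Longrightarrow> eX c \<beta> \<in> Bil"
  unfolding eX_def by (intro S.bilin_sum S.bilin_cmult fopD(1)[OF fop_XBk])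

lemma eX_cong: "\<beta> \<in> Bil \<Longrightarrow> \<beta> \<approx> \<beta>' \<Longrightarrow> eX c \<beta> \<approx> eX c \<beta>'"
  using fopD(2)[OF fop_XBk, of \<beta> \<beta>'] by (simp add: eX_def eqf_def)

lemma fop_eX: "fop (eX c)"
proof (rule fopI)
  fix \<beta> assume \<beta>: "\<beta> \<in> Bil"
  show "eX c \<beta> \<in> Bil" using \<beta> by simp
  fix a b assume ab: "a \<in> carrier AA" "b \<in> carrier AA"
  show "eX c \<beta> a b = eX c \<beta>' a b" if "\<beta> \<approx> \<beta>'" for \<beta>'
    using eqfD[OF eX_cong[OF \<beta> that] ab] .
  show "eX c (\<lambda>a b. \<beta> a b + \<beta>' a b) a b = eX c \<beta> a b + eX c \<beta>' a b" if "\<beta>' \<in> Bil" for \<beta>'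
    using eqfD[OF fopD(3)[OF fop_XBk \<beta> that] ab] by (simp add: eX_def sum.distrib distrib_left add_divide_distrib)
  show "eX c (\<lambda>a b. d * \<beta> a b) a b = d * eX c \<beta> a b" for d
    using eqfD[OF fopD(4)[OF fop_XBk \<beta>] ab] by (simp add: eX_def sum_distrib_left algebra_simps)
qed

lemma XBk_commute:
  assumes K: "fop K" and comm: "\<And>\<beta>. \<beta> \<in> Bil \<Longrightarrow> K (XB \<beta>) \<approx> XB (K \<beta>)" and \<beta>: "\<beta> \<in> Bil"
  shows "K ((XB ^^ k) \<beta>) \<approx> (XB ^^ k) (K \<beta>)"
proof (induction k)
  case 0
  then show ?case by (simp add: eqf_refl)
next
  case (Suc k)
  have b: "(XB ^^ k) \<beta> \<in> Bil" "K ((XB ^^ k) \<beta>) \<in> Bil" by (intro fopD(1)[OF fop_XBk] fopD(1)[OF K] \<beta>)+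
  have "K ((XB ^^ Suc k) \<beta>) \<approx> XB (K ((XB ^^ k) \<beta>))" using comm[OF b(1)] by simp
  also have "XB (K ((XB ^^ k) \<beta>)) \<approx> XB ((XB ^^ k) (K \<beta>))" by (rule fopD(2)[OF fop_XB b(2) Suc])
  finally show ?case by simp
qed

lemma eX_commute:
  assumes K: "fop K" and comm: "\<And>\<beta>. \<beta> \<in> Bil \<Longrightarrow> K (XB \<beta>) \<approx> XB (K \<beta>)" and \<beta>: "\<beta> \<in> Bil"
  shows "K (eX c \<beta>) \<approx> eX c (K \<beta>)"
proof -
  have "K (eX c \<beta>) \<approx> (\<lambda>a b. \<Sum>k\<le>nilp. c ^ k / fact k * K ((XB ^^ k) \<beta>) a b)"
    unfolding eX_def by (rule fop_sum[OF K]) (auto intro: fopD(1)[OF fop_XBk] \<beta>)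
  also have "(\<lambda>a b. \<Sum>k\<le>nilp. c ^ k / fact k * K ((XB ^^ k) \<beta>) a b) \<approx> eX c (K \<beta>)"
    using XBk_commute[OF K comm \<beta>] by (simp add: eX_def eqf_def)
  finally show ?thesis .
qed

lemma exp_conv: "(\<Sum>i\<le>m. (c ^ i / fact i) * (d ^ (m - i) / fact (m - i))) = (c + d) ^ m / fact m" for c d :: complex
  using exp_series_add_commuting[of c d m] by (simp add: scaleR_conv_of_real field_simps)

lemma eX_eX:
  assumes \<beta>: "\<beta> \<in> Bil"
  shows "eX c (eX (- c) \<beta>) \<approx> \<beta>"
proof (rule eqfI)
  fix a b assume ab: "a \<in> carrier AA" "b \<in> carrier AA"
  define Y where "Y m = (XB ^^ m) \<beta> a b" for m
  have Y0: "Y m = 0" if "m \<ge> nilp" for m using XBk_zero[OF \<beta> that ab] by (simp add: Y_def)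
  have Y1: "Y m \<noteq> 0 \<Longrightarrow> m < Suc nilp" for m using Y0[of m] by linarith
  have "(XB ^^ j) (eX (- c) \<beta>) a b = (\<Sum>k\<le>nilp. (- c) ^ k / fact k * Y (j + k))" for j
  proof -
    have "(XB ^^ j) (eX (- c) \<beta>) \<approx> (\<lambda>a b. \<Sum>k\<le>nilp. (- c) ^ k / fact k * (XB ^^ j) ((XB ^^ k) \<beta>) a b)"
      unfolding eX_def by (rule fop_sum[OF fop_XBk]) (auto intro: fopD(1)[OF fop_XBk] \<beta>)
    then show ?thesis using ab by (simp add: eqf_def Y_def funpow_add)
  qed
  then have "eX c (eX (- c) \<beta>) a b = (\<Sum>j\<le>nilp. \<Sum>k\<le>nilp. (c ^ j / fact j) * ((- c) ^ k / fact k) * Y (j + k))"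
    by (simp only: eX_def[of c] sum_distrib_left mult.assoc)
  also have "\<dots> = (\<Sum>(j, k)\<in>{..nilp} \<times> {..nilp}. (c ^ j / fact j) * ((- c) ^ k / fact k) * Y (j + k))"
    by (simp add: sum.cartesian_product)
  \<comment> \<open>Terms of total degree above \<open>nilp\<close> vanish, so the square of indices
    shrinks to a triangle, on which the exponential law applies degree by degree.\<close>
  also have "\<dots> = (\<Sum>(j, k)\<in>{(i, j). i + j < Suc nilp}. (c ^ j / fact j) * ((- c) ^ k / fact k) * Y (j + k))"
    by (rule sum.mono_neutral_right) (auto dest: Y1)
  also have "\<dots> = (\<Sum>m<Suc nilp. \<Sum>i\<le>m. (c ^ i / fact i) * ((- c) ^ (m - i) / fact (m - i)) * Y (i + (m - i)))"
    by (rule sum.triangle_reindex)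
  also have "\<dots> = (\<Sum>m<Suc nilp. (0 ^ m / fact m) * Y m)"
  proof (rule sum.cong[OF refl])
    fix m
    have "(\<Sum>i\<le>m. (c ^ i / fact i) * ((- c) ^ (m - i) / fact (m - i)) * Y (i + (m - i))) =
        (\<Sum>i\<le>m. (c ^ i / fact i) * ((- c) ^ (m - i) / fact (m - i))) * Y m"
      by (simp add: sum_distrib_right)
    then show "(\<Sum>i\<le>m. (c ^ i / fact i) * ((- c) ^ (m - i) / fact (m - i)) * Y (i + (m - i))) = (0 ^ m / fact m) * Y m"
      unfolding exp_conv by simp
  qed
  also have "\<dots> = Y 0"
    by (simp only: sum.lessThan_Suc_shift) simp
  finally show "eX c (eX (- c) \<beta>) a b = \<beta> a b" by (simp add: Y_def)
qed

section \<open>The tensors B and J and their right multiplications\<close>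

abbreviation "BT \<equiv> gv_tensor G V \<rho> B"

lemma bilin_VV: "\<beta> \<in> Bil \<Longrightarrow> (\<lambda>v w. \<beta> (\<eta> v) (\<eta> w)) \<in> bilin V V"
  by (simp add: bilin_iff gen_add gen_smult)

lemma BT_eq: "BT = list_tensor AA AA (map (\<lambda>z. (\<eta> (fst z), \<eta> (snd z))) bs)"
proof -
  have "B (\<lambda>v w. \<beta> (\<eta> v) (\<eta> w)) = (\<Sum>(v, w)\<leftarrow>bs. \<beta> (\<eta> v) (\<eta> w))" if "\<beta> \<in> Bil" for \<beta>
    using list_tensor_apply[OF bilin_VV[OF that], of bs] fun_cong[OF bs(2)] by (rule trans[rotated])
  then show ?thesis
    by (auto simp: gv_tensor_def Let_def bilin_HH list_tensor_def fun_eq_iff case_prod_unfold o_def)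
qed

lemma BT_closed [simp]: "BT \<in> carrier TT"
  unfolding BT_eq S.TT_simps(1) by (rule S.list_tensor_in) (use bs_in in auto)

lemma bact_BT: "\<beta> \<in> Bil \<Longrightarrow> S.bact BT \<beta> \<approx> XB \<beta>"
proof (rule eqfI)
  fix a b assume \<beta>: "\<beta> \<in> Bil" and ab: "a \<in> carrier AA" "b \<in> carrier AA"
  have "S.bact BT \<beta> a b = (\<Sum>z\<leftarrow>bs. S.mform \<beta> a b (\<eta> (fst z)) (\<eta> (snd z)))"
    unfolding BT_eq S.bact_def using list_tensor_apply[OF S.mform_bilin2[OF \<beta> ab]]
    by (simp add: o_def)
  also have "\<dots> = XB \<beta> a b"
    unfolding XB_def
    by (rule bs_cong) (use \<beta> ab bs_in in \<open>simp add: S.mform_eq S.bilin_zero1\<close>)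
  finally show "S.bact BT \<beta> a b = XB \<beta> a b" .
qed

lemma BT_pow_closed [simp]: "BT [^]\<^bsub>TT\<^esub> (k :: nat) \<in> carrier TT"
  by (rule monoid.nat_pow_closed[OF S.monoid_TT BT_closed])

lemma bact_BT_pow: "\<beta> \<in> Bil \<Longrightarrow> S.bact (BT [^]\<^bsub>TT\<^esub> (k :: nat)) \<beta> \<approx> (XB ^^ k) \<beta>"
proof (induction k arbitrary: \<beta>)
  case 0
  then show ?case by (simp add: monoid.nat_pow_0[OF S.monoid_TT] eqf_def S.bact_one)
next
  case (Suc k)
  have "S.bact (BT [^]\<^bsub>TT\<^esub> Suc k) \<beta> \<approx> S.bact (BT [^]\<^bsub>TT\<^esub> k) (S.bact BT \<beta>)"
    using S.bact_mult[OF BT_pow_closed BT_closed Suc(2)]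
    by (simp add: monoid.nat_pow_Suc[OF S.monoid_TT] eqf_def)
  also have "\<dots> \<approx> S.bact (BT [^]\<^bsub>TT\<^esub> k) (XB \<beta>)"
    by (rule fopD(2)[OF fop_bact[OF BT_pow_closed] fopD(1)[OF fop_bact[OF BT_closed] Suc(2)] bact_BT[OF Suc(2)]])
  also have "\<dots> \<approx> (XB ^^ k) (XB \<beta>)"
    by (rule Suc.IH[OF fopD(1)[OF fop_XB Suc(2)]])
  finally show ?case by (simp add: funpow_swap1)
qed

definition JJ :: "complex \<Rightarrow> (('g, 'v) gv, ('g, 'v) gv) tens" where
  "JJ c = finsum TT (\<lambda>k. (c ^ k / fact k) \<odot>\<^bsub>TT\<^esub> (BT [^]\<^bsub>TT\<^esub> k)) {..nilp}"

lemma smult_TT_closed: "t \<in> carrier TT \<Longrightarrow> c \<odot>\<^bsub>TT\<^esub> t \<in> carrier TT"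
  using Module.module.smult_closed[OF S.module_TT, of c t] by simp

lemma JJ_closed [simp]: "JJ c \<in> carrier TT"
proof -
  interpret T: module CC TT by (rule S.module_TT)
  show ?thesis unfolding JJ_def
    by (rule T.finsum_closed) (simp add: smult_TT_closed)
qed

lemma BT_pow_apply: "\<beta> \<in> Bil \<Longrightarrow> (BT [^]\<^bsub>TT\<^esub> (k :: nat)) \<beta> = (XB ^^ k) \<beta> \<one>\<^bsub>AA\<^esub> \<one>\<^bsub>AA\<^esub>"
  using S.bact_one_one[OF BT_pow_closed, of \<beta> k] eqfD[OF bact_BT_pow, of \<beta> "\<one>\<^bsub>AA\<^esub>" "\<one>\<^bsub>AA\<^esub>" k] by simp

lemma JJ_apply: "\<beta> \<in> Bil \<Longrightarrow> JJ c \<beta> = eX c \<beta> \<one>\<^bsub>AA\<^esub> \<one>\<^bsub>AA\<^esub>"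
  unfolding JJ_def by (subst S.TT_finsum_apply)
    (simp_all add: smult_TT_closed S.TT_smult_apply BT_pow_apply eX_def)

lemma bact_JJ:
  assumes \<beta>: "\<beta> \<in> Bil"
  shows "S.bact (JJ c) \<beta> \<approx> eX c \<beta>"
proof (rule eqfI)
  fix a b assume ab: "a \<in> carrier AA" "b \<in> carrier AA"
  have m: "(\<lambda>x y. S.mform \<beta> a b x y) \<in> Bil" by (rule S.mform_bilin2[OF \<beta> ab])
  have "S.bact (JJ c) \<beta> a b = (\<Sum>k\<le>nilp. c ^ k / fact k * S.bact (BT [^]\<^bsub>TT\<^esub> k) \<beta> a b)"
    unfolding S.bact_def JJ_def using m
    by (subst S.TT_finsum_apply) (simp_all add: smult_TT_closed S.TT_smult_apply)
  also have "\<dots> = eX c \<beta> a b"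
    using eqfD[OF bact_BT_pow[OF \<beta>] ab] by (simp add: eX_def)
  finally show "S.bact (JJ c) \<beta> a b = eX c \<beta> a b" .
qed

lemma JJ_inverse: "JJ c \<otimes>\<^bsub>TT\<^esub> JJ (- c) = \<one>\<^bsub>TT\<^esub>"
proof (rule S.TT_ext)
  fix \<beta> assume \<beta>: "\<beta> \<in> Bil"
  have b: "S.bact (JJ (- c)) \<beta> \<in> Bil" by (rule fopD(1)[OF fop_bact[OF JJ_closed] \<beta>])
  have "(JJ c \<otimes>\<^bsub>TT\<^esub> JJ (- c)) \<beta> = eX c (S.bact (JJ (- c)) \<beta>) \<one>\<^bsub>AA\<^esub> \<one>\<^bsub>AA\<^esub>"
    using S.TT_mult_apply[OF JJ_closed JJ_closed \<beta>] JJ_apply[OF b] by simp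
  also have "\<dots> = eX c (eX (- c) \<beta>) \<one>\<^bsub>AA\<^esub> \<one>\<^bsub>AA\<^esub>"
    by (rule eqfD[OF eX_cong[OF b bact_JJ[OF \<beta>]]]) simp_all
  also have "\<dots> = \<beta> \<one>\<^bsub>AA\<^esub> \<one>\<^bsub>AA\<^esub>" by (rule eqfD[OF eX_eX[OF \<beta>]]) simp_all
  also have "\<dots> = \<one>\<^bsub>TT\<^esub> \<beta>" using \<beta> by (simp add: S.TT_simps pure_tensor_apply)
  finally show "(JJ c \<otimes>\<^bsub>TT\<^esub> JJ (- c)) \<beta> = \<one>\<^bsub>TT\<^esub> \<beta>" .
qed simp_all

lemma inv_JJ: "inv\<^bsub>TT\<^esub> (JJ 1) = JJ (- 1)"
  using JJ_inverse[of 1] JJ_inverse[of "- 1"]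
  by (intro monoid.inv_char[OF S.monoid_TT]) simp_all

text \<open>Nonzero powers of B have exponents below \<open>nilp\<close>, and the additional terms
  of the truncated series are zero.\<close>

lemma nil_exp_BT: "nil_exp TT BT = JJ 1"
proof (rule S.TT_ext)
  interpret T: module CC TT by (rule S.module_TT)
  let ?S = "{k::nat. BT [^]\<^bsub>TT\<^esub> k \<noteq> \<zero>\<^bsub>TT\<^esub>}"
  have "BT [^]\<^bsub>TT\<^esub> k = \<zero>\<^bsub>TT\<^esub>" if "k \<ge> nilp" for k
    by (rule S.TT_ext) (simp_all add: BT_pow_apply S.TT_zero_apply XBk_zero[OF _ that])
  then have sub: "?S \<subseteq> {..nilp}" by (force simp: not_le[symmetric])
  have fin: "finite ?S" by (rule finite_subset[OF sub]) simp
  have ex: "nil_exp TT BT = finsum TT (\<lambda>k. (1 / fact k) \<odot>\<^bsub>TT\<^esub> (BT [^]\<^bsub>TT\<^esub> k)) ?S"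
    by (simp add: nil_exp_def)
  show "nil_exp TT BT \<in> carrier TT"
    unfolding ex by (rule T.finsum_closed) (simp add: smult_TT_closed)
  fix \<beta> assume \<beta>: "\<beta> \<in> Bil"
  have "nil_exp TT BT \<beta> = (\<Sum>k\<in>?S. 1 / fact k * (BT [^]\<^bsub>TT\<^esub> k) \<beta>)"
    unfolding ex using \<beta> fin by (subst S.TT_finsum_apply) (simp_all add: smult_TT_closed S.TT_smult_apply)
  also have "\<dots> = (\<Sum>k\<le>nilp. 1 / fact k * (BT [^]\<^bsub>TT\<^esub> k) \<beta>)"
    by (rule sum.mono_neutral_left) (use sub \<beta> in \<open>auto simp: S.TT_zero_apply\<close>)
  also have "\<dots> = JJ 1 \<beta>"
    using \<beta> by (simp add: JJ_apply eX_def BT_pow_apply)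
  finally show "nil_exp TT BT \<beta> = JJ 1 \<beta>" .
qed simp

end

context gvtwist
begin

subsection \<open>Evaluation of the twisted coproduct\<close>

text \<open>The value at \<beta> of J^{-1} \<Delta>(x) J; the rightmost factor is the innermost
  operator.\<close>

definition DJ :: "('g, 'v) gv \<Rightarrow> (('g, 'v) gv \<Rightarrow> ('g, 'v) gv \<Rightarrow> complex) \<Rightarrow> complex" where
  "DJ x \<beta> = eX (- 1) (S.bact (scomult HH x) (eX 1 \<beta>)) \<one>\<^bsub>AA\<^esub> \<one>\<^bsub>AA\<^esub>"

lemma fop_DJ: "x \<in> carrier AA \<Longrightarrow> fop (\<lambda>\<beta>. eX (- 1) (S.bact (scomult HH x) (eX 1 \<beta>)))"
  by (intro fop_comp[OF fop_eX] fop_comp[OF fop_bact fop_eX]) simp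

lemma DJ_cong: "x \<in> carrier AA \<Longrightarrow> \<beta> \<in> Bil \<Longrightarrow> \<beta> \<approx> \<beta>' \<Longrightarrow> DJ x \<beta> = DJ x \<beta>'"
  unfolding DJ_def by (rule eqfD[OF fopD(2)[OF fop_DJ]]) simp_all

lemma DJ_add: "x \<in> carrier AA \<Longrightarrow> \<beta> \<in> Bil \<Longrightarrow> \<beta>' \<in> Bil \<Longrightarrow> DJ x (\<lambda>a b. \<beta> a b + \<beta>' a b) = DJ x \<beta> + DJ x \<beta>'"
  unfolding DJ_def by (rule eqfD[OF fopD(3)[OF fop_DJ]]) simp_all

lemma DJ_cmult: "x \<in> carrier AA \<Longrightarrow> \<beta> \<in> Bil \<Longrightarrow> DJ x (\<lambda>a b. c * \<beta> a b) = c * DJ x \<beta>"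
  unfolding DJ_def by (rule eqfD[OF fopD(4)[OF fop_DJ]]) simp_all

lemma DJ_diff: "x \<in> carrier AA \<Longrightarrow> \<beta> \<in> Bil \<Longrightarrow> \<beta>' \<in> Bil \<Longrightarrow> DJ x (\<lambda>a b. \<beta> a b - \<beta>' a b) = DJ x \<beta> - DJ x \<beta>'"
  using DJ_add[of x \<beta> "\<lambda>a b. - 1 * \<beta>' a b"] DJ_cmult[of x \<beta>' "- 1"] S.bilin_cmult[of \<beta>' "- 1"] by simp

lemma bact_scomult_bilin [simp]: "x \<in> carrier AA \<Longrightarrow> \<beta> \<in> Bil \<Longrightarrow> S.bact (scomult HH x) \<beta> \<in> Bil"
  by (rule fopD(1)[OF fop_bact]) simp_all

lemma DJ_x_add:
  assumes "x \<in> carrier AA" "y \<in> carrier AA" "\<beta> \<in> Bil"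
  shows "DJ (x \<oplus>\<^bsub>AA\<^esub> y) \<beta> = DJ x \<beta> + DJ y \<beta>"
proof -
  have "S.bact (scomult HH (x \<oplus>\<^bsub>AA\<^esub> y)) (eX 1 \<beta>) \<approx>
      (\<lambda>a b. S.bact (scomult HH x) (eX 1 \<beta>) a b + S.bact (scomult HH y) (eX 1 \<beta>) a b)"
    using assms by (simp add: eqf_def bact_scomult_add)
  then have "eX (- 1) (S.bact (scomult HH (x \<oplus>\<^bsub>AA\<^esub> y)) (eX 1 \<beta>)) \<approx>
      eX (- 1) (\<lambda>a b. S.bact (scomult HH x) (eX 1 \<beta>) a b + S.bact (scomult HH y) (eX 1 \<beta>) a b)"
    by (rule fopD(2)[OF fop_eX, rotated]) (use assms in simp)
  also have "\<dots> \<approx> (\<lambda>a b. eX (- 1) (S.bact (scomult HH x) (eX 1 \<beta>)) a b + eX (- 1) (S.bact (scomult HH y) (eX 1 \<beta>)) a b)"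
    by (rule fopD(3)[OF fop_eX]) (use assms in simp_all)
  finally show ?thesis by (simp add: DJ_def eqf_def)
qed

lemma DJ_x_smult:
  assumes "x \<in> carrier AA" "\<beta> \<in> Bil"
  shows "DJ (c \<odot>\<^bsub>AA\<^esub> x) \<beta> = c * DJ x \<beta>"
proof -
  have cx: "c \<odot>\<^bsub>AA\<^esub> x \<in> carrier AA" using S.smult_closed[of c x] assms by simp
  have "S.bact (scomult HH (c \<odot>\<^bsub>AA\<^esub> x)) (eX 1 \<beta>) \<approx> (\<lambda>a b. c * S.bact (scomult HH x) (eX 1 \<beta>) a b)"
    using assms by (simp add: eqf_def bact_scomult_smult)
  then have "eX (- 1) (S.bact (scomult HH (c \<odot>\<^bsub>AA\<^esub> x)) (eX 1 \<beta>)) \<approx>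
      eX (- 1) (\<lambda>a b. c * S.bact (scomult HH x) (eX 1 \<beta>) a b)"
    by (rule fopD(2)[OF fop_eX, rotated]) (use assms cx in simp)
  also have "\<dots> \<approx> (\<lambda>a b. c * eX (- 1) (S.bact (scomult HH x) (eX 1 \<beta>)) a b)"
    by (rule fopD(4)[OF fop_eX]) (use assms in simp)
  finally show ?thesis by (simp add: DJ_def eqf_def)
qed

lemma DJ_lform: "\<beta> \<in> Bil \<Longrightarrow> (\<lambda>x. DJ x \<beta>) \<in> lforms AA"
  by (simp add: lforms_iff DJ_x_add DJ_x_smult)

text \<open>If \<Delta>(y) commutes with B, it commutes with J, and the twist leaves this factor
  unchanged. This covers all vectors and u, so that \<Delta>^J(g) for g in G is the only twisted
  object left to understand.\<close>

lemma DJ_gen: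
  assumes x: "x \<in> carrier AA" and y: "y \<in> XX" and \<beta>: "\<beta> \<in> Bil"
    and comm: "\<And>\<beta>. \<beta> \<in> Bil \<Longrightarrow> Op y (XB \<beta>) \<approx> XB (Op y \<beta>)"
  shows "DJ (x \<otimes>\<^bsub>AA\<^esub> gv_gen G V \<rho> y) \<beta> = DJ x (Op y \<beta>)"
proof -
  have gy: "gv_gen G V \<rho> y \<in> carrier AA" using y by (cases y) auto
  have "S.bact (scomult HH (x \<otimes>\<^bsub>AA\<^esub> gv_gen G V \<rho> y)) (eX 1 \<beta>) \<approx> S.bact (scomult HH x) (Op y (eX 1 \<beta>))"
    using x y \<beta> by (simp add: eqf_def bact_scomult_gen)
  also have "S.bact (scomult HH x) (Op y (eX 1 \<beta>)) \<approx> S.bact (scomult HH x) (eX 1 (Op y \<beta>))"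
    by (rule fopD(2)[OF fop_bact _ eX_commute[OF fop_Op[OF y] comm \<beta>]]) (use x y \<beta> in simp_all)
  finally have "S.bact (scomult HH (x \<otimes>\<^bsub>AA\<^esub> gv_gen G V \<rho> y)) (eX 1 \<beta>) \<approx> S.bact (scomult HH x) (eX 1 (Op y \<beta>))" .
  then have "eX (- 1) (S.bact (scomult HH (x \<otimes>\<^bsub>AA\<^esub> gv_gen G V \<rho> y)) (eX 1 \<beta>)) \<approx>
      eX (- 1) (S.bact (scomult HH x) (eX 1 (Op y \<beta>)))"
    by (rule fopD(2)[OF fop_eX, rotated]) (use x gy \<beta> in simp)
  then show ?thesis by (simp add: DJ_def eqf_def)
qed

lemma bilin_swap1:
  assumes "\<beta> \<in> Bil" "x \<in> carrier AA" "b \<in> carrier AA" "v \<in> carrier V" "w \<in> carrier V"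
  shows "\<beta> (x \<otimes>\<^bsub>AA\<^esub> \<eta> v \<otimes>\<^bsub>AA\<^esub> \<eta> w) b = - \<beta> (x \<otimes>\<^bsub>AA\<^esub> \<eta> w \<otimes>\<^bsub>AA\<^esub> \<eta> v) b"
  using lform_swap[OF bilin_lform1[OF assms(1,3)] assms(2,4,5)] .

lemma bilin_swap2:
  assumes "\<beta> \<in> Bil" "x \<in> carrier AA" "b \<in> carrier AA" "v \<in> carrier V" "w \<in> carrier V"
  shows "\<beta> b (x \<otimes>\<^bsub>AA\<^esub> \<eta> v \<otimes>\<^bsub>AA\<^esub> \<eta> w) = - \<beta> b (x \<otimes>\<^bsub>AA\<^esub> \<eta> w \<otimes>\<^bsub>AA\<^esub> \<eta> v)"
  using lform_swap[OF bilin_lform2[OF assms(1,3)] assms(2,4,5)] .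

lemma sgm_vec: "x \<in> carrier AA \<Longrightarrow> v \<in> carrier V \<Longrightarrow> S.sgm (x \<otimes>\<^bsub>AA\<^esub> \<eta> v) = \<ominus>\<^bsub>AA\<^esub> (S.sgm x \<otimes>\<^bsub>AA\<^esub> \<eta> v)"
  by (simp add: S.sgm_mult S.r_minus)

lemma sgm_vec_vec: "x \<in> carrier AA \<Longrightarrow> v \<in> carrier V \<Longrightarrow> w \<in> carrier V \<Longrightarrow>
    S.sgm (x \<otimes>\<^bsub>AA\<^esub> \<eta> v) \<otimes>\<^bsub>AA\<^esub> \<eta> w = \<ominus>\<^bsub>AA\<^esub> (S.sgm x \<otimes>\<^bsub>AA\<^esub> \<eta> v \<otimes>\<^bsub>AA\<^esub> \<eta> w)"
  by (simp add: sgm_vec S.l_minus)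

text \<open>\<Delta>(v) commutes with B since B is even: each reordering of vectors gives one sign,
  and \<open>\<sigma>\<close> gives another that cancels it.\<close>

lemma Op_vec_XB:
  assumes v: "v \<in> carrier V" and \<beta>: "\<beta> \<in> Bil"
  shows "Op (Inr v) (XB \<beta>) \<approx> XB (Op (Inr v) \<beta>)"
proof (rule eqfI)
  fix a b assume ab: "a \<in> carrier AA" "b \<in> carrier AA"
  have "Op (Inr v) (XB \<beta>) a b = (\<Sum>z\<leftarrow>bs. \<beta> (a \<otimes>\<^bsub>AA\<^esub> \<eta> v \<otimes>\<^bsub>AA\<^esub> \<eta> (fst z)) (b \<otimes>\<^bsub>AA\<^esub> \<eta> (snd z))
      + \<beta> (a \<otimes>\<^bsub>AA\<^esub> \<eta> (fst z)) (S.sgm (b \<otimes>\<^bsub>AA\<^esub> \<eta> v) \<otimes>\<^bsub>AA\<^esub> \<eta> (snd z)))"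
    using ab by (simp add: XB_def sum_list_addf)
  also have "\<dots> = (\<Sum>z\<leftarrow>bs. Op (Inr v) \<beta> (a \<otimes>\<^bsub>AA\<^esub> \<eta> (fst z)) (S.sgm b \<otimes>\<^bsub>AA\<^esub> \<eta> (snd z)))"
  proof (rule bs_cong)
    fix z assume "z \<in> set bs"
    then have z: "fst z \<in> carrier V" "snd z \<in> carrier V" using bs_in by auto
    show "\<beta> (a \<otimes>\<^bsub>AA\<^esub> \<eta> v \<otimes>\<^bsub>AA\<^esub> \<eta> (fst z)) (b \<otimes>\<^bsub>AA\<^esub> \<eta> (snd z))
      + \<beta> (a \<otimes>\<^bsub>AA\<^esub> \<eta> (fst z)) (S.sgm (b \<otimes>\<^bsub>AA\<^esub> \<eta> v) \<otimes>\<^bsub>AA\<^esub> \<eta> (snd z)) =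
      Op (Inr v) \<beta> (a \<otimes>\<^bsub>AA\<^esub> \<eta> (fst z)) (S.sgm b \<otimes>\<^bsub>AA\<^esub> \<eta> (snd z))"
      using ab z v \<beta> bilin_swap1[OF \<beta> ab(1) _ v z(1), of "b \<otimes>\<^bsub>AA\<^esub> \<eta> (snd z)"]
        bilin_swap2[OF \<beta> _ _ v z(2), of "S.sgm b" "a \<otimes>\<^bsub>AA\<^esub> \<eta> (fst z)"]
      by (simp add: sgm_vec S.l_minus S.r_minus S.bil_simps')
  qed
  finally show "Op (Inr v) (XB \<beta>) a b = XB (Op (Inr v) \<beta>) a b" by (simp only: XB_def)
qed

lemma eta_u: "v \<in> carrier V \<Longrightarrow> \<eta> (\<ominus>\<^bsub>V\<^esub> v) = \<ominus>\<^bsub>AA\<^esub> \<eta> v"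
proof -
  assume v: "v \<in> carrier V"
  have "\<ominus>\<^bsub>V\<^esub> v = (- 1) \<odot>\<^bsub>V\<^esub> v" using VV.smult_minus_1[OF v] by (simp add: class_ring_simps)
  moreover have "(- 1) \<odot>\<^bsub>AA\<^esub> \<eta> v = \<ominus>\<^bsub>AA\<^esub> \<eta> v" using S.smult_minus_1[of "\<eta> v"] v by (simp add: class_ring_simps)
  ultimately show ?thesis using gen_smult[OF v, of "- 1"] by simp
qed

lemma vec_u: "x \<in> carrier AA \<Longrightarrow> v \<in> carrier V \<Longrightarrow>
    x \<otimes>\<^bsub>AA\<^esub> \<eta> v \<otimes>\<^bsub>AA\<^esub> \<gamma> u = \<ominus>\<^bsub>AA\<^esub> (x \<otimes>\<^bsub>AA\<^esub> \<gamma> u \<otimes>\<^bsub>AA\<^esub> \<eta> v)"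
  using u_act by (simp add: S.m_assoc gen_gv eta_u S.r_minus)

lemma vec_g: "x \<in> carrier AA \<Longrightarrow> v \<in> carrier V \<Longrightarrow> g \<in> carrier G \<Longrightarrow>
    x \<otimes>\<^bsub>AA\<^esub> \<eta> v \<otimes>\<^bsub>AA\<^esub> \<gamma> g = x \<otimes>\<^bsub>AA\<^esub> \<gamma> g \<otimes>\<^bsub>AA\<^esub> \<eta> (\<rho> (inv\<^bsub>G\<^esub> g) v)"
  by (simp add: S.m_assoc gen_gv)

text \<open>u acts by -1 on both tensor factors of B, so the signs cancel.\<close>

lemma Op_u_XB:
  assumes \<beta>: "\<beta> \<in> Bil"
  shows "Op (Inl u) (XB \<beta>) \<approx> XB (Op (Inl u) \<beta>)"
proof (rule eqfI)
  fix a b assume ab: "a \<in> carrier AA" "b \<in> carrier AA"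
  have "XB (Op (Inl u) \<beta>) a b = Op (Inl u) (XB \<beta>) a b"
    unfolding XB_def Op.simps
    by (rule bs_cong) (use ab bs_in \<beta> in \<open>simp add: vec_u S.sgm_mult S.bil_simps'\<close>)
  then show "Op (Inl u) (XB \<beta>) a b = XB (Op (Inl u) \<beta>) a b" ..
qed

lemma DJ_vec: "x \<in> carrier AA \<Longrightarrow> v \<in> carrier V \<Longrightarrow> \<beta> \<in> Bil \<Longrightarrow> DJ (x \<otimes>\<^bsub>AA\<^esub> \<eta> v) \<beta> = DJ x (Op (Inr v) \<beta>)"
  by (rule DJ_gen) (simp_all only: in_XX Op_vec_XB)

lemma DJ_u: "x \<in> carrier AA \<Longrightarrow> \<beta> \<in> Bil \<Longrightarrow> DJ (x \<otimes>\<^bsub>AA\<^esub> \<gamma> u) \<beta> = DJ x (Op (Inl u) \<beta>)"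
  by (rule DJ_gen) (simp_all only: in_XX Op_u_XB u_in)

lemma DJ_grp:
  assumes "g \<in> carrier G" "\<beta> \<in> Bil"
  shows "DJ (\<gamma> g) \<beta> = eX (- 1) (Op (Inl g) (eX 1 \<beta>)) \<one>\<^bsub>AA\<^esub> \<one>\<^bsub>AA\<^esub>"
proof -
  have "S.bact (scomult HH (\<gamma> g)) (eX 1 \<beta>) \<approx> Op (Inl g) (eX 1 \<beta>)"
    using assms by (simp add: eqf_def bact_scomult_grp)
  then have "eX (- 1) (S.bact (scomult HH (\<gamma> g)) (eX 1 \<beta>)) \<approx> eX (- 1) (Op (Inl g) (eX 1 \<beta>))"
    by (rule fopD(2)[OF fop_eX, rotated]) (use assms in simp)
  then show ?thesis by (simp add: DJ_def eqf_def)
qed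

section \<open>Parity of the twisted coproduct\<close>

definition Sg :: "(('g, 'v) gv \<Rightarrow> ('g, 'v) gv \<Rightarrow> complex) \<Rightarrow> ('g, 'v) gv \<Rightarrow> ('g, 'v) gv \<Rightarrow> complex" where
  "Sg \<beta> = (\<lambda>a b. \<beta> (S.sgm a) (S.sgm b))"

lemma Sg_bilin [simp]: "\<beta> \<in> Bil \<Longrightarrow> Sg \<beta> \<in> Bil"
  by (simp add: Sg_def bilin_iff S.sgm_add S.sgm_smult)

lemma fop_Sg: "fop Sg"
  by (rule fopI) (simp_all add: Sg_bilin, simp_all add: Sg_def eqf_def)

lemma Sg_XB:
  assumes \<beta>: "\<beta> \<in> Bil"
  shows "Sg (XB \<beta>) \<approx> XB (Sg \<beta>)"
proof (rule eqfI)
  fix a b assume ab: "a \<in> carrier AA" "b \<in> carrier AA"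
  have "XB (Sg \<beta>) a b = Sg (XB \<beta>) a b"
    unfolding XB_def Sg_def
    by (rule bs_cong) (use ab bs_in \<beta> in \<open>simp add: sgm_vec S.bil_simps'\<close>)
  then show "Sg (XB \<beta>) a b = XB (Sg \<beta>) a b" ..
qed

text \<open>The twisted coproduct preserves parity: on group elements because B is even
  (\<open>Sg_XB\<close>), and then along products with vectors, where both sides acquire the same
  sign.\<close>

lemma DJ_sgm:
  assumes "x \<in> carrier AA" "\<beta> \<in> Bil"
  shows "DJ (S.sgm x) \<beta> = DJ x (Sg \<beta>)"
  using assms
proof (induction x arbitrary: \<beta> rule: AA_induct)
  case (grp g)
  have "Op (Inl g) (eX 1 (Sg \<beta>)) \<approx> Op (Inl g) (Sg (eX 1 \<beta>))"
    by (rule fopD(2)[OF fop_Op _ eqf_sym[OF eX_commute[OF fop_Sg Sg_XB grp(2)]]])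
      (use grp in \<open>simp_all del: Op.simps\<close>)
  also have "\<dots> \<approx> Sg (Op (Inl g) (eX 1 \<beta>))"
    using grp by (simp add: eqf_def Sg_def S.sgm_mult)
  finally have "eX (- 1) (Op (Inl g) (eX 1 (Sg \<beta>))) \<approx> eX (- 1) (Sg (Op (Inl g) (eX 1 \<beta>)))"
    by (rule fopD(2)[OF fop_eX, rotated]) (use grp in \<open>simp del: Op.simps\<close>)
  also have "eX (- 1) (Sg (Op (Inl g) (eX 1 \<beta>))) \<approx> Sg (eX (- 1) (Op (Inl g) (eX 1 \<beta>)))"
    by (rule eqf_sym[OF eX_commute[OF fop_Sg Sg_XB]]) (use grp in \<open>simp_all del: Op.simps\<close>)
  finally have "eX (- 1) (Op (Inl g) (eX 1 (Sg \<beta>))) \<one>\<^bsub>AA\<^esub> \<one>\<^bsub>AA\<^esub> =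
      Sg (eX (- 1) (Op (Inl g) (eX 1 \<beta>))) \<one>\<^bsub>AA\<^esub> \<one>\<^bsub>AA\<^esub>" by (rule eqfD) simp_all
  moreover have "Sg F \<one>\<^bsub>AA\<^esub> \<one>\<^bsub>AA\<^esub> = F \<one>\<^bsub>AA\<^esub> \<one>\<^bsub>AA\<^esub>" for F by (simp add: Sg_def)
  ultimately show ?case using grp by (simp add: DJ_grp del: Op.simps)
next
  case (vec x v)
  have b: "Op (Inr v) \<beta> \<in> Bil" "Op (Inr v) (Sg \<beta>) \<in> Bil" "Sg (Op (Inr v) \<beta>) \<in> Bil"
    using vec by (simp_all del: Op.simps)
  have "DJ (S.sgm (x \<otimes>\<^bsub>AA\<^esub> \<eta> v)) \<beta> = - DJ (S.sgm x) (Op (Inr v) \<beta>)"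
    using vec lforms_uminus[OF S.module_A DJ_lform[OF vec(4)]] by (simp add: sgm_vec DJ_vec del: Op.simps)
  also have "\<dots> = - DJ x (Sg (Op (Inr v) \<beta>))" using vec b by simp
  also have "\<dots> = DJ x (\<lambda>a b. - 1 * Sg (Op (Inr v) \<beta>) a b)"
    by (subst DJ_cmult[OF vec(1) b(3)]) simp
  also have "\<dots> = DJ x (Op (Inr v) (Sg \<beta>))"
    by (rule DJ_cong[OF vec(1) S.bilin_cmult[OF b(3)]])
      (use vec in \<open>simp add: eqf_def Sg_def sgm_vec S.bil_simps'\<close>)
  also have "\<dots> = DJ (x \<otimes>\<^bsub>AA\<^esub> \<eta> v) (Sg \<beta>)"
    by (rule DJ_vec[symmetric]) (use vec in simp_all)
  finally show ?case .
next
  case (add x y)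
  then show ?case by (simp add: S.sgm_add DJ_x_add)
next
  case (smult x c)
  then show ?case by (simp add: S.sgm_smult DJ_x_smult)
qed

subsection \<open>The twisted coproduct of a group element\<close>

text \<open>The contraction (\<xi> \<otimes> 1)(B) of B in its first factor.\<close>

definition Bv :: "('v \<Rightarrow> complex) \<Rightarrow> 'v" where
  "Bv \<xi> = foldr (\<lambda>z acc. \<xi> (fst z) \<odot>\<^bsub>V\<^esub> snd z \<oplus>\<^bsub>V\<^esub> acc) bs \<zero>\<^bsub>V\<^esub>"

lemma Bv: "Bv \<xi> \<in> carrier V" "F \<in> lforms V \<Longrightarrow> F (Bv \<xi>) = (\<Sum>z\<leftarrow>bs. \<xi> (fst z) * F (snd z))"
proof -
  have "foldr (\<lambda>z acc. \<xi> (fst z) \<odot>\<^bsub>V\<^esub> snd z \<oplus>\<^bsub>V\<^esub> acc) zs \<zero>\<^bsub>V\<^esub> \<in> carrier V \<and>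
    (F \<in> lforms V \<longrightarrow> F (foldr (\<lambda>z acc. \<xi> (fst z) \<odot>\<^bsub>V\<^esub> snd z \<oplus>\<^bsub>V\<^esub> acc) zs \<zero>\<^bsub>V\<^esub>) = (\<Sum>z\<leftarrow>zs. \<xi> (fst z) * F (snd z)))"
    if "set zs \<subseteq> carrier V \<times> carrier V" for zs F
    using that
  proof (induction zs)
    case Nil
    then show ?case using lforms_zero[OF VV.module_axioms, of F] by simp
  next
    case (Cons z zs)
    then have "snd z \<in> carrier V" by auto
    then show ?case using Cons by (simp add: lforms_add lforms_smult)
  qed
  from this[OF bs(1)] show "Bv \<xi> \<in> carrier V" "F \<in> lforms V \<Longrightarrow> F (Bv \<xi>) = (\<Sum>z\<leftarrow>bs. \<xi> (fst z) * F (snd z))"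
    unfolding Bv_def by auto
qed

text \<open>Transposed right multiplication by 1 \<otimes> c.\<close>

definition Zc :: "'v \<Rightarrow> (('g, 'v) gv \<Rightarrow> ('g, 'v) gv \<Rightarrow> complex) \<Rightarrow> ('g, 'v) gv \<Rightarrow> ('g, 'v) gv \<Rightarrow> complex" where
  "Zc c \<beta> = (\<lambda>a b. \<beta> a (b \<otimes>\<^bsub>AA\<^esub> \<eta> c))"

text \<open>Contraction in the first tensor factor. The \<open>\<sigma>\<close> on the second one is
  the Koszul sign of an odd operator; with it, the commutator with \<open>XB\<close> is a single
  \<open>Zc\<close>.\<close>

definition dd :: "('v \<Rightarrow> complex) \<Rightarrow> (('g, 'v) gv \<Rightarrow> ('g, 'v) gv \<Rightarrow> complex) \<Rightarrow> ('g, 'v) gv \<Rightarrow> ('g, 'v) gv \<Rightarrow> complex" where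
  "dd \<xi> \<beta> = (\<lambda>a b. iota \<xi> (\<lambda>x. \<beta> x (S.sgm b)) a)"

lemma fop_Zc: "c \<in> carrier V \<Longrightarrow> fop (Zc c)"
  by (rule fopI) (simp_all add: Zc_def eqf_def bilin_iff S.l_distr)

lemma Zc_XB:
  assumes c: "c \<in> carrier V" and \<beta>: "\<beta> \<in> Bil"
  shows "Zc c (XB \<beta>) \<approx> XB (Zc c \<beta>)"
proof (rule eqfI)
  fix a b assume ab: "a \<in> carrier AA" "b \<in> carrier AA"
  have "XB (Zc c \<beta>) a b = Zc c (XB \<beta>) a b"
    unfolding XB_def Zc_def
  proof (rule bs_cong)
    fix z assume "z \<in> set bs"
    then have z: "fst z \<in> carrier V" "snd z \<in> carrier V" using bs_in by auto
    show "\<beta> (a \<otimes>\<^bsub>AA\<^esub> \<eta> (fst z)) (S.sgm b \<otimes>\<^bsub>AA\<^esub> \<eta> (snd z) \<otimes>\<^bsub>AA\<^esub> \<eta> c) =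
        \<beta> (a \<otimes>\<^bsub>AA\<^esub> \<eta> (fst z)) (S.sgm (b \<otimes>\<^bsub>AA\<^esub> \<eta> c) \<otimes>\<^bsub>AA\<^esub> \<eta> (snd z))"
      using ab z c \<beta> bilin_swap2[OF \<beta> _ _ c z(2), of "S.sgm b" "a \<otimes>\<^bsub>AA\<^esub> \<eta> (fst z)"]
      by (simp add: sgm_vec_vec S.bil_simps')
  qed
  then show "Zc c (XB \<beta>) a b = XB (Zc c \<beta>) a b" ..
qed

lemma fop_dd:
  assumes \<xi>: "\<xi> \<in> lforms V"
  shows "fop (dd \<xi>)"
proof (rule fopI)
  fix \<beta> assume \<beta>: "\<beta> \<in> Bil"
  have l: "(\<lambda>x. \<beta> x b) \<in> lforms AA" if "\<beta> \<in> Bil" "b \<in> carrier AA" for b \<beta> using bilin_lform1[OF that] .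
  have 1: "dd \<xi> \<beta> a (b \<oplus>\<^bsub>AA\<^esub> b') = dd \<xi> \<beta> a b + dd \<xi> \<beta> a b'"
    if "a \<in> carrier AA" "b \<in> carrier AA" "b' \<in> carrier AA" for a b b'
  proof -
    have "iota \<xi> (\<lambda>x. \<beta> x (S.sgm (b \<oplus>\<^bsub>AA\<^esub> b'))) a = iota \<xi> (\<lambda>x. \<beta> x (S.sgm b) + \<beta> x (S.sgm b')) a"
      by (rule iota_cong[OF \<xi>]) (use that \<beta> l in \<open>simp_all add: S.sgm_add S.bil_simps\<close>)
    then show ?thesis unfolding dd_def using that by (simp add: iota_add \<xi> l \<beta>)
  qed
  have 2: "dd \<xi> \<beta> a (c \<odot>\<^bsub>AA\<^esub> b) = c * dd \<xi> \<beta> a b" if "a \<in> carrier AA" "b \<in> carrier AA" for a b c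
  proof -
    have "iota \<xi> (\<lambda>x. \<beta> x (S.sgm (c \<odot>\<^bsub>AA\<^esub> b))) a = iota \<xi> (\<lambda>x. c * \<beta> x (S.sgm b)) a"
      by (rule iota_cong[OF \<xi>]) (use that \<beta> l S.smult_closed[of c b] in \<open>simp_all add: S.sgm_smult S.bil_simps\<close>)
    then show ?thesis unfolding dd_def using that by (simp add: iota_cmult \<xi> l \<beta>)
  qed
  show "dd \<xi> \<beta> \<in> Bil"
    unfolding bilin_iff using 1 2 iota_lform[OF \<xi> l[OF \<beta>]]
    by (simp add: dd_def lforms_add lforms_smult)
  fix a b assume ab: "a \<in> carrier AA" "b \<in> carrier AA"
  show "dd \<xi> \<beta> a b = dd \<xi> \<beta>' a b" if "\<beta> \<approx> \<beta>'" for \<beta>'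
    unfolding dd_def by (rule iota_cong[OF \<xi>]) (use ab that \<beta> l in \<open>simp_all add: eqf_def\<close>)
  show "dd \<xi> (\<lambda>a b. \<beta> a b + \<beta>' a b) a b = dd \<xi> \<beta> a b + dd \<xi> \<beta>' a b" if "\<beta>' \<in> Bil" for \<beta>'
    unfolding dd_def using ab that by (simp add: iota_add \<xi> l \<beta>)
  show "dd \<xi> (\<lambda>a b. c * \<beta> a b) a b = c * dd \<xi> \<beta> a b" for c
    unfolding dd_def using ab by (simp add: iota_cmult \<xi> l \<beta>)
qed

lemma iota_sum_list:
  assumes "\<xi> \<in> lforms V" "\<And>z. z \<in> set zs \<Longrightarrow> h z \<in> lforms AA" "x \<in> carrier AA"
  shows "iota \<xi> (\<lambda>x. \<Sum>z\<leftarrow>zs. h z x) x = (\<Sum>z\<leftarrow>zs. iota \<xi> (h z) x)"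
  using assms(2)
proof (induction zs)
  case Nil
  have z: "(\<lambda>x. 0) \<in> lforms AA" by (simp add: lforms_iff)
  from iota_cmult[OF assms(1) z assms(3), of 0] show ?case by simp
next
  case (Cons z zs)
  then show ?case using assms by (simp add: iota_add lforms_sum_list)
qed

text \<open>Every term of B has one vector in the first factor. Contracting it leaves the vector
  (\<xi> \<otimes> 1)(B) in the second factor as the commutator.\<close>

lemma XB_dd:
  assumes \<xi>: "\<xi> \<in> lforms V" and \<beta>: "\<beta> \<in> Bil"
  shows "XB (dd \<xi> \<beta>) \<approx> (\<lambda>a b. dd \<xi> (XB \<beta>) a b - Zc (Bv \<xi>) \<beta> a b)"
proof (rule eqfI)
  fix a b assume ab: "a \<in> carrier AA" "b \<in> carrier AA"
  have l: "(\<lambda>x. \<beta> x b) \<in> lforms AA" if "b \<in> carrier AA" for b using bilin_lform1[OF \<beta> that] .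
  have "XB (dd \<xi> \<beta>) a b = (\<Sum>z\<leftarrow>bs. iota \<xi> (\<lambda>x. \<beta> (x \<otimes>\<^bsub>AA\<^esub> \<eta> (fst z)) (b \<otimes>\<^bsub>AA\<^esub> \<eta> (snd z))) a -
      \<xi> (fst z) * \<beta> a (b \<otimes>\<^bsub>AA\<^esub> \<eta> (snd z)))"
    unfolding XB_def
  proof (rule bs_cong)
    fix z assume "z \<in> set bs"
    then have z: "fst z \<in> carrier V" "snd z \<in> carrier V" using bs_in by auto
    let ?y = "b \<otimes>\<^bsub>AA\<^esub> \<eta> (snd z)"
    have y: "?y \<in> carrier AA" using ab z by simp
    have "dd \<xi> \<beta> (a \<otimes>\<^bsub>AA\<^esub> \<eta> (fst z)) (S.sgm b \<otimes>\<^bsub>AA\<^esub> \<eta> (snd z)) =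
        iota \<xi> (\<lambda>x. - 1 * \<beta> x ?y) (a \<otimes>\<^bsub>AA\<^esub> \<eta> (fst z))"
      unfolding dd_def by (rule iota_cong[OF \<xi>]) (use ab z \<beta> l in \<open>simp_all add: sgm_vec S.bil_simps'\<close>)
    also have "\<dots> = - iota \<xi> (\<lambda>x. \<beta> x ?y) (a \<otimes>\<^bsub>AA\<^esub> \<eta> (fst z))"
      using ab z by (subst iota_cmult[OF \<xi> l[OF y]]) simp_all
    also have "\<dots> = iota \<xi> (\<lambda>x. \<beta> (x \<otimes>\<^bsub>AA\<^esub> \<eta> (fst z)) ?y) a - \<xi> (fst z) * \<beta> a ?y"
      using ab z by (simp add: iota_vec[OF \<xi> l[OF y]])
    finally show "dd \<xi> \<beta> (a \<otimes>\<^bsub>AA\<^esub> \<eta> (fst z)) (S.sgm b \<otimes>\<^bsub>AA\<^esub> \<eta> (snd z)) =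
      iota \<xi> (\<lambda>x. \<beta> (x \<otimes>\<^bsub>AA\<^esub> \<eta> (fst z)) ?y) a - \<xi> (fst z) * \<beta> a ?y" .
  qed
  also have "\<dots> = (\<Sum>z\<leftarrow>bs. iota \<xi> (\<lambda>x. \<beta> (x \<otimes>\<^bsub>AA\<^esub> \<eta> (fst z)) (b \<otimes>\<^bsub>AA\<^esub> \<eta> (snd z))) a) -
      (\<Sum>z\<leftarrow>bs. \<xi> (fst z) * \<beta> a (b \<otimes>\<^bsub>AA\<^esub> \<eta> (snd z)))"
    by (simp add: sum_list_subtractf)
  also have "(\<Sum>z\<leftarrow>bs. \<xi> (fst z) * \<beta> a (b \<otimes>\<^bsub>AA\<^esub> \<eta> (snd z))) = Zc (Bv \<xi>) \<beta> a b"
    unfolding Zc_def by (rule Bv(2)[symmetric]) (rule lform_vec[OF bilin_lform2[OF \<beta> ab(1)] ab(2)])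
  also have "(\<Sum>z\<leftarrow>bs. iota \<xi> (\<lambda>x. \<beta> (x \<otimes>\<^bsub>AA\<^esub> \<eta> (fst z)) (b \<otimes>\<^bsub>AA\<^esub> \<eta> (snd z))) a) = dd \<xi> (XB \<beta>) a b"
    unfolding dd_def XB_def using ab
    by (subst iota_sum_list) (use ab bs_in \<xi> l in \<open>simp_all add: lform_rmult[OF l]\<close>)
  finally show "XB (dd \<xi> \<beta>) a b = dd \<xi> (XB \<beta>) a b - Zc (Bv \<xi>) \<beta> a b" .
qed

text \<open>The commutator in \<open>XB_dd\<close> itself commutes with \<open>XB\<close>, so a
  power of \<open>XB\<close> yields as many equal terms as it has factors.\<close>

lemma XBk_dd:
  assumes \<xi>: "\<xi> \<in> lforms V" and \<beta>: "\<beta> \<in> Bil"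
  shows "(XB ^^ Suc k) (dd \<xi> \<beta>) \<approx>
    (\<lambda>a b. dd \<xi> ((XB ^^ Suc k) \<beta>) a b + (- of_nat (Suc k)) * (XB ^^ k) (Zc (Bv \<xi>) \<beta>) a b)"
proof (induction k)
  case 0
  then show ?case using XB_dd[OF \<xi> \<beta>] by (simp add: eqf_def)
next
  case (Suc k)
  let ?Z = "Zc (Bv \<xi>)" and ?Y = "(XB ^^ Suc k) \<beta>"
  have Y: "?Y \<in> Bil" by (rule fopD(1)[OF fop_XBk \<beta>])
  have Zb: "?Z \<beta> \<in> Bil" by (rule fopD(1)[OF fop_Zc[OF Bv(1)] \<beta>])
  have XZ: "(XB ^^ j) (?Z \<beta>) \<in> Bil" for j by (rule fopD(1)[OF fop_XBk Zb])
  have d: "dd \<xi> ?Y \<in> Bil" by (rule fopD(1)[OF fop_dd[OF \<xi>] Y])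
  have "(XB ^^ Suc (Suc k)) (dd \<xi> \<beta>) \<approx>
      XB (\<lambda>a b. dd \<xi> ?Y a b + (- of_nat (Suc k)) * (XB ^^ k) (?Z \<beta>) a b)"
    using fopD(2)[OF fop_XB fopD(1)[OF fop_XBk fopD(1)[OF fop_dd[OF \<xi>] \<beta>]] Suc] by simp
  also have "\<dots> \<approx> (\<lambda>a b. XB (dd \<xi> ?Y) a b + XB (\<lambda>a b. (- of_nat (Suc k)) * (XB ^^ k) (?Z \<beta>) a b) a b)"
    by (rule fopD(3)[OF fop_XB d S.bilin_cmult[OF XZ]])
  also have "\<dots> \<approx> (\<lambda>a b. dd \<xi> (XB ?Y) a b - ?Z ?Y a b + (- of_nat (Suc k)) * XB ((XB ^^ k) (?Z \<beta>)) a b)"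
    using XB_dd[OF \<xi> Y] fopD(4)[OF fop_XB XZ[of k], of "- of_nat (Suc k)"] by (simp add: eqf_def)
  also have "\<dots> \<approx> (\<lambda>a b. dd \<xi> (XB ?Y) a b + (- of_nat (Suc (Suc k))) * (XB ^^ Suc k) (?Z \<beta>) a b)"
    using XBk_commute[OF fop_Zc[OF Bv(1)] Zc_XB[OF Bv(1)] \<beta>, of \<xi> "Suc k"]
    by (simp add: eqf_def algebra_simps)
  finally show ?case by simp
qed

text \<open>Termwise (k + 1) / (k + 1)! = 1 / k!, so the correction term is again a full exponential
  series.\<close>

lemma eX_dd:
  assumes \<xi>: "\<xi> \<in> lforms V" and \<beta>: "\<beta> \<in> Bil"
  shows "eX c (dd \<xi> \<beta>) \<approx> (\<lambda>a b. dd \<xi> (eX c \<beta>) a b - c * eX c (Zc (Bv \<xi>) \<beta>) a b)"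
proof (rule eqfI)
  fix a b assume ab: "a \<in> carrier AA" "b \<in> carrier AA"
  let ?Z = "Zc (Bv \<xi>)"
  have Zb: "?Z \<beta> \<in> Bil" by (rule fopD(1)[OF fop_Zc[OF Bv(1)] \<beta>])
  have d: "dd \<xi> (eX c \<beta>) a b = (\<Sum>k\<le>nilp. c ^ k / fact k * dd \<xi> ((XB ^^ k) \<beta>) a b)"
    unfolding eX_def
    by (rule eqfD[OF fop_sum[OF fop_dd[OF \<xi>]] ab]) (auto intro: fopD(1)[OF fop_XBk] \<beta>)
  have "eX c (dd \<xi> \<beta>) a b = dd \<xi> \<beta> a b + (\<Sum>k<nilp. c ^ Suc k / fact (Suc k) * (XB ^^ Suc k) (dd \<xi> \<beta>) a b)"
    unfolding eX_def by (subst sum.atMost_shift) simp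
  also have "(\<Sum>k<nilp. c ^ Suc k / fact (Suc k) * (XB ^^ Suc k) (dd \<xi> \<beta>) a b) =
      (\<Sum>k<nilp. c ^ Suc k / fact (Suc k) * dd \<xi> ((XB ^^ Suc k) \<beta>) a b - c * (c ^ k / fact k * (XB ^^ k) (?Z \<beta>) a b))"
  proof (rule sum.cong[OF refl])
    fix k
    have gen: "A * (x + (- n) * y) = A * x - A * n * y" for A x n y :: complex by (simp add: algebra_simps)
    have f: "c ^ Suc k / fact (Suc k) * of_nat (Suc k) = c * (c ^ k / fact k)"
      by (simp add: field_simps del: of_nat_Suc)
    have "c ^ Suc k / fact (Suc k) * (XB ^^ Suc k) (dd \<xi> \<beta>) a b =
        c ^ Suc k / fact (Suc k) * dd \<xi> ((XB ^^ Suc k) \<beta>) a b -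
        (c ^ Suc k / fact (Suc k) * of_nat (Suc k)) * (XB ^^ k) (?Z \<beta>) a b"
      unfolding eqfD[OF XBk_dd[OF \<xi> \<beta>] ab] by (rule gen)
    then show "c ^ Suc k / fact (Suc k) * (XB ^^ Suc k) (dd \<xi> \<beta>) a b =
        c ^ Suc k / fact (Suc k) * dd \<xi> ((XB ^^ Suc k) \<beta>) a b - c * (c ^ k / fact k * (XB ^^ k) (?Z \<beta>) a b)"
      unfolding f by (simp only: mult.assoc)
  qed
  also have "\<dots> = (\<Sum>k<nilp. c ^ Suc k / fact (Suc k) * dd \<xi> ((XB ^^ Suc k) \<beta>) a b) -
      c * (\<Sum>k<nilp. c ^ k / fact k * (XB ^^ k) (?Z \<beta>) a b)"
    by (simp only: sum_subtractf sum_distrib_left)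
  \<comment> \<open>The shifted sum stops below \<open>nilp\<close>; the missing top term of the
    exponential is zero.\<close>
  also have "(\<Sum>k<nilp. c ^ k / fact k * (XB ^^ k) (?Z \<beta>) a b) = eX c (?Z \<beta>) a b"
    unfolding eX_def using XBk_zero[OF Zb order_refl ab] by (simp add: lessThan_Suc_atMost[symmetric])
  also have "dd \<xi> \<beta> a b + ((\<Sum>k<nilp. c ^ Suc k / fact (Suc k) * dd \<xi> ((XB ^^ Suc k) \<beta>) a b) - c * eX c (?Z \<beta>) a b) =
      dd \<xi> (eX c \<beta>) a b - c * eX c (?Z \<beta>) a b"
    unfolding d by (subst sum.atMost_shift) simp
  finally show "eX c (dd \<xi> \<beta>) a b = dd \<xi> (eX c \<beta>) a b - c * eX c (?Z \<beta>) a b" .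
qed

text \<open>By symmetry of \<open>B\<close>, the value of \<open>\<xi>'\<close> at \<open>Cv g \<xi>\<close> is \<open>(B - B\<^sup>g)(\<xi>, \<xi>')\<close>.\<close>

definition Cv :: "'g \<Rightarrow> ('v \<Rightarrow> complex) \<Rightarrow> 'v" where
  "Cv g \<xi> = Bv \<xi> \<ominus>\<^bsub>V\<^esub> \<rho> (inv\<^bsub>G\<^esub> g) (Bv (\<lambda>v. \<xi> (\<rho> (inv\<^bsub>G\<^esub> g) v)))"

lemma Cv_closed [simp]: "g \<in> carrier G \<Longrightarrow> Cv g \<xi> \<in> carrier V"
  using Bv(1) by (simp add: Cv_def)

text \<open>\<open>\<Delta>\<^sup>J(g)\<close> is determined by its counit and this differential equation.\<close>

lemma DJ_dd:
  assumes g: "g \<in> carrier G" and \<xi>: "\<xi> \<in> lforms V" and \<beta>: "\<beta> \<in> Bil"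
  shows "DJ (\<gamma> g) (dd \<xi> \<beta>) = - DJ (\<gamma> g) (Zc (Cv g \<xi>) \<beta>)"
proof -
  let ?\<xi> = "\<lambda>v. \<xi> (\<rho> (inv\<^bsub>G\<^esub> g) v)" and ?G = "Op (Inl g)" and ?P = "eX 1 \<beta>"
  let ?w = "\<rho> (inv\<^bsub>G\<^esub> g) (Bv ?\<xi>)"
  have gX: "Inl g \<in> XX" using g by simp
  have \<xi>': "?\<xi> \<in> lforms V" using \<xi> g by (simp add: lform_rho)
  have w: "?w \<in> carrier V" using g Bv(1) by simp
  have P: "?P \<in> Bil" "?G ?P \<in> Bil" using \<beta> gX by (simp_all del: Op.simps)
  have Z: "Zc c \<beta> \<in> Bil" "Zc c ?P \<in> Bil" if "c \<in> carrier V" for c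
    using fopD(1)[OF fop_Zc[OF that]] \<beta> P by simp_all
  have GZ: "?G (eX 1 (Zc c \<beta>)) \<in> Bil" if "c \<in> carrier V" for c
    using gX Z[OF that] by (simp del: Op.simps)
  have dG: "dd ?\<xi> (?G ?P) \<in> Bil" by (rule fopD(1)[OF fop_dd[OF \<xi>'] P(2)])
  have "?G (eX 1 (dd \<xi> \<beta>)) \<approx> ?G (\<lambda>a b. dd \<xi> ?P a b - 1 * eX 1 (Zc (Bv \<xi>) \<beta>) a b)"
    by (rule fopD(2)[OF fop_Op[OF gX] eX_bilin[OF fopD(1)[OF fop_dd[OF \<xi>] \<beta>]] eX_dd[OF \<xi> \<beta>]])
  \<comment> \<open>Passing g turns the contraction by \<xi> into the contraction by its translate
    \<open>?\<xi>\<close>.\<close>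
  also have "\<dots> \<approx> (\<lambda>a b. dd ?\<xi> (?G ?P) a b + (- 1) * ?G (eX 1 (Zc (Bv \<xi>) \<beta>)) a b)"
  proof (rule eqfI)
    fix a b assume ab: "a \<in> carrier AA" "b \<in> carrier AA"
    have l: "(\<lambda>x. ?P x (S.sgm (b \<otimes>\<^bsub>AA\<^esub> \<gamma> g))) \<in> lforms AA"
      using bilin_lform1[OF P(1)] ab g by simp
    have "dd \<xi> ?P (a \<otimes>\<^bsub>AA\<^esub> \<gamma> g) (b \<otimes>\<^bsub>AA\<^esub> \<gamma> g) = iota ?\<xi> (\<lambda>x. ?P (x \<otimes>\<^bsub>AA\<^esub> \<gamma> g) (S.sgm (b \<otimes>\<^bsub>AA\<^esub> \<gamma> g))) a"
      unfolding dd_def by (rule iota_grp[OF \<xi> l ab(1) g])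
    then show "?G (\<lambda>a b. dd \<xi> ?P a b - 1 * eX 1 (Zc (Bv \<xi>) \<beta>) a b) a b =
        dd ?\<xi> (?G ?P) a b + (- 1) * ?G (eX 1 (Zc (Bv \<xi>) \<beta>)) a b"
      using ab g by (simp add: dd_def[of ?\<xi>] S.sgm_mult)
  qed
  finally have "eX (- 1) (?G (eX 1 (dd \<xi> \<beta>))) \<approx>
      eX (- 1) (\<lambda>a b. dd ?\<xi> (?G ?P) a b + (- 1) * ?G (eX 1 (Zc (Bv \<xi>) \<beta>)) a b)"
    by (rule fopD(2)[OF fop_eX, rotated])
      (rule Op_bilin[OF gX eX_bilin[OF fopD(1)[OF fop_dd[OF \<xi>] \<beta>]]])
  also have "\<dots> \<approx> (\<lambda>a b. eX (- 1) (dd ?\<xi> (?G ?P)) a b + (- 1) * eX (- 1) (?G (eX 1 (Zc (Bv \<xi>) \<beta>))) a b)"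
    using fopD(3)[OF fop_eX dG S.bilin_cmult[OF GZ[OF Bv(1)]], of "- 1" "- 1"]
      fopD(4)[OF fop_eX GZ[OF Bv(1)], of "- 1" "- 1"]
    by (simp add: eqf_def del: Op.simps)
  finally have 1: "DJ (\<gamma> g) (dd \<xi> \<beta>) = eX (- 1) (dd ?\<xi> (?G ?P)) \<one>\<^bsub>AA\<^esub> \<one>\<^bsub>AA\<^esub> - DJ (\<gamma> g) (Zc (Bv \<xi>) \<beta>)"
    using DJ_grp[OF g fopD(1)[OF fop_dd[OF \<xi>] \<beta>]] DJ_grp[OF g Z(1)[OF Bv(1)]]
    by (simp add: eqf_def del: Op.simps)
  \<comment> \<open>The vector produced by J^{-1} is carried to the right of g, where it becomes
    \<open>?w\<close>. The vectors from J and J^{-1} enter with opposite signs, whence the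
    difference \<open>Cv g \<xi>\<close>.\<close>
  have "Zc (Bv ?\<xi>) (?G ?P) \<approx> ?G (Zc ?w ?P)"
    using g Bv(1) by (simp add: eqf_def Zc_def vec_g)
  also have "?G (Zc ?w ?P) \<approx> ?G (eX 1 (Zc ?w \<beta>))"
    by (rule fopD(2)[OF fop_Op[OF gX] Z(2)[OF w] eX_commute[OF fop_Zc[OF w] Zc_XB[OF w] \<beta>]])
  finally have "eX (- 1) (Zc (Bv ?\<xi>) (?G ?P)) \<approx> eX (- 1) (?G (eX 1 (Zc ?w \<beta>)))"
    by (rule fopD(2)[OF fop_eX fopD(1)[OF fop_Zc[OF Bv(1)] P(2)]])
  then have 2: "eX (- 1) (Zc (Bv ?\<xi>) (?G ?P)) \<one>\<^bsub>AA\<^esub> \<one>\<^bsub>AA\<^esub> = DJ (\<gamma> g) (Zc ?w \<beta>)"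
    using DJ_grp[OF g Z(1)[OF w]] by (simp add: eqf_def del: Op.simps)
  have Q: "eX (- 1) (?G ?P) \<in> Bil" using P by (simp del: Op.simps)
  \<comment> \<open>The contraction has now passed all factors and is evaluated at the unit, where
    there is nothing to contract.\<close>
  have "dd ?\<xi> (eX (- 1) (?G ?P)) \<one>\<^bsub>AA\<^esub> \<one>\<^bsub>AA\<^esub> = 0"
    unfolding dd_def by (rule iota_one[OF \<xi>' bilin_lform1[OF Q]]) simp
  then have 3: "eX (- 1) (dd ?\<xi> (?G ?P)) \<one>\<^bsub>AA\<^esub> \<one>\<^bsub>AA\<^esub> = DJ (\<gamma> g) (Zc ?w \<beta>)"
    using eqfD[OF eX_dd[OF \<xi>' P(2), of "- 1"], of "\<one>\<^bsub>AA\<^esub>" "\<one>\<^bsub>AA\<^esub>"] 2 by simp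
  have "DJ (\<gamma> g) (Zc (Cv g \<xi>) \<beta>) = DJ (\<gamma> g) (\<lambda>a b. Zc (Bv \<xi>) \<beta> a b - Zc ?w \<beta> a b)"
  proof (rule DJ_cong)
    show "Zc (Cv g \<xi>) \<beta> \<approx> (\<lambda>a b. Zc (Bv \<xi>) \<beta> a b - Zc ?w \<beta> a b)"
    proof (rule eqfI)
      fix a b assume ab: "a \<in> carrier AA" "b \<in> carrier AA"
      from lforms_minus[OF VV.module_axioms lform_vec[OF bilin_lform2[OF \<beta> ab(1)] ab(2)] Bv(1) w]
      show "Zc (Cv g \<xi>) \<beta> a b = Zc (Bv \<xi>) \<beta> a b - Zc ?w \<beta> a b"
        by (simp add: Zc_def Cv_def)
    qed
  qed (use g Z in simp_all)
  also have "\<dots> = DJ (\<gamma> g) (Zc (Bv \<xi>) \<beta>) - DJ (\<gamma> g) (Zc ?w \<beta>)"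
    using g Z w Bv(1) by (intro DJ_diff) simp_all
  finally show ?thesis using 1 3 by simp
qed

end

context gvtwist
begin

section \<open>The dual algebra\<close>

abbreviation "HJ \<equiv> twist HH (JJ 1)"
abbreviation "AH \<equiv> A_Hopf G V \<rho> u B"

lemma HJ_simps:
  "carrier HJ = carrier AA" "mult HJ = mult AA" "one HJ = one AA" "zero HJ = zero AA"
  "add HJ = add AA" "smult HJ = smult AA" "part HJ = part AA" "scounit HJ = scounit HH"
  "scomult HJ = (\<lambda>x. inv\<^bsub>TT\<^esub> (JJ 1) \<otimes>\<^bsub>TT\<^esub> scomult HH x \<otimes>\<^bsub>TT\<^esub> JJ 1)"
  by (simp_all add: twist_def Let_def HH_simps super_tensor_sq_HH)

lemma bilin_HJ: "bilin HJ HJ = Bil"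
  by (auto simp: bilin_iff HJ_simps)

lemma super_tensor_sq_HJ: "super_tensor_sq HJ = TT"
  by (simp add: super_tensor_sq_def tensor_def bilin_HJ HJ_simps pure_tensor_def)

lemma scomult_HJ_closed: "x \<in> carrier AA \<Longrightarrow> scomult HJ x \<in> carrier TT"
  by (simp add: HJ_simps inv_JJ)

lemma scomult_HJ_apply:
  assumes x: "x \<in> carrier AA" and \<beta>: "\<beta> \<in> Bil"
  shows "scomult HJ x \<beta> = DJ x \<beta>"
proof -
  let ?D = "scomult HH x"
  have D: "?D \<in> carrier TT" using x by simp
  have b1: "S.bact (JJ 1) \<beta> \<in> Bil" by (rule fopD(1)[OF fop_bact[OF JJ_closed] \<beta>])
  have b2: "S.bact ?D (S.bact (JJ 1) \<beta>) \<in> Bil" by (rule fopD(1)[OF fop_bact[OF D] b1])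
  have "scomult HJ x \<beta> = (JJ (- 1) \<otimes>\<^bsub>TT\<^esub> ?D) (S.bact (JJ 1) \<beta>)"
    using S.TT_mult_apply[OF S.TT_mult_closed[OF JJ_closed D] JJ_closed \<beta>] by (simp add: HJ_simps inv_JJ)
  also have "\<dots> = JJ (- 1) (S.bact ?D (S.bact (JJ 1) \<beta>))"
    by (rule S.TT_mult_apply[OF JJ_closed D b1])
  also have "\<dots> = eX (- 1) (S.bact ?D (S.bact (JJ 1) \<beta>)) \<one>\<^bsub>AA\<^esub> \<one>\<^bsub>AA\<^esub>"
    by (rule JJ_apply[OF b2])
  also have "\<dots> = DJ x \<beta>" unfolding DJ_def
    by (rule eqfD[OF fopD(2)[OF fop_eX b2 fopD(2)[OF fop_bact[OF D] b1 bact_JJ[OF \<beta>]]]]) simp_all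
  finally show ?thesis .
qed

lemma snd_part_closed: "t \<in> carrier TT \<Longrightarrow> snd_part HJ p t \<in> carrier TT"
  and snd_part_apply: "\<beta> \<in> Bil \<Longrightarrow> snd_part HJ p t \<beta> = t (\<lambda>a b. \<beta> a (part AA p b))"
proof -
  show "\<beta> \<in> Bil \<Longrightarrow> snd_part HJ p t \<beta> = t (\<lambda>a b. \<beta> a (part AA p b))"
    by (simp add: snd_part_def bilin_HJ HJ_simps)
  assume t: "t \<in> carrier TT"
  then obtain xs where xs: "set xs \<subseteq> carrier AA \<times> carrier AA" "t = list_tensor AA AA xs"
    using S.tensor_list by (metis S.TT_simps(1))
  have "(\<lambda>a b. \<beta> a (part AA p b)) \<in> Bil" if "\<beta> \<in> Bil" for \<beta>
    using that by (simp add: bilin_iff S.part_add S.part_smult)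
  then have "snd_part HJ p t = list_tensor AA AA (map (\<lambda>(a, b). (a, part AA p b)) xs)"
    by (auto simp: snd_part_def bilin_HJ HJ_simps xs(2) list_tensor_def o_def case_prod_unfold fun_eq_iff)
  moreover have "set (map (\<lambda>(a, b). (a, part AA p b)) xs) \<subseteq> carrier AA \<times> carrier AA" using xs(1) by auto
  ultimately show "snd_part HJ p t \<in> carrier TT"
    using S.list_tensor_in by (simp add: S.TT_simps(1))
qed

lemma AH_simps:
  "carrier AH = carrier AA" "add AH = add AA" "smult AH = smult AA" "zero AH = zero AA"
  "counit AH = scounit HH"
  "comult AH = (\<lambda>x. \<Oplus>\<^bsub>TT\<^esub>p\<in>{0, 1}. snd_part HJ 0 (scomult HJ (part AA p x)) \<ominus>\<^bsub>TT\<^esub>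
            ((-1) ^ p \<odot>\<^bsub>TT\<^esub> (pure_tensor AA AA (\<gamma> u) \<one>\<^bsub>AA\<^esub> \<otimes>\<^bsub>TT\<^esub> snd_part HJ 1 (scomult HJ (part AA p x)))))"
proof -
  have "AH = bosonize HJ (\<gamma> u)"
    by (simp add: A_Hopf_def Let_def super_tensor_sq_HH nil_exp_BT)
  moreover have "pure_tensor HJ HJ = pure_tensor AA AA"
    by (intro ext) (simp add: pure_tensor_def bilin_HJ)
  ultimately show "carrier AH = carrier AA" "add AH = add AA" "smult AH = smult AA" "zero AH = zero AA"
  "counit AH = scounit HH"
  "comult AH = (\<lambda>x. \<Oplus>\<^bsub>TT\<^esub>p\<in>{0, 1}. snd_part HJ 0 (scomult HJ (part AA p x)) \<ominus>\<^bsub>TT\<^esub>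
            ((-1) ^ p \<odot>\<^bsub>TT\<^esub> (pure_tensor AA AA (\<gamma> u) \<one>\<^bsub>AA\<^esub> \<otimes>\<^bsub>TT\<^esub> snd_part HJ 1 (scomult HJ (part AA p x)))))"
    unfolding bosonize_def Let_def super_tensor_sq_HJ
    by (simp_all add: module.defs bialgebra.defs HJ_simps(1-8))
qed

text \<open>f \<otimes> f' pulled back along t \<mapsto> t_0 - (-1)^p (u \<otimes> 1) t_1, with p
  the parity of the argument of the coproduct. The bosonized coproduct is thus evaluated through
  \<open>DJ\<close>.\<close>

definition bf :: "nat \<Rightarrow> (('g, 'v) gv \<Rightarrow> complex) \<Rightarrow> (('g, 'v) gv \<Rightarrow> complex) \<Rightarrow> ('g, 'v) gv \<Rightarrow> ('g, 'v) gv \<Rightarrow> complex" where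
  "bf p f f' = (\<lambda>a b. f a * f' (part AA 0 b) - (-1) ^ p * (f (\<gamma> u \<otimes>\<^bsub>AA\<^esub> a) * f' (part AA (Suc 0) b)))"

lemma bf_bilin [simp]: "f \<in> lforms AA \<Longrightarrow> f' \<in> lforms AA \<Longrightarrow> bf p f f' \<in> Bil"
  by (simp add: bf_def bilin_iff S.part_add S.part_smult S.r_distr lforms_add lforms_smult algebra_simps)

text \<open>The product of the dual algebra, without the cut-off outside the carrier, so that
  translated forms can be multiplied as they stand.\<close>

definition K :: "(('g, 'v) gv \<Rightarrow> complex) \<Rightarrow> (('g, 'v) gv \<Rightarrow> complex) \<Rightarrow> ('g, 'v) gv \<Rightarrow> complex" where
  "K f f' x = DJ (part AA 0 x) (bf 0 f f') + DJ (part AA (Suc 0) x) (bf (Suc 0) f f')"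

lemma tensor_eval_comult:
  assumes f: "f \<in> lforms AA" and f': "f' \<in> lforms AA" and x: "x \<in> carrier AA"
  shows "tensor_eval (comult AH x) f f' = K f f' x"
proof -
  interpret T: module CC TT by (rule S.module_TT)
  let ?U = "pure_tensor AA AA (\<gamma> u) \<one>\<^bsub>AA\<^esub>" and ?\<beta> = "\<lambda>a b. f a * f' b"
  define s where "s p = scomult HJ (part AA p x)" for p
  have s: "s p \<in> carrier TT" for p using x by (simp add: s_def scomult_HJ_closed)
  have U: "?U \<in> carrier TT" using S.module_A by (simp add: S.TT_simps(1))
  have \<beta>: "?\<beta> \<in> Bil" using f f' by (simp add: bilin_iff lforms_add lforms_smult algebra_simps)
  have b0: "(\<lambda>a b. f a * f' (part AA 0 b)) \<in> Bil"
    and b1: "(\<lambda>a b. f (\<gamma> u \<otimes>\<^bsub>AA\<^esub> a) * f' (part AA (Suc 0) b)) \<in> Bil"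
    using f f' by (simp_all add: bilin_iff S.part_add S.part_smult S.r_distr lforms_add lforms_smult algebra_simps)
  have m: "?U \<otimes>\<^bsub>TT\<^esub> snd_part HJ 1 (s p) \<in> carrier TT" for p
    using U s by (simp add: snd_part_closed)
  have val: "(snd_part HJ 0 (s p) \<ominus>\<^bsub>TT\<^esub> ((-1) ^ p \<odot>\<^bsub>TT\<^esub> (?U \<otimes>\<^bsub>TT\<^esub> snd_part HJ 1 (s p)))) ?\<beta> =
      DJ (part AA p x) (bf p f f')" for p
  proof -
    let ?t = "snd_part HJ 1 (s p)"
    have t: "?t \<in> carrier TT" using s by (rule snd_part_closed)
    have "(?U \<otimes>\<^bsub>TT\<^esub> ?t) ?\<beta> = S.bact ?t ?\<beta> (\<gamma> u) \<one>\<^bsub>AA\<^esub>"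
      using S.TT_mult_apply[OF U t \<beta>] fopD(1)[OF fop_bact[OF t] \<beta>] by (simp add: pure_tensor_apply)
    also have "\<dots> = s p (\<lambda>a b. S.mform ?\<beta> (\<gamma> u) \<one>\<^bsub>AA\<^esub> a (part AA (Suc 0) b))"
      unfolding S.bact_def by (subst snd_part_apply) (simp_all add: S.mform_bilin2[OF \<beta>])
    also have "\<dots> = s p (\<lambda>a b. f (\<gamma> u \<otimes>\<^bsub>AA\<^esub> a) * f' (part AA (Suc 0) b))"
    proof (rule S.tensor_congA[of "s p"])
      show "s p \<in> carrier (tensor AA AA)" using s[of p] by (simp add: S.TT_simps(1))
      fix a b assume ab: "a \<in> carrier AA" "b \<in> carrier AA"
      \<comment> \<open>Left multiplication by u \<otimes> 1 carries no sign, so the two parities of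
        a recombine.\<close>
      have "f (\<gamma> u \<otimes>\<^bsub>AA\<^esub> a) = f (\<gamma> u \<otimes>\<^bsub>AA\<^esub> part AA 0 a \<oplus>\<^bsub>AA\<^esub> \<gamma> u \<otimes>\<^bsub>AA\<^esub> part AA (Suc 0) a)"
        using S.part_sum[OF ab(1)] ab by (simp flip: S.r_distr)
      then have "f (\<gamma> u \<otimes>\<^bsub>AA\<^esub> a) = f (\<gamma> u \<otimes>\<^bsub>AA\<^esub> part AA 0 a) + f (\<gamma> u \<otimes>\<^bsub>AA\<^esub> part AA (Suc 0) a)"
        using ab f by (simp add: lforms_add)
      then show "S.mform ?\<beta> (\<gamma> u) \<one>\<^bsub>AA\<^esub> a (part AA (Suc 0) b) = f (\<gamma> u \<otimes>\<^bsub>AA\<^esub> a) * f' (part AA (Suc 0) b)"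
        using ab by (simp add: S.mform_eq[OF \<beta>] distrib_right)
    qed
    also have "\<dots> = DJ (part AA p x) (\<lambda>a b. f (\<gamma> u \<otimes>\<^bsub>AA\<^esub> a) * f' (part AA (Suc 0) b))"
      unfolding s_def by (rule scomult_HJ_apply[OF _ b1]) (use x in simp)
    finally have 1: "(?U \<otimes>\<^bsub>TT\<^esub> ?t) ?\<beta> = DJ (part AA p x) (\<lambda>a b. f (\<gamma> u \<otimes>\<^bsub>AA\<^esub> a) * f' (part AA (Suc 0) b))" .
    have 2: "snd_part HJ 0 (s p) ?\<beta> = DJ (part AA p x) (\<lambda>a b. f a * f' (part AA 0 b))"
      unfolding snd_part_apply[OF \<beta>] unfolding s_def by (rule scomult_HJ_apply[OF _ b0]) (use x in simp)
    have "(snd_part HJ 0 (s p) \<ominus>\<^bsub>TT\<^esub> ((-1) ^ p \<odot>\<^bsub>TT\<^esub> (?U \<otimes>\<^bsub>TT\<^esub> ?t))) ?\<beta> =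
        snd_part HJ 0 (s p) ?\<beta> - (-1) ^ p * (?U \<otimes>\<^bsub>TT\<^esub> ?t) ?\<beta>"
      using S.TT_minus_apply[OF snd_part_closed[OF s] smult_TT_closed[OF m] \<beta>] S.TT_smult_apply[OF \<beta>] by simp
    also have "\<dots> = DJ (part AA p x) (bf p f f')"
      unfolding 1 2 bf_def using x b0 b1
      by (simp add: DJ_diff[OF _ b0 S.bilin_cmult[OF b1]] DJ_cmult[OF _ b1])
    finally show ?thesis .
  qed
  have c: "snd_part HJ 0 (s p) \<ominus>\<^bsub>TT\<^esub> ((-1) ^ p \<odot>\<^bsub>TT\<^esub> (?U \<otimes>\<^bsub>TT\<^esub> snd_part HJ 1 (s p))) \<in> carrier TT" for p
    by (intro T.minus_closed snd_part_closed s smult_TT_closed m)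
  have "tensor_eval (comult AH x) f f' = (\<Sum>p\<in>{0, 1}. (snd_part HJ 0 (s p) \<ominus>\<^bsub>TT\<^esub>
      ((-1) ^ p \<odot>\<^bsub>TT\<^esub> (?U \<otimes>\<^bsub>TT\<^esub> snd_part HJ 1 (s p)))) ?\<beta>)"
    unfolding tensor_eval_def AH_simps s_def[symmetric]
    by (rule S.TT_finsum_apply[OF c _ \<beta>]) simp
  then show ?thesis unfolding val by (simp add: K_def)
qed

lemma part_vec:
  assumes "x \<in> carrier AA" "v \<in> carrier V"
  shows "part AA 0 (x \<otimes>\<^bsub>AA\<^esub> \<eta> v) = part AA (Suc 0) x \<otimes>\<^bsub>AA\<^esub> \<eta> v"
    "part AA (Suc 0) (x \<otimes>\<^bsub>AA\<^esub> \<eta> v) = part AA 0 x \<otimes>\<^bsub>AA\<^esub> \<eta> v"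
  using S.part_mult'(3,4)[of x "\<eta> v"] assms by simp_all

lemma part_grp:
  assumes "x \<in> carrier AA" "g \<in> carrier G"
  shows "part AA 0 (x \<otimes>\<^bsub>AA\<^esub> \<gamma> g) = part AA 0 x \<otimes>\<^bsub>AA\<^esub> \<gamma> g"
    "part AA (Suc 0) (x \<otimes>\<^bsub>AA\<^esub> \<gamma> g) = part AA (Suc 0) x \<otimes>\<^bsub>AA\<^esub> \<gamma> g"
  using S.part_mult'(1,2)[of x "\<gamma> g"] assms by simp_all

lemma DJ_part:
  assumes "x \<in> carrier AA" "\<beta> \<in> Bil"
  shows "DJ (part AA 0 x) (Sg \<beta>) = DJ (part AA 0 x) \<beta>"
    "DJ (part AA (Suc 0) x) (Sg \<beta>) = - DJ (part AA (Suc 0) x) \<beta>"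
  using DJ_sgm[of "part AA 0 x" \<beta>] DJ_sgm[of "part AA (Suc 0) x" \<beta>] assms
    lforms_uminus[OF S.module_A DJ_lform[OF assms(2)], of "part AA (Suc 0) x"] by simp_all

text \<open>u acts by -1 on each vector that it passes, so conjugation by u is the parity
  automorphism.\<close>

lemma u_left:
  assumes "x \<in> carrier AA"
  shows "\<gamma> u \<otimes>\<^bsub>AA\<^esub> x = S.sgm x \<otimes>\<^bsub>AA\<^esub> \<gamma> u"
  using assms
proof (induction x rule: AA_induct)
  case (grp g)
  then show ?case by (simp add: gen_mult u_comm)
next
  case (vec x v)
  then show ?case
    by (simp add: S.m_assoc[symmetric] sgm_vec S.l_minus) (simp add: vec_u)
next
  case (add x y)
  then show ?case by (simp add: S.r_distr S.l_distr S.sgm_add)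
next
  case (smult x c)
  then show ?case by (simp add: S.sgm_smult)
qed

lemma u_u_mult: "x \<in> carrier AA \<Longrightarrow> x \<otimes>\<^bsub>AA\<^esub> \<gamma> u \<otimes>\<^bsub>AA\<^esub> \<gamma> u = x"
  by (simp add: S.m_assoc gen_mult gen_one)

abbreviation rv :: "'v \<Rightarrow> (('g, 'v) gv \<Rightarrow> complex) \<Rightarrow> ('g, 'v) gv \<Rightarrow> complex" where
  "rv v f \<equiv> (\<lambda>x. f (x \<otimes>\<^bsub>AA\<^esub> \<eta> v))"
abbreviation ru :: "(('g, 'v) gv \<Rightarrow> complex) \<Rightarrow> ('g, 'v) gv \<Rightarrow> complex" where
  "ru f \<equiv> (\<lambda>x. f (x \<otimes>\<^bsub>AA\<^esub> \<gamma> u))"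

text \<open>Since conjugation by u is the parity automorphism, the terms in which v lands in the
  second factor are again of the shape \<open>bf\<close>, for f(\<cdot> u) and f'(\<cdot> v). This
  is shared by \<open>K_vec\<close> and \<open>K_iota\<close>.\<close>

lemma bf_bracket:
  assumes f: "f \<in> lforms AA" and f': "f' \<in> lforms AA" and v: "v \<in> carrier V"
  shows "Sg (bf p (ru f) (rv v f')) \<approx> (\<lambda>a b. (-1) ^ p * (f a * f' (part AA (Suc 0) b \<otimes>\<^bsub>AA\<^esub> \<eta> v)) +
      f (\<gamma> u \<otimes>\<^bsub>AA\<^esub> a) * f' (part AA 0 b \<otimes>\<^bsub>AA\<^esub> \<eta> v))"
proof (rule eqfI)
  fix a b assume ab: "a \<in> carrier AA" "b \<in> carrier AA"
  have "\<gamma> u \<otimes>\<^bsub>AA\<^esub> S.sgm a \<otimes>\<^bsub>AA\<^esub> \<gamma> u = a"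
    using u_left[of "S.sgm a"] ab by (simp add: u_u_mult)
  moreover have "S.sgm a \<otimes>\<^bsub>AA\<^esub> \<gamma> u = \<gamma> u \<otimes>\<^bsub>AA\<^esub> a" using u_left[of a] ab by simp
  moreover have "f' ((\<ominus>\<^bsub>AA\<^esub> part AA (Suc 0) b) \<otimes>\<^bsub>AA\<^esub> \<eta> v) = - f' (part AA (Suc 0) b \<otimes>\<^bsub>AA\<^esub> \<eta> v)"
    using ab v by (simp add: S.l_minus lforms_uminus[OF S.module_A f'])
  ultimately show "Sg (bf p (ru f) (rv v f')) a b = (-1) ^ p * (f a * f' (part AA (Suc 0) b \<otimes>\<^bsub>AA\<^esub> \<eta> v)) +
      f (\<gamma> u \<otimes>\<^bsub>AA\<^esub> a) * f' (part AA 0 b \<otimes>\<^bsub>AA\<^esub> \<eta> v)"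
    using ab by (simp add: Sg_def bf_def)
qed

text \<open>The bosonized coproduct of a vector is v \<otimes> 1 + u \<otimes> v: the translation by
  u replaces the Koszul sign.\<close>

lemma K_vec:
  assumes f: "f \<in> lforms AA" and f': "f' \<in> lforms AA" and x: "x \<in> carrier AA" and v: "v \<in> carrier V"
  shows "K f f' (x \<otimes>\<^bsub>AA\<^esub> \<eta> v) = K (rv v f) f' x + K (ru f) (rv v f') x"
proof -
  have l: "rv v f \<in> lforms AA" "ru f \<in> lforms AA" "rv v f' \<in> lforms AA"
    using f f' v by (simp_all add: lform_rmult)
  let ?S = "\<lambda>p. Sg (bf p (ru f) (rv v f'))"
  \<comment> \<open>Here p is the parity of x and q that of x v, hence the opposite signs.\<close>
  have eq: "Op (Inr v) (bf q f f') \<approx> (\<lambda>a b. bf p (rv v f) f' a b + (-1) ^ p * ?S p a b)"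
    if pq: "(-1 :: complex) ^ q = - ((-1) ^ p)" for p q
  proof (rule eqfI)
    fix a b assume ab: "a \<in> carrier AA" "b \<in> carrier AA"
    have 1: "(-1) ^ p * ((-1) ^ p * z) = z" for z :: complex
      by (simp flip: mult.assoc power_mult_distrib)
    show "Op (Inr v) (bf q f f') a b = bf p (rv v f) f' a b + (-1) ^ p * ?S p a b"
      unfolding eqfD[OF bf_bracket[OF f f' v] ab] distrib_left 1 using ab v
      by (simp add: bf_def pq part_vec S.m_assoc lforms_uminus[OF S.module_A f'])
  qed
  have main: "DJ y (Op (Inr v) (bf q f f')) = DJ y (bf p (rv v f) f') + (-1) ^ p * DJ y (?S p)"
    if pq: "(-1 :: complex) ^ q = - ((-1) ^ p)" and y: "y \<in> carrier AA" for p q y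
  proof -
    have "DJ y (Op (Inr v) (bf q f f')) = DJ y (\<lambda>a b. bf p (rv v f) f' a b + (-1) ^ p * ?S p a b)"
      by (rule DJ_cong[OF y _ eq[OF pq]]) (use f f' v in \<open>simp del: Op.simps\<close>)
    also have "\<dots> = DJ y (bf p (rv v f) f') + DJ y (\<lambda>a b. (-1) ^ p * ?S p a b)"
      by (rule DJ_add[OF y]) (use l f' in \<open>simp_all add: S.bilin_cmult\<close>)
    also have "DJ y (\<lambda>a b. (-1) ^ p * ?S p a b) = (-1) ^ p * DJ y (?S p)"
      by (rule DJ_cmult[OF y]) (use l in simp)
    finally show ?thesis .
  qed
  have "K f f' (x \<otimes>\<^bsub>AA\<^esub> \<eta> v) = DJ (part AA (Suc 0) x) (Op (Inr v) (bf 0 f f')) + DJ (part AA 0 x) (Op (Inr v) (bf (Suc 0) f f'))"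
    unfolding K_def part_vec[OF x v] using x v f f' by (simp add: DJ_vec del: Op.simps)
  also have "\<dots> = K (rv v f) f' x + K (ru f) (rv v f') x"
    unfolding K_def using x l by (simp add: main[of 0 "Suc 0"] main[of "Suc 0" 0] DJ_part del: Op.simps)
  finally show ?thesis .
qed

lemma K_u:
  assumes f: "f \<in> lforms AA" and f': "f' \<in> lforms AA" and x: "x \<in> carrier AA"
  shows "K f f' (x \<otimes>\<^bsub>AA\<^esub> \<gamma> u) = K (ru f) (ru f') x"
proof -
  have "DJ (y \<otimes>\<^bsub>AA\<^esub> \<gamma> u) (bf p f f') = DJ y (bf p (ru f) (ru f'))" if y: "y \<in> carrier AA" for y p
  proof -
    have eq: "Op (Inl u) (bf p f f') \<approx> bf p (ru f) (ru f')"
      by (simp add: eqf_def bf_def part_grp S.m_assoc)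
    have b: "Op (Inl u) (bf p f f') \<in> Bil" using f f' by (intro Op_bilin) simp_all
    show ?thesis
      using DJ_u[OF y bf_bilin[OF f f']] DJ_cong[OF y b eq] by simp
  qed
  then show ?thesis using x by (simp add: K_def part_grp)
qed

lemma K_lform: "f \<in> lforms AA \<Longrightarrow> f' \<in> lforms AA \<Longrightarrow> K f f' \<in> lforms AA"
  by (simp add: lforms_iff[of "K f f'"] K_def S.part_add S.part_smult DJ_x_add DJ_x_smult algebra_simps)

lemma K_grp: "g \<in> carrier G \<Longrightarrow> f \<in> lforms AA \<Longrightarrow> f' \<in> lforms AA \<Longrightarrow> K f f' (\<gamma> g) = DJ (\<gamma> g) (bf 0 f f')"
  using lforms_zero[OF S.module_A DJ_lform[of "bf (Suc 0) f f'"]] by (simp add: K_def)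

lemma K_cong:
  assumes f: "f \<in> lforms AA" and f': "f' \<in> lforms AA" and x: "x \<in> carrier AA"
    and "\<And>x. x \<in> carrier AA \<Longrightarrow> f x = h x" "\<And>x. x \<in> carrier AA \<Longrightarrow> f' x = h' x"
  shows "K f f' x = K h h' x"
proof -
  have "bf p f f' \<approx> bf p h h'" for p using assms(4,5) by (simp add: eqf_def bf_def)
  then show ?thesis unfolding K_def using f f' x
    by (intro arg_cong2[where f = "(+)"] DJ_cong) simp_all
qed

lemma K_add1:
  assumes "f \<in> lforms AA" "h \<in> lforms AA" "f' \<in> lforms AA" "x \<in> carrier AA"
  shows "K (\<lambda>x. f x + h x) f' x = K f f' x + K h f' x"
proof -
  have "bf p (\<lambda>x. f x + h x) f' = (\<lambda>a b. bf p f f' a b + bf p h f' a b)" for p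
    by (simp add: bf_def fun_eq_iff algebra_simps)
  then show ?thesis using assms by (simp add: K_def DJ_add)
qed

lemma K_add2:
  assumes "f \<in> lforms AA" "h \<in> lforms AA" "f' \<in> lforms AA" "x \<in> carrier AA"
  shows "K f' (\<lambda>x. f x + h x) x = K f' f x + K f' h x"
proof -
  have "bf p f' (\<lambda>x. f x + h x) = (\<lambda>a b. bf p f' f a b + bf p f' h a b)" for p
    by (simp add: bf_def fun_eq_iff algebra_simps)
  then show ?thesis using assms by (simp add: K_def DJ_add)
qed

lemma K_cmult1:
  assumes "f \<in> lforms AA" "f' \<in> lforms AA" "x \<in> carrier AA"
  shows "K (\<lambda>x. c * f x) f' x = c * K f f' x"
proof -
  have "bf p (\<lambda>x. c * f x) f' = (\<lambda>a b. c * bf p f f' a b)" for p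
    by (simp add: bf_def fun_eq_iff algebra_simps)
  then show ?thesis using assms by (simp add: K_def DJ_cmult algebra_simps)
qed

lemma K_cmult2:
  assumes "f \<in> lforms AA" "f' \<in> lforms AA" "x \<in> carrier AA"
  shows "K f (\<lambda>x. c * f' x) x = c * K f f' x"
proof -
  have "bf p f (\<lambda>x. c * f' x) = (\<lambda>a b. c * bf p f f' a b)" for p
    by (simp add: bf_def fun_eq_iff algebra_simps)
  then show ?thesis using assms by (simp add: K_def DJ_cmult algebra_simps)
qed

subsection \<open>Products of special forms\<close>

lemma XB_zero:
  assumes "\<And>x v b. x \<in> carrier AA \<Longrightarrow> v \<in> carrier V \<Longrightarrow> b \<in> carrier AA \<Longrightarrow> \<beta> (x \<otimes>\<^bsub>AA\<^esub> \<eta> v) b = 0"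
  shows "XB \<beta> \<approx> (\<lambda>a b. 0)"
proof (rule eqfI)
  fix a b assume "a \<in> carrier AA" "b \<in> carrier AA"
  then have "XB \<beta> a b = (\<Sum>z\<leftarrow>bs. 0)"
    unfolding XB_def by (intro bs_cong) (use assms bs_in in simp)
  then show "XB \<beta> a b = 0" by simp
qed

lemma eX_id:
  assumes \<beta>: "\<beta> \<in> Bil" and zero: "XB \<beta> \<approx> (\<lambda>a b. 0)"
  shows "eX c \<beta> \<approx> \<beta>"
proof (rule eqfI)
  fix a b assume ab: "a \<in> carrier AA" "b \<in> carrier AA"
  have "(XB ^^ Suc k) \<beta> a b = 0" for k
  proof -
    have "(XB ^^ k) (XB \<beta>) \<approx> (XB ^^ k) (\<lambda>a b. 0 * \<beta> a b)"
      by (rule fopD(2)[OF fop_XBk fopD(1)[OF fop_XB \<beta>]]) (use zero in simp)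
    also have "\<dots> \<approx> (\<lambda>a b. 0 * (XB ^^ k) \<beta> a b)" by (rule fopD(4)[OF fop_XBk \<beta>])
    finally show ?thesis using ab by (simp add: eqf_def funpow_swap1)
  qed
  moreover have "\<beta> a b = 0" if "nilp = 0" using XBk_zero[OF \<beta> _ ab, of 0] that by simp
  ultimately show "eX c \<beta> a b = \<beta> a b"
    unfolding eX_def by (simp add: sum.atMost_shift del: funpow.simps(2))
qed

text \<open>A function on G kills multiples of vectors in the first factor, and every term of B puts
  a vector there. So J and its inverse act trivially, and the product is pointwise on G.\<close>

lemma K_phi:
  assumes g: "g \<in> carrier G" and f: "f \<in> lforms AA"
  shows "K (phi \<phi>) f (\<gamma> g) = \<phi> g * f (\<gamma> g)"
proof -
  let ?\<beta> = "bf 0 (phi \<phi>) f"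
  have \<beta>: "?\<beta> \<in> Bil" using f phi_lform by simp
  have 0: "?\<beta> (x \<otimes>\<^bsub>AA\<^esub> \<eta> v) b = 0" if "x \<in> carrier AA" "v \<in> carrier V" for x v b
    using that by (simp add: bf_def phi_vec flip: S.m_assoc)
  have 1: "eX 1 ?\<beta> \<approx> ?\<beta>" by (rule eX_id[OF \<beta> XB_zero]) (use 0 in simp)
  have G: "Op (Inl g) ?\<beta> \<in> Bil" using \<beta> g by (intro Op_bilin) simp_all
  have 2: "eX (- 1) (Op (Inl g) ?\<beta>) \<approx> Op (Inl g) ?\<beta>"
    by (rule eX_id[OF G XB_zero]) (use g 0 in \<open>simp add: vec_g\<close>)
  have "eX (- 1) (Op (Inl g) (eX 1 ?\<beta>)) \<approx> eX (- 1) (Op (Inl g) ?\<beta>)"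
    by (rule fopD(2)[OF fop_eX Op_bilin[OF _ eX_bilin[OF \<beta>]] fopD(2)[OF fop_Op eX_bilin[OF \<beta>] 1]]) (use g in simp_all)
  with 2 have "eX (- 1) (Op (Inl g) (eX 1 ?\<beta>)) \<approx> Op (Inl g) ?\<beta>" by (blast intro: eqf_trans)
  then have "DJ (\<gamma> g) ?\<beta> = Op (Inl g) ?\<beta> \<one>\<^bsub>AA\<^esub> \<one>\<^bsub>AA\<^esub>"
    using DJ_grp[OF g \<beta>] by (simp add: eqf_def del: Op.simps)
  also have "\<dots> = \<phi> g * f (\<gamma> g)"
    using g lforms_zero[OF S.module_A f] by (simp add: bf_def phi_grp)
  finally show ?thesis using K_grp[OF g phi_lform f] by simp
qed

text \<open>\<open>DJ_dd\<close> trades the contraction in the first factor for a vector in the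
  second, and \<open>bf_bracket\<close> reads the outcome as a product again.\<close>

lemma K_iota:
  assumes g: "g \<in> carrier G" and \<xi>: "\<xi> \<in> lforms V" and f: "f \<in> lforms AA" and f': "f' \<in> lforms AA"
  shows "K (iota \<xi> f) f' (\<gamma> g) = - K (ru f) (rv (Cv g \<xi>) f') (\<gamma> g)"
proof -
  let ?c = "Cv g \<xi>"
  \<comment> \<open>The plus sign compensates the \<open>\<sigma>\<close> in \<open>dd\<close>:
    contracting \<open>?B\<close> gives the form that belongs to the product of
    \<open>iota \<xi> f\<close> and f'.\<close>
  let ?B = "\<lambda>a b. f a * f' (part AA 0 b) + f (\<gamma> u \<otimes>\<^bsub>AA\<^esub> a) * f' (part AA (Suc 0) b)"
  have c: "?c \<in> carrier V" using g by simp
  have B: "?B \<in> Bil"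
    using f f' by (simp add: bilin_iff S.part_add S.part_smult S.r_distr lforms_add lforms_smult algebra_simps)
  have l: "(\<lambda>x. f (\<gamma> u \<otimes>\<^bsub>AA\<^esub> x)) \<in> lforms AA" using f by (simp add: lform_lmult)
  have "bf 0 (iota \<xi> f) f' \<approx> dd \<xi> ?B"
  proof (rule eqfI)
    fix a b assume ab: "a \<in> carrier AA" "b \<in> carrier AA"
    let ?r = "f' (part AA 0 b)" and ?s = "- f' (part AA (Suc 0) b)"
    have "dd \<xi> ?B a b = iota \<xi> (\<lambda>x. ?r * f x + ?s * f (\<gamma> u \<otimes>\<^bsub>AA\<^esub> x)) a"
      unfolding dd_def using ab by (intro iota_cong[OF \<xi> bilin_lform1[OF B]])
        (simp_all add: lforms_uminus[OF S.module_A f'])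
    also have "\<dots> = ?r * iota \<xi> f a + ?s * iota \<xi> f (\<gamma> u \<otimes>\<^bsub>AA\<^esub> a)"
      using ab f l \<xi> lform_lin(2)[OF f f] lform_lin(2)[OF l l]
      by (simp only: iota_add iota_cmult iota_left u_in)
    finally show "bf 0 (iota \<xi> f) f' a b = dd \<xi> ?B a b" by (simp add: bf_def)
  qed
  then have "K (iota \<xi> f) f' (\<gamma> g) = DJ (\<gamma> g) (dd \<xi> ?B)"
    using K_grp[OF g iota_lform[OF \<xi> f] f'] DJ_cong[OF _ bf_bilin[OF iota_lform[OF \<xi> f] f']] g by simp
  also have "\<dots> = - DJ (\<gamma> g) (Zc ?c ?B)" by (rule DJ_dd[OF g \<xi> B])
  also have "DJ (\<gamma> g) (Zc ?c ?B) = DJ (\<gamma> g) (Sg (bf 0 (ru f) (rv ?c f')))"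
  proof (rule DJ_cong)
    show "Zc ?c ?B \<approx> Sg (bf 0 (ru f) (rv ?c f'))"
      using eqf_sym[OF bf_bracket[OF f f' c, of 0]] c by (simp add: eqf_def Zc_def part_vec)
  qed (use g fopD(1)[OF fop_Zc[OF c] B] in simp_all)
  also have "\<dots> = DJ (\<gamma> g) (bf 0 (ru f) (rv ?c f'))"
    using DJ_sgm[of "\<gamma> g" "bf 0 (ru f) (rv ?c f')"] g c f f' by (simp add: lform_rmult)
  also have "\<dots> = K (ru f) (rv ?c f') (\<gamma> g)"
    using g c f f' by (simp add: K_grp lform_rmult)
  finally show ?thesis .
qed

end

context gvtwist
begin

subsection \<open>Multiplication by forms that vanish on \<open>V\<close>\<close>

definition mu :: "('g \<Rightarrow> complex) \<Rightarrow> (('g, 'v) gv \<Rightarrow> complex) \<Rightarrow> ('g, 'v) gv \<Rightarrow> complex" where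
  "mu \<phi> f = K (phi \<phi>) f"

abbreviation pu :: "('g \<Rightarrow> complex) \<Rightarrow> 'g \<Rightarrow> complex" where
  "pu \<phi> \<equiv> (\<lambda>g. \<phi> (g \<otimes>\<^bsub>G\<^esub> u))"

lemma lform_0: "(\<lambda>x. 0) \<in> lforms M"
  by (simp add: lforms_iff)

lemma lforms_eqI [consumes 3, case_names grp vec]:
  assumes "f \<in> lforms AA" "f' \<in> lforms AA" "x \<in> carrier AA"
    "\<And>g. g \<in> carrier G \<Longrightarrow> f (\<gamma> g) = f' (\<gamma> g)"
    "\<And>x v. x \<in> carrier AA \<Longrightarrow> v \<in> carrier V \<Longrightarrow> f x = f' x \<Longrightarrow> f (x \<otimes>\<^bsub>AA\<^esub> \<eta> v) = f' (x \<otimes>\<^bsub>AA\<^esub> \<eta> v)"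
  shows "f x = f' x"
  using assms(3)
  by (induction x rule: AA_induct) (use assms in \<open>simp_all add: lforms_add lforms_smult\<close>)

lemma phi_cong:
  assumes "\<And>g. g \<in> carrier G \<Longrightarrow> \<phi> g = \<psi> g" "x \<in> carrier AA"
  shows "phi \<phi> x = phi \<psi> x"
  using phi_lform phi_lform assms(2)
  by (rule lforms_eqI) (simp_all add: phi_grp phi_vec assms(1))

lemma phi_u: "x \<in> carrier AA \<Longrightarrow> phi \<phi> (x \<otimes>\<^bsub>AA\<^esub> \<gamma> u) = phi (pu \<phi>) x"
  by (rule lforms_eqI[of "ru (phi \<phi>)"])
    (simp_all add: phi_lform lform_rmult phi_grp gen_mult vec_u lforms_uminus[OF S.module_A phi_lform] phi_vec)

lemma phi_cmult: "x \<in> carrier AA \<Longrightarrow> phi (\<lambda>g. c * \<phi> g) x = c * phi \<phi> x"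
  by (rule lforms_eqI[of "phi (\<lambda>g. c * \<phi> g)" "\<lambda>x. c * phi \<phi> x"])
    (simp_all add: phi_lform lform_lin(2)[OF phi_lform phi_lform] phi_grp phi_vec)

lemma mu_lform: "f \<in> lforms AA \<Longrightarrow> mu \<phi> f \<in> lforms AA"
  unfolding mu_def by (rule K_lform[OF phi_lform])

lemma mu_cong:
  assumes "f \<in> lforms AA" "x \<in> carrier AA" "\<And>g. g \<in> carrier G \<Longrightarrow> \<phi> g = \<psi> g"
    "\<And>x. x \<in> carrier AA \<Longrightarrow> f x = f' x"
  shows "mu \<phi> f x = mu \<psi> f' x"
  unfolding mu_def by (rule K_cong) (use assms phi_lform phi_cong[OF assms(3)] in auto)

lemma mu_grp: "g \<in> carrier G \<Longrightarrow> f \<in> lforms AA \<Longrightarrow> mu \<phi> f (\<gamma> g) = \<phi> g * f (\<gamma> g)"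
  unfolding mu_def by (rule K_phi)

text \<open>Of the two terms in \<open>K_vec\<close> the first vanishes, since functions on G kill
  multiples of V; the second translates \<phi> by u.\<close>

lemma mu_vec:
  assumes "f \<in> lforms AA" "x \<in> carrier AA" "v \<in> carrier V"
  shows "mu \<phi> f (x \<otimes>\<^bsub>AA\<^esub> \<eta> v) = mu (pu \<phi>) (rv v f) x"
proof -
  have rvf: "rv v f \<in> lforms AA" using assms by (simp add: lform_rmult)
  have "K (rv v (phi \<phi>)) f x = K (\<lambda>x. 0 * 0) f x"
    by (rule K_cong) (use assms in \<open>simp_all add: phi_lform lform_rmult phi_vec\<close>)
  also have "\<dots> = 0" by (subst K_cmult1[OF lform_0]) (use assms in simp_all)
  finally have 1: "K (rv v (phi \<phi>)) f x = 0" .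
  have "K (ru (phi \<phi>)) (rv v f) x = K (phi (pu \<phi>)) (rv v f) x"
    by (rule K_cong) (use assms rvf in \<open>simp_all add: phi_lform lform_rmult phi_u\<close>)
  then show ?thesis using 1 K_vec[OF phi_lform assms] by (simp add: mu_def)
qed

lemma mu_u:
  assumes "f \<in> lforms AA" "x \<in> carrier AA"
  shows "mu \<phi> f (x \<otimes>\<^bsub>AA\<^esub> \<gamma> u) = mu (pu \<phi>) (ru f) x"
  unfolding mu_def K_u[OF phi_lform assms]
  by (rule K_cong) (use assms in \<open>simp_all add: phi_lform lform_rmult phi_u\<close>)

lemma mu_add: "f \<in> lforms AA \<Longrightarrow> f' \<in> lforms AA \<Longrightarrow> x \<in> carrier AA \<Longrightarrow>
    mu \<phi> (\<lambda>x. f x + f' x) x = mu \<phi> f x + mu \<phi> f' x"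
  unfolding mu_def by (rule K_add2[OF _ _ phi_lform])

lemma mu_cmult: "f \<in> lforms AA \<Longrightarrow> x \<in> carrier AA \<Longrightarrow> mu \<phi> (\<lambda>x. c * f x) x = c * mu \<phi> f x"
  unfolding mu_def by (rule K_cmult2[OF phi_lform])

lemma mu_scale:
  assumes "f \<in> lforms AA" "x \<in> carrier AA"
  shows "mu (\<lambda>g. c * \<phi> g) f x = c * mu \<phi> f x"
proof -
  have "mu (\<lambda>g. c * \<phi> g) f x = K (\<lambda>x. c * phi \<phi> x) f x"
    unfolding mu_def by (rule K_cong) (use assms phi_lform in \<open>simp_all add: phi_cmult\<close>)
  also have "\<dots> = c * mu \<phi> f x" unfolding mu_def by (rule K_cmult1[OF phi_lform assms])
  finally show ?thesis .
qed

lemma mu_sum_list: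
  assumes "\<And>z. z \<in> set zs \<Longrightarrow> h z \<in> lforms AA" "x \<in> carrier AA"
  shows "mu \<phi> (\<lambda>x. \<Sum>z\<leftarrow>zs. h z x) x = (\<Sum>z\<leftarrow>zs. mu \<phi> (h z) x)"
  using assms(1)
proof (induction zs)
  case Nil
  from mu_cmult[OF lform_0 assms(2), of \<phi> 0] show ?case by simp
next
  case (Cons z zs)
  then show ?case using assms(2) by (simp add: mu_add lforms_sum_list)
qed

lemma mu_g:
  assumes "f \<in> lforms AA" "x \<in> carrier AA" "g \<in> carrier G"
  shows "mu \<phi> f (x \<otimes>\<^bsub>AA\<^esub> \<gamma> g) = mu (\<lambda>h. \<phi> (h \<otimes>\<^bsub>G\<^esub> g)) (\<lambda>x. f (x \<otimes>\<^bsub>AA\<^esub> \<gamma> g)) x"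
  using assms(2,1)
proof (induction x arbitrary: f \<phi> rule: AA_induct)
  case (grp h)
  then show ?case using assms(3) by (simp add: gen_mult mu_grp lform_rmult)
next
  case (vec x v)
  let ?v = "\<rho> (inv\<^bsub>G\<^esub> g) v"
  have l: "rv ?v f \<in> lforms AA" "(\<lambda>x. f (x \<otimes>\<^bsub>AA\<^esub> \<gamma> g)) \<in> lforms AA" "(\<lambda>x. f (x \<otimes>\<^bsub>AA\<^esub> \<gamma> g \<otimes>\<^bsub>AA\<^esub> \<eta> ?v)) \<in> lforms AA"
    using vec assms(3) lform_rmult[OF lform_rmult[OF vec(4), of "\<eta> ?v"], of "\<gamma> g"] by (simp_all add: lform_rmult)
  have "mu \<phi> f (x \<otimes>\<^bsub>AA\<^esub> \<eta> v \<otimes>\<^bsub>AA\<^esub> \<gamma> g) = mu \<phi> f (x \<otimes>\<^bsub>AA\<^esub> \<gamma> g \<otimes>\<^bsub>AA\<^esub> \<eta> ?v)"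
    using vec assms(3) by (simp add: vec_g)
  also have "\<dots> = mu (pu \<phi>) (rv ?v f) (x \<otimes>\<^bsub>AA\<^esub> \<gamma> g)"
    by (rule mu_vec) (use vec assms(3) in simp_all)
  also have "\<dots> = mu (\<lambda>h. \<phi> (h \<otimes>\<^bsub>G\<^esub> g \<otimes>\<^bsub>G\<^esub> u)) (\<lambda>x. f (x \<otimes>\<^bsub>AA\<^esub> \<gamma> g \<otimes>\<^bsub>AA\<^esub> \<eta> ?v)) x"
    by (rule vec(3)[OF l(1)])
  also have "\<dots> = mu (\<lambda>h. \<phi> (h \<otimes>\<^bsub>G\<^esub> u \<otimes>\<^bsub>G\<^esub> g)) (\<lambda>x. f (x \<otimes>\<^bsub>AA\<^esub> \<eta> v \<otimes>\<^bsub>AA\<^esub> \<gamma> g)) x"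
    by (rule mu_cong[OF l(3)]) (use vec assms(3) in \<open>simp_all add: vec_g GG.m_assoc u_comm\<close>)
  also have "\<dots> = mu (\<lambda>h. \<phi> (h \<otimes>\<^bsub>G\<^esub> g)) (\<lambda>x. f (x \<otimes>\<^bsub>AA\<^esub> \<gamma> g)) (x \<otimes>\<^bsub>AA\<^esub> \<eta> v)"
    by (rule mu_vec[symmetric]) (use vec l in simp_all)
  finally show ?case .
next
  case (add x y)
  then show ?case using assms(3) by (simp add: S.l_distr lforms_add[OF mu_lform] lform_rmult)
next
  case (smult x c)
  then show ?case using assms(3) by (simp add: lforms_smult[OF mu_lform] lform_rmult)
qed

lemma mu_left_u:
  assumes "f \<in> lforms AA" "x \<in> carrier AA"
  shows "mu \<phi> f (\<gamma> u \<otimes>\<^bsub>AA\<^esub> x) = mu (pu \<phi>) (\<lambda>x. f (\<gamma> u \<otimes>\<^bsub>AA\<^esub> x)) x"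
  using assms(2,1)
proof (induction x arbitrary: f \<phi> rule: AA_induct)
  case (grp h)
  then show ?case by (simp add: gen_mult mu_grp lform_lmult u_comm)
next
  case (vec x v)
  have l: "rv v f \<in> lforms AA" "(\<lambda>x. f (\<gamma> u \<otimes>\<^bsub>AA\<^esub> x)) \<in> lforms AA" "(\<lambda>x. f (\<gamma> u \<otimes>\<^bsub>AA\<^esub> x \<otimes>\<^bsub>AA\<^esub> \<eta> v)) \<in> lforms AA"
    using vec lform_lmult[OF lform_rmult[OF vec(4), of "\<eta> v"], of "\<gamma> u"] by (simp_all add: lform_rmult lform_lmult)
  have "mu \<phi> f (\<gamma> u \<otimes>\<^bsub>AA\<^esub> (x \<otimes>\<^bsub>AA\<^esub> \<eta> v)) = mu \<phi> f (\<gamma> u \<otimes>\<^bsub>AA\<^esub> x \<otimes>\<^bsub>AA\<^esub> \<eta> v)"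
    using vec by (simp add: S.m_assoc)
  also have "\<dots> = mu (pu \<phi>) (rv v f) (\<gamma> u \<otimes>\<^bsub>AA\<^esub> x)"
    by (rule mu_vec) (use vec in simp_all)
  also have "\<dots> = mu (pu (pu \<phi>)) (\<lambda>x. f (\<gamma> u \<otimes>\<^bsub>AA\<^esub> x \<otimes>\<^bsub>AA\<^esub> \<eta> v)) x"
    by (rule vec(3)[OF l(1)])
  also have "\<dots> = mu (pu (pu \<phi>)) (\<lambda>x. f (\<gamma> u \<otimes>\<^bsub>AA\<^esub> (x \<otimes>\<^bsub>AA\<^esub> \<eta> v))) x"
    by (rule mu_cong[OF l(3)]) (use vec in \<open>simp_all add: S.m_assoc\<close>)
  also have "\<dots> = mu (pu \<phi>) (\<lambda>x. f (\<gamma> u \<otimes>\<^bsub>AA\<^esub> x)) (x \<otimes>\<^bsub>AA\<^esub> \<eta> v)"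
    by (rule mu_vec[symmetric]) (use vec l in simp_all)
  finally show ?case .
next
  case (add x y)
  then show ?case by (simp add: S.r_distr lforms_add[OF mu_lform] lform_lmult)
next
  case (smult x c)
  then show ?case by (simp add: lforms_smult[OF mu_lform] lform_lmult)
qed

lemma mu_mu:
  assumes "f \<in> lforms AA" "x \<in> carrier AA"
  shows "mu \<phi> (mu \<psi> f) x = mu (\<lambda>g. \<phi> g * \<psi> g) f x"
  using assms(2,1)
proof (induction x arbitrary: f \<phi> \<psi> rule: AA_induct)
  case (grp h)
  then show ?case by (simp add: mu_grp mu_lform)
next
  case (vec x v)
  have l: "rv v f \<in> lforms AA" "rv v (mu \<psi> f) \<in> lforms AA" using vec by (simp_all add: lform_rmult mu_lform)
  have "mu \<phi> (mu \<psi> f) (x \<otimes>\<^bsub>AA\<^esub> \<eta> v) = mu (pu \<phi>) (rv v (mu \<psi> f)) x"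
    using vec by (simp add: mu_vec mu_lform)
  also have "\<dots> = mu (pu \<phi>) (mu (pu \<psi>) (rv v f)) x"
    by (rule mu_cong[OF l(2)]) (use vec in \<open>simp_all add: mu_vec\<close>)
  also have "\<dots> = mu (\<lambda>g. pu \<phi> g * pu \<psi> g) (rv v f) x" by (rule vec(3)[OF l(1)])
  also have "\<dots> = mu (\<lambda>g. \<phi> g * \<psi> g) f (x \<otimes>\<^bsub>AA\<^esub> \<eta> v)" using vec by (simp add: mu_vec)
  finally show ?case .
next
  case (add x y)
  then show ?case by (simp add: lforms_add[OF mu_lform] mu_lform)
next
  case (smult x c)
  then show ?case by (simp add: lforms_smult[OF mu_lform] mu_lform)
qed

text \<open>The contracted vector still translates \<phi> by u. For \<open>zet\<close>, which is odd
  under this translation, the rule becomes anticommutation.\<close>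

lemma mu_iota:
  assumes \<xi>: "\<xi> \<in> lforms V" and "f \<in> lforms AA" "x \<in> carrier AA"
  shows "mu \<phi> (iota \<xi> f) x = iota \<xi> (mu (pu \<phi>) f) x"
  using assms(3,2)
proof (induction x arbitrary: f \<phi> rule: AA_induct)
  case (grp h)
  then show ?case using \<xi> by (simp add: mu_grp mu_lform iota_lform iota_g)
next
  case (vec x v)
  have l: "rv v f \<in> lforms AA" "rv v (iota \<xi> f) \<in> lforms AA" "iota \<xi> (rv v f) \<in> lforms AA"
    using vec \<xi> by (simp_all add: lform_rmult iota_lform)
  have "mu \<phi> (iota \<xi> f) (x \<otimes>\<^bsub>AA\<^esub> \<eta> v) = mu (pu \<phi>) (rv v (iota \<xi> f)) x"
    using vec \<xi> by (simp add: mu_vec iota_lform)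
  also have "\<dots> = mu (pu \<phi>) (\<lambda>x. \<xi> v * f x + - 1 * iota \<xi> (rv v f) x) x"
    by (rule mu_cong[OF l(2)]) (use vec \<xi> in \<open>simp_all add: iota_vec\<close>)
  also have "\<dots> = \<xi> v * mu (pu \<phi>) f x + - 1 * mu (pu \<phi>) (iota \<xi> (rv v f)) x"
    using vec(1,4) l lform_lin(2)[OF vec(4,4)] lform_lin(2)[OF l(3,3)] by (simp only: mu_add mu_cmult)
  also have "mu (pu \<phi>) (iota \<xi> (rv v f)) x = iota \<xi> (mu (pu (pu \<phi>)) (rv v f)) x" by (rule vec(3)[OF l(1)])
  also have "\<dots> = iota \<xi> (rv v (mu (pu \<phi>) f)) x"
    by (rule iota_cong[OF \<xi> mu_lform[OF l(1)]]) (use vec in \<open>simp_all add: mu_vec\<close>)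
  also have "\<xi> v * mu (pu \<phi>) f x + - 1 * iota \<xi> (rv v (mu (pu \<phi>) f)) x = iota \<xi> (mu (pu \<phi>) f) (x \<otimes>\<^bsub>AA\<^esub> \<eta> v)"
    using vec \<xi> by (simp add: iota_vec mu_lform)
  finally show ?case .
next
  case (add x y)
  then show ?case using \<xi> by (simp add: lforms_add[OF mu_lform] lforms_add[OF iota_lform] mu_lform iota_lform)
next
  case (smult x c)
  then show ?case using \<xi> by (simp add: lforms_smult[OF mu_lform] lforms_smult[OF iota_lform] mu_lform iota_lform)
qed

text \<open>Multiplication by \<phi> in the first factor. The translate for odd second arguments
  makes it commute with \<open>XB\<close>: a term of B adds a vector to both factors, and the two
  translations by u cancel.\<close>

definition Mf :: "('g \<Rightarrow> complex) \<Rightarrow> (('g, 'v) gv \<Rightarrow> ('g, 'v) gv \<Rightarrow> complex) \<Rightarrow> ('g, 'v) gv \<Rightarrow> ('g, 'v) gv \<Rightarrow> complex" where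
  "Mf \<phi> \<beta> = (\<lambda>a b. mu \<phi> (\<lambda>x. \<beta> x (part AA 0 b)) a + mu (pu \<phi>) (\<lambda>x. \<beta> x (part AA (Suc 0) b)) a)"

lemma fop_Mf: "fop (Mf \<phi>)"
proof (rule fopI)
  fix \<beta> assume \<beta>: "\<beta> \<in> Bil"
  have l: "(\<lambda>x. \<beta> x b) \<in> lforms AA" if "\<beta> \<in> Bil" "b \<in> carrier AA" for b \<beta> using bilin_lform1[OF that] .
  have 1: "mu \<phi> (\<lambda>x. \<beta> x (b \<oplus>\<^bsub>AA\<^esub> b')) a = mu \<phi> (\<lambda>x. \<beta> x b) a + mu \<phi> (\<lambda>x. \<beta> x b') a"
    if "a \<in> carrier AA" "b \<in> carrier AA" "b' \<in> carrier AA" for a b b' \<phi>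
  proof -
    have "mu \<phi> (\<lambda>x. \<beta> x (b \<oplus>\<^bsub>AA\<^esub> b')) a = mu \<phi> (\<lambda>x. \<beta> x b + \<beta> x b') a"
      by (rule mu_cong) (use that \<beta> l in \<open>simp_all add: S.bil_simps\<close>)
    then show ?thesis using that l[OF \<beta>] by (simp add: mu_add)
  qed
  have 2: "mu \<phi> (\<lambda>x. \<beta> x (c \<odot>\<^bsub>AA\<^esub> b)) a = c * mu \<phi> (\<lambda>x. \<beta> x b) a"
    if "a \<in> carrier AA" "b \<in> carrier AA" for a b c \<phi>
  proof -
    have "mu \<phi> (\<lambda>x. \<beta> x (c \<odot>\<^bsub>AA\<^esub> b)) a = mu \<phi> (\<lambda>x. c * \<beta> x b) a"
      by (rule mu_cong) (use that \<beta> l S.smult_closed[of c b] in \<open>simp_all add: S.bil_simps\<close>)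
    then show ?thesis using that l[OF \<beta>] by (simp add: mu_cmult)
  qed
  show "Mf \<phi> \<beta> \<in> Bil"
    unfolding bilin_iff using l[OF \<beta>]
    by (simp add: Mf_def S.part_add S.part_smult 1 2 lforms_add[OF mu_lform] lforms_smult[OF mu_lform] algebra_simps)
  fix a b assume ab: "a \<in> carrier AA" "b \<in> carrier AA"
  show "Mf \<phi> \<beta> a b = Mf \<phi> \<beta>' a b" if "\<beta> \<approx> \<beta>'" for \<beta>'
    unfolding Mf_def by (intro arg_cong2[where f = "(+)"] mu_cong) (use ab that \<beta> l in \<open>simp_all add: eqf_def\<close>)
  show "Mf \<phi> (\<lambda>a b. \<beta> a b + \<beta>' a b) a b = Mf \<phi> \<beta> a b + Mf \<phi> \<beta>' a b" if "\<beta>' \<in> Bil" for \<beta>'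
    unfolding Mf_def using ab that by (simp add: mu_add l \<beta>)
  show "Mf \<phi> (\<lambda>a b. c * \<beta> a b) a b = c * Mf \<phi> \<beta> a b" for c
    unfolding Mf_def using ab by (simp add: mu_cmult l \<beta> distrib_left)
qed

lemma Mf_XB:
  assumes \<beta>: "\<beta> \<in> Bil"
  shows "Mf \<phi> (XB \<beta>) \<approx> XB (Mf \<phi> \<beta>)"
proof (rule eqfI)
  fix a b assume ab: "a \<in> carrier AA" "b \<in> carrier AA"
  have l: "(\<lambda>x. \<beta> x b) \<in> lforms AA" if "b \<in> carrier AA" for b using bilin_lform1[OF \<beta> that] .
  have l': "(\<lambda>x. \<beta> (x \<otimes>\<^bsub>AA\<^esub> \<eta> v) b) \<in> lforms AA" if "b \<in> carrier AA" "v \<in> carrier V" for b v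
    using lform_rmult[OF l[OF that(1)], of "\<eta> v"] that by simp
  have s: "mu \<phi> (\<lambda>x. XB \<beta> x c) a = (\<Sum>z\<leftarrow>bs. mu \<phi> (\<lambda>x. \<beta> (x \<otimes>\<^bsub>AA\<^esub> \<eta> (fst z)) (S.sgm c \<otimes>\<^bsub>AA\<^esub> \<eta> (snd z))) a)"
    if "c \<in> carrier AA" for c \<phi>
    unfolding XB_def using that ab bs_in l' by (subst mu_sum_list) simp_all
  have "Mf \<phi> (XB \<beta>) a b =
      (\<Sum>z\<leftarrow>bs. mu \<phi> (\<lambda>x. \<beta> (x \<otimes>\<^bsub>AA\<^esub> \<eta> (fst z)) (part AA 0 b \<otimes>\<^bsub>AA\<^esub> \<eta> (snd z))) a +
        mu (pu \<phi>) (\<lambda>x. \<beta> (x \<otimes>\<^bsub>AA\<^esub> \<eta> (fst z)) ((\<ominus>\<^bsub>AA\<^esub> part AA (Suc 0) b) \<otimes>\<^bsub>AA\<^esub> \<eta> (snd z))) a)"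
    unfolding Mf_def using ab by (simp add: s sum_list_addf)
  also have "\<dots> = XB (Mf \<phi> \<beta>) a b"
    unfolding XB_def
  proof (rule bs_cong)
    fix z assume "z \<in> set bs"
    then have z: "fst z \<in> carrier V" "snd z \<in> carrier V" using bs_in by auto
    have "mu (pu (pu \<phi>)) (\<lambda>x. \<beta> (x \<otimes>\<^bsub>AA\<^esub> \<eta> (fst z)) (part AA 0 b \<otimes>\<^bsub>AA\<^esub> \<eta> (snd z))) a =
        mu \<phi> (\<lambda>x. \<beta> (x \<otimes>\<^bsub>AA\<^esub> \<eta> (fst z)) (part AA 0 b \<otimes>\<^bsub>AA\<^esub> \<eta> (snd z))) a"
      by (rule mu_cong) (use ab z l' in \<open>simp_all add: GG.m_assoc\<close>)
    then show "mu \<phi> (\<lambda>x. \<beta> (x \<otimes>\<^bsub>AA\<^esub> \<eta> (fst z)) (part AA 0 b \<otimes>\<^bsub>AA\<^esub> \<eta> (snd z))) a +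
        mu (pu \<phi>) (\<lambda>x. \<beta> (x \<otimes>\<^bsub>AA\<^esub> \<eta> (fst z)) ((\<ominus>\<^bsub>AA\<^esub> part AA (Suc 0) b) \<otimes>\<^bsub>AA\<^esub> \<eta> (snd z))) a =
        Mf \<phi> \<beta> (a \<otimes>\<^bsub>AA\<^esub> \<eta> (fst z)) (S.sgm b \<otimes>\<^bsub>AA\<^esub> \<eta> (snd z))"
      using ab z l by (simp add: Mf_def part_vec mu_vec)
  qed
  finally show "Mf \<phi> (XB \<beta>) a b = XB (Mf \<phi> \<beta>) a b" .
qed

text \<open>\<open>Mf\<close> commutes with both exponentials, and passing \<Delta>(g) it turns
  \<phi> into h \<mapsto> \<phi>(h g). Evaluation at the unit leaves the factor \<phi>(g).\<close>

lemma K_mu: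
  assumes g: "g \<in> carrier G" and f: "f \<in> lforms AA" and f': "f' \<in> lforms AA"
  shows "K (mu \<phi> f) f' (\<gamma> g) = \<phi> g * K f f' (\<gamma> g)"
proof -
  let ?\<beta> = "bf 0 f f'" and ?P = "eX 1 (bf 0 f f')" and ?\<phi> = "\<lambda>h. \<phi> (h \<otimes>\<^bsub>G\<^esub> g)" and ?G = "Op (Inl g)"
  have gX: "Inl g \<in> XX" using g by simp
  have \<beta>: "?\<beta> \<in> Bil" using f f' by simp
  have P: "?P \<in> Bil" "?G ?P \<in> Bil" using \<beta> gX by (simp_all del: Op.simps)
  have l: "(\<lambda>x. f (\<gamma> u \<otimes>\<^bsub>AA\<^esub> x)) \<in> lforms AA" using f by (simp add: lform_lmult)
  have Mb: "Mf \<phi> ?\<beta> \<in> Bil" by (rule fopD(1)[OF fop_Mf \<beta>])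
  have "bf 0 (mu \<phi> f) f' \<approx> Mf \<phi> ?\<beta>"
  proof (rule eqfI)
    fix a b assume ab: "a \<in> carrier AA" "b \<in> carrier AA"
    have 1: "mu \<phi> (\<lambda>x. ?\<beta> x (part AA 0 b)) a = mu \<phi> (\<lambda>x. f' (part AA 0 b) * f x) a"
      using ab lforms_zero[OF S.module_A f'] by (intro mu_cong bilin_lform1[OF \<beta>]) (simp_all add: bf_def)
    have 2: "mu (pu \<phi>) (\<lambda>x. ?\<beta> x (part AA (Suc 0) b)) a = mu (pu \<phi>) (\<lambda>x. - f' (part AA (Suc 0) b) * f (\<gamma> u \<otimes>\<^bsub>AA\<^esub> x)) a"
      using ab lforms_zero[OF S.module_A f'] by (intro mu_cong bilin_lform1[OF \<beta>]) (simp_all add: bf_def)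
    show "bf 0 (mu \<phi> f) f' a b = Mf \<phi> ?\<beta> a b"
      unfolding Mf_def 1 2 mu_cmult[OF f ab(1)] mu_cmult[OF l ab(1)] mu_left_u[OF f ab(1), symmetric]
      by (simp add: bf_def)
  qed
  then have "K (mu \<phi> f) f' (\<gamma> g) = DJ (\<gamma> g) (Mf \<phi> ?\<beta>)"
    using K_grp[OF g mu_lform[OF f] f'] DJ_cong[OF _ bf_bilin[OF mu_lform[OF f] f']] g by simp
  also have "\<dots> = eX (- 1) (?G (eX 1 (Mf \<phi> ?\<beta>))) \<one>\<^bsub>AA\<^esub> \<one>\<^bsub>AA\<^esub>" by (rule DJ_grp[OF g Mb])
  also have "\<dots> = eX (- 1) (?G (Mf \<phi> ?P)) \<one>\<^bsub>AA\<^esub> \<one>\<^bsub>AA\<^esub>"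
    by (rule eqfD[OF fopD(2)[OF fop_eX _ fopD(2)[OF fop_Op[OF gX] _ eqf_sym[OF eX_commute[OF fop_Mf Mf_XB \<beta>]]]]])
      (use gX Mb in \<open>simp_all del: Op.simps\<close>)
  also have "\<dots> = eX (- 1) (Mf ?\<phi> (?G ?P)) \<one>\<^bsub>AA\<^esub> \<one>\<^bsub>AA\<^esub>"
  proof (rule eqfD[OF fopD(2)[OF fop_eX]])
    show "?G (Mf \<phi> ?P) \<in> Bil" using gX fopD(1)[OF fop_Mf P(1)] by (rule Op_bilin)
    show "?G (Mf \<phi> ?P) \<approx> Mf ?\<phi> (?G ?P)"
    proof (rule eqfI)
      fix a b assume ab: "a \<in> carrier AA" "b \<in> carrier AA"
      have lp: "(\<lambda>x. ?P x c) \<in> lforms AA" if "c \<in> carrier AA" for c using bilin_lform1[OF P(1) that] .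
      have 3: "mu (\<lambda>h. \<phi> (h \<otimes>\<^bsub>G\<^esub> g \<otimes>\<^bsub>G\<^esub> u)) (\<lambda>x. ?P (x \<otimes>\<^bsub>AA\<^esub> \<gamma> g) (part AA (Suc 0) b \<otimes>\<^bsub>AA\<^esub> \<gamma> g)) a =
          mu (\<lambda>h. \<phi> (h \<otimes>\<^bsub>G\<^esub> u \<otimes>\<^bsub>G\<^esub> g)) (\<lambda>x. ?P (x \<otimes>\<^bsub>AA\<^esub> \<gamma> g) (part AA (Suc 0) b \<otimes>\<^bsub>AA\<^esub> \<gamma> g)) a"
        by (rule mu_cong[OF lform_rmult[OF lp]]) (use ab g in \<open>simp_all add: GG.m_assoc u_comm\<close>)
      show "?G (Mf \<phi> ?P) a b = Mf ?\<phi> (?G ?P) a b"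
        using ab g lp 3 by (simp add: Mf_def part_grp mu_g)
    qed
  qed simp_all
  also have "\<dots> = Mf ?\<phi> (eX (- 1) (?G ?P)) \<one>\<^bsub>AA\<^esub> \<one>\<^bsub>AA\<^esub>"
    by (rule eqfD[OF eqf_sym[OF eX_commute[OF fop_Mf Mf_XB P(2)]]]) simp_all
  also have "\<dots> = \<phi> g * eX (- 1) (?G ?P) \<one>\<^bsub>AA\<^esub> \<one>\<^bsub>AA\<^esub>"
  proof -
    have Q: "eX (- 1) (?G ?P) \<in> Bil" using P by (simp del: Op.simps)
    have "mu ?\<phi> (\<lambda>x. eX (- 1) (?G ?P) x c) \<one>\<^bsub>AA\<^esub> = \<phi> g * eX (- 1) (?G ?P) \<one>\<^bsub>AA\<^esub> c" if "c \<in> carrier AA" for c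
      using mu_grp[OF GG.one_closed bilin_lform1[OF Q that], of ?\<phi>] g by (simp add: gen_one)
    moreover have "mu (pu ?\<phi>) (\<lambda>x. eX (- 1) (?G ?P) x \<zero>\<^bsub>AA\<^esub>) \<one>\<^bsub>AA\<^esub> = 0"
      using mu_grp[OF GG.one_closed bilin_lform1[OF Q S.zero_closed], of "pu ?\<phi>"] g S.bilin_zero2[OF Q] by (simp add: gen_one)
    ultimately show ?thesis by (simp add: Mf_def)
  qed
  also have "eX (- 1) (?G ?P) \<one>\<^bsub>AA\<^esub> \<one>\<^bsub>AA\<^esub> = K f f' (\<gamma> g)"
    using DJ_grp[OF g \<beta>] K_grp[OF g f f'] by simp
  finally show ?thesis .
qed

text \<open>Associativity for a left factor that is a function on G: it holds on G by
  \<open>K_mu\<close>, and both sides obey the same recursion under x \<mapsto> x v.\<close>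

lemma mu_K:
  assumes "f \<in> lforms AA" "f' \<in> lforms AA" "x \<in> carrier AA"
  shows "K (mu \<phi> f) f' x = mu \<phi> (K f f') x"
  using assms(3,1,2)
proof (induction x arbitrary: f f' \<phi> rule: AA_induct)
  case (grp g)
  then show ?case by (simp add: K_mu mu_grp K_lform)
next
  case (vec x v)
  have l: "rv v f \<in> lforms AA" "ru f \<in> lforms AA" "rv v f' \<in> lforms AA" "rv v (mu \<phi> f) \<in> lforms AA" "ru (mu \<phi> f) \<in> lforms AA"
    "rv v (K f f') \<in> lforms AA"
    using vec by (simp_all add: lform_rmult mu_lform K_lform)
  have "K (mu \<phi> f) f' (x \<otimes>\<^bsub>AA\<^esub> \<eta> v) = K (rv v (mu \<phi> f)) f' x + K (ru (mu \<phi> f)) (rv v f') x"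
    using vec by (simp add: K_vec mu_lform)
  also have "K (rv v (mu \<phi> f)) f' x = K (mu (pu \<phi>) (rv v f)) f' x"
    by (rule K_cong[OF l(4)]) (use vec in \<open>simp_all add: mu_vec\<close>)
  also have "K (ru (mu \<phi> f)) (rv v f') x = K (mu (pu \<phi>) (ru f)) (rv v f') x"
    by (rule K_cong[OF l(5,3)]) (use vec in \<open>simp_all add: mu_u\<close>)
  also have "K (mu (pu \<phi>) (rv v f)) f' x + K (mu (pu \<phi>) (ru f)) (rv v f') x =
      mu (pu \<phi>) (K (rv v f) f') x + mu (pu \<phi>) (K (ru f) (rv v f')) x"
    using vec(3)[OF l(1) vec(5), of "pu \<phi>"] vec(3)[OF l(2,3), of "pu \<phi>"] by simp
  also have "\<dots> = mu (pu \<phi>) (\<lambda>x. K (rv v f) f' x + K (ru f) (rv v f') x) x"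
    using vec l by (simp add: mu_add K_lform)
  also have "\<dots> = mu (pu \<phi>) (rv v (K f f')) x"
    by (rule mu_cong) (use vec l in \<open>simp_all add: K_vec lform_lin K_lform\<close>)
  also have "\<dots> = mu \<phi> (K f f') (x \<otimes>\<^bsub>AA\<^esub> \<eta> v)"
    using vec by (simp add: mu_vec K_lform)
  finally show ?case .
next
  case (add x y)
  then show ?case by (simp add: lforms_add[OF mu_lform] lforms_add[OF K_lform] mu_lform K_lform)
next
  case (smult x c)
  then show ?case by (simp add: lforms_smult[OF mu_lform] lforms_smult[OF K_lform] mu_lform K_lform)
qed

end

context gvtwist
begin

subsection \<open>Relations between contractions\<close>

lemma iota_lin:
  assumes "\<xi> \<in> lforms V" "\<xi>' \<in> lforms V" "\<xi>'' \<in> lforms V" "f \<in> lforms AA" "x \<in> carrier AA"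
    "\<And>v. v \<in> carrier V \<Longrightarrow> \<xi>'' v = a * \<xi> v + b * \<xi>' v"
  shows "iota \<xi>'' f x = a * iota \<xi> f x + b * iota \<xi>' f x"
  using assms(5,4)
proof (induction x arbitrary: f rule: AA_induct)
  case (grp g)
  then show ?case using assms by (simp add: iota_g)
next
  case (vec x v)
  then show ?case using assms(1-3) by (simp add: iota_vec lform_rmult assms(6) algebra_simps)
next
  case (add x y)
  then show ?case using assms(1-3) by (simp add: lforms_add[OF iota_lform] algebra_simps)
next
  case (smult x c)
  then show ?case using assms(1-3) by (simp add: lforms_smult[OF iota_lform] algebra_simps)
qed

lemma iota_iota:
  assumes "\<xi> \<in> lforms V" "\<xi>' \<in> lforms V" "f \<in> lforms AA" "x \<in> carrier AA"
  shows "iota \<xi> (iota \<xi>' f) x = - iota \<xi>' (iota \<xi> f) x"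
  using assms(4,3)
proof (induction x arbitrary: f rule: AA_induct)
  case (grp g)
  then show ?case using assms by (simp add: iota_g iota_lform)
next
  case (vec x v)
  have 1: "iota \<zeta> (rv v (iota \<zeta>' f)) x = \<zeta>' v * iota \<zeta> f x - iota \<zeta> (iota \<zeta>' (rv v f)) x"
    if z: "\<zeta> \<in> lforms V" "\<zeta>' \<in> lforms V" for \<zeta> \<zeta>'
  proof -
    have l: "rv v f \<in> lforms AA" "iota \<zeta>' (rv v f) \<in> lforms AA" "iota \<zeta>' f \<in> lforms AA"
      using vec z by (simp_all add: lform_rmult iota_lform)
    have "iota \<zeta> (rv v (iota \<zeta>' f)) x = iota \<zeta> (\<lambda>x. \<zeta>' v * f x + (- 1) * iota \<zeta>' (rv v f) x) x"
      by (rule iota_cong) (use vec z l in \<open>simp_all add: iota_vec lform_rmult\<close>)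
    also have "\<dots> = iota \<zeta> (\<lambda>x. \<zeta>' v * f x) x + iota \<zeta> (\<lambda>x. (- 1) * iota \<zeta>' (rv v f) x) x"
      by (rule iota_add[OF z(1) lform_lin(2)[OF vec(4,4)] lform_lin(2)[OF l(2,2)] vec(1)])
    also have "\<dots> = \<zeta>' v * iota \<zeta> f x + (- 1) * iota \<zeta> (iota \<zeta>' (rv v f)) x"
      using iota_cmult[OF z(1) vec(4,1)] iota_cmult[OF z(1) l(2) vec(1)] by (simp only:)
    finally show ?thesis by simp
  qed
  have l: "rv v f \<in> lforms AA" using vec by (simp add: lform_rmult)
  have "iota \<xi> (iota \<xi>' f) (x \<otimes>\<^bsub>AA\<^esub> \<eta> v) = \<xi> v * iota \<xi>' f x - iota \<xi> (rv v (iota \<xi>' f)) x"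
    "iota \<xi>' (iota \<xi> f) (x \<otimes>\<^bsub>AA\<^esub> \<eta> v) = \<xi>' v * iota \<xi> f x - iota \<xi>' (rv v (iota \<xi> f)) x"
    using vec assms by (simp_all add: iota_vec iota_lform)
  then show ?case using vec(3)[OF l] 1[OF assms(1,2)] 1[OF assms(2,1)] by simp
next
  case (add x y)
  then show ?case using assms(1,2) by (simp add: lforms_add[OF iota_lform] iota_lform)
next
  case (smult x c)
  then show ?case using assms(1,2) by (simp add: lforms_smult[OF iota_lform] iota_lform)
qed

lemma iota_u:
  assumes "\<xi> \<in> lforms V" "f \<in> lforms AA" "x \<in> carrier AA"
  shows "iota \<xi> f (x \<otimes>\<^bsub>AA\<^esub> \<gamma> u) = - iota \<xi> (ru f) x"
proof -
  have "iota (\<lambda>v. \<xi> (\<rho> u v)) (ru f) x = (- 1) * iota \<xi> (ru f) x + 0 * iota \<xi> (ru f) x"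
    by (rule iota_lin) (use assms u_act in \<open>simp_all add: lform_rho lform_rmult lforms_uminus[OF VV.module_axioms]\<close>)
  then show ?thesis using assms by (simp add: iota_grp)
qed

text \<open>Symmetry of B, transferred to the list that represents it; it makes the form defined by
  \<open>Cv\<close> symmetric.\<close>

lemma form_sym:
  assumes "\<xi> \<in> lforms V" "\<xi>' \<in> lforms V"
  shows "(\<Sum>z\<leftarrow>bs. \<xi> (fst z) * \<xi>' (snd z)) = (\<Sum>z\<leftarrow>bs. \<xi>' (fst z) * \<xi> (snd z))"
proof -
  let ?\<beta> = "\<lambda>v w. \<xi> v * \<xi>' w"
  have b: "?\<beta> \<in> bilin V V" "(\<lambda>v w. ?\<beta> w v) \<in> bilin V V"
    using assms by (simp_all add: bilin_iff lforms_add lforms_smult algebra_simps)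
  have "(\<lambda>\<beta>\<in>bilin V V. B (\<lambda>v w. \<beta> w v)) ?\<beta> = B ?\<beta>" using B_sym by (simp add: sym_square_def)
  then have "B (\<lambda>v w. ?\<beta> w v) = B ?\<beta>" by (simp only: restrict_apply b if_True)
  then show ?thesis
    by (simp add: list_tensor_apply[OF b(1), of bs, folded bs(2)] list_tensor_apply[OF b(2), of bs, folded bs(2)]
      case_prod_unfold mult.commute)
qed

lemma Cv_eval:
  assumes "F \<in> lforms V" "g \<in> carrier G"
  shows "F (Cv g \<xi>) = (\<Sum>z\<leftarrow>bs. \<xi> (fst z) * F (snd z)) -
    (\<Sum>z\<leftarrow>bs. \<xi> (\<rho> (inv\<^bsub>G\<^esub> g) (fst z)) * F (\<rho> (inv\<^bsub>G\<^esub> g) (snd z)))"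
proof -
  have "(\<lambda>v. F (\<rho> (inv\<^bsub>G\<^esub> g) v)) \<in> lforms V" using assms by (simp add: lform_rho)
  from Bv(2)[OF this] show ?thesis
    using assms Bv(1) by (simp add: Cv_def lforms_minus[OF VV.module_axioms] Bv(2))
qed

lemma Cv_sym:
  assumes "\<xi> \<in> lforms V" "\<xi>' \<in> lforms V" "g \<in> carrier G"
  shows "\<xi> (Cv g \<xi>') = \<xi>' (Cv g \<xi>)"
  using form_sym[OF assms(1,2)] form_sym[OF lform_rho lform_rho, OF assms(1) _ assms(2), of "inv\<^bsub>G\<^esub> g" "inv\<^bsub>G\<^esub> g"] assms
  by (simp add: Cv_eval)

text \<open>u contributes the sign -1 in both arguments of the form, so only the coset of g
  matters.\<close>

lemma Cv_mult_u:
  assumes "F \<in> lforms V" "g \<in> carrier G" "\<xi> \<in> lforms V"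
  shows "F (Cv (g \<otimes>\<^bsub>G\<^esub> u) \<xi>) = F (Cv g \<xi>)"
proof -
  let ?i = "inv\<^bsub>G\<^esub> g"
  have "F' (\<rho> (inv\<^bsub>G\<^esub> (g \<otimes>\<^bsub>G\<^esub> u)) v) = - F' (\<rho> ?i v)" if F': "F' \<in> lforms V" and v: "v \<in> carrier V" for F' v
  proof -
    have "inv\<^bsub>G\<^esub> (g \<otimes>\<^bsub>G\<^esub> u) = u \<otimes>\<^bsub>G\<^esub> ?i" using assms by (simp add: GG.inv_mult_group)
    then have "\<rho> (inv\<^bsub>G\<^esub> (g \<otimes>\<^bsub>G\<^esub> u)) v = \<rho> u (\<rho> ?i v)" using assms v ACT.composition_rule[OF v u_in, of ?i] by simp
    also have "\<dots> = \<ominus>\<^bsub>V\<^esub> \<rho> ?i v" using u_act assms v by simp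
    finally show ?thesis using assms v by (simp add: lforms_uminus[OF VV.module_axioms F'])
  qed
  note neg = this
  have "(\<Sum>z\<leftarrow>bs. \<xi> (\<rho> (inv\<^bsub>G\<^esub> (g \<otimes>\<^bsub>G\<^esub> u)) (fst z)) * F (\<rho> (inv\<^bsub>G\<^esub> (g \<otimes>\<^bsub>G\<^esub> u)) (snd z))) =
      (\<Sum>z\<leftarrow>bs. \<xi> (\<rho> ?i (fst z)) * F (\<rho> ?i (snd z)))"
    by (intro bs_cong) (use bs_in neg[OF assms(1)] neg[OF assms(3)] in simp)
  then show ?thesis using assms by (simp add: Cv_eval)
qed

end

section \<open>Clifford operators on the dual algebra\<close>

locale gvcoset = gvtwist G V \<rho> u B
  for G :: "('g, 'n) monoid_scheme" and V :: "(complex, 'v, 'm) module_scheme" and \<rho> :: "'g \<Rightarrow> 'v \<Rightarrow> 'v"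
    and u :: 'g and B :: "('v, 'v) tens" +
  fixes g0 :: 'g
  assumes g0 [simp]: "g0 \<in> carrier G"
begin

definition ind :: "'g \<Rightarrow> complex" where
  "ind g = (if g = g0 \<or> g = g0 \<otimes>\<^bsub>G\<^esub> u then 1 else 0)"
definition zet :: "'g \<Rightarrow> complex" where
  "zet g = (if g = g0 then 1 else if g = g0 \<otimes>\<^bsub>G\<^esub> u then - 1 else 0)"
definition Dh where
  "Dh = {f \<in> lforms AA. \<forall>x\<in>carrier AA. mu ind f x = f x}"

lemma g0_u: "g0 \<otimes>\<^bsub>G\<^esub> u \<noteq> g0" "g \<in> carrier G \<Longrightarrow> g \<otimes>\<^bsub>G\<^esub> u = g0 \<longleftrightarrow> g = g0 \<otimes>\<^bsub>G\<^esub> u"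
  "g \<in> carrier G \<Longrightarrow> g \<otimes>\<^bsub>G\<^esub> u = g0 \<otimes>\<^bsub>G\<^esub> u \<longleftrightarrow> g = g0"
proof -
  show "g0 \<otimes>\<^bsub>G\<^esub> u \<noteq> g0" using u_neq GG.l_cancel_one[OF g0 u_in] by simp
  have u2: "g \<otimes>\<^bsub>G\<^esub> u \<otimes>\<^bsub>G\<^esub> u = g" if "g \<in> carrier G" for g using that by (simp add: GG.m_assoc)
  show "g \<in> carrier G \<Longrightarrow> g \<otimes>\<^bsub>G\<^esub> u = g0 \<longleftrightarrow> g = g0 \<otimes>\<^bsub>G\<^esub> u" using u2 by fastforce
  show "g \<in> carrier G \<Longrightarrow> g \<otimes>\<^bsub>G\<^esub> u = g0 \<otimes>\<^bsub>G\<^esub> u \<longleftrightarrow> g = g0" by simp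
qed

text \<open>Translation by u exchanges the two elements of the coset; this fixes the indicator and
  negates \<open>zet\<close>.\<close>

lemma ind_u: "g \<in> carrier G \<Longrightarrow> pu ind g = ind g"
  and zet_u: "g \<in> carrier G \<Longrightarrow> pu zet g = - zet g"
  and zet_zet: "zet g * zet g = ind g"
  and ind_zet: "ind g * zet g = zet g"
  and ind_ind: "ind g * ind g = ind g"
  using g0_u(1) by (auto simp: ind_def zet_def g0_u(2,3))

lemma Dh_lform: "f \<in> Dh \<Longrightarrow> f \<in> lforms AA"
  and Dh_ind: "f \<in> Dh \<Longrightarrow> x \<in> carrier AA \<Longrightarrow> mu ind f x = f x"
  by (auto simp: Dh_def)

lemma DhI: "f \<in> lforms AA \<Longrightarrow> (\<And>x. x \<in> carrier AA \<Longrightarrow> mu ind f x = f x) \<Longrightarrow> f \<in> Dh"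
  by (simp add: Dh_def)

lemma Dh_add: "f \<in> Dh \<Longrightarrow> f' \<in> Dh \<Longrightarrow> (\<lambda>x. f x + f' x) \<in> Dh"
  by (rule DhI) (simp_all add: lform_lin Dh_lform mu_add Dh_ind)

lemma Dh_cmult: "f \<in> Dh \<Longrightarrow> (\<lambda>x. c * f x) \<in> Dh"
  by (rule DhI) (simp_all add: lform_lin(2)[OF Dh_lform Dh_lform] Dh_lform mu_cmult Dh_ind)

lemma Dh_diff: "f \<in> Dh \<Longrightarrow> f' \<in> Dh \<Longrightarrow> (\<lambda>x. f x - f' x) \<in> Dh"
  using Dh_add[of f "\<lambda>x. (- 1) * f' x"] Dh_cmult[of f' "- 1"] by simp

lemma Dh_zero: "(\<lambda>x. 0) \<in> Dh"
  using mu_cmult[OF lform_0, of _ ind 0] by (intro DhI lform_0) simp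

lemma mu_ind_u: "f \<in> lforms AA \<Longrightarrow> x \<in> carrier AA \<Longrightarrow> mu (pu ind) f x = mu ind f x"
  by (rule mu_cong) (simp_all add: ind_u)

lemma mu_zet_u: "f \<in> lforms AA \<Longrightarrow> x \<in> carrier AA \<Longrightarrow> mu (pu zet) f x = - mu zet f x"
  using mu_cong[of f x "pu zet" "\<lambda>g. (- 1) * zet g" f] mu_scale[of f x "- 1" zet] by (simp add: zet_u)

lemma Dh_rv: "f \<in> Dh \<Longrightarrow> v \<in> carrier V \<Longrightarrow> rv v f \<in> Dh"
  using mu_vec[OF Dh_lform, of f _ v ind]
  by (intro DhI) (simp_all add: lform_rmult Dh_lform mu_ind_u Dh_ind)

lemma Dh_ru: "f \<in> Dh \<Longrightarrow> ru f \<in> Dh"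
  using mu_u[OF Dh_lform, of f _ ind]
  by (intro DhI) (simp_all add: lform_rmult Dh_lform mu_ind_u Dh_ind)

lemma Dh_iota: "\<xi> \<in> lforms V \<Longrightarrow> f \<in> Dh \<Longrightarrow> iota \<xi> f \<in> Dh"
proof (rule DhI)
  assume \<xi>: "\<xi> \<in> lforms V" and f: "f \<in> Dh"
  show "iota \<xi> f \<in> lforms AA" using \<xi> f by (simp add: iota_lform Dh_lform)
  fix x assume x: "x \<in> carrier AA"
  have "iota \<xi> (mu (pu ind) f) x = iota \<xi> f x"
    by (rule iota_cong) (use \<xi> f x in \<open>simp_all add: mu_lform Dh_lform mu_ind_u Dh_ind\<close>)
  then show "mu ind (iota \<xi> f) x = iota \<xi> f x" using \<xi> f x by (simp add: mu_iota Dh_lform)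
qed

lemma Dh_mu: "f \<in> Dh \<Longrightarrow> mu zet f \<in> Dh"
  using mu_cong[of f _ "\<lambda>g. ind g * zet g" zet f]
  by (intro DhI) (simp_all add: mu_lform Dh_lform mu_mu ind_zet)

lemma Dh_mu_ind: "f \<in> lforms AA \<Longrightarrow> mu ind f \<in> Dh"
  using mu_cong[of f _ "\<lambda>g. ind g * ind g" ind f]
  by (intro DhI) (simp_all add: mu_lform mu_mu ind_ind)

lemma Dh_K: "f \<in> Dh \<Longrightarrow> f' \<in> lforms AA \<Longrightarrow> K f f' \<in> Dh"
  using K_cong[of "mu ind f" f' _ f f']
  by (intro DhI) (simp_all add: K_lform Dh_lform Dh_ind mu_lform flip: mu_K)

lemma Dh_grp: "f \<in> Dh \<Longrightarrow> g \<in> carrier G \<Longrightarrow> g \<noteq> g0 \<Longrightarrow> g \<noteq> g0 \<otimes>\<^bsub>G\<^esub> u \<Longrightarrow> f (\<gamma> g) = 0"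
  using Dh_ind[of f "\<gamma> g"] mu_grp[of g f ind] by (simp add: Dh_lform ind_def)

lemma mu_zet_zet: "f \<in> Dh \<Longrightarrow> x \<in> carrier AA \<Longrightarrow> mu zet (mu zet f) x = f x"
  by (simp add: mu_mu Dh_lform zet_zet Dh_ind)

abbreviation "cc \<equiv> Cv g0"

text \<open>\<open>iota \<xi>\<close> alone does not commute with right multiplications. By
  \<open>K_iota\<close> and \<open>K_vec\<close>, the translation by \<open>cc \<xi>\<close> has the
  same defect on the coset of \<open>g0\<close>.\<close>

definition Lam :: "('v \<Rightarrow> complex) \<Rightarrow> (('g, 'v) gv \<Rightarrow> complex) \<Rightarrow> ('g, 'v) gv \<Rightarrow> complex" where
  "Lam \<xi> f = (\<lambda>x. iota \<xi> f x - f (x \<otimes>\<^bsub>AA\<^esub> \<eta> (cc \<xi>)))"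

lemma Lam_lform: "\<xi> \<in> lforms V \<Longrightarrow> f \<in> lforms AA \<Longrightarrow> Lam \<xi> f \<in> lforms AA"
  unfolding Lam_def by (intro lform_lin(3) iota_lform lform_rmult) simp_all

lemma Dh_Lam: "\<xi> \<in> lforms V \<Longrightarrow> f \<in> Dh \<Longrightarrow> Lam \<xi> f \<in> Dh"
  unfolding Lam_def by (intro Dh_diff Dh_iota Dh_rv) simp_all

lemma Lam_cong: "\<xi> \<in> lforms V \<Longrightarrow> f \<in> lforms AA \<Longrightarrow> x \<in> carrier AA \<Longrightarrow>
    (\<And>x. x \<in> carrier AA \<Longrightarrow> f x = f' x) \<Longrightarrow> Lam \<xi> f x = Lam \<xi> f' x"
  unfolding Lam_def by (intro arg_cong2[where f = "(-)"] iota_cong) simp_all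

lemma Lam_add: "\<xi> \<in> lforms V \<Longrightarrow> f \<in> lforms AA \<Longrightarrow> f' \<in> lforms AA \<Longrightarrow> x \<in> carrier AA \<Longrightarrow>
    Lam \<xi> (\<lambda>x. f x + f' x) x = Lam \<xi> f x + Lam \<xi> f' x"
  by (simp add: Lam_def iota_add)

lemma Lam_cmult: "\<xi> \<in> lforms V \<Longrightarrow> f \<in> lforms AA \<Longrightarrow> x \<in> carrier AA \<Longrightarrow>
    Lam \<xi> (\<lambda>x. c * f x) x = c * Lam \<xi> f x"
  by (simp add: Lam_def iota_cmult algebra_simps)

lemma Lam_lin:
  assumes "\<xi> \<in> lforms V" "\<xi>' \<in> lforms V" "\<xi>'' \<in> lforms V" "f \<in> lforms AA" "x \<in> carrier AA"
    "\<And>v. v \<in> carrier V \<Longrightarrow> \<xi>'' v = a * \<xi> v + b * \<xi>' v"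
  shows "Lam \<xi>'' f x = a * Lam \<xi> f x + b * Lam \<xi>' f x"
proof -
  let ?F = "\<lambda>v. f (x \<otimes>\<^bsub>AA\<^esub> \<eta> v)" and ?i = "inv\<^bsub>G\<^esub> g0"
  have F: "?F \<in> lforms V" using assms by (intro lform_vec)
  have "?F (Cv g0 \<xi>'') = (\<Sum>z\<leftarrow>bs. \<xi>'' (fst z) * ?F (snd z) - \<xi>'' (\<rho> ?i (fst z)) * ?F (\<rho> ?i (snd z)))" for \<xi>''
    unfolding Cv_eval[OF F g0] by (simp add: sum_list_subtractf)
  note ev = this
  have "?F (Cv g0 \<xi>'') = (\<Sum>z\<leftarrow>bs. a * (\<xi> (fst z) * ?F (snd z) - \<xi> (\<rho> ?i (fst z)) * ?F (\<rho> ?i (snd z))) +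
      b * (\<xi>' (fst z) * ?F (snd z) - \<xi>' (\<rho> ?i (fst z)) * ?F (\<rho> ?i (snd z))))"
    unfolding ev by (intro bs_cong) (simp add: assms(6) bs_in algebra_simps)
  also have "\<dots> = a * ?F (Cv g0 \<xi>) + b * ?F (Cv g0 \<xi>')"
    unfolding ev by (simp add: sum_list_addf sum_list_const_mult)
  finally show ?thesis
    using iota_lin[OF assms(1-5), of a b] assms(6) by (simp add: Lam_def algebra_simps)
qed

lemma Lam_vec:
  assumes "\<xi> \<in> lforms V" "f \<in> lforms AA" "x \<in> carrier AA" "v \<in> carrier V"
  shows "Lam \<xi> f (x \<otimes>\<^bsub>AA\<^esub> \<eta> v) = \<xi> v * f x - Lam \<xi> (rv v f) x"
  using lform_swap[OF assms(2,3,4), of "cc \<xi>"] assms by (simp add: Lam_def iota_vec)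

lemma Lam_u:
  assumes "\<xi> \<in> lforms V" "f \<in> lforms AA" "x \<in> carrier AA"
  shows "Lam \<xi> f (x \<otimes>\<^bsub>AA\<^esub> \<gamma> u) = - Lam \<xi> (ru f) x"
  using vec_u[OF assms(3), of "cc \<xi>"] lforms_uminus[OF S.module_A assms(2), of "x \<otimes>\<^bsub>AA\<^esub> \<gamma> u \<otimes>\<^bsub>AA\<^esub> \<eta> (cc \<xi>)"] assms
  by (simp add: Lam_def iota_u)

text \<open>Contractions anticommute, and so do translations by vectors. What the mixed terms leave
  is -\<xi>(cc \<xi>') f and -\<xi>'(cc \<xi>) f, which are equal by \<open>Cv_sym\<close>.\<close>

lemma Lam_Lam:
  assumes "\<xi> \<in> lforms V" "\<xi>' \<in> lforms V" "f \<in> lforms AA" "x \<in> carrier AA"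
  shows "Lam \<xi> (Lam \<xi>' f) x + Lam \<xi>' (Lam \<xi> f) x = - 2 * \<xi> (cc \<xi>') * f x"
proof -
  have *: "Lam \<zeta> (Lam \<zeta>' f) x = iota \<zeta> (iota \<zeta>' f) x - \<zeta> (cc \<zeta>') * f x
      + iota \<zeta> f (x \<otimes>\<^bsub>AA\<^esub> \<eta> (cc \<zeta>')) - iota \<zeta>' f (x \<otimes>\<^bsub>AA\<^esub> \<eta> (cc \<zeta>)) +
      f (x \<otimes>\<^bsub>AA\<^esub> \<eta> (cc \<zeta>) \<otimes>\<^bsub>AA\<^esub> \<eta> (cc \<zeta>'))"
    if z: "\<zeta> \<in> lforms V" "\<zeta>' \<in> lforms V" for \<zeta> \<zeta>'
  proof -
    have l: "iota \<zeta>' f \<in> lforms AA" "rv (cc \<zeta>') f \<in> lforms AA"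
      using z assms by (simp_all add: iota_lform lform_rmult)
    have "iota \<zeta> (Lam \<zeta>' f) x = iota \<zeta> (\<lambda>x. iota \<zeta>' f x + (- 1) * rv (cc \<zeta>') f x) x"
      by (rule iota_cong) (use z assms in \<open>simp_all add: Lam_lform\<close>, simp add: Lam_def)
    also have "\<dots> = iota \<zeta> (iota \<zeta>' f) x + iota \<zeta> (\<lambda>x. (- 1) * rv (cc \<zeta>') f x) x"
      by (rule iota_add[OF z(1) l(1) lform_lin(2)[OF l(2,2)] assms(4)])
    also have "\<dots> = iota \<zeta> (iota \<zeta>' f) x + (- 1) * iota \<zeta> (rv (cc \<zeta>') f) x"
      by (simp only: iota_cmult[OF z(1) l(2) assms(4)])
    also have "iota \<zeta> (rv (cc \<zeta>') f) x = \<zeta> (cc \<zeta>') * f x - iota \<zeta> f (x \<otimes>\<^bsub>AA\<^esub> \<eta> (cc \<zeta>'))"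
      using iota_vec[OF z(1) assms(3,4), of "cc \<zeta>'"] by simp
    finally have "iota \<zeta> (Lam \<zeta>' f) x = iota \<zeta> (iota \<zeta>' f) x - \<zeta> (cc \<zeta>') * f x + iota \<zeta> f (x \<otimes>\<^bsub>AA\<^esub> \<eta> (cc \<zeta>'))"
      by simp
    then show ?thesis unfolding Lam_def[of \<zeta> "Lam \<zeta>' f"] by (simp add: Lam_def[of \<zeta>' f])
  qed
  show ?thesis
    using lform_swap[OF assms(3,4), of "cc \<xi>" "cc \<xi>'"] iota_iota[OF assms] Cv_sym[OF assms(1,2) g0]
    by (simp add: *[OF assms(1,2)] *[OF assms(2,1)] algebra_simps)
qed

text \<open>Both parts of \<open>Lam\<close> translate a function on G by u, and \<open>zet\<close>
  changes sign under this.\<close>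

lemma Lam_mu:
  assumes "\<xi> \<in> lforms V" "f \<in> lforms AA" "x \<in> carrier AA"
  shows "mu zet (Lam \<xi> f) x = - Lam \<xi> (mu zet f) x"
proof -
  have l: "iota \<xi> f \<in> lforms AA" "rv (cc \<xi>) f \<in> lforms AA"
    using assms by (simp_all add: iota_lform lform_rmult)
  have "mu zet (Lam \<xi> f) x = mu zet (\<lambda>x. iota \<xi> f x + (- 1) * rv (cc \<xi>) f x) x"
    by (rule mu_cong) (use assms in \<open>simp_all add: Lam_lform\<close>, simp add: Lam_def)
  also have "\<dots> = mu zet (iota \<xi> f) x + mu zet (\<lambda>x. (- 1) * rv (cc \<xi>) f x) x"
    by (rule mu_add[OF l(1) lform_lin(2)[OF l(2,2)] assms(3)])
  also have "\<dots> = mu zet (iota \<xi> f) x + (- 1) * mu zet (rv (cc \<xi>) f) x"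
    by (simp only: mu_cmult[OF l(2) assms(3)])
  also have "mu zet (rv (cc \<xi>) f) x = - mu zet f (x \<otimes>\<^bsub>AA\<^esub> \<eta> (cc \<xi>))"
    using l assms by (simp add: mu_vec mu_zet_u)
  also have "mu zet (iota \<xi> f) x = iota \<xi> (\<lambda>x. (- 1) * mu zet f x) x"
    unfolding mu_iota[OF assms] by (rule iota_cong) (use assms in \<open>simp_all add: mu_lform mu_zet_u\<close>)
  also have "\<dots> = (- 1) * iota \<xi> (mu zet f) x"
    by (rule iota_cmult) (use assms mu_lform in simp_all)
  finally show ?thesis by (simp add: Lam_def)
qed

text \<open>On the coset, the products of f(\<cdot> u) with f'(\<cdot> c) that come from
  \<open>K_iota\<close> and from \<open>K_vec\<close> cancel, and minus the translate of f f' by c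
  remains. Off the coset both sides vanish because f is in \<open>Dh\<close>; there c would be a
  different vector.\<close>

lemma Lam_K:
  assumes \<xi>: "\<xi> \<in> lforms V" and "f \<in> Dh" "f' \<in> lforms AA" "x \<in> carrier AA"
  shows "K (Lam \<xi> f) f' x = Lam \<xi> (K f f') x"
  using assms(4,2,3)
proof (induction x arbitrary: f f' rule: AA_induct)
  case (grp g)
  note f = Dh_lform[OF grp(2)]
  show ?case
  proof (cases "g = g0 \<or> g = g0 \<otimes>\<^bsub>G\<^esub> u")
    case False
    then show ?thesis using grp \<xi> Dh_grp[OF Dh_K[OF Dh_Lam]] Dh_grp[OF Dh_Lam[OF \<xi> Dh_K]] by simp
  next
    case True
    have l: "rv (cc \<xi>) f \<in> lforms AA" "iota \<xi> f \<in> lforms AA" "ru f \<in> lforms AA"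
      "rv (cc \<xi>) f' \<in> lforms AA" "rv (Cv g \<xi>) f' \<in> lforms AA"
      using grp f \<xi> by (simp_all add: lform_rmult iota_lform)
    have "K (Lam \<xi> f) f' (\<gamma> g) = K (\<lambda>x. iota \<xi> f x + (- 1) * rv (cc \<xi>) f x) f' (\<gamma> g)"
      by (rule K_cong) (use grp \<xi> f in \<open>simp_all add: Lam_lform\<close>, simp add: Lam_def)
    also have "\<dots> = K (iota \<xi> f) f' (\<gamma> g) + K (\<lambda>x. (- 1) * rv (cc \<xi>) f x) f' (\<gamma> g)"
      by (rule K_add1[OF l(2) lform_lin(2)[OF l(1,1)] grp(3)]) (use grp in simp)
    also have "\<dots> = K (iota \<xi> f) f' (\<gamma> g) + (- 1) * K (rv (cc \<xi>) f) f' (\<gamma> g)"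
      using grp by (simp only: K_cmult1[OF l(1) grp(3)] gen_closed)
    also have "K (iota \<xi> f) f' (\<gamma> g) = - K (ru f) (rv (Cv g \<xi>) f') (\<gamma> g)"
      by (rule K_iota[OF grp(1) \<xi> f grp(3)])
    \<comment> \<open>g is \<open>g0\<close> or its product with u, and linear forms do not
      distinguish the two vectors.\<close>
    also have "K (ru f) (rv (Cv g \<xi>) f') (\<gamma> g) = K (ru f) (rv (cc \<xi>) f') (\<gamma> g)"
    proof (rule K_cong[OF l(3,5)])
      fix x assume x: "x \<in> carrier AA"
      have "(\<lambda>v. f' (x \<otimes>\<^bsub>AA\<^esub> \<eta> v)) \<in> lforms V" by (rule lform_vec[OF grp(3) x])
      from Cv_mult_u[OF this g0 \<xi>] True show "rv (Cv g \<xi>) f' x = rv (cc \<xi>) f' x" by auto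
    qed (use grp in simp_all)
    also have "K (rv (cc \<xi>) f) f' (\<gamma> g) = K f f' (\<gamma> g \<otimes>\<^bsub>AA\<^esub> \<eta> (cc \<xi>)) - K (ru f) (rv (cc \<xi>) f') (\<gamma> g)"
      using grp f by (simp add: K_vec)
    finally show ?thesis using grp f \<xi> by (simp add: Lam_def iota_g K_lform)
  qed
next
  case (vec x v)
  note f = Dh_lform[OF vec(4)]
  have D: "rv v f \<in> Dh" "ru f \<in> Dh" using vec by (simp_all add: Dh_rv Dh_ru)
  note l = D[THEN Dh_lform] lform_rmult[OF vec(5) gen_closed(2)[OF vec(2)]]
  have L: "Lam \<xi> f \<in> lforms AA" "Lam \<xi> (rv v f) \<in> lforms AA" "Lam \<xi> (ru f) \<in> lforms AA"
    using \<xi> f l by (simp_all add: Lam_lform)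
  have "K (Lam \<xi> f) f' (x \<otimes>\<^bsub>AA\<^esub> \<eta> v) = K (rv v (Lam \<xi> f)) f' x + K (ru (Lam \<xi> f)) (rv v f') x"
    by (rule K_vec) (use vec L in simp_all)
  also have "K (rv v (Lam \<xi> f)) f' x = K (\<lambda>x. \<xi> v * f x + (- 1) * Lam \<xi> (rv v f) x) f' x"
    by (rule K_cong) (use vec L \<xi> f in \<open>simp_all add: lform_rmult Lam_vec\<close>)
  also have "\<dots> = K (\<lambda>x. \<xi> v * f x) f' x + K (\<lambda>x. (- 1) * Lam \<xi> (rv v f) x) f' x"
    by (rule K_add1[OF lform_lin(2)[OF f f] lform_lin(2)[OF L(2,2)] vec(5,1)])
  also have "\<dots> = \<xi> v * K f f' x + (- 1) * K (Lam \<xi> (rv v f)) f' x"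
    by (simp only: K_cmult1[OF f vec(5,1)] K_cmult1[OF L(2) vec(5,1)])
  also have "K (Lam \<xi> (rv v f)) f' x = Lam \<xi> (K (rv v f) f') x"
    by (rule vec(3)[OF D(1) vec(5)])
  also have "K (ru (Lam \<xi> f)) (rv v f') x = K (\<lambda>x. (- 1) * Lam \<xi> (ru f) x) (rv v f') x"
    by (rule K_cong) (use vec L \<xi> f in \<open>simp_all add: lform_rmult Lam_u\<close>)
  also have "\<dots> = (- 1) * K (Lam \<xi> (ru f)) (rv v f') x"
    by (rule K_cmult1[OF L(3) l(3) vec(1)])
  also have "K (Lam \<xi> (ru f)) (rv v f') x = Lam \<xi> (K (ru f) (rv v f')) x"
    by (rule vec(3)[OF D(2) l(3)])
  finally have 1: "K (Lam \<xi> f) f' (x \<otimes>\<^bsub>AA\<^esub> \<eta> v) =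
      \<xi> v * K f f' x - (Lam \<xi> (K (rv v f) f') x + Lam \<xi> (K (ru f) (rv v f')) x)" by simp
  have "Lam \<xi> (K (rv v f) f') x + Lam \<xi> (K (ru f) (rv v f')) x = Lam \<xi> (\<lambda>x. K (rv v f) f' x + K (ru f) (rv v f') x) x"
    by (rule Lam_add[symmetric]) (use \<xi> l vec in \<open>simp_all add: K_lform\<close>)
  also have "\<dots> = Lam \<xi> (rv v (K f f')) x"
    by (rule Lam_cong) (use \<xi> f l vec in \<open>simp_all add: K_lform K_vec lform_lin\<close>)
  finally show ?case using 1 vec \<xi> f by (simp add: Lam_vec K_lform)
next
  case (add x y)
  then show ?case using \<xi> Dh_lform
    by (simp add: lforms_add[OF K_lform] lforms_add[OF Lam_lform] K_lform Lam_lform)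
next
  case (smult x c)
  then show ?case using \<xi> Dh_lform
    by (simp add: lforms_smult[OF K_lform] lforms_smult[OF Lam_lform] K_lform Lam_lform)
qed

subsection \<open>The action of the Clifford generators\<close>

text \<open>\<open>Lam \<xi>\<close> commutes with right multiplication in the dual algebra but squares to \<open>-(B - B\<^sup>g)(\<xi>, \<xi>)\<close>,
  hence the factor \<open>\<i>\<close>.\<close>

definition Lop :: "('v \<Rightarrow> complex) \<times> complex \<Rightarrow> (('g, 'v) gv \<Rightarrow> complex) \<Rightarrow> ('g, 'v) gv \<Rightarrow> complex" where
  "Lop w f = (\<lambda>x. \<i> * Lam (fst w) f x + snd w * mu zet f x)"

lemma Dh_Lop: "fst w \<in> lforms V \<Longrightarrow> f \<in> Dh \<Longrightarrow> Lop w f \<in> Dh"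
  unfolding Lop_def by (intro Dh_add Dh_cmult Dh_Lam Dh_mu)

lemma Lop_cong: "fst w \<in> lforms V \<Longrightarrow> f \<in> lforms AA \<Longrightarrow> x \<in> carrier AA \<Longrightarrow>
    (\<And>x. x \<in> carrier AA \<Longrightarrow> f x = f' x) \<Longrightarrow> Lop w f x = Lop w f' x"
  using Lam_cong[of "fst w" f x f'] mu_cong[of f x zet zet f'] by (simp add: Lop_def)

lemma Lop_add: "fst w \<in> lforms V \<Longrightarrow> f \<in> lforms AA \<Longrightarrow> f' \<in> lforms AA \<Longrightarrow> x \<in> carrier AA \<Longrightarrow>
    Lop w (\<lambda>x. f x + f' x) x = Lop w f x + Lop w f' x"
  by (simp add: Lop_def Lam_add mu_add algebra_simps)

lemma Lop_cmult: "fst w \<in> lforms V \<Longrightarrow> f \<in> lforms AA \<Longrightarrow> x \<in> carrier AA \<Longrightarrow>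
    Lop w (\<lambda>x. c * f x) x = c * Lop w f x"
  by (simp add: Lop_def Lam_cmult mu_cmult algebra_simps)

lemma Lop_lin:
  assumes "fst w \<in> lforms V" "fst w' \<in> lforms V" "fst w'' \<in> lforms V" "f \<in> lforms AA" "x \<in> carrier AA"
    "\<And>v. v \<in> carrier V \<Longrightarrow> fst w'' v = a * fst w v + b * fst w' v" "snd w'' = a * snd w + b * snd w'"
  shows "Lop w'' f x = a * Lop w f x + b * Lop w' f x"
  using Lam_lin[OF assms(1-6)] assms(7) by (simp add: Lop_def algebra_simps)

text \<open>The square of \<open>\<i>\<close> turns the sign in \<open>Lam_Lam\<close>,
  \<open>zet\<close> squares to the indicator, which is the identity on \<open>Dh\<close>, and the
  mixed terms cancel since \<open>Lam\<close> and \<open>zet\<close> anticommute.\<close>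

lemma Lop_Lop:
  assumes w: "fst w \<in> lforms V" "fst w' \<in> lforms V" and f: "f \<in> Dh" and x: "x \<in> carrier AA"
  shows "Lop w (Lop w' f) x + Lop w' (Lop w f) x = 2 * (fst w (cc (fst w')) + snd w * snd w') * f x"
proof -
  note lf = Dh_lform[OF f]
  have *: "Lop y (Lop z f) x = - Lam (fst y) (Lam (fst z) f) x + snd y * snd z * f x
      + \<i> * snd z * Lam (fst y) (mu zet f) x - \<i> * snd y * Lam (fst z) (mu zet f) x"
    if y: "fst y \<in> lforms V" "fst z \<in> lforms V" for y z
  proof -
    have l: "Lam (fst z) f \<in> lforms AA" "mu zet f \<in> lforms AA"
      using y lf by (simp_all add: Lam_lform mu_lform)
    have "Lop y (Lop z f) x = \<i> * Lam (fst y) (\<lambda>x. \<i> * Lam (fst z) f x + snd z * mu zet f x) x +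
        snd y * mu zet (\<lambda>x. \<i> * Lam (fst z) f x + snd z * mu zet f x) x"
      by (simp add: Lop_def)
    also have "Lam (fst y) (\<lambda>x. \<i> * Lam (fst z) f x + snd z * mu zet f x) x =
        \<i> * Lam (fst y) (Lam (fst z) f) x + snd z * Lam (fst y) (mu zet f) x"
      using Lam_add[OF y(1) lform_lin(2)[OF l(1,1)] lform_lin(2)[OF l(2,2)] x]
      by (simp only: Lam_cmult[OF y(1) l(1) x] Lam_cmult[OF y(1) l(2) x])
    also have "mu zet (\<lambda>x. \<i> * Lam (fst z) f x + snd z * mu zet f x) x =
        \<i> * mu zet (Lam (fst z) f) x + snd z * mu zet (mu zet f) x"
      using mu_add[OF lform_lin(2)[OF l(1,1)] lform_lin(2)[OF l(2,2)] x]
      by (simp only: mu_cmult[OF l(1) x] mu_cmult[OF l(2) x])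
    finally show ?thesis
      using lf by (simp add: mu_zet_zet[OF f x] Lam_mu[OF y(2) _ x] algebra_simps)
  qed
  show ?thesis
    using Lam_Lam[OF w lf x] by (simp add: *[OF w] *[OF w(2,1)] algebra_simps)
qed

lemma Lop_K:
  assumes w: "fst w \<in> lforms V" and f: "f \<in> Dh" and f': "f' \<in> lforms AA" and x: "x \<in> carrier AA"
  shows "K (Lop w f) f' x = Lop w (K f f') x"
proof -
  note lf = Dh_lform[OF f]
  have l: "Lam (fst w) f \<in> lforms AA" "mu zet f \<in> lforms AA"
    using w lf by (simp_all add: Lam_lform mu_lform)
  have "K (Lop w f) f' x = K (\<lambda>x. \<i> * Lam (fst w) f x) f' x + K (\<lambda>x. snd w * mu zet f x) f' x"
    unfolding Lop_def by (rule K_add1[OF lform_lin(2)[OF l(1,1)] lform_lin(2)[OF l(2,2)] f' x])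
  also have "\<dots> = \<i> * K (Lam (fst w) f) f' x + snd w * K (mu zet f) f' x"
    by (simp only: K_cmult1[OF l(1) f' x] K_cmult1[OF l(2) f' x])
  finally show ?thesis using Lam_K[OF w f f' x] mu_K[OF lf f' x] by (simp only: Lop_def)
qed

lemma Lop_vec:
  assumes "fst w \<in> lforms V" "f \<in> lforms AA" "x \<in> carrier AA" "v \<in> carrier V"
  shows "Lop w f (x \<otimes>\<^bsub>AA\<^esub> \<eta> v) = \<i> * fst w v * f x - Lop w (rv v f) x"
  using assms by (simp add: Lop_def Lam_vec mu_vec mu_zet_u lform_rmult algebra_simps)

end

section \<open>Clifford algebras\<close>

lemma lookup_scalar: "Poly_Mapping.lookup (Poly_Mapping.single 0 c * q) k = c * Poly_Mapping.lookup q k"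
  for q :: "'x fword \<Rightarrow>\<^sub>0 complex"
proof -
  have "q \<in> carrier (free_alg UNIV)" by (auto simp: carrier_free_alg)
  then show ?thesis
    by (induction q rule: free_alg_induct)
      (simp_all add: distrib_left mult_single lookup_add lookup_single when_def)
qed

lemma scalar_right: "q * (Poly_Mapping.single 0 c * p) = Poly_Mapping.single 0 c * (q * p)"
  for p q :: "'x fword \<Rightarrow>\<^sub>0 complex"
  by (metis mult.assoc single_zero_comm)

lemma scalar_simps [simp]:
  "Poly_Mapping.single 0 1 * p = p" "Poly_Mapping.single 0 0 * p = 0"
  "Poly_Mapping.single 0 (- c) * p = - (Poly_Mapping.single 0 c * p)"
  "Poly_Mapping.single 0 c * (Poly_Mapping.single 0 d * p) = Poly_Mapping.single 0 (c * d) * p"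
  "letter x * (Poly_Mapping.single 0 c * p) = Poly_Mapping.single 0 c * (letter x * p)"
  for p :: "'x fword \<Rightarrow>\<^sub>0 complex"
proof -
  show "Poly_Mapping.single 0 (- c) * p = - (Poly_Mapping.single 0 c * p)"
    by (intro poly_mapping_eqI) (simp add: lookup_scalar)
  show "letter x * (Poly_Mapping.single 0 c * p) = Poly_Mapping.single 0 c * (letter x * p)"
    by (rule scalar_right)
qed (simp_all add: mult_single flip: mult.assoc)

lemma scalar_add: "Poly_Mapping.single 0 (c + d) * p = Poly_Mapping.single 0 c * p + Poly_Mapping.single 0 d * p"
  for p :: "'x fword \<Rightarrow>\<^sub>0 complex"
  by (simp add: single_add distrib_right)

lemma free_alg_letter_induct [consumes 1, case_names one letter add scalar]:
  assumes "p \<in> carrier (free_alg X)" and one: "P 1"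
    and letter: "\<And>x p. x \<in> X \<Longrightarrow> p \<in> carrier (free_alg X) \<Longrightarrow> P p \<Longrightarrow> P (letter x * p)"
    and add: "\<And>p q. p \<in> carrier (free_alg X) \<Longrightarrow> q \<in> carrier (free_alg X) \<Longrightarrow> P p \<Longrightarrow> P q \<Longrightarrow> P (p + q)"
    and scalar: "\<And>c p. p \<in> carrier (free_alg X) \<Longrightarrow> P p \<Longrightarrow> P (Poly_Mapping.single 0 c * p)"
  shows "P p"
  using assms(1)
proof (induction p rule: free_alg_induct)
  case zero
  then show ?case using scalar[of 1 0] one by simp
next
  case (add p u c)
  have "P (Poly_Mapping.single (FWord u) 1)"
    using add(2)
  proof (induction u)
    case Nil
    then show ?case using one by (simp flip: zero_fword_def)
  next
    case (Cons x u)
    have "Poly_Mapping.single (FWord (x # u)) 1 = letter x * Poly_Mapping.single (FWord u) (1 :: complex)"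
      by (simp add: letter_def mult_single plus_fword_def)
    then show ?case using Cons letter[of x "Poly_Mapping.single (FWord u) 1"] by simp
  qed
  from scalar[OF _ this, of c] have "P (Poly_Mapping.single (FWord u) c)"
    using add(2) by (simp add: mult_single)
  then show ?case using add assms(4)[of p] by simp
qed

text \<open>Counterpart of \<open>wsum\<close> with values in a free algebra, for operators given
  word by word.\<close>

definition fsum :: "('x fword \<Rightarrow>\<^sub>0 complex) \<Rightarrow> ('x list \<Rightarrow> 'y fword \<Rightarrow>\<^sub>0 complex) \<Rightarrow> 'y fword \<Rightarrow>\<^sub>0 complex" where
  "fsum p F = (\<Sum>w\<in>Poly_Mapping.keys p. Poly_Mapping.single 0 (Poly_Mapping.lookup p w) * F (letters w))"

lemma lookup_fsum: "Poly_Mapping.lookup (fsum p F) k = wsum p (\<lambda>w. Poly_Mapping.lookup (F w) k)"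
  by (simp add: fsum_def wsum_def lookup_sum lookup_scalar)

lemma fsum_simps [simp]:
  "fsum 0 F = 0" "fsum 1 F = F []" "fsum (p + q) F = fsum p F + fsum q F"
  "fsum (p - q) F = fsum p F - fsum q F"
  "fsum (Poly_Mapping.single 0 c * p) F = Poly_Mapping.single 0 c * fsum p F"
  "fsum (Poly_Mapping.single w c) F = Poly_Mapping.single 0 c * F (letters w)"
  "fsum (letter x * p) F = fsum p (\<lambda>w. F (x # w))"
  by (simp_all add: poly_mapping_eq_iff fun_eq_iff lookup_fsum lookup_add lookup_minus lookup_scalar)

lemma fsum_fun_diff: "fsum p (\<lambda>w. F w - G w) = fsum p F - fsum p G"
  by (simp add: poly_mapping_eq_iff fun_eq_iff lookup_fsum lookup_minus wsum_fun_diff)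

lemma fsum_fun_mult:
  fixes F :: "'x list \<Rightarrow> 'y fword \<Rightarrow>\<^sub>0 complex"
  shows "fsum p (\<lambda>w. q * F w) = q * fsum p F"
proof -
  have "p \<in> carrier (free_alg UNIV)" by (auto simp: carrier_free_alg)
  then show ?thesis
    by (induction p rule: free_alg_induct) (simp_all add: distrib_left scalar_right)
qed

lemma fsum_words: "fsum p (\<lambda>w. Poly_Mapping.single (FWord w) 1) = p"
proof -
  have "p \<in> carrier (free_alg UNIV)" by (auto simp: carrier_free_alg)
  then show ?thesis
    by (induction p rule: free_alg_induct) (simp_all add: mult_single)
qed

context gvdata
begin

abbreviation "WW \<equiv> direct_sum (dual_space V) ground"
abbreviation "FW \<equiv> free_alg (carrier WW)"
definition zz :: "('v \<Rightarrow> complex) \<times> complex" where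
  "zz = (\<lambda>v\<in>carrier V. 0, 1)"

lemma WW_simps:
  "carrier WW = (lforms V \<inter> extensional (carrier V)) \<times> UNIV"
  "w \<oplus>\<^bsub>WW\<^esub> w' = (\<lambda>v\<in>carrier V. fst w v + fst w' v, snd w + snd w')"
  "c \<odot>\<^bsub>WW\<^esub> w = (\<lambda>v\<in>carrier V. c * fst w v, c * snd w)"
  by (auto simp: direct_sum_def dual_space_def ground_def class_ring.func_space_def class_ring_simps)

lemma WW_fst: "w \<in> carrier WW \<Longrightarrow> fst w \<in> lforms V"
  by (auto simp: WW_simps)

lemma WW_closed [simp]:
  "w \<in> carrier WW \<Longrightarrow> w' \<in> carrier WW \<Longrightarrow> w \<oplus>\<^bsub>WW\<^esub> w' \<in> carrier WW"
  "w \<in> carrier WW \<Longrightarrow> c \<odot>\<^bsub>WW\<^esub> w \<in> carrier WW"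
  "\<xi> \<in> lforms V \<inter> extensional (carrier V) \<Longrightarrow> (\<xi>, s) \<in> carrier WW"
  "zz \<in> carrier WW"
  by (auto simp: WW_simps zz_def lforms_iff algebra_simps)

text \<open>Contraction of a word with \<open>v\<close>; the summand \<open>\<complex>\<close> is orthogonal to \<open>v\<close>.\<close>

fun ctr_word :: "'v \<Rightarrow> (('v \<Rightarrow> complex) \<times> complex) list \<Rightarrow> (('v \<Rightarrow> complex) \<times> complex) fword \<Rightarrow>\<^sub>0 complex" where
  "ctr_word v [] = 0"
| "ctr_word v (w # ws) = Poly_Mapping.single 0 (fst w v) * Poly_Mapping.single (FWord ws) 1 - letter w * ctr_word v ws"

definition ctr :: "'v \<Rightarrow> ((('v \<Rightarrow> complex) \<times> complex) fword \<Rightarrow>\<^sub>0 complex) \<Rightarrow> (('v \<Rightarrow> complex) \<times> complex) fword \<Rightarrow>\<^sub>0 complex" where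
  "ctr v p = fsum p (ctr_word v)"

lemma ctr_simps [simp]:
  "ctr v 0 = 0" "ctr v 1 = 0" "ctr v (p + q) = ctr v p + ctr v q" "ctr v (p - q) = ctr v p - ctr v q"
  "ctr v (Poly_Mapping.single 0 c * p) = Poly_Mapping.single 0 c * ctr v p"
  "ctr v (letter w * p) = Poly_Mapping.single 0 (fst w v) * p - letter w * ctr v p"
  by (simp_all add: ctr_def fsum_fun_diff fsum_fun_mult fsum_words)

lemma ctr_closed [simp]: "p \<in> carrier FW \<Longrightarrow> ctr v p \<in> carrier FW"
  by (induction p rule: free_alg_letter_induct) simp_all

end

section \<open>The ideal of Clifford relations and its filtration\<close>

locale cliff = gvdata G V \<rho>
  for G :: "('g, 'n) monoid_scheme" and V :: "(complex, 'v, 'm) module_scheme" and \<rho> :: "'g \<Rightarrow> 'v \<Rightarrow> 'v" +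
  fixes Q :: "('v \<Rightarrow> complex) \<times> complex \<Rightarrow> ('v \<Rightarrow> complex) \<times> complex \<Rightarrow> complex"
begin

definition "crel w w' = letter w * letter w' + letter w' * letter w - Poly_Mapping.single 0 (2 * Q w w')"
definition "RW = linear_rels WW letter \<union> {crel w w' | w w'. w \<in> carrier WW \<and> w' \<in> carrier WW}"
text \<open>Presents the Clifford algebra as one quotient of the free algebra; the construction
  through the tensor algebra is compared with it in \<open>cl_zero_iff\<close>.\<close>

definition "NN = Idl\<^bsub>FW\<^esub> RW"

lemma RW_subset: "RW \<subseteq> carrier FW"
  by (auto simp: RW_def linear_rels_def crel_def)

sublocale N: calg_ideal FW NN
proof (intro calg_ideal.intro calg_free_alg)
  interpret ring FW by (rule ring_free_alg)
  show "ideal NN FW" unfolding NN_def by (rule genideal_ideal[OF RW_subset])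
qed

lemma RW_in_NN: "r \<in> RW \<Longrightarrow> r \<in> NN"
  using N.genideal_self[OF RW_subset] by (auto simp: NN_def)

lemma NN_closed [intro]:
  "p \<in> NN \<Longrightarrow> q \<in> NN \<Longrightarrow> p + q \<in> NN" "p \<in> NN \<Longrightarrow> q \<in> carrier FW \<Longrightarrow> q * p \<in> NN"
  "p \<in> NN \<Longrightarrow> q \<in> carrier FW \<Longrightarrow> p * q \<in> NN" "0 \<in> NN" "p \<in> NN \<Longrightarrow> Poly_Mapping.single 0 c * p \<in> NN"
  using N.additive_subgroup_axioms N.a_closed[of p q] N.I_l_closed[of p q] N.I_r_closed[of p q]
    N.zero_closed N.smult_ideal[of p c] by simp_all

lemma NN_uminus: "p \<in> NN \<Longrightarrow> - p \<in> NN"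
  using NN_closed(5)[of p "- 1"] by simp

lemma NN_diff: "p \<in> NN \<Longrightarrow> q \<in> NN \<Longrightarrow> p - q \<in> NN"
  using NN_closed(1)[OF _ NN_uminus, of p q] by simp

text \<open>Contraction is an antiderivation that annihilates each defining relation, whatever the
  form Q is. So it passes a relation up to sign, and words to the left are handled letter by
  letter.\<close>

lemma ctr_NN: "p \<in> NN \<Longrightarrow> v \<in> carrier V \<Longrightarrow> ctr v p \<in> NN"
proof -
  assume p: "p \<in> NN" and v: "v \<in> carrier V"
  have rel: "ctr v (r * q) \<in> NN" if r: "r \<in> RW" and q: "q \<in> carrier FW" for r q
  proof -
    have "r * ctr v q \<in> NN" using RW_in_NN[OF r] q by (intro NN_closed) simp_all
    moreover consider (add) w w' where "r = letter (w \<oplus>\<^bsub>WW\<^esub> w') - letter w - letter w'"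
      | (smult) c w where "r = letter (c \<odot>\<^bsub>WW\<^esub> w) - Poly_Mapping.single 0 c * letter w"
      | (cl) w w' where "r = crel w w'"
      using r by (auto simp: RW_def linear_rels_def)
    then have "ctr v (r * q) = r * ctr v q \<or> ctr v (r * q) = - (r * ctr v q)"
    proof cases
      case add
      have "fst (w \<oplus>\<^bsub>WW\<^esub> w') v = fst w v + fst w' v" using v by (simp add: WW_simps)
      then have "ctr v (r * q) = - (r * ctr v q)"
        unfolding add by (simp add: left_diff_distrib scalar_add)
      then show ?thesis ..
    next
      case smult
      have "fst (c \<odot>\<^bsub>WW\<^esub> w) v = c * fst w v" using v by (simp add: WW_simps)
      then have "ctr v (r * q) = - (r * ctr v q)"
        unfolding smult by (simp add: left_diff_distrib right_diff_distrib mult.assoc)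
      then show ?thesis ..
    next
      case cl
      have "ctr v (r * q) = r * ctr v q"
        unfolding cl crel_def by (simp add: distrib_right left_diff_distrib right_diff_distrib mult.assoc)
      then show ?thesis ..
    qed
    ultimately show ?thesis using NN_uminus by auto
  qed
  have words: "ctr v (Poly_Mapping.single (FWord u) c * q) \<in> NN"
    if "q \<in> NN" "ctr v q \<in> NN" "set u \<subseteq> carrier WW" for u c q
    using that(3)
  proof (induction u arbitrary: c)
    case Nil
    show ?case using NN_closed(5)[OF that(2), of c] by (simp only: zero_fword_def[symmetric] ctr_simps)
  next
    case (Cons w u)
    have eq: "Poly_Mapping.single (FWord (w # u)) c = letter w * Poly_Mapping.single (FWord u) (c :: complex)"
      by (simp add: letter_def mult_single plus_fword_def)
    have "Poly_Mapping.single (FWord u) c * q \<in> NN" using that Cons by (intro NN_closed) simp_all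
    then show ?case using Cons unfolding eq mult.assoc ctr_simps
      by (intro NN_diff NN_closed(5)[of "Poly_Mapping.single (FWord u) c * q"] NN_closed(2)[of "ctr v (Poly_Mapping.single (FWord u) c * q)"]) simp_all
  qed
  show ?thesis
    using RW_subset p[unfolded NN_def]
  proof (induction p rule: Idl_free_alg_induct)
    case (gen u w c r)
    then show ?case unfolding mult.assoc
      by (intro words rel NN_closed(3) RW_in_NN) simp_all
  qed auto
qed

lemma cong_scalar_letter:
  assumes "w \<in> carrier WW"
  shows "letter (c \<odot>\<^bsub>WW\<^esub> w) - Poly_Mapping.single 0 c * letter w \<in> NN"
  by (rule RW_in_NN, unfold RW_def linear_rels_def, rule UnI1, rule UnI2, rule CollectI)
    (rule exI[of _ c], rule exI[of _ w], rule conjI[OF refl assms])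

lemma cong_add_letter:
  assumes "w \<in> carrier WW" "w' \<in> carrier WW"
  shows "letter (w \<oplus>\<^bsub>WW\<^esub> w') - letter w - letter w' \<in> NN"
  by (rule RW_in_NN, unfold RW_def linear_rels_def, rule UnI1, rule UnI1, rule CollectI)
    (rule exI[of _ w], rule exI[of _ w'], intro conjI refl assms)

lemma crel_NN:
  assumes "w \<in> carrier WW" "w' \<in> carrier WW"
  shows "crel w w' \<in> NN"
  by (rule RW_in_NN, unfold RW_def, rule UnI2, rule CollectI)
    (rule exI[of _ w], rule exI[of _ w'], intro conjI refl assms)

abbreviation xl :: "('v \<Rightarrow> complex) \<Rightarrow> (('v \<Rightarrow> complex) \<times> complex) fword \<Rightarrow>\<^sub>0 complex" where
  "xl \<xi> \<equiv> letter (\<xi>, 0)"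
abbreviation "zl \<equiv> letter zz"
abbreviation "VD \<equiv> lforms V \<inter> extensional (carrier V)"

lemma letter_split: "w \<in> carrier WW \<Longrightarrow> letter w - xl (fst w) - Poly_Mapping.single 0 (snd w) * zl \<in> NN"
proof -
  assume w: "w \<in> carrier WW"
  then have f: "fst w \<in> VD" by (auto simp: WW_simps)
  have eq: "(fst w, 0) \<oplus>\<^bsub>WW\<^esub> (snd w \<odot>\<^bsub>WW\<^esub> zz) = w"
    using f by (auto simp: WW_simps zz_def extensional_def fun_eq_iff prod_eq_iff)
  have "letter w - xl (fst w) - letter (snd w \<odot>\<^bsub>WW\<^esub> zz) \<in> NN"
    using cong_add_letter[of "(fst w, 0)" "snd w \<odot>\<^bsub>WW\<^esub> zz"] f unfolding eq by simp
  from NN_closed(1)[OF this cong_scalar_letter[of zz "snd w"]] show ?thesis by simp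
qed

lemma letter_sum:
  assumes "finite S" "\<And>e. e \<in> S \<Longrightarrow> \<epsilon> e \<in> VD"
  shows "xl (\<lambda>v\<in>carrier V. \<Sum>e\<in>S. c e * \<epsilon> e v) - (\<Sum>e\<in>S. Poly_Mapping.single 0 (c e) * xl (\<epsilon> e)) \<in> NN"
  using assms
proof (induction S rule: finite_induct)
  case empty
  have "0 \<odot>\<^bsub>WW\<^esub> zz = (\<lambda>v\<in>carrier V. 0, 0)" by (auto simp: WW_simps zz_def)
  then show ?case using cong_scalar_letter[of zz 0] by (simp only: sum.empty scalar_simps diff_zero WW_closed)
next
  case (insert e S)
  let ?\<xi> = "\<lambda>v\<in>carrier V. \<Sum>e\<in>S. c e * \<epsilon> e v"
  have l: "\<epsilon> e \<in> lforms V" if "e \<in> S" for e using insert(4) that by simp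
  have \<xi>: "?\<xi> \<in> VD"
    by (simp add: lforms_iff lforms_add[OF l] lforms_smult[OF l] distrib_left sum.distrib sum_distrib_left mult.left_commute
      cong: sum.cong_simp)
  have e: "\<epsilon> e \<in> VD" using insert(4) by simp
  have eq: "(\<lambda>v\<in>carrier V. \<Sum>e\<in>insert e S. c e * \<epsilon> e v, 0) = (c e \<odot>\<^bsub>WW\<^esub> (\<epsilon> e, 0)) \<oplus>\<^bsub>WW\<^esub> (?\<xi>, 0)"
    using insert(1,2) by (auto simp: WW_simps)
  have "letter ((c e \<odot>\<^bsub>WW\<^esub> (\<epsilon> e, 0)) \<oplus>\<^bsub>WW\<^esub> (?\<xi>, 0)) - letter (c e \<odot>\<^bsub>WW\<^esub> (\<epsilon> e, 0)) - xl ?\<xi> \<in> NN"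
    using \<xi> e by (intro cong_add_letter) simp_all
  note this[folded eq]
  moreover have "letter (c e \<odot>\<^bsub>WW\<^esub> (\<epsilon> e, 0)) - Poly_Mapping.single 0 (c e) * xl (\<epsilon> e) \<in> NN"
    using e by (intro cong_scalar_letter) simp
  moreover have "xl ?\<xi> - (\<Sum>e\<in>S. Poly_Mapping.single 0 (c e) * xl (\<epsilon> e)) \<in> NN"
    by (rule insert.IH[OF insert(4)[OF insertI2]])
  ultimately have "letter (\<lambda>v\<in>carrier V. \<Sum>e\<in>insert e S. c e * \<epsilon> e v, 0) - letter (c e \<odot>\<^bsub>WW\<^esub> (\<epsilon> e, 0)) - xl ?\<xi> +
      (letter (c e \<odot>\<^bsub>WW\<^esub> (\<epsilon> e, 0)) - Poly_Mapping.single 0 (c e) * xl (\<epsilon> e)) +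
      (xl ?\<xi> - (\<Sum>e\<in>S. Poly_Mapping.single 0 (c e) * xl (\<epsilon> e))) \<in> NN"
    by (intro NN_closed(1))
  moreover have "x - y - z + (y - t) + (z - r) = x - (t + r)"
    for x y z t r :: "(('v \<Rightarrow> complex) \<times> complex) fword \<Rightarrow>\<^sub>0 complex" by simp
  ultimately show ?case unfolding sum.insert[OF insert(1,2)] by (simp only:)
qed

text \<open>\<open>filt k\<close> allows fewer than \<open>k\<close> letters from \<open>V\<^sup>*\<close>, so that \<open>filt 0\<close> is the ideal itself.\<close>

inductive filt :: "nat \<Rightarrow> ((('v \<Rightarrow> complex) \<times> complex) fword \<Rightarrow>\<^sub>0 complex) \<Rightarrow> bool" where
  filt_NN: "p \<in> NN \<Longrightarrow> filt k p"
| filt_one: "filt (Suc k) 1"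
| filt_add: "filt k p \<Longrightarrow> filt k q \<Longrightarrow> filt k (p + q)"
| filt_scalar: "filt k p \<Longrightarrow> filt k (Poly_Mapping.single 0 c * p)"
| filt_z: "filt k p \<Longrightarrow> filt k (zl * p)"
| filt_x: "\<xi> \<in> VD \<Longrightarrow> filt k p \<Longrightarrow> filt (Suc k) (xl \<xi> * p)"

lemma filt_carrier: "filt k p \<Longrightarrow> p \<in> carrier FW"
  by (induction rule: filt.induct) simp_all

text \<open>At level 0 only the rules that preserve the ideal apply.\<close>

lemma filt_0: "filt k p \<Longrightarrow> k = 0 \<Longrightarrow> p \<in> NN"
  by (induction rule: filt.induct) auto

lemma filt_Suc: "filt k p \<Longrightarrow> filt (Suc k) p"
  by (induction rule: filt.induct) (auto intro: filt.intros)

lemma filt_mono: "k \<le> l \<Longrightarrow> filt k p \<Longrightarrow> filt l p"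
  by (induction l rule: dec_induct) (auto intro: filt_Suc)

lemma filt_uminus: "filt k p \<Longrightarrow> filt k (- p)"
  using filt_scalar[of k p "- 1"] by simp

lemma filt_diff: "filt k p \<Longrightarrow> filt k q \<Longrightarrow> filt k (p - q)"
  using filt_add[OF _ filt_uminus, of k p q] by simp

lemma filt_sum: "finite S \<Longrightarrow> (\<And>e. e \<in> S \<Longrightarrow> filt k (h e)) \<Longrightarrow> filt k (\<Sum>e\<in>S. h e)"
  by (induction S rule: finite_induct) (auto intro: filt_add filt_NN)

lemma filt_exhaust:
  assumes "p \<in> carrier FW"
  shows "\<exists>k. filt k p"
  using assms
proof (induction p rule: free_alg_letter_induct)
  case one
  then show ?case by (intro exI[of _ "Suc 0"] filt_one)
next
  case (letter w p)
  from letter.IH obtain k where k: "filt k p" by (elim exE)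
  have w: "fst w \<in> VD" using letter by (auto simp: WW_simps)
  have "(letter w - xl (fst w) - Poly_Mapping.single 0 (snd w) * zl) * p \<in> NN"
    using letter by (intro NN_closed(3) letter_split) simp_all
  then have "filt (Suc k) ((letter w - xl (fst w) - Poly_Mapping.single 0 (snd w) * zl) * p +
      (xl (fst w) * p + Poly_Mapping.single 0 (snd w) * (zl * p)))"
    by (rule filt_add[OF filt_NN filt_add[OF filt_x[OF w k] filt_scalar[OF filt_z[OF filt_Suc[OF k]]]]])
  then show ?case by (intro exI[of _ "Suc k"]) (simp add: left_diff_distrib mult.assoc)
next
  case (add p q)
  from add.IH(1) obtain k where k: "filt k p" by (elim exE)
  from add.IH(2) obtain l where l: "filt l q" by (elim exE)
  have "filt (max k l) p" by (rule filt_mono[OF max.cobounded1 k])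
  moreover have "filt (max k l) q" by (rule filt_mono[OF max.cobounded2 l])
  ultimately show ?case by (intro exI[of _ "max k l"] filt_add)
next
  case (scalar c p)
  from scalar.IH obtain k where "filt k p" by (elim exE)
  then show ?case by (intro exI[of _ k] filt_scalar)
qed

lemma filt_ctr:
  assumes "filt k p" "v \<in> carrier V"
  shows "filt (k - 1) (ctr v p)"
  using assms(1)
proof (induction rule: filt.induct)
  case (filt_NN p k)
  then show ?case using assms(2) by (intro filt.filt_NN ctr_NN)
next
  case (filt_one k)
  then show ?case by (simp add: filt.filt_NN NN_closed)
next
  case (filt_add k p q)
  then show ?case by (simp add: filt.filt_add)
next
  case (filt_scalar k p c)
  then show ?case by (simp add: filt.filt_scalar)
next
  case (filt_z k p)
  then show ?case using assms(2) filt_uminus[OF filt.filt_z] by (simp add: zz_def)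
next
  case (filt_x \<xi> k p)
  have "filt k (xl \<xi> * ctr v p)"
  proof (cases k)
    \<comment> \<open>\<open>filt_x\<close> would lead to level 1 here; instead p lies in the ideal,
      and so does its contraction.\<close>
    case 0
    then have "p \<in> NN" using filt_x filt_0 by blast
    then show ?thesis using filt_x(1) assms(2) by (intro filt_NN NN_closed(2) ctr_NN) simp_all
  next
    case (Suc j)
    then show ?thesis using filt_x filt.filt_x by simp
  qed
  then show ?case using filt_x by (simp add: filt_diff filt.filt_scalar)
qed

text \<open>Without letters from V* only powers of z remain, and z^2 is a scalar modulo the
  ideal.\<close>

lemma filt_1: "filt k p \<Longrightarrow> k = Suc 0 \<Longrightarrow>
  \<exists>a b. p - (Poly_Mapping.single 0 a + Poly_Mapping.single 0 b * zl) \<in> NN"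
proof (induction rule: filt.induct)
  case (filt_NN p k)
  then show ?case by (intro exI[of _ 0]) simp
next
  case (filt_one k)
  then show ?case by (intro exI[of _ 1] exI[of _ 0]) (simp add: NN_closed)
next
  case (filt_add k p q)
  then obtain a b a' b' where "p - (Poly_Mapping.single 0 a + Poly_Mapping.single 0 b * zl) \<in> NN"
    "q - (Poly_Mapping.single 0 a' + Poly_Mapping.single 0 b' * zl) \<in> NN" by blast
  from NN_closed(1)[OF this] show ?case
    by (intro exI[of _ "a + a'"] exI[of _ "b + b'"]) (simp add: single_add algebra_simps)
next
  case (filt_scalar k p c)
  then obtain a b where "p - (Poly_Mapping.single 0 a + Poly_Mapping.single 0 b * zl) \<in> NN" by blast
  from NN_closed(5)[OF this, of c] show ?case
    by (intro exI[of _ "c * a"] exI[of _ "c * b"]) (simp add: mult_single right_diff_distrib distrib_left)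
next
  case (filt_z k p)
  then obtain a b where ab: "p - (Poly_Mapping.single 0 a + Poly_Mapping.single 0 b * zl) \<in> NN" by blast
  \<comment> \<open>\<open>crel zz zz\<close> is twice z^2 - Q(z, z), so its multiple by b / 2
    exchanges b z^2 for a scalar.\<close>
  have "zl * (p - (Poly_Mapping.single 0 a + Poly_Mapping.single 0 b * zl)) +
      Poly_Mapping.single 0 (b / 2) * crel zz zz \<in> NN"
    using ab by (intro NN_closed crel_NN) simp_all
  also have "zl * (p - (Poly_Mapping.single 0 a + Poly_Mapping.single 0 b * zl)) +
      Poly_Mapping.single 0 (b / 2) * crel zz zz =
      zl * p - (Poly_Mapping.single 0 (b * Q zz zz) + Poly_Mapping.single 0 a * zl)"
  proof -
    have "Poly_Mapping.single 0 (b / 2) * q + Poly_Mapping.single 0 (b / 2) * q = Poly_Mapping.single 0 b * q"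
      for q :: "(('v \<Rightarrow> complex) \<times> complex) fword \<Rightarrow>\<^sub>0 complex"
      by (simp flip: scalar_add)
    then show ?thesis
      using single_zero_comm[of a zl]
      by (simp add: crel_def right_diff_distrib distrib_left mult_single)
  qed
  finally show ?case by blast
next
  case (filt_x \<xi> k p)
  then have "p \<in> NN" using filt_0 by simp
  then have "xl \<xi> * p \<in> NN" using filt_x by (intro NN_closed(2)) simp_all
  then show ?case by (intro exI[of _ 0]) simp
qed

end

subsection \<open>Iterated quotients\<close>

context calg_ideal
begin

lemma ideal_image:
  assumes "ideal N A"
  shows "ideal (cls ` N) (quot_alg A I)"
proof -
  interpret Q: calg "quot_alg A I" by (rule calg_quot)
  interpret N: ideal N A by fact
  have N: "x \<in> N \<Longrightarrow> x \<in> carrier A" for x using N.a_subset by auto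
  have "subgroup (cls ` N) (add_monoid (quot_alg A I))"
  proof (rule Q.add.subgroupI)
    show "cls ` N \<noteq> {}" using additive_subgroup.zero_closed[OF N.additive_subgroup_axioms] by blast
    fix a b assume a: "a \<in> cls ` N"
    then obtain x where x: "x \<in> N" "a = cls x" by auto
    have "\<ominus>\<^bsub>quot_alg A I\<^esub> cls x = cls (\<ominus> x)"
      by (rule Q.minus_equality) (use N x in \<open>simp_all add: l_neg\<close>)
    then show "\<ominus>\<^bsub>quot_alg A I\<^esub> a \<in> cls ` N" using x N.a_inv_closed by auto
    assume "b \<in> cls ` N"
    then show "a \<oplus>\<^bsub>quot_alg A I\<^esub> b \<in> cls ` N" using x N N.a_closed by auto
  qed (use N in auto)
  then show ?thesis
    by (rule idealI[OF Q.ring_axioms]) (use N N.I_l_closed N.I_r_closed in \<open>auto simp: carrier_quot\<close>)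
qed

lemma ideal_vimage:
  assumes "ideal J (quot_alg A I)"
  shows "ideal {x \<in> carrier A. cls x \<in> J} A"
proof -
  interpret Q: calg "quot_alg A I" by (rule calg_quot)
  interpret J: ideal J "quot_alg A I" by fact
  have "subgroup {x \<in> carrier A. cls x \<in> J} (add_monoid A)"
  proof (rule add.subgroupI)
    have "cls \<zero> \<in> J" using additive_subgroup.zero_closed[OF J.additive_subgroup_axioms] unfolding quot_zero .
    then have "\<zero> \<in> {x \<in> carrier A. cls x \<in> J}" by simp
    then show "{x \<in> carrier A. cls x \<in> J} \<noteq> {}" by (metis empty_iff)
    fix x y assume x: "x \<in> {x \<in> carrier A. cls x \<in> J}"
    have "cls (\<ominus> x) = \<ominus>\<^bsub>quot_alg A I\<^esub> cls x"
      by (rule Q.minus_equality[symmetric]) (use x in \<open>simp_all add: l_neg\<close>)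
    then show "\<ominus> x \<in> {x \<in> carrier A. cls x \<in> J}" using x J.a_inv_closed by auto
    assume "y \<in> {x \<in> carrier A. cls x \<in> J}"
    then show "x \<oplus> y \<in> {x \<in> carrier A. cls x \<in> J}" using x J.a_closed[of "cls x" "cls y"] by auto
  qed auto
  then show ?thesis
  proof (rule idealI[OF ring_axioms])
    fix a x assume a: "a \<in> {x \<in> carrier A. cls x \<in> J}" and x: "x \<in> carrier A"
    then show "x \<otimes> a \<in> {x \<in> carrier A. cls x \<in> J}" "a \<otimes> x \<in> {x \<in> carrier A. cls x \<in> J}"
      using J.I_l_closed[of "cls a" "cls x"] J.I_r_closed[of "cls a" "cls x"] by auto
  qed
qed

text \<open>Third isomorphism theorem on the level of generators. Each direction is minimality of a
  generated ideal, tested against the image or the preimage of the other one.\<close>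

lemma cls_in_genideal_iff:
  assumes I: "I = Idl R" and R: "R \<subseteq> carrier A" and S: "S \<subseteq> carrier A" and x: "x \<in> carrier A"
  shows "cls x \<in> Idl\<^bsub>quot_alg A I\<^esub> (cls ` S) \<longleftrightarrow> x \<in> Idl (R \<union> S)"
proof -
  interpret Q: calg "quot_alg A I" by (rule calg_quot)
  have RS: "R \<union> S \<subseteq> carrier A" and clS: "cls ` S \<subseteq> carrier (quot_alg A I)" using R S by auto
  interpret N: ideal "Idl (R \<union> S)" A by (rule genideal_ideal[OF RS])
  have IN: "I \<subseteq> Idl (R \<union> S)"
    unfolding I by (rule genideal_minimal[OF N.is_ideal]) (use genideal_self[OF RS] in auto)
  show ?thesis
  proof
    assume "cls x \<in> Idl\<^bsub>quot_alg A I\<^esub> (cls ` S)"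
    also have "Idl\<^bsub>quot_alg A I\<^esub> (cls ` S) \<subseteq> cls ` (Idl (R \<union> S))"
      by (rule Q.genideal_minimal[OF ideal_image[OF N.is_ideal]]) (use genideal_self[OF RS] in auto)
    finally obtain n where n: "n \<in> Idl (R \<union> S)" "cls x = cls n" by auto
    then have n': "n \<in> carrier A" using N.a_subset by auto
    have "x \<ominus> n \<in> Idl (R \<union> S)" using n n' x cls_eq_iff IN by auto
    then have "(x \<ominus> n) \<oplus> n \<in> Idl (R \<union> S)" using n by simp
    then show "x \<in> Idl (R \<union> S)" using x n' by (simp add: a_minus_def a_assoc l_neg)
  next
    assume "x \<in> Idl (R \<union> S)"
    also have "Idl (R \<union> S) \<subseteq> {x \<in> carrier A. cls x \<in> Idl\<^bsub>quot_alg A I\<^esub> (cls ` S)}"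
    proof (rule genideal_minimal[OF ideal_vimage[OF Q.genideal_ideal[OF clS]]])
      interpret J: ideal "Idl\<^bsub>quot_alg A I\<^esub> (cls ` S)" "quot_alg A I" by (rule Q.genideal_ideal[OF clS])
      have "cls r \<in> Idl\<^bsub>quot_alg A I\<^esub> (cls ` S)" if "r \<in> R" for r
      proof -
        have r: "r \<in> carrier A" "r \<in> I" using that R genideal_self[OF R] I by auto
        then have "cls r = cls \<zero>" using cls_eq_iff[of r \<zero>] by (simp add: a_minus_def)
        then show ?thesis
          using additive_subgroup.zero_closed[OF J.additive_subgroup_axioms] unfolding quot_zero by (simp only:)
      qed
      then show "R \<union> S \<subseteq> {x \<in> carrier A. cls x \<in> Idl\<^bsub>quot_alg A I\<^esub> (cls ` S)}"
        using R S Q.genideal_self[OF clS] by auto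
    qed
    finally show "cls x \<in> Idl\<^bsub>quot_alg A I\<^esub> (cls ` S)" by simp
  qed
qed

end

context cliff
begin

abbreviation "TI \<equiv> tensor_alg_ideal WW"
abbreviation "TA \<equiv> tensor_alg WW"
abbreviation "CI \<equiv> Idl\<^bsub>TA\<^esub> {clifford_rel WW Q v w | v w. v \<in> carrier WW \<and> w \<in> carrier WW}"
abbreviation "Cl \<equiv> clifford WW Q"

lemma linear_rels_subset: "linear_rels WW letter \<subseteq> carrier FW"
  using RW_subset by (auto simp: RW_def)

sublocale T0: calg_ideal FW TI
  unfolding tensor_alg_ideal_def
  by (intro calg_ideal.intro calg_free_alg N.genideal_ideal linear_rels_subset)

lemma calg_TA: "calg TA"
  unfolding tensor_alg_def by (rule T0.calg_quot)

lemma clifford_rel_eq: "w \<in> carrier WW \<Longrightarrow> w' \<in> carrier WW \<Longrightarrow> clifford_rel WW Q w w' = T0.cls (crel w w')"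
proof -
  assume w: "w \<in> carrier WW" "w' \<in> carrier WW"
  interpret T: calg "quot_alg FW TI" by (rule T0.calg_quot)
  let ?c = "Poly_Mapping.single 0 (2 * Q w w')"
  have c: "?c \<in> carrier FW" by simp
  have "\<ominus>\<^bsub>quot_alg FW TI\<^esub> T0.cls ?c = T0.cls (- ?c)"
    by (rule T.minus_equality) (use c in simp_all)
  then show ?thesis
    using w by (simp add: clifford_rel_def Let_def tensor_alg_def tensor_alg_incl_def a_minus_def crel_def
      del: T0.quot_zero)
qed

lemma clifford_rels_eq: "{clifford_rel WW Q v w | v w. v \<in> carrier WW \<and> w \<in> carrier WW} =
    T0.cls ` {crel w w' | w w'. w \<in> carrier WW \<and> w' \<in> carrier WW}"
  using clifford_rel_eq by (auto simp: image_Collect) metis+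

lemma crel_closed: "w \<in> carrier WW \<Longrightarrow> w' \<in> carrier WW \<Longrightarrow> crel w w' \<in> carrier FW"
  by (simp add: crel_def)

sublocale T1: calg_ideal TA CI
proof (intro calg_ideal.intro calg_TA)
  interpret T: calg TA by (rule calg_TA)
  show "ideal CI TA"
    by (rule T.genideal_ideal) (auto simp: clifford_rel_eq tensor_alg_def crel_closed)
qed

definition cl :: "((('v \<Rightarrow> complex) \<times> complex) fword \<Rightarrow>\<^sub>0 complex) \<Rightarrow> ((('v \<Rightarrow> complex) \<times> complex) fword \<Rightarrow>\<^sub>0 complex) set set" where
  "cl p = T1.cls (T0.cls p)"

lemma T0_cls_TA: "p \<in> carrier FW \<Longrightarrow> T0.cls p \<in> carrier TA"
  by (simp add: tensor_alg_def)

lemma carrier_Cl: "carrier Cl = cl ` carrier FW"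
proof -
  have "carrier Cl = T1.cls ` carrier TA" unfolding clifford_def by (rule T1.carrier_quot)
  moreover have "carrier TA = T0.cls ` carrier FW" unfolding tensor_alg_def by (rule T0.carrier_quot)
  ultimately show ?thesis unfolding cl_def[abs_def] by (simp only: image_image)
qed

lemma cl_simps [simp]:
  "\<one>\<^bsub>Cl\<^esub> = cl 1" "\<zero>\<^bsub>Cl\<^esub> = cl 0"
  "p \<in> carrier FW \<Longrightarrow> q \<in> carrier FW \<Longrightarrow> cl p \<otimes>\<^bsub>Cl\<^esub> cl q = cl (p * q)"
  "p \<in> carrier FW \<Longrightarrow> q \<in> carrier FW \<Longrightarrow> cl p \<oplus>\<^bsub>Cl\<^esub> cl q = cl (p + q)"
  "p \<in> carrier FW \<Longrightarrow> c \<odot>\<^bsub>Cl\<^esub> cl p = cl (Poly_Mapping.single 0 c * p)"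
proof -
  have TA: "mult TA = mult (quot_alg FW TI)" "add TA = add (quot_alg FW TI)" "smult TA = smult (quot_alg FW TI)"
    "one TA = one (quot_alg FW TI)" "zero TA = zero (quot_alg FW TI)"
    by (simp_all add: tensor_alg_def)
  show "\<one>\<^bsub>Cl\<^esub> = cl 1" "\<zero>\<^bsub>Cl\<^esub> = cl 0"
    by (simp_all only: clifford_def T1.quot_one T1.quot_zero cl_def TA T0.quot_one T0.quot_zero free_alg_simps)
  show "cl p \<otimes>\<^bsub>Cl\<^esub> cl q = cl (p * q)" "cl p \<oplus>\<^bsub>Cl\<^esub> cl q = cl (p + q)"
    if "p \<in> carrier FW" "q \<in> carrier FW"
    using that T1.cls_mult[OF T0_cls_TA T0_cls_TA, of p q] T1.cls_add[OF T0_cls_TA T0_cls_TA, of p q]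
      T0.cls_mult[of p q] T0.cls_add[of p q]
    by (simp_all add: clifford_def cl_def TA)
  show "c \<odot>\<^bsub>Cl\<^esub> cl p = cl (Poly_Mapping.single 0 c * p)" if "p \<in> carrier FW"
    using that T1.cls_smult[OF T0_cls_TA, of p c] T0.cls_smult[of p c]
    by (simp add: clifford_def cl_def TA)
qed

text \<open>The kernel of the composite quotient map, by \<open>cls_in_genideal_iff\<close> for the
  linear relations followed by the Clifford relations.\<close>

lemma cl_zero_iff: "p \<in> carrier FW \<Longrightarrow> cl p = cl 0 \<longleftrightarrow> p \<in> NN"
proof -
  assume p: "p \<in> carrier FW"
  interpret T: calg TA by (rule calg_TA)
  have z: "T0.cls 0 = \<zero>\<^bsub>TA\<^esub>" by (simp add: tensor_alg_def)
  have "cl p = cl 0 \<longleftrightarrow> T0.cls p \<in> CI"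
    using T1.cls_eq_iff[OF T0_cls_TA T0_cls_TA, of p 0] p T0_cls_TA[OF p]
    by (simp add: cl_def z a_minus_def)
  also have "\<dots> \<longleftrightarrow> p \<in> NN"
    unfolding clifford_rels_eq NN_def RW_def tensor_alg_def
    by (rule T0.cls_in_genideal_iff[OF tensor_alg_ideal_def linear_rels_subset _ p]) (auto simp: crel_closed)
  finally show ?thesis .
qed

lemma cl_eq_iff: "p \<in> carrier FW \<Longrightarrow> q \<in> carrier FW \<Longrightarrow> cl p = cl q \<longleftrightarrow> p - q \<in> NN"
proof -
  assume p: "p \<in> carrier FW" "q \<in> carrier FW"
  interpret C: calg Cl unfolding clifford_def by (rule T1.calg_quot)
  have "cl p \<oplus>\<^bsub>Cl\<^esub> cl (- q) = cl (p - q)" "cl q \<oplus>\<^bsub>Cl\<^esub> cl (- q) = cl 0"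
    using p by simp_all
  moreover have "cl p \<in> carrier Cl" "cl q \<in> carrier Cl" "cl (- q) \<in> carrier Cl"
    using p by (simp_all add: carrier_Cl)
  ultimately have "cl p = cl q \<longleftrightarrow> cl (p - q) = cl 0"
    using C.add.right_cancel[of "cl (- q)" "cl p" "cl q"] by (simp only:)
  then show ?thesis using cl_zero_iff p by simp
qed

end

subsection \<open>Injectivity criterion\<close>

context cliff
begin

text \<open>The Euler operator \<open>\<Sum>\<^sub>e \<epsilon>\<^sub>e \<cdot> ctr e\<close> counts the letters from \<open>V\<^sup>*\<close>.\<close>

lemma filt_euler:
  assumes E: "finite E" "E \<subseteq> carrier V" and \<epsilon>: "\<And>e. e \<in> E \<Longrightarrow> \<epsilon> e \<in> VD"
    and expand: "\<And>F v. F \<in> lforms V \<Longrightarrow> v \<in> carrier V \<Longrightarrow> F v = (\<Sum>e\<in>E. \<epsilon> e v * F e)"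
    and p: "filt k p"
  shows "filt (k - 1) ((\<Sum>e\<in>E. xl (\<epsilon> e) * ctr e p) - Poly_Mapping.single 0 (of_nat (k - 1)) * p)"
proof -
  \<comment> \<open>Keeps the natural number inside \<open>single 0\<close>, where it is treated as
    a scalar.\<close>
  note single_of_nat [simp del]
  define Eu where "Eu p = (\<Sum>e\<in>E. xl (\<epsilon> e) * ctr e p)" for p
  have xE: "xl (\<epsilon> e) \<in> carrier FW" "e \<in> carrier V" "(\<epsilon> e, 0) \<in> carrier WW" if "e \<in> E" for e
    using \<epsilon>[OF that] E that by (auto simp: WW_simps)
  have NN_sum: "(\<And>e. e \<in> E \<Longrightarrow> h e \<in> NN) \<Longrightarrow> (\<Sum>e\<in>E. h e) \<in> NN" for h
    using filt_0[OF filt_sum[OF E(1), of 0 h]] filt_NN by blast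
  have EuN: "Eu p \<in> NN" if "p \<in> NN" for p
    unfolding Eu_def using that xE by (intro NN_sum NN_closed(2) ctr_NN)
  \<comment> \<open>The Clifford relations move a letter w across each \<epsilon> e; the error is a
    linear combination of contractions, hence of lower order.\<close>
  have swap: "(\<Sum>e\<in>E. xl (\<epsilon> e) * (letter w * ctr e p)) + letter w * Eu p -
      (\<Sum>e\<in>E. Poly_Mapping.single 0 (2 * Q (\<epsilon> e, 0) w) * ctr e p) \<in> NN"
    if w: "w \<in> carrier WW" and p: "p \<in> carrier FW" for w p
  proof -
    have "(\<Sum>e\<in>E. crel (\<epsilon> e, 0) w * ctr e p) \<in> NN"
      using w p xE by (intro NN_sum NN_closed(3) crel_NN) simp_all
    then show ?thesis
      by (simp add: crel_def Eu_def sum_distrib_left left_diff_distrib distrib_right mult.assoc sum.distrib sum_subtractf)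
  qed
  have ctr_filt: "filt (k - 1) (\<Sum>e\<in>E. Poly_Mapping.single 0 (2 * Q (\<epsilon> e, 0) w) * ctr e p)" if "filt k p" for w p k
    using that xE by (intro filt_sum[OF E(1)] filt_scalar filt_ctr)
  \<comment> \<open>Level k allows at most k - 1 letters from V*, hence the eigenvalue k -
    1.\<close>
  have "filt (k - 1) (Eu p - Poly_Mapping.single 0 (of_nat (k - 1)) * p)"
    using p
  proof (induction rule: filt.induct)
    case (filt_NN p k)
    then show ?case by (intro filt.filt_NN NN_diff EuN NN_closed(5))
  next
    case (filt_one k)
    have "filt k (- (Poly_Mapping.single 0 (of_nat k) * 1))"
    proof (cases k)
      case 0
      then show ?thesis using filt.filt_NN[OF NN_closed(4)] by simp
    next
      case (Suc j)
      then show ?thesis using filt_uminus[OF filt.filt_scalar[OF filt.filt_one]] by (simp only:)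
    qed
    moreover have "Eu 1 = 0" by (simp add: Eu_def)
    ultimately show ?case by (simp only: diff_Suc_1 diff_0)
  next
    case (filt_add k p q)
    have "Eu (p + q) - Poly_Mapping.single 0 (of_nat (k - 1)) * (p + q) =
      (Eu p - Poly_Mapping.single 0 (of_nat (k - 1)) * p) + (Eu q - Poly_Mapping.single 0 (of_nat (k - 1)) * q)"
      by (simp add: Eu_def distrib_left sum.distrib)
    then show ?case using filt.filt_add[OF filt_add(3,4)] by simp
  next
    case (filt_scalar k p c)
    have "Eu (Poly_Mapping.single 0 c * p) = Poly_Mapping.single 0 c * Eu p"
      by (simp add: Eu_def sum_distrib_left)
    then have "Eu (Poly_Mapping.single 0 c * p) - Poly_Mapping.single 0 (of_nat (k - 1)) * (Poly_Mapping.single 0 c * p) =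
      Poly_Mapping.single 0 c * (Eu p - Poly_Mapping.single 0 (of_nat (k - 1)) * p)"
      by (simp only: right_diff_distrib scalar_right[of "Poly_Mapping.single 0 (of_nat (k - 1))" c p])
    then show ?case using filt.filt_scalar[OF filt_scalar(2), of c] by (simp only:)
  next
    case (filt_z k p)
    let ?S = "\<Sum>e\<in>E. Poly_Mapping.single 0 (2 * Q (\<epsilon> e, 0) zz) * ctr e p"
    let ?T = "\<Sum>e\<in>E. xl (\<epsilon> e) * (zl * ctr e p)"
    have c: "p \<in> carrier FW" by (rule filt_carrier[OF filt_z(1)])
    have "fst zz e = 0" if "e \<in> E" for e using xE(2)[OF that] by (simp add: zz_def)
    then have Euz: "Eu (zl * p) = - ?T" by (simp add: Eu_def sum_negf cong: sum.cong_simp)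
    have "filt (k - 1) (zl * (Eu p - Poly_Mapping.single 0 (of_nat (k - 1)) * p) - ?S - (?T + zl * Eu p - ?S))"
      by (intro filt_diff filt.filt_z filt_z(2) ctr_filt filt_z(1) filt.filt_NN swap c) simp
    also have "zl * (Eu p - Poly_Mapping.single 0 (of_nat (k - 1)) * p) - ?S - (?T + zl * Eu p - ?S) =
        Eu (zl * p) - Poly_Mapping.single 0 (of_nat (k - 1)) * (zl * p)"
      unfolding Euz by (simp add: right_diff_distrib)
    finally show ?case .
  next
    case (filt_x \<xi> k p)
    let ?S = "\<Sum>e\<in>E. Poly_Mapping.single 0 (2 * Q (\<epsilon> e, 0) (\<xi>, 0)) * ctr e p"
    let ?T = "\<Sum>e\<in>E. xl (\<epsilon> e) * (xl \<xi> * ctr e p)"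
    let ?U = "\<Sum>e\<in>E. Poly_Mapping.single 0 (\<xi> e) * xl (\<epsilon> e)"
    have c: "p \<in> carrier FW" by (rule filt_carrier[OF filt_x(2)])
    have xi: "(\<xi>, 0) \<in> carrier WW" using filt_x(1) by simp
    have "filt k (Eu (xl \<xi> * p) - Poly_Mapping.single 0 (of_nat k) * (xl \<xi> * p))"
    proof (cases k)
      \<comment> \<open>The subtraction in the induction hypothesis is truncated here; p is in the
        ideal, and everything stays there.\<close>
      case 0
      then have "xl \<xi> * p \<in> NN" using filt_0[OF filt_x(2)] xi by (intro NN_closed(2)) simp_all
      then show ?thesis by (intro filt_NN NN_diff EuN NN_closed(5))
    next
      case (Suc j)
      have "(\<lambda>v\<in>carrier V. \<Sum>e\<in>E. \<xi> e * \<epsilon> e v) = \<xi>"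
        using filt_x(1) expand[of \<xi>] by (auto simp: extensional_def fun_eq_iff mult.commute)
      then have "xl \<xi> - ?U \<in> NN" using letter_sum[OF E(1), of \<epsilon>, where c = \<xi>] \<epsilon> by (simp only:)
      then have 1: "(xl \<xi> - ?U) * p \<in> NN" using c by (intro NN_closed(3))
      \<comment> \<open>The term \<open>?U * p\<close> is congruent to \<xi> p and raises the
        eigenvalue by one.\<close>
      have Eux: "Eu (xl \<xi> * p) = ?U * p - ?T"
        by (simp add: Eu_def right_diff_distrib sum_subtractf sum_distrib_right mult.assoc)
      have IH: "filt j (Eu p - Poly_Mapping.single 0 (of_nat j) * p)" using filt_x(3) Suc by simp
      have S: "filt k ?S" using filt_Suc[OF ctr_filt[OF filt_x(2)], of "(\<xi>, 0)"] Suc by simp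
      have "filt k (xl \<xi> * (Eu p - Poly_Mapping.single 0 (of_nat j) * p) - ?S -
          (?T + xl \<xi> * Eu p - ?S) - (xl \<xi> - ?U) * p)"
        unfolding Suc
        by (intro filt_diff filt.filt_x filt_x(1) IH S[unfolded Suc] filt.filt_NN swap xi c 1)
      also have "xl \<xi> * (Eu p - Poly_Mapping.single 0 (of_nat j) * p) - ?S -
          (?T + xl \<xi> * Eu p - ?S) - (xl \<xi> - ?U) * p =
          Eu (xl \<xi> * p) - Poly_Mapping.single 0 (of_nat k) * (xl \<xi> * p)"
        unfolding Eux Suc by (simp add: right_diff_distrib left_diff_distrib scalar_add)
      finally show ?thesis .
    qed
    then show ?case by simp
  qed
  then show ?thesis by (simp only: Eu_def)
qed

text \<open>Z stands for the kernel of the map to the dual algebra. For p at level k + 1 with k > 0,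
  the contractions of p lie in the ideal by induction, so its Euler image does too; but this image
  is k p modulo level k. Dividing by k lowers the level, until \<open>filt_1\<close> and
  \<open>low\<close> apply.\<close>

lemma NN_criterion:
  assumes ctr: "\<And>p v. p \<in> carrier FW \<Longrightarrow> Z p \<Longrightarrow> v \<in> carrier V \<Longrightarrow> Z (ctr v p)"
    and low: "\<And>p a b. p \<in> carrier FW \<Longrightarrow> Z p \<Longrightarrow>
      p - (Poly_Mapping.single 0 a + Poly_Mapping.single 0 b * zl) \<in> NN \<Longrightarrow> p \<in> NN"
    and p: "p \<in> carrier FW" "Z p"
  shows "p \<in> NN"
proof -
  note single_of_nat [simp del]
  obtain E \<epsilon> where E: "finite E" "E \<subseteq> carrier V" "\<And>e. e \<in> E \<Longrightarrow> \<epsilon> e \<in> VD"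
    and expand: "\<And>F v. F \<in> lforms V \<Longrightarrow> v \<in> carrier V \<Longrightarrow> F v = (\<Sum>e\<in>E. \<epsilon> e v * F e)"
    by (rule dual_basis) blast
  have "filt k p \<Longrightarrow> Z p \<Longrightarrow> p \<in> NN" for k p
  proof (induction k arbitrary: p)
    case 0
    then show ?case using filt_0 by blast
  next
    case (Suc k)
    have c: "p \<in> carrier FW" using Suc(2) by (rule filt_carrier)
    show ?case
    proof (cases "k = 0")
      case True
      then show ?thesis using filt_1[OF Suc(2)] low[OF c Suc(3)] by auto
    next
      case False
      let ?E = "\<Sum>e\<in>E. xl (\<epsilon> e) * ctr e p"
      have "xl (\<epsilon> e) * ctr e p \<in> NN" if e: "e \<in> E" for e
      proof -
        have v: "e \<in> carrier V" using E e by auto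
        have "filt k (ctr e p)" using filt_ctr[OF Suc(2) v] by simp
        then have "ctr e p \<in> NN" using Suc(1) ctr[OF c Suc(3) v] by blast
        then show ?thesis using E(3)[OF e] by (intro NN_closed(2)) simp_all
      qed
      then have "filt k ?E" by (intro filt_sum[OF E(1)] filt_NN)
      moreover have "filt k (?E - Poly_Mapping.single 0 (of_nat k) * p)"
        using filt_euler[OF E expand Suc(2)] by simp
      ultimately have "filt k (?E - (?E - Poly_Mapping.single 0 (of_nat k) * p))" by (rule filt_diff)
      from filt_scalar[OF this, of "1 / of_nat k"] have "filt k p" using False by simp
      then show ?thesis using Suc by blast
    qed
  qed
  then show ?thesis using filt_exhaust[OF p(1)] p(2) by blast
qed

end

subsection \<open>The Clifford module\<close>

context gvcoset
begin

definition act :: "((('v \<Rightarrow> complex) \<times> complex) fword \<Rightarrow>\<^sub>0 complex) \<Rightarrow> (('g, 'v) gv \<Rightarrow> complex) \<Rightarrow> ('g, 'v) gv \<Rightarrow> complex" where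
  "act p f = (\<lambda>x. wsum p (\<lambda>ws. foldr Lop ws f x))"

lemma foldr_Dh: "set ws \<subseteq> carrier WW \<Longrightarrow> f \<in> Dh \<Longrightarrow> foldr Lop ws f \<in> Dh"
  by (induction ws) (simp_all add: Dh_Lop WW_fst)

lemma foldr_cong:
  assumes "set ws \<subseteq> carrier WW" "f \<in> Dh" "\<And>x. x \<in> carrier AA \<Longrightarrow> f x = f' x" "x \<in> carrier AA"
  shows "foldr Lop ws f x = foldr Lop ws f' x"
  using assms(1,4)
proof (induction ws arbitrary: x)
  case Nil
  then show ?case using assms(3) by simp
next
  case (Cons w ws)
  then show ?case using assms(2) unfolding foldr.simps o_apply
    by (intro Lop_cong WW_fst Dh_lform foldr_Dh) simp_all
qed

lemma foldr_add:
  assumes "set ws \<subseteq> carrier WW" "f \<in> Dh" "f' \<in> Dh" "x \<in> carrier AA"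
  shows "foldr Lop ws (\<lambda>x. f x + f' x) x = foldr Lop ws f x + foldr Lop ws f' x"
  using assms(1,4)
proof (induction ws arbitrary: x)
  case (Cons w ws)
  have D: "foldr Lop ws f \<in> lforms AA" "foldr Lop ws f' \<in> lforms AA" "foldr Lop ws (\<lambda>x. f x + f' x) \<in> lforms AA"
    using Cons assms by (intro Dh_lform foldr_Dh Dh_add; simp)+
  have "Lop w (foldr Lop ws (\<lambda>x. f x + f' x)) x = Lop w (\<lambda>x. foldr Lop ws f x + foldr Lop ws f' x) x"
    using Cons D by (intro Lop_cong WW_fst) simp_all
  then show ?case using Cons D by (simp add: Lop_add WW_fst)
qed simp

lemma foldr_cmult:
  assumes "set ws \<subseteq> carrier WW" "f \<in> Dh" "x \<in> carrier AA"
  shows "foldr Lop ws (\<lambda>x. c * f x) x = c * foldr Lop ws f x"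
  using assms(1,3)
proof (induction ws arbitrary: x)
  case (Cons w ws)
  have D: "foldr Lop ws f \<in> lforms AA" "foldr Lop ws (\<lambda>x. c * f x) \<in> lforms AA"
    using Cons assms by (intro Dh_lform foldr_Dh Dh_cmult; simp)+
  have "Lop w (foldr Lop ws (\<lambda>x. c * f x)) x = Lop w (\<lambda>x. c * foldr Lop ws f x) x"
    using Cons D by (intro Lop_cong WW_fst) simp_all
  then show ?case using Cons D by (simp add: Lop_cmult WW_fst)
qed simp

lemma foldr_K:
  assumes "set ws \<subseteq> carrier WW" "f \<in> Dh" "f' \<in> lforms AA" "x \<in> carrier AA"
  shows "K (foldr Lop ws f) f' x = foldr Lop ws (K f f') x"
  using assms(1,4)
proof (induction ws arbitrary: x)
  case (Cons w ws)
  have D: "foldr Lop ws f \<in> Dh" "foldr Lop ws (K f f') \<in> Dh"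
    using Cons assms by (intro foldr_Dh Dh_K; simp)+
  have "K (Lop w (foldr Lop ws f)) f' x = Lop w (K (foldr Lop ws f) f') x"
    using Cons D assms by (intro Lop_K WW_fst) simp_all
  also have "\<dots> = Lop w (foldr Lop ws (K f f')) x"
    using Cons D assms by (intro Lop_cong WW_fst) (simp_all add: K_lform Dh_lform)
  finally show ?case by simp
qed simp

lemma act_simps [simp]:
  "act 0 f x = 0" "act 1 f x = f x" "act (p + q) f x = act p f x + act q f x" "act (p - q) f x = act p f x - act q f x"
  "act (Poly_Mapping.single 0 c * p) f x = c * act p f x"
  "act (Poly_Mapping.single w c) f x = c * foldr Lop (letters w) f x"
  by (simp_all add: act_def)

lemma act_add_single: "act (p + Poly_Mapping.single (FWord ws) c) f = (\<lambda>x. act p f x + c * foldr Lop ws f x)"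
  by (simp add: fun_eq_iff)

lemma act_Dh: "p \<in> carrier FW \<Longrightarrow> f \<in> Dh \<Longrightarrow> act p f \<in> Dh"
proof (induction p rule: free_alg_induct)
  case zero
  then show ?case using Dh_zero by (simp add: act_def)
next
  case (add p u c)
  then show ?case unfolding act_add_single by (intro Dh_add Dh_cmult foldr_Dh)
qed

lemma act_cong:
  assumes "p \<in> carrier FW" "f \<in> Dh" "\<And>x. x \<in> carrier AA \<Longrightarrow> f x = f' x" "x \<in> carrier AA"
  shows "act p f x = act p f' x"
  unfolding act_def by (rule wsum_cong[OF assms(1)]) (rule foldr_cong[OF _ assms(2-4)])

lemma foldr_act:
  assumes "p \<in> carrier FW" "f \<in> Dh" "set us \<subseteq> carrier WW" "x \<in> carrier AA"
  shows "foldr Lop us (act p f) x = wsum p (\<lambda>w. foldr Lop (us @ w) f x)"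
  using assms(1)
proof (induction p rule: free_alg_induct)
  case zero
  from foldr_cmult[OF assms(3) Dh_zero assms(4), of 0] show ?case by (simp add: act_def)
next
  case (add p w c)
  have "foldr Lop us (\<lambda>x. act p f x + c * foldr Lop w f x) x =
      foldr Lop us (act p f) x + foldr Lop us (\<lambda>x. c * foldr Lop w f x) x"
    using add assms by (intro foldr_add act_Dh Dh_cmult foldr_Dh)
  also have "foldr Lop us (\<lambda>x. c * foldr Lop w f x) x = c * foldr Lop us (foldr Lop w f) x"
    using add assms by (intro foldr_cmult foldr_Dh)
  finally show ?case unfolding act_add_single using add by simp
qed

lemma act_mult:
  assumes "p \<in> carrier FW" "q \<in> carrier FW" "f \<in> Dh" "x \<in> carrier AA"
  shows "act (p * q) f x = act p (act q f) x"
proof -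
  have "wsum p (\<lambda>u. wsum q (\<lambda>v. foldr Lop (u @ v) f x)) = wsum p (\<lambda>u. foldr Lop u (act q f) x)"
    by (rule wsum_cong[OF assms(1)]) (rule foldr_act[OF assms(2,3) _ assms(4), symmetric])
  then show ?thesis by (simp only: act_def wsum_mult)
qed

lemma act_letter:
  assumes "w \<in> carrier WW" "p \<in> carrier FW" "f \<in> Dh" "x \<in> carrier AA"
  shows "act (letter w * p) f x = Lop w (act p f) x"
proof -
  have "act (letter w) (act p f) x = Lop w (act p f) x" by (simp add: act_def)
  then show ?thesis using act_mult[of "letter w" p f x] assms by simp
qed

lemma act_K:
  assumes "p \<in> carrier FW" "f \<in> Dh" "f' \<in> lforms AA" "x \<in> carrier AA"
  shows "K (act p f) f' x = act p (K f f') x"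
  using assms(1)
proof (induction p rule: free_alg_induct)
  case zero
  have z: "(\<lambda>x. 0) \<in> lforms AA" by (rule lform_0)
  from K_cmult1[OF z assms(3,4), of 0] show ?case by (simp add: act_def)
next
  case (add p u c)
  have l: "act p f \<in> lforms AA" "foldr Lop u f \<in> lforms AA"
    using add assms by (intro Dh_lform act_Dh foldr_Dh; simp)+
  have "K (\<lambda>x. act p f x + c * foldr Lop u f x) f' x = K (act p f) f' x + K (\<lambda>x. c * foldr Lop u f x) f' x"
    by (rule K_add1[OF l(1) lform_lin(2)[OF l(2,2)] assms(3,4)])
  also have "K (\<lambda>x. c * foldr Lop u f x) f' x = c * K (foldr Lop u f) f' x"
    by (rule K_cmult1[OF l(2) assms(3,4)])
  finally show ?case unfolding act_add_single using add assms by (simp add: foldr_K)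
qed

subsection \<open>The cyclic vector\<close>

lemma mu_phi:
  assumes x: "x \<in> carrier AA"
  shows "mu \<phi> (phi \<psi>) x = phi (\<lambda>g. \<phi> g * \<psi> g) x"
  using mu_lform[OF phi_lform] phi_lform x
proof (rule lforms_eqI)
  fix y v assume y: "y \<in> carrier AA" and v: "v \<in> carrier V"
  have "mu (pu \<phi>) (rv v (phi \<psi>)) y = mu (pu \<phi>) (\<lambda>x. 0 * phi \<psi> x) y"
    by (rule mu_cong) (use y v phi_lform in \<open>simp_all add: lform_rmult phi_vec\<close>)
  also have "\<dots> = 0 * mu (pu \<phi>) (phi \<psi>) y" by (rule mu_cmult[OF phi_lform y])
  finally show "mu \<phi> (phi \<psi>) (y \<otimes>\<^bsub>AA\<^esub> \<eta> v) = phi (\<lambda>g. \<phi> g * \<psi> g) (y \<otimes>\<^bsub>AA\<^esub> \<eta> v)"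
    using y v by (simp add: mu_vec phi_lform phi_vec)
qed (simp add: mu_grp phi_lform phi_grp)

lemma phi_ind_Dh: "phi ind \<in> Dh"
  by (rule DhI[OF phi_lform]) (simp add: mu_phi ind_ind)

text \<open>\<open>phi ind\<close> is the unit of the summand. As the action commutes with right
  multiplications, p acts on the summand as left multiplication by \<open>Psi p\<close>.\<close>

definition Psi :: "((('v \<Rightarrow> complex) \<times> complex) fword \<Rightarrow>\<^sub>0 complex) \<Rightarrow> ('g, 'v) gv \<Rightarrow> complex" where
  "Psi p = act p (phi ind)"

lemma Psi_simps [simp]:
  "Psi 0 x = 0" "Psi (p + q) x = Psi p x + Psi q x" "Psi (p - q) x = Psi p x - Psi q x"
  "Psi (Poly_Mapping.single 0 c * p) x = c * Psi p x" "Psi 1 = phi ind"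
  by (simp_all add: Psi_def fun_eq_iff)

lemma Psi_Dh: "p \<in> carrier FW \<Longrightarrow> Psi p \<in> Dh"
  unfolding Psi_def by (intro act_Dh phi_ind_Dh)

lemma Psi_letter: "w \<in> carrier WW \<Longrightarrow> p \<in> carrier FW \<Longrightarrow> x \<in> carrier AA \<Longrightarrow> Psi (letter w * p) x = Lop w (Psi p) x"
  unfolding Psi_def by (intro act_letter phi_ind_Dh)

text \<open>Both sides obey the same antiderivation rule in the first letter, by
  \<open>Lop_vec\<close> and by the recursion for \<open>ctr\<close>; the factor \<open>\<i>\<close>
  is the one in \<open>Lop\<close>.\<close>

lemma Psi_vec:
  assumes "p \<in> carrier FW" "v \<in> carrier V" "x \<in> carrier AA"
  shows "Psi p (x \<otimes>\<^bsub>AA\<^esub> \<eta> v) = \<i> * Psi (ctr v p) x"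
  using assms(1,3)
proof (induction p arbitrary: x rule: free_alg_letter_induct)
  case one
  then show ?case using assms by (simp add: phi_vec)
next
  case (letter w p)
  have w: "fst w \<in> lforms V" using letter by (intro WW_fst)
  have l: "Psi p \<in> lforms AA" "Psi (ctr v p) \<in> lforms AA" "rv v (Psi p) \<in> lforms AA"
    using letter assms by (simp_all add: Psi_Dh Dh_lform lform_rmult)
  have "Lop w (rv v (Psi p)) x = Lop w (\<lambda>x. \<i> * Psi (ctr v p) x) x"
    using w l letter by (intro Lop_cong) simp_all
  also have "\<dots> = \<i> * Lop w (Psi (ctr v p)) x" by (rule Lop_cmult[OF w l(2) letter(4)])
  finally show ?case using letter assms w l by (simp add: Psi_letter Lop_vec algebra_simps)
next
  case (add p q)
  then show ?case by (simp add: algebra_simps)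
next
  case (scalar c p)
  then show ?case by simp
qed

lemma Psi_z:
  assumes "x \<in> carrier AA"
  shows "Psi (letter zz) x = mu zet (phi ind) x"
proof -
  have z: "fst zz \<in> lforms V" by (rule WW_fst) simp
  have "Lam (fst zz) (phi ind) x = 0 * Lam (fst zz) (phi ind) x + 0 * Lam (fst zz) (phi ind) x"
    by (rule Lam_lin) (use z assms phi_lform in \<open>simp_all add: zz_def\<close>)
  moreover have "Psi (letter zz) x = Lop zz (phi ind) x" using Psi_letter[of zz 1 x] assms by simp
  moreover have "snd zz = 1" by (simp add: zz_def)
  ultimately show ?thesis by (simp add: Lop_def)
qed

lemma Psi_grp:
  "Psi (Poly_Mapping.single 0 a + Poly_Mapping.single 0 b * letter zz) (\<gamma> g0) = a + b"
  "Psi (Poly_Mapping.single 0 a + Poly_Mapping.single 0 b * letter zz) (\<gamma> (g0 \<otimes>\<^bsub>G\<^esub> u)) = a - b"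
proof -
  have "Psi (Poly_Mapping.single 0 a) = (\<lambda>x. a * phi ind x)" by (simp add: Psi_def fun_eq_iff)
  then show "Psi (Poly_Mapping.single 0 a + Poly_Mapping.single 0 b * letter zz) (\<gamma> g0) = a + b"
    "Psi (Poly_Mapping.single 0 a + Poly_Mapping.single 0 b * letter zz) (\<gamma> (g0 \<otimes>\<^bsub>G\<^esub> u)) = a - b"
    using g0_u(1) by (simp_all add: Psi_z mu_grp phi_lform phi_grp ind_def zet_def)
qed

subsection \<open>Surjectivity\<close>

text \<open>Degree below k in the vectors, with the same shift as in \<open>filt\<close>: level 0
  means vanishing.\<close>

definition degle :: "nat \<Rightarrow> (('g, 'v) gv \<Rightarrow> complex) \<Rightarrow> bool" where
  "degle k f \<longleftrightarrow> (\<forall>x\<in>carrier AA. \<forall>vs. set vs \<subseteq> carrier V \<longrightarrow> length vs = k \<longrightarrow> f (foldl vmul x vs) = 0)"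

lemma degle_0: "degle 0 f \<longleftrightarrow> (\<forall>x\<in>carrier AA. f x = 0)"
  by (simp add: degle_def)

lemma degle_Suc: "degle (Suc k) f \<longleftrightarrow> (\<forall>v\<in>carrier V. degle k (rv v f))"
proof
  assume f: "degle (Suc k) f"
  show "\<forall>v\<in>carrier V. degle k (rv v f)"
    unfolding degle_def
  proof (intro ballI allI impI)
    fix v x vs assume "v \<in> carrier V" "x \<in> carrier AA" "set vs \<subseteq> carrier V" "length vs = k"
    then show "rv v f (foldl vmul x vs) = 0" using f[unfolded degle_def, rule_format, of x "vs @ [v]"] by simp
  qed
next
  assume f: "\<forall>v\<in>carrier V. degle k (rv v f)"
  show "degle (Suc k) f"
    unfolding degle_def
  proof (intro ballI allI impI)
    fix x vs assume x: "x \<in> carrier AA" and vs: "set vs \<subseteq> carrier V" "length vs = Suc k"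
    then obtain ws v where "vs = ws @ [v]" by (cases vs rule: rev_cases) auto
    then show "f (foldl vmul x vs) = 0" using f[unfolded degle_def] x vs by simp
  qed
qed

lemma degle_cong: "degle k f \<Longrightarrow> (\<And>x. x \<in> carrier AA \<Longrightarrow> f x = f' x) \<Longrightarrow> degle k f'"
  by (simp add: degle_def)

lemma Dh_low:
  assumes f: "f \<in> Dh" "degle (Suc 0) f"
  shows "\<exists>p\<in>carrier FW. \<forall>x\<in>carrier AA. Psi p x = f x"
proof -
  \<comment> \<open>The values of a + b z on the coset are a + b and a - b; these are the solutions
    for a and b.\<close>
  let ?a = "(f (\<gamma> g0) + f (\<gamma> (g0 \<otimes>\<^bsub>G\<^esub> u))) / 2" and ?b = "(f (\<gamma> g0) - f (\<gamma> (g0 \<otimes>\<^bsub>G\<^esub> u))) / 2"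
  let ?p = "Poly_Mapping.single 0 ?a + Poly_Mapping.single 0 ?b * letter zz"
  have p: "?p \<in> carrier FW" by simp
  have "Psi ?p x = f x" if x: "x \<in> carrier AA" for x
    using Dh_lform[OF Psi_Dh[OF p]] Dh_lform[OF f(1)] x
  proof (rule lforms_eqI)
    fix g assume g: "g \<in> carrier G"
    consider "g = g0" | "g = g0 \<otimes>\<^bsub>G\<^esub> u" | "g \<noteq> g0" "g \<noteq> g0 \<otimes>\<^bsub>G\<^esub> u" by blast
    then show "Psi ?p (\<gamma> g) = f (\<gamma> g)"
    proof cases
      case 1
      then show ?thesis unfolding 1 Psi_grp by (simp add: field_simps)
    next
      case 2
      then show ?thesis unfolding 2 Psi_grp by (simp add: field_simps)
    next
      case 3
      then show ?thesis using Dh_grp[OF Psi_Dh[OF p] g] Dh_grp[OF f(1) g] by simp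
    qed
  next
    fix y v assume y: "y \<in> carrier AA" "v \<in> carrier V"
    have "ctr v ?p = Poly_Mapping.single 0 ?a * ctr v 1 + Poly_Mapping.single 0 ?b * ctr v (letter zz * 1)"
      by (simp only: ctr_simps(3,5)[symmetric] mult_1_right)
    then have "ctr v ?p = 0" using y by (simp only: ctr_simps) (simp add: zz_def)
    moreover have "f (y \<otimes>\<^bsub>AA\<^esub> \<eta> v) = 0" using f(2) y by (simp add: degle_Suc degle_0)
    ultimately show "Psi ?p (y \<otimes>\<^bsub>AA\<^esub> \<eta> v) = f (y \<otimes>\<^bsub>AA\<^esub> \<eta> v)" using Psi_vec[OF p y(2,1)] by simp
  qed
  then show ?thesis using p by blast
qed

lemma Psi_surj:
  assumes "f \<in> Dh"
  shows "\<exists>p\<in>carrier FW. \<forall>x\<in>carrier AA. Psi p x = f x"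
proof -
  obtain E \<epsilon> where E: "finite E" "E \<subseteq> carrier V" "\<And>e. e \<in> E \<Longrightarrow> \<epsilon> e \<in> lforms V \<inter> extensional (carrier V)"
    and expand: "\<And>F v. F \<in> lforms V \<Longrightarrow> v \<in> carrier V \<Longrightarrow> F v = (\<Sum>e\<in>E. \<epsilon> e v * F e)"
    by (rule dual_basis) blast
  have xE: "(\<epsilon> e, 0) \<in> carrier WW" "\<epsilon> e \<in> lforms V" "e \<in> carrier V" if "e \<in> E" for e
    using E that by auto
  \<comment> \<open>Built from \<open>Lop\<close> and translations, so that Eu f is in the image of
    \<open>Psi\<close> as soon as the translates of f are.\<close>
  define Eu where "Eu f = (\<lambda>x. \<Sum>e\<in>E. Lop (\<epsilon> e, 0) (rv e f) x)" for f
  have Eu_vec: "Eu f (x \<otimes>\<^bsub>AA\<^esub> \<eta> v) = \<i> * f (x \<otimes>\<^bsub>AA\<^esub> \<eta> v) + Eu (rv v f) x"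
    if f: "f \<in> lforms AA" and x: "x \<in> carrier AA" and v: "v \<in> carrier V" for f x v
  proof -
    have "Lop (\<epsilon> e, 0) (rv e f) (x \<otimes>\<^bsub>AA\<^esub> \<eta> v) = \<i> * (\<epsilon> e v * f (x \<otimes>\<^bsub>AA\<^esub> \<eta> e)) + Lop (\<epsilon> e, 0) (rv e (rv v f)) x"
      if e: "e \<in> E" for e
    proof -
      have "Lop (\<epsilon> e, 0) (rv v (rv e f)) x = Lop (\<epsilon> e, 0) (\<lambda>x. (- 1) * rv e (rv v f) x) x"
      proof (rule Lop_cong)
        fix y assume "y \<in> carrier AA"
        then show "rv v (rv e f) y = (- 1) * rv e (rv v f) y" using lform_swap[OF f _ v xE(3)[OF e], of y] by simp
      qed (use xE[OF e] f x v lform_rmult[of "rv e f" "\<eta> v"] in \<open>simp_all add: lform_rmult\<close>)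
      also have "\<dots> = (- 1) * Lop (\<epsilon> e, 0) (rv e (rv v f)) x"
        by (rule Lop_cmult) (use xE[OF e] f x v lform_rmult[of "rv v f" "\<eta> e"] in \<open>simp_all add: lform_rmult\<close>)
      finally show ?thesis
        using xE[OF e] f x v by (simp add: Lop_vec lform_rmult)
    qed
    then have "Eu f (x \<otimes>\<^bsub>AA\<^esub> \<eta> v) = (\<Sum>e\<in>E. \<i> * (\<epsilon> e v * f (x \<otimes>\<^bsub>AA\<^esub> \<eta> e))) + Eu (rv v f) x"
      by (simp add: Eu_def sum.distrib)
    also have "(\<Sum>e\<in>E. \<i> * (\<epsilon> e v * f (x \<otimes>\<^bsub>AA\<^esub> \<eta> e))) = \<i> * f (x \<otimes>\<^bsub>AA\<^esub> \<eta> v)"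
      using expand[OF lform_vec[OF f x] v] by (simp add: sum_distrib_left)
    finally show ?thesis .
  qed
  have Eu_zero: "Eu f x = 0" if f: "f \<in> lforms AA" "degle (Suc 0) f" and x: "x \<in> carrier AA" for f x
  proof -
    have "Lop (\<epsilon> e, 0) (rv e f) x = 0" if e: "e \<in> E" for e
    proof -
      have "Lop (\<epsilon> e, 0) (rv e f) x = Lop (\<epsilon> e, 0) (\<lambda>x. 0 * f x) x"
        using f x xE[OF e] by (intro Lop_cong) (simp_all add: lform_rmult degle_Suc degle_0)
      also have "\<dots> = 0 * Lop (\<epsilon> e, 0) f x" using f x xE[OF e] by (intro Lop_cmult) simp_all
      finally show ?thesis by simp
    qed
    then show ?thesis by (simp add: Eu_def)
  qed
  \<comment> \<open>\<open>Eu\<close> acts as \<open>\<i> k\<close> on the homogeneous forms of degree \<open>k\<close>, up to lower degree.\<close>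
  have lower: "degle k (\<lambda>x. Eu f x - \<i> * of_nat k * f x)" if "f \<in> Dh" "degle (Suc k) f" for k f
    using that
  proof (induction k arbitrary: f)
    case 0
    then show ?case using Eu_zero by (simp add: degle_0 Dh_lform)
  next
    case (Suc k)
    show ?case
      unfolding degle_Suc
    proof
      fix v assume v: "v \<in> carrier V"
      have "degle k (\<lambda>x. Eu (rv v f) x - \<i> * of_nat k * rv v f x)"
        using Suc(2,3) v degle_Suc[of "Suc k" f] by (intro Suc(1) Dh_rv) auto
      then show "degle k (rv v (\<lambda>x. Eu f x - \<i> * of_nat (Suc k) * f x))"
      proof (rule degle_cong)
        fix x assume "x \<in> carrier AA"
        then show "Eu (rv v f) x - \<i> * of_nat k * rv v f x = rv v (\<lambda>x. Eu f x - \<i> * of_nat (Suc k) * f x) x"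
          using Eu_vec[OF Dh_lform[OF Suc(2)] _ v] by (simp add: algebra_simps)
      qed
    qed
  qed
  have "f \<in> Dh \<Longrightarrow> degle (Suc k) f \<Longrightarrow> \<exists>p\<in>carrier FW. \<forall>x\<in>carrier AA. Psi p x = f x" for k f
  proof (induction k arbitrary: f)
    case 0
    then show ?case by (rule Dh_low)
  next
    case (Suc k)
    note lf = Dh_lform[OF Suc(2)]
    have "\<exists>p\<in>carrier FW. \<forall>x\<in>carrier AA. Psi p x = rv e f x" if e: "e \<in> E" for e
      using Suc(2,3) xE(3)[OF e] degle_Suc[of "Suc k" f] by (intro Suc(1) Dh_rv) auto
    then have "\<forall>e\<in>E. \<exists>p. p \<in> carrier FW \<and> (\<forall>x\<in>carrier AA. Psi p x = rv e f x)" by (auto simp: Bex_def)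
    from bchoice[OF this] obtain P where "\<forall>e\<in>E. P e \<in> carrier FW \<and> (\<forall>x\<in>carrier AA. Psi (P e) x = rv e f x)" ..
    then have P: "\<And>e. e \<in> E \<Longrightarrow> P e \<in> carrier FW"
      "\<And>e x. e \<in> E \<Longrightarrow> x \<in> carrier AA \<Longrightarrow> Psi (P e) x = rv e f x" by simp_all
    let ?p = "\<Sum>e\<in>E. letter (\<epsilon> e, 0) * P e"
    have p: "(\<Sum>e\<in>S. letter (\<epsilon> e, 0) * P e) \<in> carrier FW \<and>
        (\<forall>x\<in>carrier AA. Psi (\<Sum>e\<in>S. letter (\<epsilon> e, 0) * P e) x = (\<Sum>e\<in>S. Lop (\<epsilon> e, 0) (rv e f) x))" if "S \<subseteq> E" for S
      using finite_subset[OF that E(1)] that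
    proof (induction S rule: finite_induct)
      case empty
      then show ?case by simp
    next
      case (insert e S)
      have e: "e \<in> E" using insert by simp
      have "Psi (letter (\<epsilon> e, 0) * P e) x = Lop (\<epsilon> e, 0) (rv e f) x" if x: "x \<in> carrier AA" for x
        using Psi_letter[OF xE(1)[OF e] P(1)[OF e] x] Lop_cong[of "(\<epsilon> e, 0)" "Psi (P e)" x "rv e f"] x
          xE(2)[OF e] P(2)[OF e] Dh_lform[OF Psi_Dh[OF P(1)[OF e]]] by simp
      then show ?case using insert xE(1)[OF e] P(1)[OF e] by simp
    qed
    have Eu: "Psi ?p x = Eu f x" if "x \<in> carrier AA" for x using p[of E] that by (simp add: Eu_def)
    have "(\<lambda>x. Psi ?p x - \<i> * of_nat (Suc k) * f x) \<in> Dh"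
      using p[of E] Suc(2) by (intro Dh_diff Dh_cmult Psi_Dh) simp_all
    moreover have "degle (Suc k) (\<lambda>x. Psi ?p x - \<i> * of_nat (Suc k) * f x)"
      by (rule degle_cong[OF lower[OF Suc(2,3)]]) (simp add: Eu)
    ultimately obtain q where q: "q \<in> carrier FW" "\<And>x. x \<in> carrier AA \<Longrightarrow> Psi q x = Psi ?p x - \<i> * of_nat (Suc k) * f x"
      using Suc(1) by blast
    \<comment> \<open>f is recovered from Eu f and the lower-degree difference, both in the image of
      \<open>Psi\<close>, because the eigenvalue \<open>\<i> * of_nat (Suc k)\<close> is
      nonzero.\<close>
    let ?c = "1 / (\<i> * of_nat (Suc k)) :: complex"
    have "Psi (Poly_Mapping.single 0 ?c * (?p - q)) x = f x" if "x \<in> carrier AA" for x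
    proof -
      have "\<i> * of_nat (Suc k) \<noteq> (0 :: complex)" by (simp del: of_nat_Suc)
      then show ?thesis using q(2)[OF that] by (simp del: of_nat_Suc)
    qed
    then show ?case using p[of E] q(1) by (intro bexI[of _ "Poly_Mapping.single 0 ?c * (?p - q)"]) simp_all
  qed
  \<comment> \<open>\<open>nilp\<close> bounds the degree of every form, so the induction reaches
    f.\<close>
  from this[OF assms, of nilp] show ?thesis
    unfolding degle_Suc unfolding degle_def
    using nilp[OF lform_rmult[OF Dh_lform[OF assms]]] by simp
qed

end

locale gvcl = gvcoset G V \<rho> u B g0 + cliff G V \<rho> Q
  for G :: "('g, 'n) monoid_scheme" and V :: "(complex, 'v, 'm) module_scheme" and \<rho> :: "'g \<Rightarrow> 'v \<Rightarrow> 'v"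
    and u :: 'g and B :: "('v, 'v) tens" and g0 :: 'g
    and Q :: "('v \<Rightarrow> complex) \<times> complex \<Rightarrow> ('v \<Rightarrow> complex) \<times> complex \<Rightarrow> complex" +
  assumes Q_eq: "w \<in> carrier WW \<Longrightarrow> w' \<in> carrier WW \<Longrightarrow> Q w w' = fst w (Cv g0 (fst w')) + snd w * snd w'"
begin

lemma act_RW:
  assumes r: "r \<in> RW" and f: "f \<in> Dh" and x: "x \<in> carrier AA"
  shows "act r f x = 0"
proof -
  consider (add) w w' where "w \<in> carrier WW" "w' \<in> carrier WW" "r = letter (w \<oplus>\<^bsub>WW\<^esub> w') - letter w - letter w'"
    | (smult) c w where "w \<in> carrier WW" "r = letter (c \<odot>\<^bsub>WW\<^esub> w) - Poly_Mapping.single 0 c * letter w"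
    | (cl) w w' where "w \<in> carrier WW" "w' \<in> carrier WW" "r = crel w w'"
    using r unfolding RW_def linear_rels_def by blast
  then show ?thesis
  proof cases
    case add
    have "Lop (w \<oplus>\<^bsub>WW\<^esub> w') f x = 1 * Lop w f x + 1 * Lop w' f x"
      by (rule Lop_lin) (use add f x in \<open>simp_all add: WW_fst Dh_lform\<close>, simp_all add: WW_simps)
    then show ?thesis unfolding add by (simp add: act_def)
  next
    case smult
    have "Lop (c \<odot>\<^bsub>WW\<^esub> w) f x = c * Lop w f x + 0 * Lop w f x"
      by (rule Lop_lin) (use smult f x in \<open>simp_all add: WW_fst Dh_lform\<close>, simp_all add: WW_simps)
    then show ?thesis unfolding smult by (simp add: act_def)
  next
    case cl
    show ?thesis
      using Lop_Lop[of w w' f x] WW_fst cl f x Q_eq[OF cl(1,2)] unfolding cl(3) crel_def by (simp add: act_def)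
  qed
qed

lemma act_NN:
  assumes p: "p \<in> NN" and f: "f \<in> Dh" and x: "x \<in> carrier AA"
  shows "act p f x = 0"
  using RW_subset p[unfolded NN_def]
proof (induction p rule: Idl_free_alg_induct)
  case (gen v w c r)
  let ?v = "Poly_Mapping.single (FWord v) c" and ?w = "Poly_Mapping.single (FWord w) (1 :: complex)"
  have c: "?v \<in> carrier FW" "?w \<in> carrier FW" "r \<in> carrier FW" using gen RW_subset by auto
  have "act (?v * (r * ?w)) f x = act ?v (act (r * ?w) f) x" by (rule act_mult) (use c f x in simp_all)
  also have "\<dots> = act ?v (\<lambda>x. 0 * f x) x"
    by (rule act_cong) (use c f x gen act_mult[of r ?w f] act_RW[OF gen(3) act_Dh[of ?w f]] in \<open>simp_all add: act_Dh\<close>)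
  also have "\<dots> = 0" using foldr_cmult[of v f x 0] gen f x by simp
  finally show ?case by (simp add: mult.assoc)
qed simp_all

text \<open>The kernel satisfies \<open>NN_criterion\<close>: by \<open>Psi_vec\<close> it is stable
  under contraction, and in degree zero a + b z is determined by its values a + b and a - b on the
  coset.\<close>

lemma Psi_NN_iff:
  assumes p: "p \<in> carrier FW"
  shows "(\<forall>x\<in>carrier AA. Psi p x = 0) \<longleftrightarrow> p \<in> NN"
proof
  show "p \<in> NN \<Longrightarrow> \<forall>x\<in>carrier AA. Psi p x = 0"
    unfolding Psi_def using act_NN[OF _ phi_ind_Dh] by blast
  assume Z: "\<forall>x\<in>carrier AA. Psi p x = 0"
  show "p \<in> NN"
  proof (rule NN_criterion[of "\<lambda>p. \<forall>x\<in>carrier AA. Psi p x = 0"])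
    fix p v assume p: "p \<in> carrier FW" "\<forall>x\<in>carrier AA. Psi p x = 0" and v: "v \<in> carrier V"
    show "\<forall>x\<in>carrier AA. Psi (ctr v p) x = 0"
    proof
      fix x assume x: "x \<in> carrier AA"
      then have "Psi p (x \<otimes>\<^bsub>AA\<^esub> \<eta> v) = 0" using p v by simp
      then show "Psi (ctr v p) x = 0" using Psi_vec[OF p(1) v x] by simp
    qed
  next
    fix p a b assume p: "p \<in> carrier FW" "\<forall>x\<in>carrier AA. Psi p x = 0"
      and n: "p - (Poly_Mapping.single 0 a + Poly_Mapping.single 0 b * letter zz) \<in> NN" (is "p - ?l \<in> NN")
    have "Psi ?l x = 0" if x: "x \<in> carrier AA" for x
    proof -
      have "Psi p x = Psi ?l x"
        using act_NN[OF n phi_ind_Dh x] unfolding Psi_def[symmetric] Psi_simps(3) by (simp only: right_minus_eq)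
      then show ?thesis using p(2) x by simp
    qed
    then have "Psi ?l (\<gamma> g0) = 0" "Psi ?l (\<gamma> (g0 \<otimes>\<^bsub>G\<^esub> u)) = 0" by simp_all
    then have "a + b = 0" "a - b = 0" unfolding Psi_grp .
    then have "a = 0" "b = 0" by auto
    then show "p \<in> NN" using n by simp
  qed (use p Z in auto)
qed

end

subsection \<open>The component maps\<close>

context gvcl
begin

text \<open>The inverse of \<open>Psi\<close> after projection to the summand of the coset. The
  choice of p is immaterial, because the kernel of \<open>Psi\<close> is the Clifford ideal.\<close>

definition cmap :: "(('g, 'v) gv \<Rightarrow> complex) \<Rightarrow> ((('v \<Rightarrow> complex) \<times> complex) fword \<Rightarrow>\<^sub>0 complex) set set" where
  "cmap f = cl (SOME p. p \<in> carrier FW \<and> (\<forall>x\<in>carrier AA. Psi p x = mu ind f x))"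

lemma cl_eq_Psi:
  assumes "p \<in> carrier FW" "q \<in> carrier FW"
  shows "cl p = cl q \<longleftrightarrow> (\<forall>x\<in>carrier AA. Psi p x = Psi q x)"
proof -
  have "cl p = cl q \<longleftrightarrow> (\<forall>x\<in>carrier AA. Psi (p - q) x = 0)"
    using cl_eq_iff[OF assms] Psi_NN_iff[of "p - q"] assms by simp
  then show ?thesis by simp
qed

lemma cmap_eq:
  assumes "p \<in> carrier FW" "\<And>x. x \<in> carrier AA \<Longrightarrow> Psi p x = mu ind f x"
  shows "cmap f = cl p"
proof -
  let ?P = "\<lambda>p. p \<in> carrier FW \<and> (\<forall>x\<in>carrier AA. Psi p x = mu ind f x)"
  have "?P (Eps ?P)" by (rule someI[of ?P p]) (use assms in simp)
  then show ?thesis unfolding cmap_def using cl_eq_Psi[of "Eps ?P" p] assms by simp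
qed

lemma cmap_ex:
  assumes "f \<in> lforms AA"
  shows "\<exists>p. p \<in> carrier FW \<and> (\<forall>x\<in>carrier AA. Psi p x = mu ind f x) \<and> cmap f = cl p"
proof -
  obtain p where p: "p \<in> carrier FW" "\<forall>x\<in>carrier AA. Psi p x = mu ind f x"
    using Psi_surj[OF Dh_mu_ind[OF assms]] by (elim bexE)
  then show ?thesis using cmap_eq[of p f] by (intro exI[of _ p]) simp
qed

lemma cmap_closed: "f \<in> lforms AA \<Longrightarrow> cmap f \<in> carrier Cl"
  using cmap_ex[of f] by (auto simp: carrier_Cl)

lemma cmap_add:
  assumes f: "f \<in> lforms AA" "f' \<in> lforms AA" and h: "h \<in> lforms AA" "\<And>x. x \<in> carrier AA \<Longrightarrow> h x = f x + f' x"
  shows "cmap h = cmap f \<oplus>\<^bsub>Cl\<^esub> cmap f'"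
proof -
  obtain p where p: "p \<in> carrier FW" "\<forall>x\<in>carrier AA. Psi p x = mu ind f x" "cmap f = cl p"
    using cmap_ex[OF f(1)] by (elim exE conjE)
  obtain q where q: "q \<in> carrier FW" "\<forall>x\<in>carrier AA. Psi q x = mu ind f' x" "cmap f' = cl q"
    using cmap_ex[OF f(2)] by (elim exE conjE)
  have "cmap h = cl (p + q)"
  proof (rule cmap_eq)
    fix x assume x: "x \<in> carrier AA"
    have "mu ind h x = mu ind (\<lambda>x. f x + f' x) x" by (rule mu_cong) (use h x in simp_all)
    then show "Psi (p + q) x = mu ind h x" using p q f x by (simp add: mu_add)
  qed (use p q in simp)
  then show ?thesis using p q by simp
qed

lemma cmap_smult:
  assumes f: "f \<in> lforms AA" and h: "h \<in> lforms AA" "\<And>x. x \<in> carrier AA \<Longrightarrow> h x = c * f x"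
  shows "cmap h = c \<odot>\<^bsub>Cl\<^esub> cmap f"
proof -
  obtain p where p: "p \<in> carrier FW" "\<forall>x\<in>carrier AA. Psi p x = mu ind f x" "cmap f = cl p"
    using cmap_ex[OF f(1)] by (elim exE conjE)
  have "cmap h = cl (Poly_Mapping.single 0 c * p)"
  proof (rule cmap_eq)
    fix x assume x: "x \<in> carrier AA"
    have "mu ind h x = mu ind (\<lambda>x. c * f x) x" by (rule mu_cong) (use h x in simp_all)
    then show "Psi (Poly_Mapping.single 0 c * p) x = mu ind h x" using p f x by (simp add: mu_cmult)
  qed (use p in simp)
  then show ?thesis using p by simp
qed

text \<open>Left multiplication by Clifford elements commutes with right multiplication in the dual
  algebra, so \<open>\<Psi>\<close> is multiplicative.\<close>

lemma cmap_mult: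
  assumes f: "f \<in> lforms AA" "f' \<in> lforms AA" and h: "h \<in> lforms AA" "\<And>x. x \<in> carrier AA \<Longrightarrow> h x = K f f' x"
  shows "cmap h = cmap f \<otimes>\<^bsub>Cl\<^esub> cmap f'"
proof -
  obtain p where p: "p \<in> carrier FW" "\<forall>x\<in>carrier AA. Psi p x = mu ind f x" "cmap f = cl p"
    using cmap_ex[OF f(1)] by (elim exE conjE)
  obtain q where q: "q \<in> carrier FW" "\<forall>x\<in>carrier AA. Psi q x = mu ind f' x" "cmap f' = cl q"
    using cmap_ex[OF f(2)] by (elim exE conjE)
  have "cmap h = cl (p * q)"
  proof (rule cmap_eq)
    fix x assume x: "x \<in> carrier AA"
    have "mu ind h x = mu ind (K f f') x" by (rule mu_cong) (use h x in simp_all)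
    also have "\<dots> = K (mu ind f) f' x" by (rule mu_K[OF f x, symmetric])
    also have "\<dots> = K (Psi p) f' x" by (rule K_cong) (use p f x mu_lform in simp_all)
    also have "\<dots> = act p (K (phi ind) f') x" unfolding Psi_def by (rule act_K[OF p(1) phi_ind_Dh f(2) x])
    also have "\<dots> = act p (Psi q) x"
      by (rule act_cong[OF p(1) Dh_K[OF phi_ind_Dh f(2)] _ x]) (simp add: q(2) mu_def)
    also have "\<dots> = Psi (p * q) x"
      unfolding Psi_def by (rule act_mult[OF p(1) q(1) phi_ind_Dh x, symmetric])
    finally show "Psi (p * q) x = mu ind h x" by (rule sym)
  qed (use p q in simp)
  then show ?thesis using p q by simp
qed

lemma cmap_one:
  assumes "\<And>x. x \<in> carrier AA \<Longrightarrow> h x = phi (\<lambda>g. 1) x"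
  shows "cmap h = \<one>\<^bsub>Cl\<^esub>"
proof -
  have "cmap h = cl 1"
  proof (rule cmap_eq)
    fix x assume x: "x \<in> carrier AA"
    have "mu ind (phi (\<lambda>g. 1)) x = mu ind h x" by (rule mu_cong[OF phi_lform x]) (use assms in simp_all)
    then show "Psi 1 x = mu ind h x" using x by (simp add: mu_phi)
  qed simp
  then show ?thesis by simp
qed

lemma cmap_inj:
  assumes f: "f \<in> lforms AA" "f' \<in> lforms AA" and eq: "cmap f = cmap f'" and x: "x \<in> carrier AA"
  shows "mu ind f x = mu ind f' x"
proof -
  obtain p where p: "p \<in> carrier FW" "\<forall>x\<in>carrier AA. Psi p x = mu ind f x" "cmap f = cl p"
    using cmap_ex[OF f(1)] by (elim exE conjE)
  obtain q where q: "q \<in> carrier FW" "\<forall>x\<in>carrier AA. Psi q x = mu ind f' x" "cmap f' = cl q"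
    using cmap_ex[OF f(2)] by (elim exE conjE)
  show ?thesis using cl_eq_Psi[OF p(1) q(1)] p q eq x by simp
qed

text \<open>Phrased for all forms with the given component, because a family over the cosets will be
  realised by a sum of forms of which each \<open>cmap\<close> sees one summand.\<close>

lemma cmap_surj:
  assumes "c \<in> carrier Cl"
  shows "\<exists>f\<in>Dh. \<forall>f'\<in>lforms AA. (\<forall>x\<in>carrier AA. mu ind f' x = f x) \<longrightarrow> cmap f' = c"
proof -
  obtain p where p: "p \<in> carrier FW" "c = cl p" using assms by (auto simp: carrier_Cl)
  then show ?thesis using cmap_eq[OF p(1)] by (intro bexI[of _ "Psi p"] ballI impI Psi_Dh) simp_all
qed

end

section \<open>The isomorphism\<close>

lemma ground_simps [simp]:
  "carrier ground = UNIV" "add ground = (+)" "mult ground = (*)" "smult ground = (*)" "one ground = 1" "zero ground = 0"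
  by (simp_all add: ground_def)

lemma finsum_ground: "finite S \<Longrightarrow> finsum ground f S = sum f S"
proof (induction S rule: finite_induct)
  interpret abelian_group ground
    by (rule abelian_groupI) (auto simp: algebra_simps intro: exI[of _ "- x" for x])
  case empty
  then show ?case by simp
next
  interpret abelian_group ground
    by (rule abelian_groupI) (auto simp: algebra_simps intro: exI[of _ "- x" for x])
  case (insert x S)
  then show ?case by simp
qed

context gvtwist
begin

lemma counit_eq:
  assumes "x \<in> carrier AA"
  shows "scounit HH x = phi (\<lambda>g. 1) x"
proof -
  obtain p where p: "p \<in> carrier FF" "x = Q.cls p" using assms by (rule AA_cases)
  have w: "foldr (\<lambda>x y. case_sum (\<lambda>g. 1) (\<lambda>v. 0) x * y) w (1 :: complex) = phi_word (\<lambda>g. 1) w" for w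
    by (induction w) (auto simp: phi_word_def split: sum.splits)
  have "free_lift ground (case_sum (\<lambda>g. 1) (\<lambda>v. 0)) q = phi (\<lambda>g. 1) x" if "q \<in> x" for q
  proof -
    have q: "q \<in> carrier FF" "Q.cls q = x" using Q.in_cls[of q p] that p by auto
    have "free_lift ground (case_sum (\<lambda>g. 1) (\<lambda>v. 0)) q = wsum q (phi_word (\<lambda>g. 1))"
      by (simp add: free_lift_def finsum_ground wsum_def w)
    also have "\<dots> = phi (\<lambda>g. 1) (Q.cls q)"
      unfolding phi_def by (rule lift_form_cls[OF kills_phi q(1), symmetric])
    finally show ?thesis using q(2) by simp
  qed
  moreover have "p \<in> x" unfolding p(2) using p(1) by (intro Q.a_rcos_self) simp_all
  ultimately have "free_lift ground (case_sum (\<lambda>g. 1) (\<lambda>v. 0)) ` x = {phi (\<lambda>g. 1) x}" by auto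
  then show ?thesis by (simp add: HH_simps)
qed

lemma dual_simps:
  "carrier (dual_alg AH) = lforms AA \<inter> extensional (carrier AA)"
  "f \<in> lforms AA \<Longrightarrow> f' \<in> lforms AA \<Longrightarrow> f \<otimes>\<^bsub>dual_alg AH\<^esub> f' = (\<lambda>x\<in>carrier AA. K f f' x)"
  "\<one>\<^bsub>dual_alg AH\<^esub> = (\<lambda>x\<in>carrier AA. phi (\<lambda>g. 1) x)"
  "f \<oplus>\<^bsub>dual_alg AH\<^esub> f' = (\<lambda>x\<in>carrier AA. f x + f' x)"
  "c \<odot>\<^bsub>dual_alg AH\<^esub> f = (\<lambda>x\<in>carrier AA. c * f x)"
proof -
  have "lforms AH = lforms AA" by (simp add: set_eq_iff lforms_iff AH_simps)
  then show "carrier (dual_alg AH) = lforms AA \<inter> extensional (carrier AA)"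
    by (simp add: dual_alg_def dual_space_def AH_simps(1))
  show "f \<in> lforms AA \<Longrightarrow> f' \<in> lforms AA \<Longrightarrow> f \<otimes>\<^bsub>dual_alg AH\<^esub> f' = (\<lambda>x\<in>carrier AA. K f f' x)"
    unfolding dual_alg_def by (simp add: AH_simps(1) tensor_eval_comult cong: restrict_cong)
  show "\<one>\<^bsub>dual_alg AH\<^esub> = (\<lambda>x\<in>carrier AA. phi (\<lambda>g. 1) x)"
    unfolding dual_alg_def by (simp add: AH_simps(1,5) counit_eq cong: restrict_cong)
  show "f \<oplus>\<^bsub>dual_alg AH\<^esub> f' = (\<lambda>x\<in>carrier AA. f x + f' x)" "c \<odot>\<^bsub>dual_alg AH\<^esub> f = (\<lambda>x\<in>carrier AA. c * f x)"
    by (simp_all add: dual_alg_def dual_space_def class_ring.func_space_def AH_simps(1) class_ring_simps)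
qed

lemma lforms_restrict: "f \<in> lforms AA \<Longrightarrow> (\<lambda>x\<in>carrier AA. f x) \<in> lforms AA"
  by (simp add: lforms_iff)

section \<open>Cosets of the subgroup generated by u\<close>

abbreviation "Cos \<equiv> carrier (G Mod generate G {u})"
abbreviation "rep h \<equiv> (SOME g. g \<in> carrier G \<and> h = {g, g \<otimes>\<^bsub>G\<^esub> u})"

lemma coset_iff: "h \<in> Cos \<longleftrightarrow> (\<exists>g\<in>carrier G. h = {g, g \<otimes>\<^bsub>G\<^esub> u})"
proof -
  have sub: "subgroup {\<one>\<^bsub>G\<^esub>, u} G" by (rule GG.subgroupI) auto
  have "generate G {u} \<subseteq> {\<one>\<^bsub>G\<^esub>, u}" by (rule GG.generate_subgroup_incl[OF _ sub]) simp
  moreover have "{\<one>\<^bsub>G\<^esub>, u} \<subseteq> generate G {u}" by (auto intro: generate.one generate.incl)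
  ultimately have "generate G {u} = {\<one>\<^bsub>G\<^esub>, u}" by auto
  then have "Cos = (\<lambda>g. {g, u \<otimes>\<^bsub>G\<^esub> g}) ` carrier G"
    by (auto simp: FactGroup_def RCOSETS_def r_coset_def)
  then show ?thesis using u_comm by (auto simp: image_iff)
qed

lemma rep:
  assumes "h \<in> Cos"
  shows "rep h \<in> carrier G" "h = {rep h, rep h \<otimes>\<^bsub>G\<^esub> u}"
proof -
  have "\<exists>g. g \<in> carrier G \<and> h = {g, g \<otimes>\<^bsub>G\<^esub> u}" using assms by (simp add: coset_iff Bex_def)
  from someI_ex[OF this] show "rep h \<in> carrier G" "h = {rep h, rep h \<otimes>\<^bsub>G\<^esub> u}" by simp_all
qed

lemma finite_Cos: "finite Cos"
proof -
  have "Cos = (\<lambda>g. {g, g \<otimes>\<^bsub>G\<^esub> u}) ` carrier G" by (auto simp: coset_iff image_iff)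
  then show ?thesis using finG by simp
qed

lemma coset_eqI:
  assumes "h \<in> Cos" "g \<in> h"
  shows "h = {g, g \<otimes>\<^bsub>G\<^esub> u}" "g \<in> carrier G"
proof -
  obtain k where k: "k \<in> carrier G" "h = {k, k \<otimes>\<^bsub>G\<^esub> u}" using assms by (auto simp: coset_iff)
  then show "g \<in> carrier G" using assms by auto
  show "h = {g, g \<otimes>\<^bsub>G\<^esub> u}"
  proof (cases "g = k")
    case False
    then have "g = k \<otimes>\<^bsub>G\<^esub> u" using k assms by auto
    moreover have "k \<otimes>\<^bsub>G\<^esub> u \<otimes>\<^bsub>G\<^esub> u = k" using k by (simp add: GG.m_assoc)
    ultimately show ?thesis using k by auto
  qed (use k in simp)
qed

lemma tensor_eval_B:
  assumes "x \<in> lforms V" "y \<in> lforms V"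
  shows "tensor_eval B x y = (\<Sum>z\<leftarrow>bs. x (fst z) * y (snd z))"
proof -
  have b: "(\<lambda>v w. x v * y w) \<in> bilin V V"
    using assms by (simp add: bilin_iff lforms_add lforms_smult algebra_simps)
  show ?thesis
    unfolding tensor_eval_def
    by (simp add: list_tensor_apply[OF b, of bs, folded bs(2)] case_prod_unfold)
qed

lemma dual_act_lform: "x \<in> lforms V \<Longrightarrow> g \<in> carrier G \<Longrightarrow> dual_act G V \<rho> g x \<in> lforms V"
  using lform_rho[of x "inv\<^bsub>G\<^esub> g"] by (simp add: dual_act_def lforms_iff)

lemma form_act_apply:
  assumes "x \<in> lforms V" "y \<in> lforms V" "g \<in> carrier G"
  shows "tensor_eval B (dual_act G V \<rho> g x) (dual_act G V \<rho> g y) =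
    (\<Sum>z\<leftarrow>bs. x (\<rho> (inv\<^bsub>G\<^esub> g) (fst z)) * y (\<rho> (inv\<^bsub>G\<^esub> g) (snd z)))"
  unfolding tensor_eval_B[OF dual_act_lform[OF assms(1,3)] dual_act_lform[OF assms(2,3)]]
  by (rule bs_cong) (use bs_in in \<open>simp add: dual_act_def\<close>)

text \<open>Ensures that \<open>the_elem\<close> in \<open>form_coset\<close> is applied to a
  singleton; the reason is the cancellation of signs in \<open>Cv_mult_u\<close>.\<close>

lemma form_act_u:
  assumes "g \<in> carrier G"
  shows "form_act G V \<rho> B (g \<otimes>\<^bsub>G\<^esub> u) = form_act G V \<rho> B g"
  unfolding form_act_def
proof (intro restrict_ext)
  fix x y assume "x \<in> carrier (dual_space V)" "y \<in> carrier (dual_space V)"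
  then have l: "x \<in> lforms V" "y \<in> lforms V" by (auto simp: dual_space_def)
  show "tensor_eval B (dual_act G V \<rho> (g \<otimes>\<^bsub>G\<^esub> u) x) (dual_act G V \<rho> (g \<otimes>\<^bsub>G\<^esub> u) y) =
      tensor_eval B (dual_act G V \<rho> g x) (dual_act G V \<rho> g y)"
    using Cv_mult_u[OF l(2) assms l(1)] assms l by (simp add: form_act_apply Cv_eval)
qed

lemma block_form_eq:
  assumes h: "h \<in> Cos" and w: "w \<in> carrier WW" "w' \<in> carrier WW"
  shows "block_form G V \<rho> B h w w' = fst w (Cv (rep h) (fst w')) + snd w * snd w'"
proof -
  note r = rep[OF h]
  have "fst w \<in> lforms V \<inter> extensional (carrier V)" "fst w' \<in> lforms V \<inter> extensional (carrier V)"
    using w by (auto simp: WW_simps)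
  then have l: "fst w \<in> lforms V" "fst w' \<in> lforms V"
    and c: "fst w \<in> carrier (dual_space V)" "fst w' \<in> carrier (dual_space V)"
    by (simp_all add: dual_space_def)
  have "form_act G V \<rho> B ` h = {form_act G V \<rho> B (rep h)}"
    by (subst r(2)) (simp only: image_insert image_empty form_act_u[OF r(1)] insert_absorb2)
  then have "form_coset G V \<rho> B h = form_act G V \<rho> B (rep h)" by (simp add: form_coset_def)
  \<comment> \<open>\<open>Cv_eval\<close> yields the form with its arguments exchanged, and
    \<open>Cv_sym\<close> restores their order.\<close>
  then have "block_form G V \<rho> B h w w' = fst w' (Cv (rep h) (fst w)) + snd w * snd w'"
    using c l r(1)
    by (simp add: block_form_def case_prod_unfold form_act_def form_act_apply tensor_eval_B Cv_eval)
  then show ?thesis using Cv_sym[OF l r(1)] by simp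
qed

lemma gvcl_rep: "h \<in> Cos \<Longrightarrow> gvcl G V \<rho> u B (rep h) (block_form G V \<rho> B h)"
  by (intro gvcl.intro gvcoset.intro gvcoset_axioms.intro cliff.intro gvcl_axioms.intro
    gvtwist_axioms gvdata_axioms rep(1) block_form_eq)

section \<open>Assembling the components\<close>

abbreviation "CB h \<equiv> clifford WW (block_form G V \<rho> B h)"
definition "cm h = gvcl.cmap G V \<rho> u B (rep h) (block_form G V \<rho> B h)"
definition chi :: "'g set \<Rightarrow> 'g \<Rightarrow> complex" where
  "chi h = (\<lambda>g. if g \<in> h then 1 else 0)"

text \<open>Exports the component map from the locale of one coset, with the indicator expressed by
  the coset instead of its representative.\<close>

lemma cm_facts:
  assumes h: "h \<in> Cos"
  shows "f \<in> lforms AA \<Longrightarrow> cm h f \<in> carrier (CB h)"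
    "f \<in> lforms AA \<Longrightarrow> f' \<in> lforms AA \<Longrightarrow> cm h (\<lambda>x\<in>carrier AA. f x + f' x) = cm h f \<oplus>\<^bsub>CB h\<^esub> cm h f'"
    "f \<in> lforms AA \<Longrightarrow> cm h (\<lambda>x\<in>carrier AA. a * f x) = a \<odot>\<^bsub>CB h\<^esub> cm h f"
    "f \<in> lforms AA \<Longrightarrow> f' \<in> lforms AA \<Longrightarrow> cm h (\<lambda>x\<in>carrier AA. K f f' x) = cm h f \<otimes>\<^bsub>CB h\<^esub> cm h f'"
    "cm h (\<lambda>x\<in>carrier AA. phi (\<lambda>g. 1) x) = \<one>\<^bsub>CB h\<^esub>"
    "f \<in> lforms AA \<Longrightarrow> f' \<in> lforms AA \<Longrightarrow> cm h f = cm h f' \<Longrightarrow> x \<in> carrier AA \<Longrightarrow> mu (chi h) f x = mu (chi h) f' x"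
    "c \<in> carrier (CB h) \<Longrightarrow> \<exists>f\<in>lforms AA. (\<forall>x\<in>carrier AA. mu (chi h) f x = f x) \<and>
      (\<forall>f'\<in>lforms AA. (\<forall>x\<in>carrier AA. mu (chi h) f' x = f x) \<longrightarrow> cm h f' = c)"
proof -
  interpret h: gvcl G V \<rho> u B "rep h" "block_form G V \<rho> B h" by (rule gvcl_rep[OF h])
  have "h.ind g = chi h g" for g
    by (subst rep(2)[OF h]) (simp add: h.ind_def chi_def)
  then have ind: "h.ind = chi h" by (rule ext)
  note l = lforms_restrict lform_lin K_lform phi_lform
  show "f \<in> lforms AA \<Longrightarrow> cm h f \<in> carrier (CB h)"
    unfolding cm_def by (rule h.cmap_closed)
  show "f \<in> lforms AA \<Longrightarrow> f' \<in> lforms AA \<Longrightarrow> cm h (\<lambda>x\<in>carrier AA. f x + f' x) = cm h f \<oplus>\<^bsub>CB h\<^esub> cm h f'"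
    unfolding cm_def by (rule h.cmap_add) (simp_all add: l(1,2))
  show "f \<in> lforms AA \<Longrightarrow> cm h (\<lambda>x\<in>carrier AA. a * f x) = a \<odot>\<^bsub>CB h\<^esub> cm h f"
    unfolding cm_def by (rule h.cmap_smult) (simp_all add: lforms_restrict lform_lin(2)[of f AA f])
  show "f \<in> lforms AA \<Longrightarrow> f' \<in> lforms AA \<Longrightarrow> cm h (\<lambda>x\<in>carrier AA. K f f' x) = cm h f \<otimes>\<^bsub>CB h\<^esub> cm h f'"
    unfolding cm_def by (rule h.cmap_mult) (simp_all add: lforms_restrict K_lform)
  show "cm h (\<lambda>x\<in>carrier AA. phi (\<lambda>g. 1) x) = \<one>\<^bsub>CB h\<^esub>"
    unfolding cm_def by (rule h.cmap_one) simp
  show "f \<in> lforms AA \<Longrightarrow> f' \<in> lforms AA \<Longrightarrow> cm h f = cm h f' \<Longrightarrow> x \<in> carrier AA \<Longrightarrow> mu (chi h) f x = mu (chi h) f' x"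
    unfolding cm_def ind[symmetric] by (rule h.cmap_inj)
  assume "c \<in> carrier (CB h)"
  from h.cmap_surj[OF this] obtain f where f: "f \<in> h.Dh"
    "\<forall>f'\<in>lforms AA. (\<forall>x\<in>carrier AA. mu (chi h) f' x = f x) \<longrightarrow> cm h f' = c"
    unfolding ind cm_def[symmetric] by (elim bexE)
  then show "\<exists>f\<in>lforms AA. (\<forall>x\<in>carrier AA. mu (chi h) f x = f x) \<and>
      (\<forall>f'\<in>lforms AA. (\<forall>x\<in>carrier AA. mu (chi h) f' x = f x) \<longrightarrow> cm h f' = c)"
    using h.Dh_lform[OF f(1)] h.Dh_ind[OF f(1)] unfolding ind by (intro bexI[of _ f] conjI) simp_all
qed

lemma chi_u: "h \<in> Cos \<Longrightarrow> g \<in> carrier G \<Longrightarrow> pu (chi h) g = chi h g"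
proof -
  assume h: "h \<in> Cos" and g: "g \<in> carrier G"
  have "g \<otimes>\<^bsub>G\<^esub> u \<otimes>\<^bsub>G\<^esub> u = g" using g by (simp add: GG.m_assoc)
  then have "g \<otimes>\<^bsub>G\<^esub> u \<in> h \<longleftrightarrow> g \<in> h"
    using coset_eqI(1)[OF h, of g] coset_eqI(1)[OF h, of "g \<otimes>\<^bsub>G\<^esub> u"] by auto
  then show ?thesis by (simp add: chi_def)
qed

text \<open>Every element of G lies in some coset, and the indicators are invariant under
  translation by u, so taking components commutes with f \<mapsto> f(\<cdot> v).\<close>

lemma lforms_eq_components:
  assumes "f \<in> lforms AA" "f' \<in> lforms AA" "x \<in> carrier AA"
    and "\<And>h x. h \<in> Cos \<Longrightarrow> x \<in> carrier AA \<Longrightarrow> mu (chi h) f x = mu (chi h) f' x"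
  shows "f x = f' x"
  using assms(3,1,2,4)
proof (induction x arbitrary: f f' rule: AA_induct)
  case (grp g)
  let ?h = "{g, g \<otimes>\<^bsub>G\<^esub> u}"
  have "?h \<in> Cos" using grp by (auto simp: coset_iff)
  from grp(4)[OF this gen_closed(1)[OF grp(1)]] show ?case using grp by (simp add: mu_grp chi_def)
next
  case (vec x v)
  have l: "rv v f \<in> lforms AA" "rv v f' \<in> lforms AA" using vec by (simp_all add: lform_rmult)
  have *: "mu (chi h) (rv v k) y = mu (chi h) k (y \<otimes>\<^bsub>AA\<^esub> \<eta> v)"
    if "h \<in> Cos" "y \<in> carrier AA" "k \<in> lforms AA" for h y k
  proof -
    have "mu (chi h) (rv v k) y = mu (pu (chi h)) (rv v k) y"
      by (rule mu_cong) (use that vec chi_u in \<open>simp_all add: lform_rmult\<close>)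
    then show ?thesis using that vec by (simp add: mu_vec)
  qed
  show ?case by (rule vec(3)[OF l]) (use * vec in simp)
next
  case (add x y)
  have "f x = f' x" by (rule add.IH(1)[OF add.prems])
  moreover have "f y = f' y" by (rule add.IH(2)[OF add.prems])
  ultimately show ?case using add.hyps add.prems(1,2) by (simp add: lforms_add)
next
  case (smult x c)
  have "f x = f' x" by (rule smult.IH[OF smult.prems])
  then show ?case using smult.hyps smult.prems(1,2) by (simp add: lforms_smult)
qed

lemma lform_sum: "finite S \<Longrightarrow> (\<And>i. i \<in> S \<Longrightarrow> F i \<in> lforms AA) \<Longrightarrow> (\<lambda>x. \<Sum>i\<in>S. F i x) \<in> lforms AA"
  by (induction S rule: finite_induct) (simp_all add: lform_0 lform_lin)

lemma mu_sum:
  assumes "finite S" "\<And>i. i \<in> S \<Longrightarrow> F i \<in> lforms AA" "x \<in> carrier AA"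
  shows "mu \<phi> (\<lambda>x. \<Sum>i\<in>S. F i x) x = (\<Sum>i\<in>S. mu \<phi> (F i) x)"
  using assms(1,2)
proof (induction S rule: finite_induct)
  case empty
  from mu_cmult[OF lform_0 assms(3), of \<phi> 0] show ?case by simp
next
  case (insert i S)
  then show ?case using assms(3) by (simp add: mu_add lform_sum)
qed

text \<open>Preimages of the single components are added up. Distinct cosets are disjoint, so their
  indicators are orthogonal and each component sees its own summand only.\<close>

lemma components_surj:
  assumes y: "y \<in> (\<Pi>\<^sub>E h\<in>Cos. carrier (CB h))"
  shows "\<exists>f\<in>carrier (dual_alg AH). (\<lambda>h\<in>Cos. cm h f) = y"
proof -
  have "\<forall>h\<in>Cos. \<exists>f. f \<in> lforms AA \<and> (\<forall>x\<in>carrier AA. mu (chi h) f x = f x) \<and>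
      (\<forall>f'\<in>lforms AA. (\<forall>x\<in>carrier AA. mu (chi h) f' x = f x) \<longrightarrow> cm h f' = y h)"
  proof
    fix h assume h: "h \<in> Cos"
    show "\<exists>f. f \<in> lforms AA \<and> (\<forall>x\<in>carrier AA. mu (chi h) f x = f x) \<and>
        (\<forall>f'\<in>lforms AA. (\<forall>x\<in>carrier AA. mu (chi h) f' x = f x) \<longrightarrow> cm h f' = y h)"
      using cm_facts(7)[OF h PiE_mem[OF y h]] unfolding Bex_def .
  qed
  from bchoice[OF this] obtain F where F0: "\<forall>h\<in>Cos. F h \<in> lforms AA \<and> (\<forall>x\<in>carrier AA. mu (chi h) (F h) x = F h x) \<and>
      (\<forall>f'\<in>lforms AA. (\<forall>x\<in>carrier AA. mu (chi h) f' x = F h x) \<longrightarrow> cm h f' = y h)" ..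
  have F1: "F h \<in> lforms AA" if "h \<in> Cos" for h
    by (rule conjunct1[OF bspec[OF F0 that]])
  have F2: "\<forall>x\<in>carrier AA. mu (chi h) (F h) x = F h x" if "h \<in> Cos" for h
    by (rule conjunct1[OF conjunct2[OF bspec[OF F0 that]]])
  have F3: "\<forall>f'\<in>lforms AA. (\<forall>x\<in>carrier AA. mu (chi h) f' x = F h x) \<longrightarrow> cm h f' = y h" if "h \<in> Cos" for h
    by (rule conjunct2[OF conjunct2[OF bspec[OF F0 that]]])
  let ?f = "\<lambda>x\<in>carrier AA. \<Sum>h\<in>Cos. F h x"
  have s: "(\<lambda>x. \<Sum>h\<in>Cos. F h x) \<in> lforms AA" by (rule lform_sum[OF finite_Cos F1])
  then have f: "?f \<in> lforms AA" by (rule lforms_restrict)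
  have zero: "mu (chi k) (F h) x = 0" if k: "k \<in> Cos" "h \<in> Cos" "h \<noteq> k" and x: "x \<in> carrier AA" for h k x
  proof -
    have "mu (chi k) (F h) x = mu (chi k) (mu (chi h) (F h)) x"
      by (rule mu_cong) (use F1 F2 k x in simp_all)
    also have "\<dots> = mu (\<lambda>g. chi k g * chi h g) (F h) x" by (rule mu_mu[OF F1[OF k(2)] x])
    also have "\<dots> = mu (\<lambda>g. 0 * chi h g) (F h) x"
    proof (rule mu_cong[OF F1[OF k(2)] x])
      fix g
      show "chi k g * chi h g = 0 * chi h g"
        using coset_eqI(1)[OF k(1), of g] coset_eqI(1)[OF k(2), of g] k(3) by (auto simp: chi_def)
    qed simp
    also have "\<dots> = 0 * mu (chi h) (F h) x" by (rule mu_scale[OF F1[OF k(2)] x])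
    finally show ?thesis by simp
  qed
  have "cm k ?f = y k" if k: "k \<in> Cos" for k
  proof (rule mp[OF bspec[OF F3[OF k] f]], rule ballI)
    fix x assume x: "x \<in> carrier AA"
    have "mu (chi k) ?f x = mu (chi k) (\<lambda>x. \<Sum>h\<in>Cos. F h x) x"
      by (rule mu_cong) (use f x in simp_all)
    also have "\<dots> = (\<Sum>h\<in>Cos. mu (chi k) (F h) x)" by (rule mu_sum[OF finite_Cos F1 x])
    also have "\<dots> = (\<Sum>h\<in>Cos. if h = k then F k x else 0)"
      by (rule sum.cong) (use zero[OF k _ _ x] bspec[OF F2[OF k] x] in auto)
    also have "\<dots> = F k x" using k finite_Cos by simp
    finally show "mu (chi k) ?f x = F k x" .
  qed
  then have "(\<lambda>h\<in>Cos. cm h ?f) = y"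
    using y by (intro extensionalityI[of _ Cos]) (simp_all add: PiE_def)
  moreover have "?f \<in> carrier (dual_alg AH)" using f by (simp add: dual_simps)
  ultimately show ?thesis by blast
qed

lemma prod_alg_simps:
  "carrier (prod_alg I A) = (\<Pi>\<^sub>E i\<in>I. carrier (A i))" "x \<otimes>\<^bsub>prod_alg I A\<^esub> y = (\<lambda>i\<in>I. x i \<otimes>\<^bsub>A i\<^esub> y i)"
  "\<one>\<^bsub>prod_alg I A\<^esub> = (\<lambda>i\<in>I. \<one>\<^bsub>A i\<^esub>)" "x \<oplus>\<^bsub>prod_alg I A\<^esub> y = (\<lambda>i\<in>I. x i \<oplus>\<^bsub>A i\<^esub> y i)"
  "c \<odot>\<^bsub>prod_alg I A\<^esub> x = (\<lambda>i\<in>I. c \<odot>\<^bsub>A i\<^esub> x i)"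
  by (simp_all add: prod_alg_def)

lemma components_iso: "(\<lambda>f. \<lambda>h\<in>Cos. cm h f) \<in> alg_iso (dual_alg AH) (prod_alg Cos CB)"
proof -
  let ?D = "dual_alg AH" and ?\<phi> = "\<lambda>f. \<lambda>h\<in>Cos. cm h f"
  have l: "f \<in> lforms AA" "f \<in> extensional (carrier AA)" if "f \<in> carrier ?D" for f
    using that by (simp_all add: dual_simps(1))
  have closed: "?\<phi> f \<in> carrier (prod_alg Cos CB)" if "f \<in> carrier ?D" for f
    unfolding prod_alg_simps by (intro PiE_I) (simp_all add: cm_facts(1)[OF _ l(1)[OF that]])
  have add: "?\<phi> (f \<oplus>\<^bsub>?D\<^esub> f') = ?\<phi> f \<oplus>\<^bsub>prod_alg Cos CB\<^esub> ?\<phi> f'" if "f \<in> carrier ?D" "f' \<in> carrier ?D" for f f'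
    unfolding dual_simps(4) prod_alg_simps
    by (rule restrict_ext) (use cm_facts(2)[OF _ l(1)[OF that(1)] l(1)[OF that(2)]] in simp)
  have mult: "?\<phi> (f \<otimes>\<^bsub>?D\<^esub> f') = ?\<phi> f \<otimes>\<^bsub>prod_alg Cos CB\<^esub> ?\<phi> f'" if "f \<in> carrier ?D" "f' \<in> carrier ?D" for f f'
    unfolding dual_simps(2)[OF l(1)[OF that(1)] l(1)[OF that(2)]] prod_alg_simps
    by (rule restrict_ext) (use cm_facts(4)[OF _ l(1)[OF that(1)] l(1)[OF that(2)]] in simp)
  have smult: "?\<phi> (c \<odot>\<^bsub>?D\<^esub> f) = c \<odot>\<^bsub>prod_alg Cos CB\<^esub> ?\<phi> f" if "f \<in> carrier ?D" for c f
    unfolding dual_simps(5) prod_alg_simps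
    by (rule restrict_ext) (use cm_facts(3)[OF _ l(1)[OF that]] in simp)
  have one: "?\<phi> \<one>\<^bsub>?D\<^esub> = \<one>\<^bsub>prod_alg Cos CB\<^esub>"
    unfolding dual_simps(3) prod_alg_simps
    by (rule restrict_ext) (rule cm_facts(5))
  have inj: "inj_on ?\<phi> (carrier ?D)"
  proof (rule inj_onI)
    fix f f' assume f: "f \<in> carrier ?D" "f' \<in> carrier ?D" and eq: "?\<phi> f = ?\<phi> f'"
    show "f = f'"
    proof (rule extensionalityI[OF l(2)[OF f(1)] l(2)[OF f(2)]])
      fix x assume x: "x \<in> carrier AA"
      show "f x = f' x"
      proof (rule lforms_eq_components[OF l(1)[OF f(1)] l(1)[OF f(2)] x])
        fix h y assume h: "h \<in> Cos" and y: "y \<in> carrier AA"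
        have "cm h f = cm h f'" using fun_cong[OF eq, of h] h by simp
        then show "mu (chi h) f y = mu (chi h) f' y"
          by (rule cm_facts(6)[OF h l(1)[OF f(1)] l(1)[OF f(2)] _ y])
      qed
    qed
  qed
  have "?\<phi> ` carrier ?D = carrier (prod_alg Cos CB)"
  proof (rule equalityI)
    show "?\<phi> ` carrier ?D \<subseteq> carrier (prod_alg Cos CB)" using closed by (rule image_subsetI)
    show "carrier (prod_alg Cos CB) \<subseteq> ?\<phi> ` carrier ?D"
    proof
      fix y assume "y \<in> carrier (prod_alg Cos CB)"
      from components_surj[OF this[unfolded prod_alg_simps]] obtain f where "f \<in> carrier ?D" "?\<phi> f = y" by (elim bexE)
      then show "y \<in> ?\<phi> ` carrier ?D" by (intro image_eqI[of _ _ f]) simp_all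
    qed
  qed
  then have "bij_betw ?\<phi> (carrier ?D) (carrier (prod_alg Cos CB))" using inj by (simp only: bij_betw_def)
  then have "?\<phi> \<in> ring_iso ?D (prod_alg Cos CB)"
    unfolding ring_iso_def by (intro CollectI conjI ring_hom_memI closed mult add one)
  moreover have "?\<phi> \<in> module_hom CC ?D (prod_alg Cos CB)"
    unfolding module_hom_def
  proof (intro CollectI conjI allI impI)
    show "?\<phi> \<in> carrier ?D \<rightarrow> carrier (prod_alg Cos CB)" by (rule Pi_I) (rule closed)
  qed (use add smult in \<open>simp_all only:\<close>)
  ultimately show ?thesis unfolding alg_iso_def by (rule IntI)
qed

end

theorem theorem5p2:
  fixes G :: "('g, 'n) monoid_scheme" and V :: "(complex, 'v, 'm) module_scheme"
    and \<rho> :: "'g \<Rightarrow> 'v \<Rightarrow> 'v" and u :: 'g and B :: "('v, 'v) tens"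
  assumes "group G" and "finite (carrier G)"
    and "vectorspace class_ring V" and "vectorspace.fin_dim class_ring V"
    and "group_action G (carrier V) \<rho>"
    and "\<forall>g\<in>carrier G. linear_map class_ring V V (\<rho> g)"
    and "u \<in> carrier G" and "\<forall>g\<in>carrier G. u \<otimes>\<^bsub>G\<^esub> g = g \<otimes>\<^bsub>G\<^esub> u"
    and "group.ord G u = 2"
    and "\<forall>v\<in>carrier V. \<rho> u v = \<ominus>\<^bsub>V\<^esub> v"
    and "B \<in> sym_square V"
  shows "\<exists>\<phi>. \<phi> \<in> alg_iso (dual_alg (A_Hopf G V \<rho> u B))
    (prod_alg (carrier (G Mod generate G {u}))
      (\<lambda>h. clifford (direct_sum (dual_space V) ground) (block_form G V \<rho> B h)))"
proof -
  interpret gvtwist G V \<rho> u B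
    by (intro gvtwist.intro gvdata.intro gvtwist_axioms.intro) (fact assms)+
  show ?thesis by (rule exI) (rule components_iso)
qed

end
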